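(* Let $\mathfrak{A}=\{\mathfrak{A}_k\}_k$ be a holomorphy type and $E$ a complex Banach space with $\dim(E)>1$ and separable dual such that the finite type polynomials are dense in $\mathfrak{A}_k(E)$ for every $k$. If $T:\mathcal{H}_{b\mathfrak{A}}(E)\to\mathcal{H}_{b\mathfrak{A}}(E)$ is a non-trivial convolution operator, then $T$ has a frequently hypercyclic subspace.
   Context: All Banach spaces are complex. For a Banach space $E$, $\mathcal{P}(^kE)$ is the Banach space of continuous $k$-homogeneous polynomials $P:E\to\mathbb{C}$ with norm $\sup_{\|z\|=1}|P(z)|$ (and $\mathcal{P}(^0E)=\mathbb{C}$); $\overset{\vee}{P}$ is the symmetric $k$-linear form associated to $P$. The finite type polynomials of degree $k$ are the elements of the linear span of $\{\gamma(\cdot)^k:\gamma\in E'\}$, where $E'$ is the dual of $E$. $\mathcal{H}(E)$ is the space of holomorphic functions $E\to\mathbb{C}$; for $f\in\mathcal{H}(E)$, $\frac{d^kf(0)}{k!}$ is the $k$-homogeneous polynomial that is the $k$-th term of the Taylor series of $f$ at $0$. For $P\in\mathcal{P}(^kE)$, $a\in E$, $0\le j\le k$, let $P_{a^j}\in\mathcal{P}(^{k-j}E)$ be $P_{a^j}(x)=\overset{\vee}{P}(a,\dots,a,x,\dots,x)$ with $a$ repeated $j$ times and $x$ repeated $k-j$ times. A Banach ideal of scalar-valued continuous $k$-homogeneous polynomials ($k\ge 0$) is a pair $(\mathfrak{A}_k,\|\cdot\|_{\mathfrak{A}_k})$ such that: (i) for every Banach space $E$, $\mathfrak{A}_k(E)=\mathfrak{A}_k\cap\mathcal{P}(^kE)$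 is a linear subspace of $\mathcal{P}(^kE)$ and $\|\cdot\|_{\mathfrak{A}_k(E)}$ is a norm making it a Banach space; (ii) if $R:E_1\to E$ is bounded and linear and $P\in\mathfrak{A}_k(E)$ then $P\circ R\in\mathfrak{A}_k(E_1)$ and $\|P\circ R\|_{\mathfrak{A}_k(E_1)}\le\|P\|_{\mathfrak{A}_k(E)}\|R\|^k$; (iii) $z\mapsto z^k$ belongs to $\mathfrak{A}_k(\mathbb{C})$ and has norm $1$. A holomorphy type is a sequence $\mathfrak{A}=\{\mathfrak{A}_k\}_{k=0}^\infty$, where each $\mathfrak{A}_k$ is a Banach ideal of $k$-homogeneous polynomials, for which there exist constants $c$ and $C_{k,l}$ with $C_{k,l}\le c^k$ for all $0\le l\le k$ such that for every Banach space $E$, $P\in\mathfrak{A}_k(E)$ and $a\in E$: $P_{a^l}\in\mathfrak{A}_{k-l}(E)$ and $\|P_{a^l}\|_{\mathfrak{A}_{k-l}(E)}\le C_{k,l}\|P\|_{\mathfrak{A}_k(E)}\|a\|^l$. $\mathcal{H}_{b\mathfrak{A}}(E)$ is the set of $f\in\mathcal{H}(E)$ such that $d^kf(0)\in\mathfrak{A}_k(E)$ for every $k$ and $\lim_{k\to\infty}\left\|\frac{d^kf(0)}{k!}\right\|_{\mathfrak{A}_k}^{1/k}=0$; it is a Fréchet space with the seminorms $p_s(f)=\sum_{k=0}^\infty s^k\left\|\frac{d^kf(0)}{k!}\right\|_{\mathfrak{A}_k}$, $s>0$. For $x\in E$, $\tau_x f=f(x+\cdot)$ is the translation operator, which is a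 continuous linear operator on $\mathcal{H}_{b\mathfrak{A}}(E)$. A convolution operator is a continuous linear operator $T$ on $\mathcal{H}_{b\mathfrak{A}}(E)$ with $T\circ\tau_x=\tau_x\circ T$ for every $x\in E$. It is trivial if it is a scalar multiple of the identity. A vector $x\in X$ is frequently hypercyclic for a continuous linear operator $T:X\to X$ if for every non-empty open set $U\subset X$ the set $\{n\ge0:T^nx\in U\}$ has positive lower density. A frequently hypercyclic subspace for $T$ is a closed infinite-dimensional linear subspace of $X$ in which every non-zero vector is frequently hypercyclic for $T$. *)

theory Defs
  imports
    "HOL-Analysis.Analysis"
    "HOL-Algebra.Module"
    "HOL-Library.Function_Algebras"
    "HOL-Library.Multiset"
begin

section \<open>Complex Banach spaces with explicit carrier\<close>

text \<open>
  A polynomial ideal is a family indexed by all Banach spaces, so Banach spaces have to be values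
  that can be quantified over, not types. They are modules over the complex numbers in the sense
  of HOL-Algebra with an added norm, and their carrier is a subset of a type \<open>'u\<close> that plays
  the role of the universe: ``every Banach space'' means ``every Banach space whose underlying
  set is a subset of \<open>'u\<close>''. The type \<open>'u\<close> is arbitrary in the main statement. The
  fields \<open>mult\<close> and \<open>one\<close>, which the record inherits, carry no meaning.
\<close>

definition complex_ring :: "complex ring" where
  "complex_ring = \<lparr>carrier = UNIV, mult = (*), one = 1, zero = 0, add = (+)\<rparr>"

record 'u cnspace = "(complex, 'u) module" +
  nrm :: "'u \<Rightarrow> real"

text \<open>The value outside the carrier is irrelevant; it is \<open>0\<close> because the locale
  \<open>Metric_space\<close> asks for nonnegativity and symmetry on the whole type.\<close>

definition ndist :: "'u cnspace \<Rightarrow> 'u \<Rightarrow> 'u \<Rightarrow> real" where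
  "ndist E x y = (if x \<in> carrier E \<and> y \<in> carrier E then nrm E (x \<ominus>\<^bsub>E\<^esub> y) else 0)"

definition ntop :: "'u cnspace \<Rightarrow> 'u topology" where
  "ntop E = Metric_space.mtopology (carrier E) (ndist E)"

locale complex_normed_space = Module.module complex_ring E
  for E :: "'u cnspace" (structure) +
  assumes nrm_nonneg: "x \<in> carrier E \<Longrightarrow> 0 \<le> nrm E x"
    and nrm_eq_zero_iff: "x \<in> carrier E \<Longrightarrow> nrm E x = 0 \<longleftrightarrow> x = \<zero>\<^bsub>E\<^esub>"
    and nrm_smult: "x \<in> carrier E \<Longrightarrow> nrm E (c \<odot>\<^bsub>E\<^esub> x) = cmod c * nrm E x"
    and nrm_triangle:
      "x \<in> carrier E \<Longrightarrow> y \<in> carrier E \<Longrightarrow> nrm E (x \<oplus>\<^bsub>E\<^esub> y) \<le> nrm E x + nrm E y"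

locale complex_banach_space = complex_normed_space +
  assumes complete: "Metric_space.mcomplete (carrier E) (ndist E)"

definition complex_space :: "complex cnspace" where
  "complex_space = \<lparr>carrier = UNIV, mult = (*), one = 1, zero = 0, add = (+),
     smult = (*), nrm = cmod\<rparr>"

definition bdd_linear :: "'u cnspace \<Rightarrow> 'v cnspace \<Rightarrow> ('u \<Rightarrow> 'v) \<Rightarrow> bool" where
  "bdd_linear E F R \<longleftrightarrow>
     R \<in> carrier E \<rightarrow> carrier F \<and>
     (\<forall>x\<in>carrier E. \<forall>y\<in>carrier E. R (x \<oplus>\<^bsub>E\<^esub> y) = R x \<oplus>\<^bsub>F\<^esub> R y) \<and>
     (\<forall>c. \<forall>x\<in>carrier E. R (c \<odot>\<^bsub>E\<^esub> x) = c \<odot>\<^bsub>F\<^esub> R x) \<and>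
     (\<exists>B. \<forall>x\<in>carrier E. nrm F (R x) \<le> B * nrm E x)"

definition opnorm :: "'u cnspace \<Rightarrow> 'v cnspace \<Rightarrow> ('u \<Rightarrow> 'v) \<Rightarrow> real" where
  "opnorm E F R = (SUP x\<in>{x \<in> carrier E. nrm E x \<le> 1}. nrm F (R x))"

section \<open>Spaces of scalar functions\<close>

text \<open>
  A function \<open>E \<rightarrow> \<complex>\<close> is represented by a function on \<open>'u\<close> that vanishes off the carrier.
  Such functions form a linear subspace of \<open>'u \<Rightarrow> complex\<close> under pointwise operations, and
  they are equal as soon as they agree on the carrier.
\<close>

definition zext :: "'u set \<Rightarrow> ('u \<Rightarrow> complex) \<Rightarrow> 'u \<Rightarrow> complex" where
  "zext S g = (\<lambda>x. if x \<in> S then g x else 0)"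

definition fscale :: "complex \<Rightarrow> ('u \<Rightarrow> complex) \<Rightarrow> 'u \<Rightarrow> complex" where
  "fscale c f = (\<lambda>x. c * f x)"

interpretation cfun: vector_space fscale
  by unfold_locales (auto simp: fscale_def fun_eq_iff algebra_simps)

definition fun_space :: "('u \<Rightarrow> complex) set \<Rightarrow> (('u \<Rightarrow> complex) \<Rightarrow> real) \<Rightarrow> ('u \<Rightarrow> complex) cnspace" where
  "fun_space S N = \<lparr>carrier = S, mult = (*), one = 1, zero = 0, add = (+),
     smult = fscale, nrm = N\<rparr>"

definition dual :: "'u cnspace \<Rightarrow> ('u \<Rightarrow> complex) cnspace" where
  "dual E = fun_space
     {\<gamma>. bdd_linear E complex_space \<gamma> \<and> (\<forall>x. x \<notin> carrier E \<longrightarrow> \<gamma> x = 0)}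
     (opnorm E complex_space)"

section \<open>Homogeneous polynomials\<close>

text \<open>\<open>k\<close>-linear forms are functions of a list of \<open>k\<close> vectors, zero on all other lists; this
  makes the symmetric form in \<open>polar\<close> unique.\<close>

definition multilinear_form :: "'u cnspace \<Rightarrow> nat \<Rightarrow> ('u list \<Rightarrow> complex) \<Rightarrow> bool" where
  "multilinear_form E k A \<longleftrightarrow>
     (\<forall>xs. \<not> (length xs = k \<and> set xs \<subseteq> carrier E) \<longrightarrow> A xs = 0) \<and>
     (\<forall>us vs x y c d.
        length us + length vs + 1 = k \<and> set us \<union> set vs \<union> {x, y} \<subseteq> carrier E \<longrightarrow>
        A (us @ (c \<odot>\<^bsub>E\<^esub> x \<oplus>\<^bsub>E\<^esub> d \<odot>\<^bsub>E\<^esub> y) # vs) = c * A (us @ x # vs) + d * A (us @ y # vs))"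

definition symmetric_form :: "('u list \<Rightarrow> complex) \<Rightarrow> bool" where
  "symmetric_form A \<longleftrightarrow> (\<forall>xs ys. mset xs = mset ys \<longrightarrow> A xs = A ys)"

definition diag :: "'u cnspace \<Rightarrow> nat \<Rightarrow> ('u list \<Rightarrow> complex) \<Rightarrow> 'u \<Rightarrow> complex" where
  "diag E k A = zext (carrier E) (\<lambda>x. A (replicate k x))"

definition hom_poly :: "'u cnspace \<Rightarrow> nat \<Rightarrow> ('u \<Rightarrow> complex) set" where
  "hom_poly E k =
     {P. (\<exists>A. multilinear_form E k A \<and> P = diag E k A) \<and> continuous_map (ntop E) euclidean P}"

definition polar :: "'u cnspace \<Rightarrow> nat \<Rightarrow> ('u \<Rightarrow> complex) \<Rightarrow> 'u list \<Rightarrow> complex" where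
  "polar E k P = (THE A. multilinear_form E k A \<and> symmetric_form A \<and> diag E k A = P)"

text \<open>\<open>poly_at E k P a j\<close> is the polynomial \<open>P\<^bsub>a\<^sup>j\<^esub>\<close> of a \<open>k\<close>-homogeneous \<open>P\<close>.\<close>

definition poly_at :: "'u cnspace \<Rightarrow> nat \<Rightarrow> ('u \<Rightarrow> complex) \<Rightarrow> 'u \<Rightarrow> nat \<Rightarrow> 'u \<Rightarrow> complex" where
  "poly_at E k P a j =
     zext (carrier E) (\<lambda>x. polar E k P (replicate j a @ replicate (k - j) x))"

definition finite_type :: "'u cnspace \<Rightarrow> nat \<Rightarrow> ('u \<Rightarrow> complex) set" where
  "finite_type E k = cfun.span {zext (carrier E) (\<lambda>x. \<gamma> x ^ k) | \<gamma>. \<gamma> \<in> carrier (dual E)}"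

section \<open>Banach ideals of polynomials and holomorphy types\<close>

text \<open>\<open>polys I E\<close> is the component of the ideal at \<open>E\<close>, and \<open>pnorm I E\<close> its norm.\<close>

record 'u poly_ideal =
  polys :: "'u cnspace \<Rightarrow> ('u \<Rightarrow> complex) set"
  pnorm :: "'u cnspace \<Rightarrow> ('u \<Rightarrow> complex) \<Rightarrow> real"

definition ideal_space :: "'u poly_ideal \<Rightarrow> 'u cnspace \<Rightarrow> ('u \<Rightarrow> complex) cnspace" where
  "ideal_space I E = fun_space (polys I E) (pnorm I E)"

text \<open>
  The third condition of a Banach ideal is about the Banach space of complex numbers, which is
  present in the universe \<open>'u\<close> only through its copies. A copy is a Banach space \<open>X\<close> together with
  an isometric linear bijection \<open>\<phi>\<close> onto the complex numbers, and the monomial \<open>z \<mapsto> z\<^sup>k\<close> is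
  \<open>\<phi>\<^sup>k\<close> in terms of it. As soon as \<open>'u\<close> carries a nonzero Banach space, such copies
  exist (its one-dimensional subspaces); by the second condition it makes no difference which
  copy is used.
\<close>

definition copy_of_scalars :: "'u cnspace \<Rightarrow> ('u \<Rightarrow> complex) \<Rightarrow> bool" where
  "copy_of_scalars X \<phi> \<longleftrightarrow>
     complex_banach_space X \<and> bdd_linear X complex_space \<phi> \<and>
     bij_betw \<phi> (carrier X) UNIV \<and> (\<forall>x\<in>carrier X. cmod (\<phi> x) = nrm X x)"

definition banach_ideal :: "nat \<Rightarrow> 'u poly_ideal \<Rightarrow> bool" where
  "banach_ideal k I \<longleftrightarrow>
     (\<forall>E. complex_banach_space E \<longrightarrow>
        polys I E \<subseteq> hom_poly E k \<and> complex_banach_space (ideal_space I E)) \<and>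
     (\<forall>E\<^sub>1 E R P. complex_banach_space E\<^sub>1 \<and> complex_banach_space E \<and>
        bdd_linear E\<^sub>1 E R \<and> P \<in> polys I E \<longrightarrow>
        zext (carrier E\<^sub>1) (P \<circ> R) \<in> polys I E\<^sub>1 \<and>
        pnorm I E\<^sub>1 (zext (carrier E\<^sub>1) (P \<circ> R)) \<le> pnorm I E P * opnorm E\<^sub>1 E R ^ k) \<and>
     (\<forall>X \<phi>. copy_of_scalars X \<phi> \<longrightarrow>
        zext (carrier X) (\<lambda>z. \<phi> z ^ k) \<in> polys I X \<and>
        pnorm I X (zext (carrier X) (\<lambda>z. \<phi> z ^ k)) = 1)"

definition holomorphy_type :: "(nat \<Rightarrow> 'u poly_ideal) \<Rightarrow> bool" where
  "holomorphy_type \<AA> \<longleftrightarrow>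
     (\<forall>k. banach_ideal k (\<AA> k)) \<and>
     (\<exists>(c::real) (C::nat \<Rightarrow> nat \<Rightarrow> real).
        (\<forall>k. \<forall>l\<le>k. C k l \<le> c ^ k) \<and>
        (\<forall>E k l P a. complex_banach_space E \<and> l \<le> k \<and> P \<in> polys (\<AA> k) E \<and> a \<in> carrier E \<longrightarrow>
           poly_at E k P a l \<in> polys (\<AA> (k - l)) E \<and>
           pnorm (\<AA> (k - l)) E (poly_at E k P a l) \<le> C k l * pnorm (\<AA> k) E P * nrm E a ^ l))"

section \<open>Holomorphic functions of bounded type associated with a holomorphy type\<close>

definition taylor_series_at :: "'u cnspace \<Rightarrow> ('u \<Rightarrow> complex) \<Rightarrow> 'u \<Rightarrow> (nat \<Rightarrow> 'u \<Rightarrow> complex) \<Rightarrow> bool" where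
  "taylor_series_at E f a P \<longleftrightarrow>
     (\<forall>k. P k \<in> hom_poly E k) \<and>
     (\<exists>r>0. uniform_limit {x \<in> carrier E. nrm E (x \<ominus>\<^bsub>E\<^esub> a) < r}
        (\<lambda>n x. \<Sum>k<n. P k (x \<ominus>\<^bsub>E\<^esub> a)) f sequentially)"

definition entire :: "'u cnspace \<Rightarrow> ('u \<Rightarrow> complex) set" where
  "entire E = {f. (\<forall>x. x \<notin> carrier E \<longrightarrow> f x = 0) \<and>
     (\<forall>a\<in>carrier E. \<exists>P. taylor_series_at E f a P)}"

text \<open>\<open>taylor_term E f k\<close> is \<open>d\<^sup>kf(0)/k!\<close>.\<close>

definition taylor_term :: "'u cnspace \<Rightarrow> ('u \<Rightarrow> complex) \<Rightarrow> nat \<Rightarrow> 'u \<Rightarrow> complex" where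
  "taylor_term E f = (THE P. taylor_series_at E f \<zero>\<^bsub>E\<^esub> P)"

definition Hb :: "(nat \<Rightarrow> 'u poly_ideal) \<Rightarrow> 'u cnspace \<Rightarrow> ('u \<Rightarrow> complex) set" where
  "Hb \<AA> E = {f \<in> entire E.
     (\<forall>k. fscale (fact k) (taylor_term E f k) \<in> polys (\<AA> k) E) \<and>
     (\<lambda>k. root k (pnorm (\<AA> k) E (taylor_term E f k))) \<longlonglongrightarrow> 0}"

definition Hb_seminorm :: "(nat \<Rightarrow> 'u poly_ideal) \<Rightarrow> 'u cnspace \<Rightarrow> real \<Rightarrow> ('u \<Rightarrow> complex) \<Rightarrow> real" where
  "Hb_seminorm \<AA> E s f = (\<Sum>k. s ^ k * pnorm (\<AA> k) E (taylor_term E f k))"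

definition Hb_topology :: "(nat \<Rightarrow> 'u poly_ideal) \<Rightarrow> 'u cnspace \<Rightarrow> ('u \<Rightarrow> complex) topology" where
  "Hb_topology \<AA> E = topology_generated_by
     {{g \<in> Hb \<AA> E. Hb_seminorm \<AA> E s (g - f) < r} | f s r. f \<in> Hb \<AA> E \<and> 0 < s \<and> 0 < r}"

section \<open>Convolution operators\<close>

definition translation :: "'u cnspace \<Rightarrow> 'u \<Rightarrow> ('u \<Rightarrow> complex) \<Rightarrow> 'u \<Rightarrow> complex" where
  "translation E x f = zext (carrier E) (\<lambda>y. f (x \<oplus>\<^bsub>E\<^esub> y))"

definition convolution_operator ::
    "(nat \<Rightarrow> 'u poly_ideal) \<Rightarrow> 'u cnspace \<Rightarrow> (('u \<Rightarrow> complex) \<Rightarrow> 'u \<Rightarrow> complex) \<Rightarrow> bool" where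
  "convolution_operator \<AA> E T \<longleftrightarrow>
     T \<in> Hb \<AA> E \<rightarrow> Hb \<AA> E \<and>
     (\<forall>f\<in>Hb \<AA> E. \<forall>g\<in>Hb \<AA> E. T (f + g) = T f + T g) \<and>
     (\<forall>c. \<forall>f\<in>Hb \<AA> E. T (fscale c f) = fscale c (T f)) \<and>
     continuous_map (Hb_topology \<AA> E) (Hb_topology \<AA> E) T \<and>
     (\<forall>x\<in>carrier E. \<forall>f\<in>Hb \<AA> E. T (translation E x f) = translation E x (T f))"

definition trivial_operator ::
    "(nat \<Rightarrow> 'u poly_ideal) \<Rightarrow> 'u cnspace \<Rightarrow> (('u \<Rightarrow> complex) \<Rightarrow> 'u \<Rightarrow> complex) \<Rightarrow> bool" where
  "trivial_operator \<AA> E T \<longleftrightarrow> (\<exists>c. \<forall>f\<in>Hb \<AA> E. T f = fscale c f)"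

section \<open>Frequent hypercyclicity\<close>

definition lower_density :: "nat set \<Rightarrow> ereal" where
  "lower_density A = liminf (\<lambda>N. ereal (real (card (A \<inter> {..N})) / real (N + 1)))"

definition frequently_hypercyclic :: "'x topology \<Rightarrow> ('x \<Rightarrow> 'x) \<Rightarrow> 'x \<Rightarrow> bool" where
  "frequently_hypercyclic X T x \<longleftrightarrow>
     x \<in> topspace X \<and>
     (\<forall>U. openin X U \<and> U \<noteq> {} \<longrightarrow> 0 < lower_density {n. (T ^^ n) x \<in> U})"

definition frequently_hypercyclic_subspace ::
    "('u \<Rightarrow> complex) topology \<Rightarrow> (('u \<Rightarrow> complex) \<Rightarrow> 'u \<Rightarrow> complex) \<Rightarrow> ('u \<Rightarrow> complex) set \<Rightarrow> bool" where
  "frequently_hypercyclic_subspace X T M \<longleftrightarrow>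
     closedin X M \<and> cfun.subspace M \<and>
     \<not> (\<exists>B. finite B \<and> M \<subseteq> cfun.span B) \<and>
     (\<forall>f\<in>M. f \<noteq> 0 \<longrightarrow> frequently_hypercyclic X T f)"

end

theory Submission
  imports Defs "HOL-Complex_Analysis.Complex_Analysis" "HOL-Combinatorics.Permutations"
begin

text \<open>A convolution operator \<open>T\<close> acts on exponentials of functionals by \<open>T (exp \<gamma>) = \<phi>(\<gamma>) exp \<gamma>\<close>,
  where the symbol \<open>\<phi>\<close> is entire along complex lines and non-constant since \<open>T\<close> is non-trivial.
  Averaging these eigenvectors over arcs on which \<open>\<bar>\<phi>\<bar> = 1\<close> gives bilateral orbits
  \<open>(Y\<^sub>n)\<close> whose seminorms decay quadratically in both directions and whose members \<open>Y\<^sub>0\<close> are dense.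

  Fix \<open>\<lambda>\<close> with \<open>\<bar>\<lambda>\<bar> < 1\<close> in the range of \<open>\<phi>\<close>. By Hurwitz' theorem in a two-dimensional
  space of functionals, the functions of two variables in the eigenspace for \<open>\<lambda>\<close> form a closed
  infinite-dimensional space \<open>M\<^sub>0\<close>, on which \<open>T\<^sup>n \<longlongrightarrow> 0\<close>. Choose countably many functionals \<open>c\<^sub>l\<close> that
  separate \<open>M\<^sub>0\<close> and are bounded by one seminorm, and let \<open>K f\<close> be the sum of \<open>c\<^sub>l(f) Y\<^bsub>-n\<^esub>\<close> over suitable pairwise
  separated sets of positions \<open>n\<close> of positive lower density, one for each \<open>l\<close> and each orbit. Then
  \<open>T\<^sup>n (f + K f)\<close> is close to \<open>c\<^sub>l(f) Y\<^sub>0\<close> at these positions, so \<open>f + K f\<close> is frequently hypercyclic unless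
  \<open>f = 0\<close>. Since \<open>K\<close> is small with respect to that one seminorm, \<open>I + K\<close> is injective on \<open>M\<^sub>0\<close> with closed
  range, and the range is the desired subspace.\<close>

section \<open>Normed spaces with explicit carrier\<close>

text \<open>The second dimension of \<open>E\<close> enters because an eigenspace in one variable
  can be finite-dimensional (for differentiation it is spanned by one exponential), whereas level
  sets of a holomorphic symbol in two variables have no isolated points. Orbits of eigenvectors with
  unimodular eigenvalue do not decay; averages over an arc against a weight with double zeros at its
  ends decay like 1/n^2, which is summable, and so infinitely many shifted orbits can be superposed.
  All requirements share one time axis. The exponent of 2 in k + 1 takes each value along an
  arithmetic progression, so that requirement i can claim a set of positive density and still keep
  the distance \<open>N i\<close> from all other positions. The topology of \<open>Hb\<close> is not
  given by one norm, but each of its seminorms is a norm. As the coordinates are bounded by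
  \<open>p 1\<close>, the operator K is bounded from \<open>p 1\<close> into every seminorm, and the
  one estimate p 1 (K f) \<le> p 1 f / 4 yields both injectivity and closed range of I + K.
  Functions of two variables allow explicit coordinates: values of Taylor polynomials at countably
  many points of a plane.\<close>

lemma complex_ring_simps [simp]:
  "carrier complex_ring = UNIV" "mult complex_ring = (*)" "one complex_ring = 1"
  "zero complex_ring = 0" "add complex_ring = (+)"
  by (simp_all add: complex_ring_def)

lemma complex_space_simps [simp]:
  "carrier complex_space = UNIV" "zero complex_space = 0" "add complex_space = (+)"
  "smult complex_space = (*)" "nrm complex_space = cmod"
  by (simp_all add: complex_space_def)

lemma fun_space_simps [simp]:
  "carrier (fun_space S N) = S" "zero (fun_space S N) = 0" "add (fun_space S N) = (+)"
  "smult (fun_space S N) = fscale" "nrm (fun_space S N) = N"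
  by (simp_all add: fun_space_def)

lemma complex_ring_cring: "cring complex_ring"
  by (rule cringI, rule abelian_groupI)
    (auto simp: algebra_simps add_eq_0_iff intro!: comm_monoidI exI[of _ "- _"])

lemma zext_simps [simp]: "x \<in> S \<Longrightarrow> zext S g x = g x" "x \<notin> S \<Longrightarrow> zext S g x = 0"
  by (auto simp: zext_def)

lemma fscale_apply [simp]: "fscale c f x = c * f x"
  by (simp add: fscale_def)

lemma fscale_simps [simp]: "fscale 0 f = 0" "fscale c 0 = 0" "fscale 1 f = f"
  by (auto simp: fscale_def fun_eq_iff)

context complex_normed_space
begin

lemma smult_carrier [simp]: "x \<in> carrier E \<Longrightarrow> c \<odot> x \<in> carrier E"
  using smult_closed[of c x] by simp

lemma smult_add_left: "x \<in> carrier E \<Longrightarrow> (a + b) \<odot> x = a \<odot> x \<oplus> b \<odot> x"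
  using smult_l_distr[of a b x] by simp

lemma smult_add_right: "x \<in> carrier E \<Longrightarrow> y \<in> carrier E \<Longrightarrow> c \<odot> (x \<oplus> y) = c \<odot> x \<oplus> c \<odot> y"
  using smult_r_distr[of c x y] by simp

lemma smult_smult: "x \<in> carrier E \<Longrightarrow> a \<odot> (b \<odot> x) = (a * b) \<odot> x"
  using smult_assoc1[of a b x] by simp

lemma smult_1 [simp]: "x \<in> carrier E \<Longrightarrow> 1 \<odot> x = x"
  using smult_one[of x] by simp

lemma smult_0_left [simp]: "x \<in> carrier E \<Longrightarrow> 0 \<odot> x = \<zero>"
  using smult_l_null[of x] by simp

lemma smult_0_right [simp]: "c \<odot> \<zero> = \<zero>"
  using smult_r_null[of c] by simp

lemma a_inv_eq_smult: "x \<in> carrier E \<Longrightarrow> \<ominus> x = (-1) \<odot> x"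
  using smult_l_minus[of 1 x] complex_ring_cring
  by (metis add.inv_equality add.m_comm add.r_inv complex_ring_simps(1) neg_eq_iff_add_eq_0
      smult_0_left smult_1 smult_add_left smult_carrier)

lemma diff_eq_smult: "x \<in> carrier E \<Longrightarrow> y \<in> carrier E \<Longrightarrow> x \<ominus> y = x \<oplus> (-1) \<odot> y"
  by (simp add: a_minus_def a_inv_eq_smult)

lemma nrm_0 [simp]: "nrm E \<zero> = 0"
  using nrm_eq_zero_iff by blast

lemma nrm_minus_commute:
  assumes "x \<in> carrier E" "y \<in> carrier E" shows "nrm E (x \<ominus> y) = nrm E (y \<ominus> x)"
proof -
  have "(-1) \<odot> (y \<ominus> x) = x \<ominus> y"
    using assms by (simp add: diff_eq_smult smult_add_right smult_smult M.add.m_comm)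
  then show ?thesis
    using nrm_smult[of "y \<ominus> x" "-1"] assms by simp
qed

lemma nrm_triangle_diff:
  assumes "x \<in> carrier E" "y \<in> carrier E" "z \<in> carrier E"
  shows "nrm E (x \<ominus> z) \<le> nrm E (x \<ominus> y) + nrm E (y \<ominus> z)"
proof -
  have "x \<ominus> z = (x \<ominus> y) \<oplus> (y \<ominus> z)"
    using assms by (simp add: M.minus_eq M.a_assoc M.r_neg1)
  then show ?thesis using nrm_triangle[of "x \<ominus> y" "y \<ominus> z"] assms by simp
qed

lemma Metric_space: "Metric_space (carrier E) (ndist E)"
proof
  show "0 \<le> ndist E x y" for x y by (simp add: ndist_def nrm_nonneg)
  show "ndist E x y = ndist E y x" for x y
    by (simp add: ndist_def nrm_minus_commute)
  show "(ndist E x y = 0) = (x = y)" if "x \<in> carrier E" "y \<in> carrier E" for x y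
    using that
    by (metis M.a_inv_closed M.add.right_cancel M.minus_closed M.minus_eq M.r_neg ndist_def nrm_eq_zero_iff)
  show "ndist E x z \<le> ndist E x y + ndist E y z"
    if "x \<in> carrier E" "y \<in> carrier E" "z \<in> carrier E" for x y z
    using that by (simp add: ndist_def nrm_triangle_diff)
qed

sublocale MS: Metric_space "carrier E" "ndist E"
  rewrites "Metric_space.mtopology (carrier E) (ndist E) = ntop E"
  by (rule Metric_space) (simp add: ntop_def)

end

lemma complex_normed_space_fun_spaceI:
  assumes "cfun.subspace S"
    and "\<And>f. f \<in> S \<Longrightarrow> 0 \<le> N f" "\<And>f. f \<in> S \<Longrightarrow> N f = 0 \<Longrightarrow> f = 0" "N 0 = 0"
    and "\<And>f c. f \<in> S \<Longrightarrow> N (fscale c f) = cmod c * N f"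
    and "\<And>f g. f \<in> S \<Longrightarrow> g \<in> S \<Longrightarrow> N (f + g) \<le> N f + N g"
  shows "complex_normed_space (fun_space S N)"
proof -
  have "module complex_ring (fun_space S N)"
  proof (rule moduleI[OF complex_ring_cring])
    have "\<exists>y\<in>S. y + x = 0" if "x \<in> S" for x
      using cfun.subspace_neg[OF assms(1) that] by (intro bexI[of _ "-x"]) auto
    then show "abelian_group (fun_space S N)"
      using assms(1) by (intro abelian_groupI) (auto simp: algebra_simps cfun.subspace_def)
  qed (use assms(1) in \<open>auto simp: cfun.subspace_def fun_eq_iff algebra_simps\<close>)
  then show ?thesis
    using assms by (intro complex_normed_space.intro complex_normed_space_axioms.intro) auto
qed

text \<open>The dual and every component of an ideal are records over functions. The locale
  translates the record operations once into pointwise \<open>+\<close>, \<open>-\<close> and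
  \<open>fscale\<close>, so that later estimates read as ordinary ones.\<close>

locale function_normed_space =
  fixes S :: "('u \<Rightarrow> complex) set" and N
  assumes normed_space: "complex_normed_space (fun_space S N)"
begin

sublocale FS: complex_normed_space "fun_space S N"
  by (rule normed_space)

lemma add_mem: "f \<in> S \<Longrightarrow> g \<in> S \<Longrightarrow> f + g \<in> S"
  using FS.M.a_closed[of f g] by simp

lemma fscale_mem: "f \<in> S \<Longrightarrow> fscale c f \<in> S"
  using FS.smult_carrier[of f c] by simp

lemma zero_mem: "0 \<in> S"
  using FS.M.zero_closed by simp

lemma subspace: "cfun.subspace S"
  by (simp add: cfun.subspace_def add_mem fscale_mem zero_mem)

lemma diff_mem: "f \<in> S \<Longrightarrow> g \<in> S \<Longrightarrow> f - g \<in> S"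
  using cfun.subspace_diff[OF subspace] .

lemma sum_mem: "(\<And>i. i \<in> I \<Longrightarrow> f i \<in> S) \<Longrightarrow> (\<Sum>i\<in>I. f i) \<in> S"
  using cfun.subspace_sum[OF subspace] .

lemma minus_eq:
  assumes "f \<in> S" "g \<in> S"
  shows "f \<ominus>\<^bsub>fun_space S N\<^esub> g = f - g"
proof -
  have "f \<ominus>\<^bsub>fun_space S N\<^esub> g = f + fscale (-1) g"
    using FS.diff_eq_smult[of f g] assms by simp
  then show ?thesis by (simp add: fun_eq_iff)
qed

lemma norm_nonneg: "f \<in> S \<Longrightarrow> 0 \<le> N f"
  using FS.nrm_nonneg[of f] by simp

lemma norm_eq_0: "f \<in> S \<Longrightarrow> N f = 0 \<longleftrightarrow> f = 0"
  using FS.nrm_eq_zero_iff[of f] by simp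

lemma norm_0 [simp]: "N 0 = 0"
  using FS.nrm_0 by simp

lemma norm_fscale: "f \<in> S \<Longrightarrow> N (fscale c f) = cmod c * N f"
  using FS.nrm_smult[of f c] by simp

lemma norm_triangle: "f \<in> S \<Longrightarrow> g \<in> S \<Longrightarrow> N (f + g) \<le> N f + N g"
  using FS.nrm_triangle[of f g] by simp

lemma norm_minus_commute: "f \<in> S \<Longrightarrow> g \<in> S \<Longrightarrow> N (f - g) = N (g - f)"
  using FS.nrm_minus_commute[of f g] by (simp add: minus_eq)

lemma norm_triangle_diff: "f \<in> S \<Longrightarrow> g \<in> S \<Longrightarrow> h \<in> S \<Longrightarrow> N (f - h) \<le> N (f - g) + N (g - h)"
  using FS.nrm_triangle_diff[of f g h] by (simp add: minus_eq)

lemma norm_sum: "(\<And>i. i \<in> I \<Longrightarrow> f i \<in> S) \<Longrightarrow> N (\<Sum>i\<in>I. f i) \<le> (\<Sum>i\<in>I. N (f i))"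
proof (induction I rule: infinite_finite_induct)
  case (insert i I)
  have "N (f i + (\<Sum>i\<in>I. f i)) \<le> N (f i) + N (\<Sum>i\<in>I. f i)"
    using insert.prems by (intro norm_triangle sum_mem) auto
  moreover have "N (\<Sum>i\<in>I. f i) \<le> (\<Sum>i\<in>I. N (f i))"
    using insert.prems by (intro insert.IH) auto
  ultimately show ?case unfolding sum.insert[OF insert.hyps] by linarith
qed auto

lemma dist_eq: "f \<in> S \<Longrightarrow> g \<in> S \<Longrightarrow> ndist (fun_space S N) f g = N (f - g)"
  by (simp add: ndist_def minus_eq)

lemma topspace_eq: "topspace (ntop (fun_space S N)) = S"
  using FS.MS.topspace_mtopology by simp

lemma mball_iff:
  "g \<in> Metric_space.mball S (ndist (fun_space S N)) f r \<longleftrightarrow> f \<in> S \<and> g \<in> S \<and> N (g - f) < r"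
  using FS.MS.in_mball[of g f r] by (auto simp: dist_eq norm_minus_commute)

lemma closure_iff:
  assumes "X \<subseteq> S"
  shows "f \<in> ntop (fun_space S N) closure_of X \<longleftrightarrow> f \<in> S \<and> (\<forall>e>0. \<exists>g\<in>X. N (g - f) < e)"
proof -
  have "f \<in> ntop (fun_space S N) closure_of X \<longleftrightarrow> f \<in> S \<and>
     (\<forall>r>0. \<exists>g\<in>X. g \<in> Metric_space.mball S (ndist (fun_space S N)) f r)"
    using FS.MS.metric_closure_of[of X] by simp
  then show ?thesis using assms by (auto simp: mball_iff subset_iff)
qed

end

section \<open>Multilinear forms and homogeneous polynomials\<close>

text \<open>Pascal's rule, in the form that the induction in \<open>multilinear_binomial\<close>
  produces when one more argument is split.\<close>

lemma sum_binomial_shift: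
  fixes g :: "nat \<Rightarrow> complex"
  shows "(\<Sum>j\<le>n. of_nat (n choose j) * (g (Suc j) + g j)) = (\<Sum>j\<le>Suc n. of_nat (Suc n choose j) * g j)"
proof -
  have "(\<Sum>j\<le>Suc n. of_nat (Suc n choose j) * g j) =
      g 0 + (\<Sum>j\<le>n. of_nat (Suc n choose Suc j) * g (Suc j))"
    by (subst sum.atMost_Suc_shift) simp
  also have "\<dots> = (\<Sum>j\<le>n. of_nat (n choose j) * g (Suc j)) +
      (g 0 + (\<Sum>j\<le>n. of_nat (n choose Suc j) * g (Suc j)))"
    by (simp add: algebra_simps sum.distrib)
  also have "g 0 + (\<Sum>j\<le>n. of_nat (n choose Suc j) * g (Suc j)) = (\<Sum>j\<le>Suc n. of_nat (n choose j) * g j)"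
    by (subst sum.atMost_Suc_shift) simp
  also have "\<dots> = (\<Sum>j\<le>n. of_nat (n choose j) * g j)" by simp
  finally show ?thesis by (simp add: algebra_simps sum.distrib)
qed

context complex_normed_space
begin

lemma multilinear_lincomb:
  assumes "multilinear_form E k A" "length us + length vs + 1 = k"
    "set us \<subseteq> carrier E" "set vs \<subseteq> carrier E" "x \<in> carrier E" "y \<in> carrier E"
  shows "A (us @ (c \<odot> x \<oplus> d \<odot> y) # vs) = c * A (us @ x # vs) + d * A (us @ y # vs)"
  using assms unfolding multilinear_form_def by simp

lemma multilinear_add:
  assumes "multilinear_form E k A" "length us + length vs + 1 = k"
    "set us \<subseteq> carrier E" "set vs \<subseteq> carrier E" "x \<in> carrier E" "y \<in> carrier E"
  shows "A (us @ (x \<oplus> y) # vs) = A (us @ x # vs) + A (us @ y # vs)"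
  using multilinear_lincomb[OF assms, of 1 1] assms by simp

lemma multilinear_smult:
  assumes "multilinear_form E k A" "length us + length vs + 1 = k"
    "set us \<subseteq> carrier E" "set vs \<subseteq> carrier E" "x \<in> carrier E"
  shows "A (us @ (c \<odot> x) # vs) = c * A (us @ x # vs)"
  using multilinear_lincomb[OF assms assms(5), of c 0] assms by simp

lemma multilinear_replicate_smult:
  assumes "multilinear_form E k A" "length us + n = k" "set us \<subseteq> carrier E" "x \<in> carrier E"
  shows "A (us @ replicate n (c \<odot> x)) = c ^ n * A (us @ replicate n x)"
  using assms(2,3)
proof (induction n arbitrary: us)
  case (Suc n)
  have "A (us @ replicate (Suc n) (c \<odot> x)) = c * A ((us @ [x]) @ replicate n (c \<odot> x))"
    using multilinear_smult[OF assms(1), of us "replicate n (c \<odot> x)" x c] Suc.prems assms(4)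
    by (auto simp: set_replicate_conv_if)
  also have "A ((us @ [x]) @ replicate n (c \<odot> x)) = c ^ n * A ((us @ [x]) @ replicate n x)"
    using Suc.prems assms(4) by (intro Suc.IH) auto
  finally show ?case by simp
qed simp

lemma multilinear_binomial:
  assumes "multilinear_form E k A" "symmetric_form A" "length us + n = k" "set us \<subseteq> carrier E"
    "x \<in> carrier E" "y \<in> carrier E"
  shows "A (us @ replicate n (x \<oplus> y)) =
    (\<Sum>j\<le>n. of_nat (n choose j) * A (us @ replicate j x @ replicate (n - j) y))"
  using assms(3,4)
proof (induction n arbitrary: us)
  case (Suc n)
  let ?g = "\<lambda>j. A (us @ replicate j x @ replicate (Suc n - j) y)"
  have "A (us @ replicate (Suc n) (x \<oplus> y)) =
      A ((us @ [x]) @ replicate n (x \<oplus> y)) + A ((us @ [y]) @ replicate n (x \<oplus> y))"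
    using multilinear_add[OF assms(1), of us "replicate n (x \<oplus> y)" x y] Suc.prems assms(5,6)
    by (auto simp: set_replicate_conv_if)
  also have "A ((us @ [x]) @ replicate n (x \<oplus> y)) =
      (\<Sum>j\<le>n. of_nat (n choose j) * A ((us @ [x]) @ replicate j x @ replicate (n - j) y))"
    using Suc.prems assms(5) by (intro Suc.IH) auto
  also have "\<dots> = (\<Sum>j\<le>n. of_nat (n choose j) * ?g (Suc j))" by simp
  also have "A ((us @ [y]) @ replicate n (x \<oplus> y)) =
      (\<Sum>j\<le>n. of_nat (n choose j) * A ((us @ [y]) @ replicate j x @ replicate (n - j) y))"
    using Suc.prems assms(6) by (intro Suc.IH) auto
  also have "\<dots> = (\<Sum>j\<le>n. of_nat (n choose j) * ?g j)"
    using assms(2) by (intro sum.cong refl arg_cong2[where f="(*)"])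
      (auto simp: symmetric_form_def Suc_diff_le)
  also have "(\<Sum>j\<le>n. of_nat (n choose j) * ?g (Suc j)) + (\<Sum>j\<le>n. of_nat (n choose j) * ?g j) =
      (\<Sum>j\<le>n. of_nat (n choose j) * (?g (Suc j) + ?g j))"
    by (simp only: sum.distrib distrib_left)
  also have "\<dots> = (\<Sum>j\<le>Suc n. of_nat (Suc n choose j) * ?g j)" by (rule sum_binomial_shift)
  finally show ?case .
qed simp

text \<open>Polarization by induction instead of by a formula. With t y + x in all n + 1 free
  places, \<open>A\<close> is a polynomial in the scalar t that vanishes identically; its linear
  coefficient is n + 1 times \<open>A\<close> with one entry y and n entries x. So one diagonal
  entry after the other is freed.\<close>

lemma symmetric_multilinear_eq_0:
  assumes A: "multilinear_form E k A" "symmetric_form A"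
    and 0: "\<And>x. x \<in> carrier E \<Longrightarrow> A (us @ replicate n x) = 0"
    and "length us + n = k" "set us \<subseteq> carrier E" "length ys = n" "set ys \<subseteq> carrier E"
  shows "A (us @ ys) = 0"
  using 0 assms(4-)
proof (induction n arbitrary: us ys)
  case 0
  then show ?case using 0(1)[of \<zero>] by simp
next
  case (Suc n)
  obtain y zs where ys: "ys = y # zs" using Suc.prems(4) by (cases ys) auto
  have y: "y \<in> carrier E" using Suc.prems ys by simp
  have "A ((us @ [y]) @ replicate n x) = 0" if x: "x \<in> carrier E" for x
  proof -
    define c where "c j = of_nat (Suc n choose j) * A (us @ replicate j y @ replicate (Suc n - j) x)" for j
    have "(\<Sum>j\<le>Suc n. c j * t ^ j) = 0" for t
    proof -
      have "A (us @ replicate j (t \<odot> y) @ replicate (Suc n - j) x) =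
          t ^ j * A (us @ replicate j y @ replicate (Suc n - j) x)" if "j \<le> Suc n" for j
      proof -
        have "A (us @ replicate j (t \<odot> y) @ replicate (Suc n - j) x) =
            A ((us @ replicate (Suc n - j) x) @ replicate j (t \<odot> y))"
          using A(2) by (auto simp: symmetric_form_def)
        also have "\<dots> = t ^ j * A ((us @ replicate (Suc n - j) x) @ replicate j y)"
          using Suc.prems x y that by (intro multilinear_replicate_smult[OF A(1)]) auto
        also have "A ((us @ replicate (Suc n - j) x) @ replicate j y) =
            A (us @ replicate j y @ replicate (Suc n - j) x)"
          using A(2) by (auto simp: symmetric_form_def)
        finally show ?thesis .
      qed
      then have "(\<Sum>j\<le>Suc n. c j * t ^ j) = A (us @ replicate (Suc n) (t \<odot> y \<oplus> x))"
        using multilinear_binomial[OF A Suc.prems(2,3), of "t \<odot> y" x] x y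
        by (simp del: sum.atMost_Suc add: c_def mult_ac)
      then show ?thesis using Suc.prems(1)[of "t \<odot> y \<oplus> x"] x y by simp
    qed
    then have "c 1 = 0" using polyfun_eq_0[of c "Suc n"] by auto
    then show ?thesis unfolding c_def by (simp del: of_nat_Suc)
  qed
  then show ?case
    using Suc.IH[of "us @ [y]" zs] Suc.prems ys y by simp
qed

lemma permute_multilinear:
  assumes A: "multilinear_form E k A" and p: "p permutes {..<k}"
    and l: "length us + length vs + 1 = k" "set us \<subseteq> carrier E" "set vs \<subseteq> carrier E"
      "x \<in> carrier E" "y \<in> carrier E"
  defines "S \<equiv> \<lambda>xs. map (\<lambda>i. xs ! p i) [0..<k]"
  shows "A (S (us @ (c \<odot> x \<oplus> d \<odot> y) # vs)) = c * A (S (us @ x # vs)) + d * A (S (us @ y # vs))"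
proof -
  \<comment> \<open>The slot that receives the varying vector after the permutation; every other
    slot reads an entry that does not depend on it.\<close>
  define i where "i = Hilbert_Choice.inv p (length us)"
  have pi: "p i = length us" and i: "i < k"
    using p l(1) permutes_inverses(1)[OF p] permutes_in_image[OF permutes_inv[OF p], of "length us"]
    by (auto simp: i_def)
  have split: "[0..<k] = [0..<i] @ i # [Suc i..<k]"
    using i upt_add_eq_append[of 0 i "k - i"] by (simp add: upt_conv_Cons)
  define L R where "L z = map (\<lambda>j. (us @ z # vs) ! p j) [0..<i]" and
    "R z = map (\<lambda>j. (us @ z # vs) ! p j) [Suc i..<k]" for z
  have ne: "p j \<noteq> length us" if "j \<noteq> i" for j
    using that pi permutes_inj[OF p] by (metis injD)
  have nth: "(us @ z # vs) ! p j = (us @ x # vs) ! p j" if "j \<noteq> i" for z j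
    using ne[OF that] by (auto simp: nth_append nth_Cons split: nat.split)
  have "L z = L x" "R z = R x" for z
    unfolding L_def R_def by (intro map_cong refl nth; simp)+
  moreover have "S (us @ z # vs) = L z @ z # R z" for z
    unfolding S_def split L_def R_def using pi by simp
  ultimately have S: "S (us @ z # vs) = L x @ z # R x" for z by metis
  have mem: "(us @ x # vs) ! p j \<in> carrier E" if "j < k" for j
  proof -
    have "p j < k" using permutes_in_image[OF p, of j] that by simp
    then have "(us @ x # vs) ! p j \<in> set (us @ x # vs)" using l by (intro nth_mem) simp
    then show ?thesis using l by auto
  qed
  have "length (L x) + length (R x) + 1 = k" "set (L x) \<subseteq> carrier E" "set (R x) \<subseteq> carrier E"
    using i mem by (auto simp: L_def R_def)
  then show ?thesis unfolding S using l by (intro multilinear_lincomb[OF A]) auto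
qed

text \<open>Averaging over all permutations. A \<open>hom_poly\<close> comes from an arbitrary
  multilinear form, whereas \<open>polar\<close> asks for a symmetric one.\<close>

lemma symmetrization:
  assumes A: "multilinear_form E k A"
  shows "\<exists>B. multilinear_form E k B \<and> symmetric_form B \<and> diag E k B = diag E k A"
proof -
  define S where "S p xs = map (\<lambda>i. xs ! p i) [0..<k]" for p and xs :: "'u list"
  define ok where "ok xs \<longleftrightarrow> length xs = k \<and> set xs \<subseteq> carrier E" for xs
  define B where "B xs = (if ok xs then (\<Sum>p | p permutes {..<k}. A (S p xs)) / fact k else 0)" for xs
  have "multilinear_form E k B"
    unfolding multilinear_form_def
  proof (intro conjI allI impI)
    show "B xs = 0" if "\<not> (length xs = k \<and> set xs \<subseteq> carrier E)" for xs
      using that by (auto simp: B_def ok_def)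
    fix us vs x y c d
    assume *: "length us + length vs + 1 = k \<and> set us \<union> set vs \<union> {x, y} \<subseteq> carrier E"
    have "A (S p (us @ (c \<odot> x \<oplus> d \<odot> y) # vs)) = c * A (S p (us @ x # vs)) + d * A (S p (us @ y # vs))"
      if "p permutes {..<k}" for p
      unfolding S_def using * by (intro permute_multilinear[OF A that]) auto
    then have "(\<Sum>p | p permutes {..<k}. A (S p (us @ (c \<odot> x \<oplus> d \<odot> y) # vs))) =
        (\<Sum>p | p permutes {..<k}. c * A (S p (us @ x # vs)) + d * A (S p (us @ y # vs)))"
      by (intro sum.cong refl) simp
    moreover have "ok (us @ z # vs)" if "z \<in> carrier E" for z
      using * that by (auto simp: ok_def)
    ultimately show "B (us @ (c \<odot> x \<oplus> d \<odot> y) # vs) = c * B (us @ x # vs) + d * B (us @ y # vs)"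
      using * by (simp add: B_def sum.distrib flip: sum_distrib_left) (simp add: add_divide_distrib)
  qed
  moreover have "symmetric_form B"
    unfolding symmetric_form_def
  proof (intro allI impI)
    fix xs ys :: "'u list" assume "mset xs = mset ys"
    then obtain q where q: "q permutes {..<length ys}" "permute_list q ys = xs"
      using mset_eq_permutation by blast
    have ok: "ok xs \<longleftrightarrow> ok ys"
      using \<open>mset xs = mset ys\<close> by (metis mset_eq_length mset_eq_setD ok_def)
    show "B xs = B ys"
    proof (cases "ok ys")
      case True
      then have k: "length ys = k" "length xs = k" using ok by (auto simp: ok_def)
      have "S p xs = S (q \<circ> p) ys" if "p permutes {..<k}" for p
        unfolding S_def q(2)[symmetric] using k permutes_in_image[OF that]
        by (auto simp: permute_list_def)
      then have "(\<Sum>p | p permutes {..<k}. A (S p xs)) = (\<Sum>p | p permutes {..<k}. A (S (q \<circ> p) ys))"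
        by (intro sum.cong) auto
      also have "\<dots> = (\<Sum>p | p permutes {..<k}. A (S p ys))"
        using setum_permutations_compose_left[of q "{..<k}" "\<lambda>p. A (S p ys)"] q(1) k by simp
      finally show ?thesis using True ok by (simp add: B_def)
    qed (use ok in \<open>simp add: B_def\<close>)
  qed
  moreover have "diag E k B = diag E k A"
  proof
    fix x
    have "S p (replicate k x) = replicate k x" if "p permutes {..<k}" for p
      using permutes_in_image[OF that] by (auto simp: S_def list_eq_iff_nth_eq)
    then have "(\<Sum>p | p permutes {..<k}. A (S p (replicate k x))) =
        of_nat (card {p. p permutes {..<k}}) * A (replicate k x)"
      by simp
    then have "(\<Sum>p | p permutes {..<k}. A (S p (replicate k x))) = fact k * A (replicate k x)"
      by (simp add: card_permutations)
    then show "diag E k B x = diag E k A x"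
      by (auto simp: diag_def zext_def B_def ok_def)
  qed
  ultimately show ?thesis by blast
qed

text \<open>Justifies the description in \<open>polar\<close>: existence is
  \<open>symmetrization\<close>, and two candidates differ by a symmetric form with zero diagonal,
  which vanishes by \<open>symmetric_multilinear_eq_0\<close>.\<close>

lemma polar:
  assumes "P \<in> hom_poly E k"
  shows "multilinear_form E k (polar E k P)" "symmetric_form (polar E k P)"
    "diag E k (polar E k P) = P"
proof -
  obtain A where "multilinear_form E k A" "P = diag E k A"
    using assms by (auto simp: hom_poly_def)
  then obtain B where B: "multilinear_form E k B" "symmetric_form B" "diag E k B = P"
    using symmetrization by metis
  have "C = B" if C: "multilinear_form E k C" "symmetric_form C" "diag E k C = P" for C
  proof
    fix ys
    define D where "D xs = C xs - B xs" for xs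
    have D: "multilinear_form E k D"
      using B(1) C(1) unfolding multilinear_form_def D_def by (simp add: algebra_simps)
    have D': "symmetric_form D"
      using B(2) C(2) unfolding symmetric_form_def D_def by metis
    have 0: "D ([] @ replicate k x) = 0" if "x \<in> carrier E" for x
      using fun_cong[OF B(3), of x] fun_cong[OF C(3), of x] that by (simp add: diag_def D_def)
    have "D ys = 0"
    proof (cases "length ys = k \<and> set ys \<subseteq> carrier E")
      case True
      then show ?thesis using symmetric_multilinear_eq_0[OF D D' 0, where ys=ys] by simp
    qed (use D in \<open>simp add: multilinear_form_def\<close>)
    then show "C ys = B ys" by (simp add: D_def)
  qed
  then have "\<exists>!A. multilinear_form E k A \<and> symmetric_form A \<and> diag E k A = P"
    using B by blast
  from theI'[OF this] show "multilinear_form E k (polar E k P)" "symmetric_form (polar E k P)"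
    "diag E k (polar E k P) = P"
    by (simp_all add: polar_def)
qed

lemma hom_poly_outside: "P \<in> hom_poly E k \<Longrightarrow> x \<notin> carrier E \<Longrightarrow> P x = 0"
  by (auto simp: hom_poly_def diag_def)

lemma hom_poly_smult:
  assumes "P \<in> hom_poly E k" "x \<in> carrier E"
  shows "P (c \<odot> x) = c ^ k * P x"
proof -
  have "P z = polar E k P ([] @ replicate k z)" if "z \<in> carrier E" for z
    using fun_cong[OF polar(3)[OF assms(1)], of z] that by (simp add: diag_def)
  then show ?thesis
    using multilinear_replicate_smult[OF polar(1)[OF assms(1)], of "[]" k x c] assms by simp
qed

lemma hom_poly_binomial:
  assumes "P \<in> hom_poly E k" "x \<in> carrier E" "y \<in> carrier E"
  shows "P (x \<oplus> y) = (\<Sum>j\<le>k. of_nat (k choose j) * poly_at E k P x j y)"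
proof -
  have "P z = polar E k P ([] @ replicate k z)" if "z \<in> carrier E" for z
    using fun_cong[OF polar(3)[OF assms(1)], of z] that by (simp add: diag_def)
  then show ?thesis
    using multilinear_binomial[OF polar(1,2)[OF assms(1)], of "[]" k x y] assms
    by (simp add: poly_at_def)
qed

lemma poly_at_smult:
  assumes "P \<in> hom_poly E k" "x \<in> carrier E" "y \<in> carrier E" "j \<le> k"
  shows "poly_at E k P (c \<odot> x) j y = c ^ j * poly_at E k P x j y"
proof -
  have sym: "polar E k P (replicate j z @ replicate (k - j) y) =
      polar E k P (replicate (k - j) y @ replicate j z)" for z
    using polar(2)[OF assms(1)] by (auto simp: symmetric_form_def)
  have "set (replicate (k - j) y) \<subseteq> carrier E" using assms by auto
  then show ?thesis
    using multilinear_replicate_smult[OF polar(1)[OF assms(1)], of "replicate (k - j) y" j x c] assms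
    by (simp add: poly_at_def sym)
qed

end

section \<open>The Hahn-Banach theorem\<close>

context complex_normed_space
begin

text \<open>Positive homogeneity refers to real scalars, since the real form of the theorem is
  proved first. The fixed value off the carrier lets the comparisons in Zorn's lemma range over the
  whole type.\<close>

definition sublinear :: "('u \<Rightarrow> real) \<Rightarrow> bool" where
  "sublinear p \<longleftrightarrow> (\<forall>x\<in>carrier E. \<forall>y\<in>carrier E. p (x \<oplus> y) \<le> p x + p y) \<and>
     (\<forall>x\<in>carrier E. \<forall>r\<ge>0. p (complex_of_real r \<odot> x) = r * p x) \<and> (\<forall>x. x \<notin> carrier E \<longrightarrow> p x = 0)"

lemma sublinearD:
  assumes "sublinear p"
  shows "x \<in> carrier E \<Longrightarrow> y \<in> carrier E \<Longrightarrow> p (x \<oplus> y) \<le> p x + p y"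
    "x \<in> carrier E \<Longrightarrow> 0 \<le> r \<Longrightarrow> p (complex_of_real r \<odot> x) = r * p x"
    "x \<notin> carrier E \<Longrightarrow> p x = 0"
  using assms by (auto simp: sublinear_def)

lemma sublinear_zero: "sublinear p \<Longrightarrow> p \<zero> = 0"
  using sublinearD(2)[of p \<zero> 0] by simp

lemma sublinear_neg: "sublinear p \<Longrightarrow> x \<in> carrier E \<Longrightarrow> - p ((-1) \<odot> x) \<le> p x"
  using sublinearD(1)[of p x "(-1) \<odot> x"] sublinear_zero[of p]
  by (simp add: M.r_neg flip: a_inv_eq_smult)

text \<open>One inequality for positive factors is enough, because applying it to the inverse factor
  gives the other. For infima only this inequality is immediate.\<close>

lemma sublinearI:
  assumes "\<And>x y. x \<in> carrier E \<Longrightarrow> y \<in> carrier E \<Longrightarrow> p (x \<oplus> y) \<le> p x + p y"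
    and le: "\<And>x r. x \<in> carrier E \<Longrightarrow> 0 < r \<Longrightarrow> p (complex_of_real r \<odot> x) \<le> r * p x"
    and "p \<zero> = 0" "\<And>x. x \<notin> carrier E \<Longrightarrow> p x = 0"
  shows "sublinear p"
proof -
  have "p (complex_of_real r \<odot> x) = r * p x" if x: "x \<in> carrier E" and r: "0 \<le> r" for x r
  proof (cases "r = 0")
    case False
    then have "p x \<le> inverse r * p (complex_of_real r \<odot> x)"
      using le[of "complex_of_real r \<odot> x" "inverse r"] x r
      by (simp add: smult_smult flip: of_real_mult)
    then have "r * p x \<le> p (complex_of_real r \<odot> x)"
      using False r by (simp add: field_simps)
    then show ?thesis using le[of x r] False r x by simp
  qed (use x assms in simp)
  then show ?thesis using assms unfolding sublinear_def by blast
qed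

text \<open>Lowering \<open>p\<close> in the direction \<open>a\<close> until it is linear on the line through \<open>a\<close>.\<close>

lemma sublinear_reduce:
  assumes p: "sublinear p" and a: "a \<in> carrier E"
  shows "\<exists>q. sublinear q \<and> (\<forall>x. q x \<le> p x) \<and> q ((-1) \<odot> a) \<le> - p a"
proof -
  define h where "h x t = p (x \<oplus> complex_of_real t \<odot> a) - t * p a" for x t
  define q where "q x = (if x \<in> carrier E then INF t\<in>{0..}. h x t else 0)" for x
  \<comment> \<open>This bound does not depend on t, so the infimum in \<open>q\<close> is taken
    over a set that is bounded below.\<close>
  have lower: "- p ((-1) \<odot> x) \<le> h x t" if x: "x \<in> carrier E" and t: "0 \<le> t" for x t
  proof -
    have "t * p a = p (complex_of_real t \<odot> a)" using p a t by (simp add: sublinearD)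
    also have "complex_of_real t \<odot> a = (x \<oplus> complex_of_real t \<odot> a) \<oplus> (-1) \<odot> x"
      using x a by (simp add: M.a_ac M.r_neg2 flip: a_inv_eq_smult)
    also have "p \<dots> \<le> p (x \<oplus> complex_of_real t \<odot> a) + p ((-1) \<odot> x)"
      using x a by (intro sublinearD(1)[OF p]) auto
    finally show ?thesis by (simp add: h_def)
  qed
  have bdd: "bdd_below (h x ` {0..})" if "x \<in> carrier E" for x
    using lower[OF that] by (intro bdd_belowI2[where m="- p ((-1) \<odot> x)"]) auto
  have le: "q x \<le> h x t" if "x \<in> carrier E" "0 \<le> t" for x t
    using that bdd by (auto simp: q_def intro!: cINF_lower)
  have ge: "c \<le> q x" if "x \<in> carrier E" "\<And>t. 0 \<le> t \<Longrightarrow> c \<le> h x t" for x c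
    using that by (auto simp: q_def intro!: cINF_greatest)
  have "sublinear q"
  proof (rule sublinearI)
    fix x y assume x: "x \<in> carrier E" and y: "y \<in> carrier E"
    have "q (x \<oplus> y) \<le> h x t + h y s" if "0 \<le> t" "0 \<le> s" for t s
    proof -
      have "q (x \<oplus> y) \<le> h (x \<oplus> y) (t + s)" using x y that by (intro le) auto
      also have "(x \<oplus> y) \<oplus> complex_of_real (t + s) \<odot> a =
          (x \<oplus> complex_of_real t \<odot> a) \<oplus> (y \<oplus> complex_of_real s \<odot> a)"
        using x y a by (simp add: smult_add_left M.a_ac)
      then have "h (x \<oplus> y) (t + s) \<le> h x t + h y s"
        using sublinearD(1)[OF p, of "x \<oplus> complex_of_real t \<odot> a" "y \<oplus> complex_of_real s \<odot> a"] x y a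
        by (simp add: h_def algebra_simps)
      finally show ?thesis .
    qed
    then have "q (x \<oplus> y) - h y s \<le> q x" if "0 \<le> s" for s
      using that x by (intro ge) (auto simp: algebra_simps)
    then have "q (x \<oplus> y) - q x \<le> q y"
      using y by (intro ge) (auto simp: algebra_simps)
    then show "q (x \<oplus> y) \<le> q x + q y" by simp
  next
    fix x and r :: real assume x: "x \<in> carrier E" and r: "0 < r"
    have "q (complex_of_real r \<odot> x) / r \<le> h x t" if "0 \<le> t" for t
    proof -
      have "q (complex_of_real r \<odot> x) \<le> h (complex_of_real r \<odot> x) (r * t)"
        using x r that by (intro le) auto
      also have "complex_of_real r \<odot> x \<oplus> complex_of_real (r * t) \<odot> a =
          complex_of_real r \<odot> (x \<oplus> complex_of_real t \<odot> a)"
        using x a by (simp add: smult_add_right smult_smult)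
      then have "h (complex_of_real r \<odot> x) (r * t) = r * h x t"
        using sublinearD(2)[OF p, of "x \<oplus> complex_of_real t \<odot> a" r] x a r
        by (simp add: h_def algebra_simps)
      finally show ?thesis using r by (simp add: field_simps)
    qed
    then have "q (complex_of_real r \<odot> x) / r \<le> q x" using x by (intro ge) auto
    then show "q (complex_of_real r \<odot> x) \<le> r * q x" using r by (simp add: field_simps)
  next
    have "h \<zero> t = 0" if "0 \<le> t" for t
      using p a that sublinearD(2)[OF p a] by (simp add: h_def)
    then have "q \<zero> = (INF t\<in>{0::real..}. 0)" by (simp add: q_def cong: INF_cong_simp)
    then show "q \<zero> = 0" by simp
  qed (simp add: q_def)
  moreover have "q x \<le> p x" for x
    using le[of x 0] sublinearD(3)[OF p, of x] a by (cases "x \<in> carrier E") (auto simp: h_def q_def)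
  moreover have "q ((-1) \<odot> a) \<le> - p a"
    using le[of "(-1) \<odot> a" 1] a sublinear_zero[OF p] by (simp add: h_def M.l_neg flip: a_inv_eq_smult)
  ultimately show ?thesis by blast
qed

text \<open>A minimal sublinear functional is odd, for otherwise \<open>sublinear_reduce\<close>
  would produce a strictly smaller one. Oddness and subadditivity together give real
  linearity.\<close>

lemma minimal_sublinear:
  assumes p: "sublinear p"
  shows "\<exists>q. sublinear q \<and> (\<forall>x. q x \<le> p x) \<and> (\<forall>a\<in>carrier E. q ((-1) \<odot> a) = - q a)"
proof -
  define \<Q> where "\<Q> = {q. sublinear q \<and> (\<forall>x. q x \<le> p x)}"
  \<comment> \<open>The order is reversed, so that the maximal element of Zorn's lemma is minimal
    and a chain is bounded by its pointwise infimum.\<close>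
  define le where "le q r \<longleftrightarrow> (\<forall>x. r x \<le> q x)" for q r :: "'u \<Rightarrow> real"
  have "\<exists>m\<in>\<Q>. \<forall>q\<in>\<Q>. le m q \<longrightarrow> q = m"
  proof (rule predicate_Zorn)
    show "partial_order_on \<Q> (relation_of le \<Q>)"
      by (rule partial_order_on_relation_ofI) (auto simp: le_def fun_eq_iff intro: order.trans antisym)
    fix C assume C: "C \<in> Chains (relation_of le \<Q>)"
    then have sub: "C \<subseteq> \<Q>" by (auto simp: Chains_def relation_of_def)
    have chain: "le q r \<or> le r q" if "q \<in> C" "r \<in> C" for q r
      using C that by (auto simp: Chains_def relation_of_def)
    show "\<exists>u\<in>\<Q>. \<forall>q\<in>C. le q u"
    proof (cases "C = {}")
      case True
      then show ?thesis using p by (intro bexI[of _ p]) (auto simp: \<Q>_def)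
    next
      case False
      define u where "u x = (INF q\<in>C. q x)" for x
      have sl: "sublinear q" if "q \<in> C" for q using sub that by (auto simp: \<Q>_def)
      have bdd: "bdd_below ((\<lambda>q. q x) ` C)" for x
      proof (cases "x \<in> carrier E")
        case True
        have "- p ((-1) \<odot> x) \<le> q x" if "q \<in> C" for q
        proof -
          have "q ((-1) \<odot> x) \<le> p ((-1) \<odot> x)" using sub that by (auto simp: \<Q>_def)
          then show ?thesis using sublinear_neg[OF sl[OF that] True] by linarith
        qed
        then show ?thesis by (rule bdd_belowI2)
      next
        case False
        then show ?thesis by (intro bdd_belowI2[where m=0]) (simp add: sublinearD(3)[OF sl])
      qed
      have ule: "u x \<le> q x" if "q \<in> C" for q x
        unfolding u_def using that bdd by (intro cINF_lower) auto
      have uge: "c \<le> u x" if "\<And>q. q \<in> C \<Longrightarrow> c \<le> q x" for c x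
        unfolding u_def using that False by (intro cINF_greatest) auto
      have "sublinear u"
      proof (rule sublinearI)
        fix x y assume x: "x \<in> carrier E" and y: "y \<in> carrier E"
        \<comment> \<open>Subadditivity of the infimum needs the chain: the smaller of the two
          members serves at x and at y alike.\<close>
        have "u (x \<oplus> y) \<le> q x + r y" if qr: "q \<in> C" "r \<in> C" for q r
        proof -
          obtain s where s: "s \<in> C" "s x \<le> q x" "s y \<le> r y"
            using chain[OF qr] qr by (auto simp: le_def)
          have "u (x \<oplus> y) \<le> s x + s y"
            using ule[OF s(1), of "x \<oplus> y"] sublinearD(1)[OF sl[OF s(1)] x y] by linarith
          then show ?thesis using s by linarith
        qed
        then have "u (x \<oplus> y) - r y \<le> u x" if "r \<in> C" for r
          using that by (intro uge) (auto simp: algebra_simps)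
        then have "u (x \<oplus> y) - u x \<le> u y"
          by (intro uge) (auto simp: algebra_simps)
        then show "u (x \<oplus> y) \<le> u x + u y" by simp
      next
        fix x and r :: real assume x: "x \<in> carrier E" and r: "0 < r"
        have "u (complex_of_real r \<odot> x) / r \<le> q x" if "q \<in> C" for q
          using ule[OF that, of "complex_of_real r \<odot> x"] sublinearD(2)[OF sl[OF that] x, of r] r
          by (simp add: field_simps)
        then have "u (complex_of_real r \<odot> x) / r \<le> u x" by (rule uge)
        then show "u (complex_of_real r \<odot> x) \<le> r * u x" using r by (simp add: field_simps)
      next
        show "u \<zero> = 0"
          using ule[of _ \<zero>] uge[of 0 \<zero>] sublinear_zero[OF sl] False by (metis all_not_in_conv antisym order.refl)
        show "u x = 0" if "x \<notin> carrier E" for x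
          using ule[of _ x] uge[of 0 x] sublinearD(3)[OF sl that] False by (metis all_not_in_conv antisym order.refl)
      qed
      moreover have "u x \<le> p x" for x
        using False ule sub by (force simp: \<Q>_def intro: order.trans)
      ultimately show ?thesis using ule by (intro bexI[of _ u]) (auto simp: \<Q>_def le_def)
    qed
  qed
  then obtain q where q: "sublinear q" "\<And>x. q x \<le> p x"
    and min: "\<And>r. sublinear r \<Longrightarrow> (\<And>x. r x \<le> q x) \<Longrightarrow> r = q"
    by (auto simp: \<Q>_def le_def) (meson order.trans)
  have "q ((-1) \<odot> a) = - q a" if a: "a \<in> carrier E" for a
  proof -
    obtain r where r: "sublinear r" "\<And>x. r x \<le> q x" "r ((-1) \<odot> a) \<le> - q a"
      using sublinear_reduce[OF q(1) a] by blast
    then have "q ((-1) \<odot> a) \<le> - q a" using min by blast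
    then show ?thesis using sublinear_neg[OF q(1) a] by linarith
  qed
  then show ?thesis using q by blast
qed

text \<open>The norm is first lowered in the direction x0, so that every odd minorant q of the
  result satisfies q(x0) \<ge> nrm x0 > 0. Only then is a minimal minorant taken.\<close>

theorem hahn_banach:
  assumes x0: "x0 \<in> carrier E" "x0 \<noteq> \<zero>"
  shows "\<exists>\<gamma>\<in>carrier (dual E). \<gamma> x0 \<noteq> 0"
proof -
  define p where "p x = (if x \<in> carrier E then nrm E x else 0)" for x
  have "sublinear p"
    by (rule sublinearI) (auto simp: p_def nrm_triangle nrm_smult)
  then obtain p' where p': "sublinear p'" "\<And>x. p' x \<le> p x" "p' ((-1) \<odot> x0) \<le> - p x0"
    using sublinear_reduce x0 by metis
  obtain q where q: "sublinear q" "\<And>x. q x \<le> p' x" and neg: "\<And>a. a \<in> carrier E \<Longrightarrow> q ((-1) \<odot> a) = - q a"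
    using minimal_sublinear[OF p'(1)] by metis
  have add: "q (x \<oplus> y) = q x + q y" if "x \<in> carrier E" "y \<in> carrier E" for x y
  proof -
    have "(x \<oplus> y) \<oplus> (-1) \<odot> y = x"
      using that by (simp add: M.a_ac M.r_neg flip: a_inv_eq_smult)
    then have "q x \<le> q (x \<oplus> y) + q ((-1) \<odot> y)"
      using sublinearD(1)[OF q(1), of "x \<oplus> y" "(-1) \<odot> y"] that by simp
    then show ?thesis using sublinearD(1)[OF q(1), of x y] neg that by fastforce
  qed
  have scale: "q (complex_of_real r \<odot> x) = r * q x" if "x \<in> carrier E" for x r
  proof (cases "0 \<le> r")
    case False
    have "q (complex_of_real r \<odot> x) = q ((-1) \<odot> (complex_of_real (-r) \<odot> x))"
      using that by (simp add: smult_smult)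
    then show ?thesis using neg[of "complex_of_real (-r) \<odot> x"] sublinearD(2)[OF q(1) that, of "-r"] that False
      by simp
  qed (use sublinearD(2)[OF q(1) that] in simp)
  have bound: "\<bar>q x\<bar> \<le> nrm E x" if "x \<in> carrier E" for x
  proof -
    have "q y \<le> nrm E y" if "y \<in> carrier E" for y
      using order.trans[OF q(2)[of y] p'(2)[of y]] that by (simp add: p_def)
    from this[of x] this[of "(-1) \<odot> x"] have "q x \<le> nrm E x" "q ((-1) \<odot> x) \<le> nrm E ((-1) \<odot> x)"
      using that by simp_all
    then show ?thesis using neg[OF that] that by (simp add: nrm_smult)
  qed
  have "q ((-1) \<odot> x0) \<le> - nrm E x0"
    using order.trans[OF q(2) p'(3)] x0 by (simp add: p_def)
  then have pos: "q x0 > 0"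
    using neg[OF x0(1)] x0 nrm_eq_zero_iff nrm_nonneg by (metis neg_le_iff_le order_le_less order.strict_trans2)
  \<comment> \<open>The complex linear functional with real part q. The factor 2 in its bound comes
    from adding the bounds of real and imaginary part.\<close>
  define \<gamma> where "\<gamma> = zext (carrier E) (\<lambda>x. Complex (q x) (- q (\<i> \<odot> x)))"
  have "\<gamma> (x \<oplus> y) = \<gamma> x + \<gamma> y" if "x \<in> carrier E" "y \<in> carrier E" for x y
    using that by (simp add: \<gamma>_def add smult_add_right complex_eq_iff)
  moreover have "\<gamma> (c \<odot> x) = c * \<gamma> x" if x: "x \<in> carrier E" for c x
  proof -
    have *: "q (c \<odot> x) = Re c * q x + Im c * q (\<i> \<odot> x)" for c
    proof -
      have "complex_of_real (Re c) \<odot> x \<oplus> complex_of_real (Im c) \<odot> (\<i> \<odot> x) =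
          (complex_of_real (Re c) + complex_of_real (Im c) * \<i>) \<odot> x"
        using x smult_add_left smult_smult by simp
      also have "complex_of_real (Re c) + complex_of_real (Im c) * \<i> = c"
        by (simp add: complex_eq_iff)
      finally have "q (c \<odot> x) = q (complex_of_real (Re c) \<odot> x \<oplus> complex_of_real (Im c) \<odot> (\<i> \<odot> x))"
        by simp
      then show ?thesis using x add scale by simp
    qed
    have "q (\<i> \<odot> (c \<odot> x)) = - Im c * q x + Re c * q (\<i> \<odot> x)"
      using *[of "\<i> * c"] x by (simp add: smult_smult)
    then show ?thesis using x *[of c] by (simp add: \<gamma>_def complex_eq_iff algebra_simps)
  qed
  moreover have "cmod (\<gamma> x) \<le> 2 * nrm E x" if "x \<in> carrier E" for x
    using cmod_le[of "\<gamma> x"] bound[OF that] bound[of "\<i> \<odot> x"] that by (simp add: \<gamma>_def nrm_smult)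
  moreover have "\<gamma> x0 \<noteq> 0" using pos x0 by (simp add: \<gamma>_def complex_eq_iff)
  moreover have "\<gamma> x = 0" if "x \<notin> carrier E" for x using that by (simp add: \<gamma>_def)
  ultimately show ?thesis
    unfolding dual_def bdd_linear_def fun_space_simps
    by (intro bexI[of _ \<gamma>] CollectI conjI exI[of _ 2]) auto
qed

end

section \<open>Operator norms and dual spaces\<close>

lemma opnorm_bound:
  assumes E: "complex_normed_space E" and F: "complex_normed_space F"
    and R: "bdd_linear E F R" and x: "x \<in> carrier E"
  shows "nrm F (R x) \<le> opnorm E F R * nrm E x"
proof -
  interpret E: complex_normed_space E by fact
  interpret F: complex_normed_space F by fact
  obtain B where B: "\<forall>x\<in>carrier E. nrm F (R x) \<le> B * nrm E x"
    using R by (auto simp: bdd_linear_def)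
  note B = bspec[OF B]
  have RF: "R x \<in> carrier F" if "x \<in> carrier E" for x using R that by (auto simp: bdd_linear_def)
  have sm: "R (c \<odot>\<^bsub>E\<^esub> x) = c \<odot>\<^bsub>F\<^esub> R x" if "x \<in> carrier E" for c x
    using R that by (auto simp: bdd_linear_def)
  have bdd: "bdd_above ((\<lambda>x. nrm F (R x)) ` {x \<in> carrier E. nrm E x \<le> 1})"
  proof (rule bdd_aboveI2)
    fix x assume x: "x \<in> {x \<in> carrier E. nrm E x \<le> 1}"
    have "nrm F (R x) \<le> B * nrm E x" using B x by simp
    also have "\<dots> \<le> \<bar>B\<bar> * 1" using x E.nrm_nonneg by (intro mult_mono) auto
    finally show "nrm F (R x) \<le> \<bar>B\<bar>" by simp
  qed
  show ?thesis
  proof (cases "nrm E x = 0")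
    case True
    then have "nrm F (R x) \<le> 0" using B[OF x] by simp
    then show ?thesis using True by simp
  next
    case False
    define y where "y = complex_of_real (inverse (nrm E x)) \<odot>\<^bsub>E\<^esub> x"
    have pos: "nrm E x > 0" using False E.nrm_nonneg[OF x] by simp
    have "y \<in> carrier E" "nrm E y \<le> 1"
      using x pos by (simp_all add: y_def E.nrm_smult norm_inverse)
    then have "nrm F (R y) \<le> opnorm E F R"
      unfolding opnorm_def using bdd by (intro cSUP_upper) auto
    moreover have "nrm F (R y) = inverse (nrm E x) * nrm F (R x)"
      using x pos by (simp add: y_def sm F.nrm_smult RF norm_inverse)
    ultimately show ?thesis using pos by (simp add: field_simps)
  qed
qed

lemma opnorm_le:
  assumes E: "complex_normed_space E"
    and "\<And>x. x \<in> carrier E \<Longrightarrow> nrm F (R x) \<le> B * nrm E x" "0 \<le> B"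
  shows "opnorm E F R \<le> B"
proof -
  interpret E: complex_normed_space E by fact
  show ?thesis unfolding opnorm_def
  proof (rule cSUP_least)
    show "{x \<in> carrier E. nrm E x \<le> 1} \<noteq> {}" using E.M.zero_closed by force
    fix x assume x: "x \<in> {x \<in> carrier E. nrm E x \<le> 1}"
    then have "nrm F (R x) \<le> B * nrm E x" using assms by simp
    also have "\<dots> \<le> B * 1" using x assms by (intro mult_left_mono) auto
    finally show "nrm F (R x) \<le> B" by simp
  qed
qed

lemma opnorm_nonneg:
  assumes E: "complex_normed_space E" and F: "complex_normed_space F" and R: "bdd_linear E F R"
  shows "0 \<le> opnorm E F R"
proof (cases "\<exists>x\<in>carrier E. nrm E x \<noteq> 0")
  case True
  then obtain x where x: "x \<in> carrier E" "nrm E x > 0"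
    using complex_normed_space.nrm_nonneg[OF E] by force
  have "0 \<le> opnorm E F R * nrm E x"
    using opnorm_bound[OF E F R x(1)] complex_normed_space.nrm_nonneg[OF F, of "R x"] R x
    by (force simp: bdd_linear_def)
  then show ?thesis using x by (simp add: zero_le_mult_iff)
next
  case False
  interpret E: complex_normed_space E by fact
  interpret F: complex_normed_space F by fact
  have "nrm F (R x) = 0" if "x \<in> carrier E" for x
  proof -
    have "nrm F (R x) \<le> 0" using False that opnorm_bound[OF E F R that] by auto
    then show ?thesis using F.nrm_nonneg[of "R x"] R that by (auto simp: bdd_linear_def)
  qed
  then have "opnorm E F R = (SUP x\<in>{x \<in> carrier E. nrm E x \<le> 1}. 0)"
    unfolding opnorm_def by (intro SUP_cong) auto
  moreover have "{x \<in> carrier E. nrm E x \<le> 1} \<noteq> {}" using E.M.zero_closed by force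
  ultimately show ?thesis by simp
qed

lemma complex_space_normed: "complex_normed_space complex_space"
proof -
  have "abelian_group complex_space"
    by (rule abelian_groupI) (auto simp: algebra_simps add_eq_0_iff intro!: exI[of _ "- _"])
  then have "module complex_ring complex_space"
    by (intro moduleI[OF complex_ring_cring]) (auto simp: algebra_simps)
  then show ?thesis
    by (intro complex_normed_space.intro complex_normed_space_axioms.intro)
      (auto simp: norm_mult norm_triangle_ineq)
qed

context complex_normed_space
begin

abbreviation dnorm :: "('u \<Rightarrow> complex) \<Rightarrow> real" where "dnorm \<equiv> opnorm E complex_space"

lemma dual_iff: "\<gamma> \<in> carrier (dual E) \<longleftrightarrow>
   (\<forall>x\<in>carrier E. \<forall>y\<in>carrier E. \<gamma> (x \<oplus> y) = \<gamma> x + \<gamma> y) \<and>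
   (\<forall>c. \<forall>x\<in>carrier E. \<gamma> (c \<odot> x) = c * \<gamma> x) \<and>
   (\<exists>B. \<forall>x\<in>carrier E. cmod (\<gamma> x) \<le> B * nrm E x) \<and> (\<forall>x. x \<notin> carrier E \<longrightarrow> \<gamma> x = 0)"
  by (simp add: dual_def bdd_linear_def)

lemma dualD:
  assumes "\<gamma> \<in> carrier (dual E)"
  shows "x \<in> carrier E \<Longrightarrow> y \<in> carrier E \<Longrightarrow> \<gamma> (x \<oplus> y) = \<gamma> x + \<gamma> y"
    "x \<in> carrier E \<Longrightarrow> \<gamma> (c \<odot> x) = c * \<gamma> x" "x \<notin> carrier E \<Longrightarrow> \<gamma> x = 0"
  using assms by (auto simp: dual_iff)

lemma dual_bound: "\<gamma> \<in> carrier (dual E) \<Longrightarrow> x \<in> carrier E \<Longrightarrow> cmod (\<gamma> x) \<le> dnorm \<gamma> * nrm E x"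
  using opnorm_bound[OF complex_normed_space_axioms complex_space_normed, of \<gamma> x]
  by (simp add: dual_def)

lemma dnorm_nonneg: "\<gamma> \<in> carrier (dual E) \<Longrightarrow> 0 \<le> dnorm \<gamma>"
  using opnorm_nonneg[OF complex_normed_space_axioms complex_space_normed, of \<gamma>]
  by (simp add: dual_def)

lemma dnorm_le: "(\<And>x. x \<in> carrier E \<Longrightarrow> cmod (\<gamma> x) \<le> B * nrm E x) \<Longrightarrow> 0 \<le> B \<Longrightarrow> dnorm \<gamma> \<le> B"
  using opnorm_le[OF complex_normed_space_axioms, of complex_space \<gamma> B] by simp

lemma dual_subspace: "cfun.subspace (carrier (dual E))"
  unfolding cfun.subspace_def
proof (intro conjI ballI allI)
  show "0 \<in> carrier (dual E)" by (auto simp: dual_iff intro!: exI[of _ 0])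
  fix f g assume f: "f \<in> carrier (dual E)" and g: "g \<in> carrier (dual E)"
  have "cmod ((f + g) x) \<le> (dnorm f + dnorm g) * nrm E x" if "x \<in> carrier E" for x
    using norm_triangle_ineq[of "f x" "g x"] dual_bound[OF f that] dual_bound[OF g that]
    by (simp add: algebra_simps)
  then show "f + g \<in> carrier (dual E)"
    using f g unfolding dual_iff by (intro conjI exI[of _ "dnorm f + dnorm g"]) (auto simp: algebra_simps)
next
  fix c f assume f: "f \<in> carrier (dual E)"
  have "cmod (fscale c f x) \<le> (cmod c * dnorm f) * nrm E x" if "x \<in> carrier E" for x
    using mult_left_mono[OF dual_bound[OF f that], of "cmod c"] by (simp add: norm_mult mult_ac)
  then show "fscale c f \<in> carrier (dual E)"
    using f unfolding dual_iff by (intro conjI exI[of _ "cmod c * dnorm f"]) (auto simp: algebra_simps)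
qed

lemma dual_add: "f \<in> carrier (dual E) \<Longrightarrow> g \<in> carrier (dual E) \<Longrightarrow> f + g \<in> carrier (dual E)"
  and dual_fscale: "f \<in> carrier (dual E) \<Longrightarrow> fscale c f \<in> carrier (dual E)"
  and dual_zero: "0 \<in> carrier (dual E)"
  and dual_diff: "f \<in> carrier (dual E) \<Longrightarrow> g \<in> carrier (dual E) \<Longrightarrow> f - g \<in> carrier (dual E)"
  using dual_subspace cfun.subspace_diff[OF dual_subspace] by (auto simp: cfun.subspace_def)

lemma dnorm_fscale_le:
  assumes f: "f \<in> carrier (dual E)"
  shows "dnorm (fscale c f) \<le> cmod c * dnorm f"
proof (rule dnorm_le)
  fix x assume x: "x \<in> carrier E"
  show "cmod (fscale c f x) \<le> cmod c * dnorm f * nrm E x"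
    unfolding fscale_apply norm_mult mult.assoc
    by (rule mult_left_mono[OF dual_bound[OF f x] norm_ge_zero])
qed (rule mult_nonneg_nonneg[OF norm_ge_zero dnorm_nonneg[OF f]])

lemma dual_normed: "complex_normed_space (fun_space (carrier (dual E)) dnorm)"
proof (rule complex_normed_space_fun_spaceI[OF dual_subspace])
  fix f assume f: "f \<in> carrier (dual E)"
  show "f = 0" if "dnorm f = 0"
  proof
    fix x show "f x = 0 x"
      using dual_bound[OF f, of x] dualD(3)[OF f, of x] that by (cases "x \<in> carrier E") auto
  qed
  show "dnorm (fscale c f) = cmod c * dnorm f" for c
  proof (rule antisym)
    show "cmod c * dnorm f \<le> dnorm (fscale c f)"
    proof (cases "c = 0")
      case False
      have "dnorm (fscale (inverse c) (fscale c f)) \<le> cmod (inverse c) * dnorm (fscale c f)"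
        using f by (intro dnorm_fscale_le dual_fscale)
      moreover have "fscale (inverse c) (fscale c f) = f" using False by (simp add: fun_eq_iff)
      ultimately show ?thesis using False by (simp add: norm_divide norm_inverse field_simps)
    qed (use dnorm_nonneg[OF dual_zero] in simp)
  qed (rule dnorm_fscale_le[OF f])
  fix g assume g: "g \<in> carrier (dual E)"
  show "dnorm (f + g) \<le> dnorm f + dnorm g"
  proof (rule dnorm_le)
    fix x assume "x \<in> carrier E"
    then show "cmod ((f + g) x) \<le> (dnorm f + dnorm g) * nrm E x"
      using norm_triangle_ineq[of "f x" "g x"] dual_bound[OF f] dual_bound[OF g]
      by (fastforce simp: algebra_simps)
  qed (use f g dnorm_nonneg in auto)
next
  have "dnorm 0 \<le> 0" by (rule dnorm_le) auto
  then show "dnorm 0 = 0" using dnorm_nonneg[OF dual_zero] by simp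
qed (rule dnorm_nonneg)

lemma dual_function_normed_space: "function_normed_space (carrier (dual E)) dnorm"
  by (rule function_normed_space.intro[OF dual_normed])

lemma dual_eq_fun_space: "dual E = fun_space (carrier (dual E)) dnorm"
  by (simp add: dual_def)

end

section \<open>Absolutely convergent series\<close>

lemma (in function_normed_space) absolutely_convergent:
  assumes complete: "complex_banach_space (fun_space S N)"
    and f: "\<And>i::nat. f i \<in> S" and sum: "summable (\<lambda>i. N (f i))"
  shows "\<exists>F\<in>S. (\<lambda>n. N (F - (\<Sum>i<n. f i))) \<longlonglongrightarrow> 0"
proof -
  define \<sigma> where "\<sigma> n = (\<Sum>i<n. f i)" for n
  have \<sigma>: "\<sigma> n \<in> S" for n unfolding \<sigma>_def using f by (intro sum_mem)
  have diff: "N (\<sigma> n - \<sigma> m) \<le> (\<Sum>i=m..<n. N (f i))" if "m \<le> n" for m n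
  proof -
    have "\<sigma> m + (\<Sum>i=m..<n. f i) = \<sigma> n"
      unfolding \<sigma>_def lessThan_atLeast0 using that by (intro sum.atLeastLessThan_concat) auto
    from this[symmetric] have eq: "\<sigma> n - \<sigma> m = (\<Sum>i=m..<n. f i)"
      by (simp only: add_diff_cancel_left')
    show ?thesis unfolding eq by (rule norm_sum) (rule f)
  qed
  have "\<exists>M. \<forall>n m. M \<le> n \<longrightarrow> M \<le> m \<longrightarrow> N (\<sigma> n - \<sigma> m) < e" if e: "e > 0" for e
  proof -
    obtain M where M: "\<And>m n. M \<le> m \<Longrightarrow> norm (\<Sum>i=m..<n. N (f i)) < e"
      using summable_Cauchy[THEN iffD1, OF sum, rule_format, OF e] by blast
    have *: "N (\<sigma> n - \<sigma> m) < e" if "M \<le> m" "m \<le> n" for m n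
      using diff[OF that(2)] M[OF that(1), of n] by simp
    have "N (\<sigma> n - \<sigma> m) < e" if "M \<le> n" "M \<le> m" for m n
    proof (cases "m \<le> n")
      case False
      then show ?thesis using *[of n m] that norm_minus_commute[OF \<sigma> \<sigma>, of n m] by simp
    qed (use * that in simp)
    then show ?thesis by blast
  qed
  then have "FS.MS.MCauchy \<sigma>"
    using \<sigma> by (subst FS.MS.MCauchy_def) (auto simp: dist_eq)
  then obtain F where F: "limitin (ntop (fun_space S N)) \<sigma> F sequentially"
    using complex_banach_space.complete[OF complete] FS.MS.mcomplete_def by blast
  then have F: "F \<in> S" "\<And>e. 0 < e \<Longrightarrow> \<forall>\<^sub>F n in sequentially. ndist (fun_space S N) (\<sigma> n) F < e"
    using FS.MS.limitin_metric[of \<sigma> F sequentially] by (auto elim: eventually_mono)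
  have "N (F - \<sigma> n) = ndist (fun_space S N) (\<sigma> n) F" for n
    using dist_eq[OF \<sigma> F(1)] norm_minus_commute[OF \<sigma> F(1)] by simp
  then have "(\<lambda>n. N (F - \<sigma> n)) \<longlonglongrightarrow> 0"
    using F(2) by (intro tendstoI) simp
  then show ?thesis unfolding \<sigma>_def using F(1) by blast
qed

section \<open>Ideal norms\<close>

lemma powser_unique:
  fixes a b :: "nat \<Rightarrow> complex"
  assumes "0 < r" "\<And>z. cmod z < r \<Longrightarrow> (\<lambda>k. a k * z ^ k) sums g z"
    "\<And>z. cmod z < r \<Longrightarrow> (\<lambda>k. b k * z ^ k) sums g z"
  shows "a = b"
proof (rule ccontr)
  define d where "d k = a k - b k" for k
  have sm: "(\<lambda>k. d k * (z - 0) ^ k) sums 0" if "cmod (z - 0) < r" for z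
    using sums_diff[OF assms(2)[of z] assms(3)[of z]] that by (simp add: d_def algebra_simps)
  have "d 0 = 0" using sm[of 0] assms(1) by simp
  moreover assume "a \<noteq> b"
  then obtain m where "d m \<noteq> 0" by (auto simp: d_def fun_eq_iff)
  ultimately have "d m \<noteq> 0" "m > 0" by (auto intro: Nat.gr0I)
  show False
  proof (rule powser_0_nonzero[OF assms(1) sm _ \<open>d m \<noteq> 0\<close> \<open>m > 0\<close>])
    fix s :: real assume "0 < s" and nz: "\<And>z::complex. z \<in> cball 0 s - {0} \<Longrightarrow> (0::complex) \<noteq> 0"
    then show False using nz[of "complex_of_real s"] by simp
  qed auto
qed

text \<open>Completeness of the complex numbers is pulled back along \<phi>. Through this lemma the
  lines in \<open>E\<close> fall under the third condition of a Banach ideal.\<close>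

lemma scalar_copy_complete:
  assumes X: "complex_normed_space X" and \<phi>: "bdd_linear X complex_space \<phi>"
    "bij_betw \<phi> (carrier X) UNIV" "\<And>x. x \<in> carrier X \<Longrightarrow> cmod (\<phi> x) = nrm X x"
  shows "copy_of_scalars X \<phi>"
proof -
  interpret X: complex_normed_space X by fact
  have dist: "ndist X x y = cmod (\<phi> x - \<phi> y)" if "x \<in> carrier X" "y \<in> carrier X" for x y
  proof -
    have "\<phi> (x \<ominus>\<^bsub>X\<^esub> y) = \<phi> x - \<phi> y"
      using that \<phi>(1) by (simp add: X.diff_eq_smult bdd_linear_def)
    then show ?thesis using that \<phi>(3)[of "x \<ominus>\<^bsub>X\<^esub> y"] by (simp add: ndist_def)
  qed
  have "X.MS.mcomplete"
    unfolding X.MS.mcomplete_def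
  proof (intro allI impI)
    fix \<sigma> assume \<sigma>: "X.MS.MCauchy \<sigma>"
    then have car: "\<sigma> n \<in> carrier X" for n by (auto simp: X.MS.MCauchy_def)
    have "Cauchy (\<lambda>n. \<phi> (\<sigma> n))"
      using \<sigma> dist[OF car car] unfolding X.MS.MCauchy_def Cauchy_def dist_norm by simp
    then obtain c where c: "(\<lambda>n. \<phi> (\<sigma> n)) \<longlonglongrightarrow> c" by (auto simp: Cauchy_convergent_iff convergent_def)
    obtain y where y: "y \<in> carrier X" "\<phi> y = c" using \<phi>(2) by (metis UNIV_I bij_betw_imp_surj_on imageE)
    have "limitin (ntop X) \<sigma> y sequentially"
      unfolding X.MS.limitin_metric
      using y car tendstoD[OF c] dist[OF car y(1)] by (simp add: dist_norm)
    then show "\<exists>x. limitin (ntop X) \<sigma> x sequentially" by blast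
  qed
  then have "complex_banach_space X" by unfold_locales
  then show ?thesis using \<phi> by (simp add: copy_of_scalars_def)
qed

locale holomorphy =
  fixes \<AA> :: "nat \<Rightarrow> 'u poly_ideal" and E :: "'u cnspace" (structure)
  assumes holo: "holomorphy_type \<AA>" and banach: "complex_banach_space E"
    and dim_gt_1: "\<exists>x\<in>carrier E. \<exists>y\<in>carrier E. \<forall>a b.
          a \<odot> x \<oplus> b \<odot> y = \<zero> \<longrightarrow> a = 0 \<and> b = 0"
begin

sublocale complex_banach_space E by (rule banach)

abbreviation A :: "nat \<Rightarrow> ('u \<Rightarrow> complex) set" where "A k \<equiv> polys (\<AA> k) E"
abbreviation nk :: "nat \<Rightarrow> ('u \<Rightarrow> complex) \<Rightarrow> real" where "nk k \<equiv> pnorm (\<AA> k) E"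

lemma ideal: "banach_ideal k (\<AA> k)"
  using holo by (simp add: holomorphy_type_def)

lemma ideal_banach: "complex_banach_space X \<Longrightarrow> complex_banach_space (fun_space (polys (\<AA> k) X) (pnorm (\<AA> k) X))"
  using ideal[of k] unfolding banach_ideal_def ideal_space_def by blast

lemma A_hom: "P \<in> A k \<Longrightarrow> P \<in> hom_poly E k"
  using ideal[of k] banach unfolding banach_ideal_def by blast

lemma ideal_compose:
  assumes "complex_banach_space X" "complex_banach_space Y" "bdd_linear X Y R" "P \<in> polys (\<AA> k) Y"
  shows "zext (carrier X) (P \<circ> R) \<in> polys (\<AA> k) X"
    "pnorm (\<AA> k) X (zext (carrier X) (P \<circ> R)) \<le> pnorm (\<AA> k) Y P * opnorm X Y R ^ k"
  using ideal[of k] assms unfolding banach_ideal_def by blast+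

lemma ideal_scalars:
  assumes "copy_of_scalars X \<phi>"
  shows "zext (carrier X) (\<lambda>z. \<phi> z ^ k) \<in> polys (\<AA> k) X"
    "pnorm (\<AA> k) X (zext (carrier X) (\<lambda>z. \<phi> z ^ k)) = 1"
  using ideal[of k] assms unfolding banach_ideal_def by blast+

lemma ideal_function_space:
  "complex_banach_space X \<Longrightarrow> function_normed_space (polys (\<AA> k) X) (pnorm (\<AA> k) X)"
  by (rule function_normed_space.intro[OF complex_banach_space.axioms(1)[OF ideal_banach]])

sublocale A: function_normed_space "A k" "nk k" for k
  by (rule ideal_function_space[OF banach])

section \<open>One-dimensional subspaces as copies of the scalars\<close>

lemma ex_unit: "\<exists>e\<in>carrier E. nrm E e = 1"
proof -
  obtain x y where x: "x \<in> carrier E" "y \<in> carrier E" "\<And>a b. a \<odot> x \<oplus> b \<odot> y = \<zero> \<Longrightarrow> a = 0 \<and> b = 0"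
    using dim_gt_1 by blast
  then have "x \<noteq> \<zero>" using x(3)[of 1 0] by auto
  then have "nrm E x > 0" using x nrm_nonneg nrm_eq_zero_iff by (metis order_le_less)
  then show ?thesis using x
    by (intro bexI[of _ "complex_of_real (inverse (nrm E x)) \<odot> x"]) (auto simp: nrm_smult norm_inverse)
qed

text \<open>Copies of the scalars are where the axioms of an ideal prescribe a norm. The line
  through a unit vector is such a copy inside the universe, and both \<open>poly_bound\<close> and
  \<open>pw_in_A\<close> pass through it.\<close>

definition line :: "'u \<Rightarrow> 'u cnspace" where "line e = E\<lparr>carrier := range (\<lambda>c. c \<odot> e)\<rparr>"
definition coord :: "'u \<Rightarrow> 'u \<Rightarrow> complex" where "coord e y = (THE c. y = c \<odot> e)"

lemma line_simps [simp]:
  "carrier (line e) = range (\<lambda>c. c \<odot> e)" "add (line e) = add E" "smult (line e) = smult E"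
  "zero (line e) = zero E" "nrm (line e) = nrm E"
  by (simp_all add: line_def)

lemma coord_smult:
  assumes "e \<in> carrier E" "nrm E e = 1" shows "coord e (c \<odot> e) = c"
proof -
  have "c = d" if eq: "c \<odot> e = d \<odot> e" for d
  proof -
    have "(c - d) \<odot> e = c \<odot> e \<oplus> (-1) \<odot> (d \<odot> e)"
      using assms smult_add_left[of e c "-d"] by (simp add: smult_smult)
    also have "\<dots> = \<zero>" unfolding eq using assms by (simp add: M.r_neg flip: a_inv_eq_smult)
    finally have "cmod (c - d) * nrm E e = 0"
      using nrm_smult[of e "c - d"] assms by simp
    then show ?thesis using assms by simp
  qed
  then show ?thesis unfolding coord_def by (intro the_equality) auto
qed

lemma line_copy:
  assumes e: "e \<in> carrier E" "nrm E e = 1"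
  shows "copy_of_scalars (line e) (coord e)"
proof (rule scalar_copy_complete)
  have in_E: "x \<in> carrier E" if "x \<in> range (\<lambda>c. c \<odot> e)" for x using that e by auto
  have "abelian_group (line e)"
  proof (rule abelian_groupI)
    fix x y assume "x \<in> carrier (line e)" "y \<in> carrier (line e)"
    then show "x \<oplus>\<^bsub>line e\<^esub> y \<in> carrier (line e)"
      using e smult_add_left[of e] by auto (metis rangeI)
  next
    fix x assume "x \<in> carrier (line e)"
    then obtain c where c: "x = c \<odot> e" by auto
    have "(-c) \<odot> e \<oplus> x = \<zero>" using c e smult_add_left[of e "-c" c] by simp
    then show "\<exists>y\<in>carrier (line e). y \<oplus>\<^bsub>line e\<^esub> x = \<zero>\<^bsub>line e\<^esub>" by auto
  next
    have "\<zero> = 0 \<odot> e" using e by simp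
    then show "\<zero>\<^bsub>line e\<^esub> \<in> carrier (line e)" by (simp only: line_simps) blast
  qed (auto simp: in_E M.a_ac e)
  then have "module complex_ring (line e)"
    by (intro moduleI[OF complex_ring_cring])
      (auto simp: in_E e smult_add_left smult_add_right smult_smult)
  then show "complex_normed_space (line e)"
    by (intro complex_normed_space.intro complex_normed_space_axioms.intro)
      (auto simp: in_E e nrm_nonneg nrm_eq_zero_iff nrm_smult intro!: nrm_triangle)
  have cE: "coord e (c \<odot> e) = c" for c using coord_smult[OF e] .
  show norm: "cmod (coord e x) = nrm (line e) x" if "x \<in> carrier (line e)" for x
    using that e by (auto simp: cE nrm_smult)
  show "bij_betw (coord e) (carrier (line e)) UNIV"
    unfolding bij_betw_def inj_on_def by (auto simp: cE image_def)
  have "coord e (x \<oplus> y) = coord e x + coord e y" if "x \<in> range (\<lambda>c. c \<odot> e)" "y \<in> range (\<lambda>c. c \<odot> e)" for x y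
    using that cE by (auto simp: e simp flip: smult_add_left)
  moreover have "coord e (c \<odot> x) = c * coord e x" if "x \<in> range (\<lambda>c. c \<odot> e)" for c x
    using that cE by (auto simp: e smult_smult)
  ultimately show "bdd_linear (line e) complex_space (coord e)"
    unfolding bdd_linear_def using norm by (auto intro!: exI[of _ 1])
qed

text \<open>The ideal norm dominates the sup norm: on the line through a unit vector e, P is P(e)
  times the monomial, which has norm 1, and restriction does not increase the ideal norm.\<close>

lemma poly_bound:
  assumes P: "P \<in> A k" and x: "x \<in> carrier E"
  shows "cmod (P x) \<le> nk k P * nrm E x ^ k"
proof -
  have unit: "cmod (P e) \<le> nk k P" if e: "e \<in> carrier E" "nrm E e = 1" for e
  proof -
    let ?X = "line e" and ?Q = "zext (carrier (line e)) (\<lambda>z. coord e z ^ k)"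
    have copy: "copy_of_scalars ?X (coord e)" by (rule line_copy[OF e])
    then have X: "complex_banach_space ?X" by (simp add: copy_of_scalars_def)
    interpret PX: function_normed_space "polys (\<AA> k) ?X" "pnorm (\<AA> k) ?X"
      by (rule ideal_function_space[OF X])
    have id: "bdd_linear ?X E (\<lambda>x. x)" using e by (auto simp: bdd_linear_def intro!: exI[of _ 1])
    have "zext (carrier ?X) (P \<circ> (\<lambda>x. x)) = fscale (P e) ?Q"
    proof
      fix z show "zext (carrier ?X) (P \<circ> (\<lambda>x. x)) z = fscale (P e) ?Q z"
        using hom_poly_smult[OF A_hom[OF P] e(1)] coord_smult[OF e] by (auto simp: zext_def)
    qed
    then have "cmod (P e) = pnorm (\<AA> k) ?X (zext (carrier ?X) (P \<circ> (\<lambda>x. x)))"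
      using PX.norm_fscale[OF ideal_scalars(1)[OF copy], of "P e"] ideal_scalars(2)[OF copy, of k] by simp
    also have "\<dots> \<le> nk k P * opnorm ?X E (\<lambda>x. x) ^ k" by (rule ideal_compose(2)[OF X banach id P])
    also have "opnorm ?X E (\<lambda>x. x) \<le> 1"
      using X by (intro opnorm_le complex_banach_space.axioms) auto
    then have "nk k P * opnorm ?X E (\<lambda>x. x) ^ k \<le> nk k P * 1 ^ k"
      using opnorm_nonneg[OF _ _ id] X A.norm_nonneg[OF P] complex_normed_space_axioms
      by (intro mult_left_mono power_mono) (auto dest: complex_banach_space.axioms)
    finally show ?thesis by simp
  qed
  show ?thesis
  proof (cases "x = \<zero>")
    case True
    \<comment> \<open>For k = 0 the right-hand side is the norm of P because 0^0 = 1, and P is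
      constant; its value is read off at a unit vector.\<close>
    obtain e where e: "e \<in> carrier E" "nrm E e = 1" using ex_unit by blast
    have "P x = 0 ^ k * P e" using hom_poly_smult[OF A_hom[OF P] e(1), of 0] True e by simp
    then show ?thesis using unit[OF e] True by (cases k) auto
  next
    case False
    then have pos: "nrm E x > 0" using x nrm_nonneg nrm_eq_zero_iff by (metis order_le_less)
    define e where "e = complex_of_real (inverse (nrm E x)) \<odot> x"
    have e: "e \<in> carrier E" "nrm E e = 1" using pos x by (auto simp: e_def nrm_smult norm_inverse)
    have "x = complex_of_real (nrm E x) \<odot> e"
      using pos x by (simp add: e_def smult_smult flip: of_real_mult)
    then have "P x = complex_of_real (nrm E x) ^ k * P e"
      using hom_poly_smult[OF A_hom[OF P] e(1)] by metis
    then show ?thesis using unit[OF e] pos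
      by (simp add: norm_mult norm_power mult.commute[of "nk k P"])
  qed
qed

definition pw :: "('u \<Rightarrow> complex) \<Rightarrow> nat \<Rightarrow> 'u \<Rightarrow> complex" where
  "pw \<gamma> k = zext (carrier E) (\<lambda>x. \<gamma> x ^ k)"

text \<open>The power is the monomial on a line composed with the map that sends x to \<gamma>(x) e,
  whose norm is at most \<open>dnorm \<gamma>\<close>.\<close>

lemma pw_in_A:
  assumes \<gamma>: "\<gamma> \<in> carrier (dual E)"
  shows "pw \<gamma> k \<in> A k" and "nk k (pw \<gamma> k) \<le> dnorm \<gamma> ^ k"
proof -
  obtain e where e: "e \<in> carrier E" "nrm E e = 1" using ex_unit by blast
  let ?X = "line e" and ?Q = "zext (carrier (line e)) (\<lambda>z. coord e z ^ k)" and ?R = "\<lambda>x. \<gamma> x \<odot> e"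
  have copy: "copy_of_scalars ?X (coord e)" by (rule line_copy[OF e])
  then have X: "complex_banach_space ?X" by (simp add: copy_of_scalars_def)
  have bound: "nrm ?X (?R x) \<le> dnorm \<gamma> * nrm E x" if "x \<in> carrier E" for x
    using dual_bound[OF \<gamma> that] e by (simp add: nrm_smult)
  have R: "bdd_linear E ?X ?R"
    unfolding bdd_linear_def
  proof (intro conjI ballI allI)
    show "\<exists>B. \<forall>x\<in>carrier E. nrm ?X (?R x) \<le> B * nrm E x" using bound by blast
  qed (use e in \<open>auto simp: dualD[OF \<gamma>] smult_add_left smult_smult\<close>)
  have eq: "zext (carrier E) (?Q \<circ> ?R) = pw \<gamma> k"
    using coord_smult[OF e] by (auto simp: pw_def zext_def fun_eq_iff)
  show "pw \<gamma> k \<in> A k"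
    using ideal_compose(1)[OF banach X R ideal_scalars(1)[OF copy, of k]] unfolding eq .
  have "nk k (pw \<gamma> k) \<le> 1 * opnorm E ?X ?R ^ k"
    using ideal_compose(2)[OF banach X R ideal_scalars(1)[OF copy, of k]] unfolding eq ideal_scalars(2)[OF copy] .
  also have "opnorm E ?X ?R ^ k \<le> dnorm \<gamma> ^ k"
    using opnorm_nonneg[OF complex_normed_space_axioms complex_banach_space.axioms(1)[OF X] R]
      bound dnorm_nonneg[OF \<gamma>]
    by (intro power_mono opnorm_le complex_normed_space_axioms) auto
  finally show "nk k (pw \<gamma> k) \<le> dnorm \<gamma> ^ k" by simp
qed

lemma poly_at_bound:
  "\<exists>c\<ge>1. \<forall>k P a l. l \<le> k \<longrightarrow> P \<in> A k \<longrightarrow> a \<in> carrier E \<longrightarrow>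
     poly_at E k P a l \<in> A (k - l) \<and> nk (k - l) (poly_at E k P a l) \<le> c ^ k * nk k P * nrm E a ^ l"
proof -
  obtain c C where C: "\<And>k l. l \<le> k \<Longrightarrow> C k l \<le> c ^ k"
    and b: "\<And>k l P a. l \<le> k \<Longrightarrow> P \<in> A k \<Longrightarrow> a \<in> carrier E \<Longrightarrow> poly_at E k P a l \<in> A (k - l) \<and>
           nk (k - l) (poly_at E k P a l) \<le> C k l * nk k P * nrm E a ^ l"
    using holo banach unfolding holomorphy_type_def by metis
  have "C k l * nk k P * nrm E a ^ l \<le> (\<bar>c\<bar> + 1) ^ k * nk k P * nrm E a ^ l"
    if "l \<le> k" "P \<in> A k" "a \<in> carrier E" for k l P a
  proof -
    have "C k l \<le> c ^ k" by (rule C[OF that(1)])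
    also have "\<dots> \<le> \<bar>c\<bar> ^ k" by (simp flip: power_abs)
    also have "\<dots> \<le> (\<bar>c\<bar> + 1) ^ k" by (intro power_mono) auto
    finally show ?thesis using A.norm_nonneg[OF that(2)] nrm_nonneg[OF that(3)]
      by (intro mult_right_mono) auto
  qed
  then show ?thesis using b order.trans by (intro exI[of _ "\<bar>c\<bar> + 1"]) (fastforce simp del: power_mult_distrib)
qed

end

section \<open>Power series with ideal coefficients\<close>

text \<open>Turns the k-th roots in \<open>Hb\<close> into convergence of all seminorm series, the
  form in which membership is checked from here on.\<close>

lemma root_tendsto_0_iff_summable:
  fixes a :: "nat \<Rightarrow> real"
  assumes a: "\<And>k. 0 \<le> a k"
  shows "(\<lambda>k. root k (a k)) \<longlonglongrightarrow> 0 \<longleftrightarrow> (\<forall>s>0. summable (\<lambda>k. s ^ k * a k))"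
proof (intro iffI allI impI)
  fix s :: real assume lim: "(\<lambda>k. root k (a k)) \<longlonglongrightarrow> 0" and s: "0 < s"
  have "\<forall>\<^sub>F k in sequentially. root k (a k) < 1 / (2 * s)"
    using order_tendstoD(2)[OF lim, of "1 / (2 * s)"] s by simp
  then have "\<forall>\<^sub>F k in sequentially. norm (s ^ k * a k) \<le> (1 / 2) ^ k"
    using eventually_gt_at_top[of 0]
  proof eventually_elim
    case (elim k)
    have "a k = root k (a k) ^ k" using elim a by simp
    also have "\<dots> \<le> (1 / (2 * s)) ^ k"
      using elim a by (intro power_mono) auto
    finally have "s ^ k * a k \<le> s ^ k * (1 / (2 * s)) ^ k" using s by (intro mult_left_mono) auto
    then show ?case using s a by (simp add: abs_mult flip: power_mult_distrib)
  qed
  then show "summable (\<lambda>k. s ^ k * a k)"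
    by (rule summable_comparison_test_ev) (simp add: summable_geometric)
next
  assume sum: "\<forall>s>0. summable (\<lambda>k. s ^ k * a k)"
  show "(\<lambda>k. root k (a k)) \<longlonglongrightarrow> 0"
  proof (rule tendstoI)
    fix e :: real assume e: "0 < e"
    have "(\<lambda>k. (2 / e) ^ k * a k) \<longlonglongrightarrow> 0" using sum e by (intro summable_LIMSEQ_zero) auto
    then have "\<forall>\<^sub>F k in sequentially. (2 / e) ^ k * a k < 1" by (rule order_tendstoD) simp
    then show "\<forall>\<^sub>F k in sequentially. dist (root k (a k)) 0 < e"
      using eventually_gt_at_top[of 0]
    proof eventually_elim
      case (elim k)
      then have "a k \<le> (e / 2) ^ k" using e by (simp add: field_simps power_divide)
      then have "root k (a k) \<le> root k ((e / 2) ^ k)" using elim by simp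
      also have "\<dots> = e / 2" using elim e by (simp add: real_root_power_cancel)
      finally show ?case using e a[of k] elim by simp
    qed
  qed
qed

text \<open>Iterated and diagonal summation agree: their n-th partial sums differ by n row tails,
  each of order 4^(-n), and n 4^(-n) tends to 0.\<close>

lemma sums_diagonal:
  fixes g :: "nat \<Rightarrow> nat \<Rightarrow> complex"
  assumes bound: "\<And>j i. cmod (g j i) \<le> S / 4 ^ (i + j)"
  shows "(\<lambda>k. \<Sum>i\<le>k. g (k - i) i) sums (\<Sum>j. \<Sum>i. g j i)"
proof -
  have geo: "(\<lambda>i. S / 4 ^ (i + m)) sums (S / 4 ^ m * (4 / 3))" for m :: nat
    using sums_mult[OF geometric_sums[of "1/4 :: real"], of "S / 4 ^ m"]
    by (simp add: power_add power_divide field_simps)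
  have sm: "summable (\<lambda>i. g j (i + m))" for j m
  proof (rule summable_comparison_test')
    show "summable (\<lambda>i. S / 4 ^ (i + (m + j)))" using geo by (rule sums_summable)
    show "norm (g j (i + m)) \<le> S / 4 ^ (i + (m + j))" for i
      using bound[of j "i + m"] by (simp add: add.assoc)
  qed
  have tail: "cmod (\<Sum>i. g j (i + m)) \<le> S / 4 ^ (m + j) * (4 / 3)" for j m
  proof (rule norm_suminf_le[of _ "\<lambda>i. S / 4 ^ (i + (m + j))", THEN order.trans])
    show "norm (g j (i + m)) \<le> S / 4 ^ (i + (m + j))" for i
      using bound[of j "i + m"] by (simp add: add.assoc)
    show "summable (\<lambda>i. S / 4 ^ (i + (m + j)))" using geo by (rule sums_summable)
    show "(\<Sum>i. S / 4 ^ (i + (m + j))) \<le> S / 4 ^ (m + j) * (4 / 3)"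
      using sums_unique[OF geo[of "m + j"]] by simp
  qed
  have outer: "summable (\<lambda>j. \<Sum>i. g j i)"
  proof (rule summable_comparison_test')
    show "summable (\<lambda>j. S / 4 ^ (j + 0) * (4 / 3))" using geo by (intro summable_mult2 sums_summable)
    show "norm (\<Sum>i. g j i) \<le> S / 4 ^ (j + 0) * (4 / 3)" for j using tail[of j 0] by simp
  qed
  have diff: "(\<Sum>j<n. \<Sum>i. g j i) - (\<Sum>k<n. \<Sum>i\<le>k. g (k - i) i) = (\<Sum>j<n. \<Sum>i. g j (i + (n - j)))" for n
  proof -
    have "(\<Sum>k<n. \<Sum>i\<le>k. g (k - i) i) = (\<Sum>(i,j)\<in>{(i,j). i + j < n}. g j i)"
      by (rule sum.triangle_reindex[symmetric])
    also have "\<dots> = (\<Sum>(j,i)\<in>(SIGMA j:{..<n}. {..<n - j}). g j i)"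
      by (rule sum.reindex_bij_witness[where i=prod.swap and j=prod.swap]) auto
    also have "\<dots> = (\<Sum>j<n. \<Sum>i<n - j. g j i)" by (rule sum.Sigma[symmetric]) auto
    finally have "(\<Sum>k<n. \<Sum>i\<le>k. g (k - i) i) = (\<Sum>j<n. \<Sum>i<n - j. g j i)" .
    moreover have "(\<Sum>i. g j i) = (\<Sum>i. g j (i + (n - j))) + (\<Sum>i<n - j. g j i)" for j
      using sm[of j 0] by (intro suminf_split_initial_segment) simp
    ultimately show ?thesis by (simp add: sum.distrib)
  qed
  have "(\<lambda>n. \<Sum>j<n. \<Sum>i. g j (i + (n - j))) \<longlonglongrightarrow> 0"
  proof (rule tendsto_norm_zero_cancel, rule Lim_null_comparison)
    show "\<forall>\<^sub>F n in sequentially. norm (norm (\<Sum>j<n. \<Sum>i. g j (i + (n - j)))) \<le> real n * (S / 4 ^ n * (4 / 3))"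
    proof (rule always_eventually, rule allI)
      fix n
      have "norm (\<Sum>j<n. \<Sum>i. g j (i + (n - j))) \<le> (\<Sum>j<n. S / 4 ^ n * (4 / 3))"
      proof (rule sum_norm_le)
        show "norm (\<Sum>i. g j (i + (n - j))) \<le> S / 4 ^ n * (4 / 3)" if "j \<in> {..<n}" for j
          using tail[of j "n - j"] that by simp
      qed
      then show "norm (norm (\<Sum>j<n. \<Sum>i. g j (i + (n - j)))) \<le> real n * (S / 4 ^ n * (4 / 3))" by simp
    qed
    have "(\<lambda>n. real n * (S * (4/3)) * (1/4) ^ n) \<longlonglongrightarrow> 0"
      using tendsto_mult_right[OF powser_times_n_limit_0[of "1/4::real"], of "S * (4/3)"] by (simp add: mult_ac)
    moreover have "(\<lambda>n. real n * (S / 4 ^ n * (4 / 3))) = (\<lambda>n. real n * (S * (4/3)) * (1/4) ^ n)"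
      by (simp add: fun_eq_iff power_divide)
    ultimately show "(\<lambda>n. real n * (S / 4 ^ n * (4 / 3))) \<longlonglongrightarrow> 0" by (simp only:)
  qed
  then have "(\<lambda>n. (\<Sum>j<n. \<Sum>i. g j i) - (\<Sum>j<n. \<Sum>i. g j (i + (n - j)))) \<longlonglongrightarrow> (\<Sum>j. \<Sum>i. g j i) - 0"
    using outer by (intro tendsto_diff summable_LIMSEQ)
  moreover have cancel: "a - (a - b) = b" for a b :: complex by simp
  have "(\<Sum>j<n. \<Sum>i. g j i) - (\<Sum>j<n. \<Sum>i. g j (i + (n - j))) = (\<Sum>k<n. \<Sum>i\<le>k. g (k - i) i)" for n
    unfolding diff[symmetric] by (rule cancel)
  ultimately show ?thesis unfolding sums_def by (simp only: diff_zero)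
qed

lemma sum_apply: "(\<Sum>i\<in>I. f i) x = (\<Sum>i\<in>I. f i x)" for f :: "'i \<Rightarrow> 'a \<Rightarrow> 'b::comm_monoid_add"
  by (induction I rule: infinite_finite_induct) auto

context holomorphy
begin

lemma sums_of_ideal_limit:
  assumes "F \<in> A k" "\<And>i. f i \<in> A k" "(\<lambda>n. nk k (F - (\<Sum>i<n. f i))) \<longlonglongrightarrow> 0" "x \<in> carrier E"
  shows "(\<lambda>i. f i x) sums F x"
proof -
  have "(\<lambda>n. F x - (\<Sum>i<n. f i x)) \<longlonglongrightarrow> 0"
  proof (rule Lim_null_comparison)
    show "\<forall>\<^sub>F n in sequentially. norm (F x - (\<Sum>i<n. f i x)) \<le> nk k (F - (\<Sum>i<n. f i)) * nrm E x ^ k"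
    proof (rule always_eventually, rule allI)
      fix n
      have "F - (\<Sum>i<n. f i) \<in> A k" using assms by (intro A.diff_mem A.sum_mem) auto
      from poly_bound[OF this assms(4)]
      show "norm (F x - (\<Sum>i<n. f i x)) \<le> nk k (F - (\<Sum>i<n. f i)) * nrm E x ^ k"
        by (simp add: sum_apply)
    qed
    show "(\<lambda>n. nk k (F - (\<Sum>i<n. f i)) * nrm E x ^ k) \<longlonglongrightarrow> 0"
      using tendsto_mult_left_zero[OF assms(3)] by simp
  qed
  from tendsto_diff[OF tendsto_const[of "F x"] this] show ?thesis unfolding sums_def by simp
qed

text \<open>The Taylor coefficient sequences of the functions in \<open>H\<close>: by
  \<open>tt_fsum\<close> and \<open>fsum_tt\<close>, the maps \<open>fsum\<close> and
  \<open>taylor_term\<close> are inverse to each other.\<close>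

definition coeffs :: "(nat \<Rightarrow> 'u \<Rightarrow> complex) \<Rightarrow> bool" where
  "coeffs P \<longleftrightarrow> (\<forall>k. P k \<in> A k) \<and> (\<forall>s>0. summable (\<lambda>k. s ^ k * nk k (P k)))"

definition fsum :: "(nat \<Rightarrow> 'u \<Rightarrow> complex) \<Rightarrow> 'u \<Rightarrow> complex" where
  "fsum P = zext (carrier E) (\<lambda>x. \<Sum>k. P k x)"

lemma coeffs_mem: "coeffs P \<Longrightarrow> P k \<in> A k"
  by (simp add: coeffs_def)

lemma coeffs_summable:
  assumes "coeffs P" "0 \<le> s"
  shows "summable (\<lambda>k. s ^ k * nk k (P k))"
proof (rule summable_comparison_test')
  show "summable (\<lambda>k. (s + 1) ^ k * nk k (P k))" using assms by (simp add: coeffs_def)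
  show "norm (s ^ k * nk k (P k)) \<le> (s + 1) ^ k * nk k (P k)" for k
    using assms A.norm_nonneg[OF coeffs_mem[OF assms(1)], of k]
    by (auto simp: abs_mult intro!: mult_right_mono power_mono)
qed

lemma minus_zero [simp]: "x \<in> carrier E \<Longrightarrow> x \<ominus> \<zero> = x"
  by (simp add: diff_eq_smult)

lemma add_diff_cancel [simp]: "a \<in> carrier E \<Longrightarrow> x \<in> carrier E \<Longrightarrow> a \<oplus> (x \<ominus> a) = x"
  using M.a_lcomm[of a x "\<ominus> a"] by (simp add: M.minus_eq M.r_neg)

lemma add_minus_cancel [simp]: "a \<in> carrier E \<Longrightarrow> y \<in> carrier E \<Longrightarrow> (a \<oplus> y) \<ominus> a = y"
  using M.a_comm[of "a \<oplus> y" "\<ominus> a"] M.r_neg1[of a y] by (simp add: M.minus_eq)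

lemma taylor_series_at_0:
  assumes P: "coeffs P"
  shows "taylor_series_at E (fsum P) \<zero> P"
  unfolding taylor_series_at_def
proof (intro conjI allI exI[of _ 1])
  show "P k \<in> hom_poly E k" for k by (rule A_hom[OF coeffs_mem[OF P]])
  let ?B = "{x \<in> carrier E. nrm E (x \<ominus> \<zero>) < 1}"
  have "uniform_limit ?B (\<lambda>n x. \<Sum>k<n. P k x) (\<lambda>x. \<Sum>k. P k x) sequentially"
  proof (rule Weierstrass_m_test)
    show "summable (\<lambda>k. 1 ^ k * nk k (P k))" by (rule coeffs_summable[OF P]) simp
    fix k x assume x: "x \<in> ?B"
    have "cmod (P k x) \<le> nk k (P k) * nrm E x ^ k" using x by (intro poly_bound coeffs_mem[OF P]) simp
    also have "\<dots> \<le> nk k (P k) * 1 ^ k"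
      using x A.norm_nonneg[OF coeffs_mem[OF P]] nrm_nonneg[of x]
      by (intro mult_left_mono power_mono) auto
    finally show "norm (P k x) \<le> 1 ^ k * nk k (P k)" by simp
  qed
  then show "uniform_limit ?B (\<lambda>n x. \<Sum>k<n. P k (x \<ominus> \<zero>)) (fsum P) sequentially"
    by (rule uniform_limit_cong'[THEN iffD1, rotated -1]) (auto simp: fsum_def)
qed simp

text \<open>Each P k (a + h) is expanded by the binomial formula, and the terms of degree j in h are
  collected. They are summed in the ideal norm, so that the new coefficients are again members of
  the ideals and in particular continuous.\<close>

lemma taylor_series_at_exists:
  assumes P: "coeffs P" and a: "a \<in> carrier E"
  shows "\<exists>Q. taylor_series_at E (fsum P) a Q"
proof -
  obtain c where c: "1 \<le> c" and pa0: "\<forall>k P a l. l \<le> k \<longrightarrow> P \<in> A k \<longrightarrow> a \<in> carrier E \<longrightarrow>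
     poly_at E k P a l \<in> A (k - l) \<and> nk (k - l) (poly_at E k P a l) \<le> c ^ k * nk k P * nrm E a ^ l"
    using poly_at_bound by (elim exE conjE) (rule that)
  note pa = pa0[rule_format]
  define G where "G j i = fscale (of_nat (i + j choose i)) (poly_at E (i + j) (P (i + j)) a i)" for j i
  \<comment> \<open>The factors of \<open>d\<close> bound the binomial coefficient, the constant of
    the holomorphy type and the powers of a. Evaluating the series at 4 d gains the factor 4^(-(i +
    j)) that \<open>sums_diagonal\<close> asks for.\<close>
  define d where "d = 2 * c * (1 + nrm E a)"
  define S where "S = (\<Sum>m. (4 * d) ^ m * nk m (P m))"
  have na: "0 \<le> nrm E a" by (rule nrm_nonneg[OF a])
  have d: "0 \<le> d" using c na by (simp add: d_def)
  have nP: "0 \<le> nk m (P m)" for m by (rule A.norm_nonneg[OF coeffs_mem[OF P]])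
  have pG: "poly_at E (i + j) (P (i + j)) a i \<in> A j"
    "nk j (poly_at E (i + j) (P (i + j)) a i) \<le> c ^ (i + j) * nk (i + j) (P (i + j)) * nrm E a ^ i" for i j
    using pa[OF le_add1 coeffs_mem[OF P] a, of i j] by simp_all
  have GA: "G j i \<in> A j" for j i unfolding G_def by (rule A.fscale_mem[OF pG(1)])
  have S: "d ^ m * nk m (P m) \<le> S / 4 ^ m" for m
  proof -
    have sm: "summable (\<lambda>m. (4 * d) ^ m * nk m (P m))" using d by (intro coeffs_summable[OF P]) simp
    have "(\<Sum>m\<in>{m}. (4 * d) ^ m * nk m (P m)) \<le> S"
      unfolding S_def using sm d nP by (intro sum_le_suminf) auto
    then show ?thesis by (simp add: field_simps power_mult_distrib)
  qed
  have GN: "nk j (G j i) \<le> S / 4 ^ (i + j)" for j i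
  proof -
    have "nk j (G j i) = real (i + j choose i) * nk j (poly_at E (i + j) (P (i + j)) a i)"
      unfolding G_def by (subst A.norm_fscale[OF pG(1)]) simp
    also have "\<dots> \<le> 2 ^ (i + j) * (c ^ (i + j) * nk (i + j) (P (i + j)) * nrm E a ^ i)"
    proof (rule mult_mono[OF _ pG(2) _ A.norm_nonneg[OF pG(1)]])
      show "real (i + j choose i) \<le> 2 ^ (i + j)"
        using binomial_le_pow2[of "i + j" i] by (metis of_nat_le_iff of_nat_numeral of_nat_power)
    qed simp
    also have "\<dots> \<le> 2 ^ (i + j) * (c ^ (i + j) * nk (i + j) (P (i + j)) * (1 + nrm E a) ^ (i + j))"
    proof -
      have "nrm E a ^ i \<le> (1 + nrm E a) ^ i" using na by (intro power_mono) auto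
      also have "\<dots> \<le> (1 + nrm E a) ^ (i + j)" using na by (intro power_increasing) auto
      finally show ?thesis using c nP by (intro mult_left_mono) auto
    qed
    also have "\<dots> = d ^ (i + j) * nk (i + j) (P (i + j))"
      unfolding d_def power_mult_distrib by (simp only: mult_ac)
    also have "\<dots> \<le> S / 4 ^ (i + j)" by (rule S)
    finally show ?thesis .
  qed
  have geo: "(\<lambda>i. S / 4 ^ (i + j)) sums (S / 4 ^ j * (4 / 3))" for j :: nat
    using sums_mult[OF geometric_sums[of "1/4 :: real"], of "S / 4 ^ j"]
    by (simp add: power_add power_divide field_simps)
  have "\<exists>F\<in>A j. (\<lambda>n. nk j (F - (\<Sum>i<n. G j i))) \<longlonglongrightarrow> 0" for j
  proof (rule A.absolutely_convergent[OF ideal_banach[OF banach] GA])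
    show "summable (\<lambda>i. nk j (G j i))"
      by (rule summable_comparison_test'[OF sums_summable[OF geo[of j]]])
        (use GN A.norm_nonneg[OF GA] in simp)
  qed
  then obtain Q where Q: "\<And>j. Q j \<in> A j" "\<And>j. (\<lambda>n. nk j (Q j - (\<Sum>i<n. G j i))) \<longlonglongrightarrow> 0"
    by metis
  have Gh: "cmod (G j i h) \<le> S / 4 ^ (i + j)" if "h \<in> carrier E" "nrm E h < 1" for j i h
  proof -
    have "cmod (G j i h) \<le> nk j (G j i) * nrm E h ^ j" using that by (intro poly_bound GA)
    also have "\<dots> \<le> nk j (G j i) * 1 ^ j"
      using that nrm_nonneg A.norm_nonneg[OF GA] by (intro mult_left_mono power_mono) auto
    finally show ?thesis using GN[of j i] by simp
  qed
  have Qh: "Q j h = (\<Sum>i. G j i h)" if "h \<in> carrier E" for j h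
    by (rule sums_unique[OF sums_of_ideal_limit[OF Q(1) GA Q(2) that]])
  have QM: "cmod (Q j h) \<le> S / 4 ^ j * (4 / 3)" if "h \<in> carrier E" "nrm E h < 1" for j h
    using norm_suminf_le[OF Gh[OF that] sums_summable[OF geo], of j] sums_unique[OF geo[of j]] Qh[OF that(1)]
    by simp
  let ?B = "{x \<in> carrier E. nrm E (x \<ominus> a) < 1}"
  have "uniform_limit ?B (\<lambda>n x. \<Sum>j<n. Q j (x \<ominus> a)) (\<lambda>x. \<Sum>j. Q j (x \<ominus> a)) sequentially"
  proof (rule Weierstrass_m_test)
    show "summable (\<lambda>j. S / 4 ^ j * (4 / 3))"
      using sums_summable[OF geo[of 0]] by (intro summable_mult2) simp
    show "norm (Q j (x \<ominus> a)) \<le> S / 4 ^ j * (4 / 3)" if "x \<in> ?B" for j x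
      using that a by (intro QM) auto
  qed
  moreover have "(\<Sum>j. Q j (x \<ominus> a)) = fsum P x" if x: "x \<in> ?B" for x
  proof -
    define h where "h = x \<ominus> a"
    have h: "h \<in> carrier E" "nrm E h < 1" "x = a \<oplus> h"
      using x a by (auto simp: h_def)
    have "P k x = (\<Sum>i\<le>k. G (k - i) i h)" for k
      using hom_poly_binomial[OF A_hom[OF coeffs_mem[OF P]] a h(1), of k] h(3)
      by (simp add: G_def)
    then have "(\<lambda>k. P k x) sums (\<Sum>j. \<Sum>i. G j i h)"
      using sums_diagonal[of "\<lambda>j i. G j i h" S] Gh[OF h(1,2)] by simp
    then have "(\<Sum>k. P k x) = (\<Sum>j. Q j h)" using Qh[OF h(1)] by (simp add: sums_iff)
    then show ?thesis using x by (simp add: fsum_def h_def)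
  qed
  ultimately have "uniform_limit ?B (\<lambda>n x. \<Sum>j<n. Q j (x \<ominus> a)) (fsum P) sequentially"
    by (subst uniform_limit_cong'[where g="\<lambda>n x. \<Sum>j<n. Q j (x \<ominus> a)" and i="\<lambda>x. \<Sum>j. Q j (x \<ominus> a)"]) auto
  then show ?thesis
    unfolding taylor_series_at_def using A_hom[OF Q(1)]
    by (intro exI[of _ Q] conjI allI exI[of _ 1]) auto
qed

lemma fsum_entire: "coeffs P \<Longrightarrow> fsum P \<in> entire E"
  using taylor_series_at_exists by (auto simp: entire_def fsum_def)

section \<open>Taylor series along complex lines\<close>

lemma taylor_series_at_line:
  assumes T: "taylor_series_at E f a P" and a: "a \<in> carrier E" and y: "y \<in> carrier E"
  shows "\<exists>r>0. \<forall>z. cmod z < r \<longrightarrow> (\<lambda>k. P k y * z ^ k) sums f (a \<oplus> z \<odot> y)"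
proof -
  obtain r where r: "r > 0" and hom: "\<And>k. P k \<in> hom_poly E k" and
    lim: "uniform_limit {x \<in> carrier E. nrm E (x \<ominus> a) < r} (\<lambda>n x. \<Sum>k<n. P k (x \<ominus> a)) f sequentially"
    using T by (auto simp: taylor_series_at_def)
  have ny: "0 \<le> nrm E y" by (rule nrm_nonneg[OF y])
  have "(\<lambda>k. P k y * z ^ k) sums f (a \<oplus> z \<odot> y)" if z: "cmod z < r / (nrm E y + 1)" for z
  proof -
    have eq: "(a \<oplus> z \<odot> y) \<ominus> a = z \<odot> y"
      using a y by simp
    have "cmod z * nrm E y \<le> cmod z * (nrm E y + 1)" by (intro mult_left_mono) auto
    also have "\<dots> < r" using z ny by (simp add: field_simps)
    finally have "a \<oplus> z \<odot> y \<in> {x \<in> carrier E. nrm E (x \<ominus> a) < r}"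
      using a y eq by (simp add: nrm_smult)
    from tendsto_uniform_limitI[OF lim this] show ?thesis
      unfolding eq sums_def using hom_poly_smult[OF hom y] by (simp add: mult.commute)
  qed
  then show ?thesis using r ny by (intro exI[of _ "r / (nrm E y + 1)"]) auto
qed

lemma taylor_series_at_unique:
  assumes "taylor_series_at E f a P" "taylor_series_at E f a Q" "a \<in> carrier E"
  shows "P = Q"
proof (intro ext)
  fix k y
  show "P k y = Q k y"
  proof (cases "y \<in> carrier E")
    case True
    obtain r1 r2 where r: "r1 > 0" "r2 > 0"
      "\<And>z. cmod z < r1 \<Longrightarrow> (\<lambda>k. P k y * z ^ k) sums f (a \<oplus> z \<odot> y)"
      "\<And>z. cmod z < r2 \<Longrightarrow> (\<lambda>k. Q k y * z ^ k) sums f (a \<oplus> z \<odot> y)"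
      using taylor_series_at_line[OF assms(1,3) True] taylor_series_at_line[OF assms(2,3) True] by blast
    have "(\<lambda>k. P k y) = (\<lambda>k. Q k y)"
      by (rule powser_unique[of "min r1 r2" _ "\<lambda>z. f (a \<oplus> z \<odot> y)"]) (use r in auto)
    then show ?thesis by (rule fun_cong)
  next
    case False
    have "P k \<in> hom_poly E k" "Q k \<in> hom_poly E k"
      using assms unfolding taylor_series_at_def by blast+
    then show ?thesis by (metis hom_poly_outside False)
  qed
qed

lemma taylor_term_eq: "taylor_series_at E f \<zero> P \<Longrightarrow> taylor_term E f = P"
  unfolding taylor_term_def using taylor_series_at_unique[OF _ _ M.zero_closed] by (intro the_equality) auto

text \<open>By definition the Taylor series converges only near each point. Restricted to the line
  through y the function is entire in one variable, so its power series converges everywhere; near 0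
  its coefficients are identified with the values of the Taylor polynomials at y.\<close>

lemma entire_taylor_sums:
  assumes f: "f \<in> entire E" and y: "y \<in> carrier E"
  shows "(\<lambda>k. taylor_term E f k y) sums f y"
proof -
  define g where "g z = f (z \<odot> y)" for z
  have ball: "\<exists>r>0. \<exists>c. \<forall>z. cmod (z - w) < r \<longrightarrow> (\<lambda>k. c k * (z - w) ^ k) sums g z" for w
  proof -
    have w: "w \<odot> y \<in> carrier E" using y by simp
    obtain P where "taylor_series_at E f (w \<odot> y) P" using f w by (auto simp: entire_def)
    from taylor_series_at_line[OF this w y] obtain r where r: "r > 0"
      "\<And>z. cmod z < r \<Longrightarrow> (\<lambda>k. P k y * z ^ k) sums f (w \<odot> y \<oplus> z \<odot> y)" by blast
    have "(\<lambda>k. P k y * (z - w) ^ k) sums g z" if "cmod (z - w) < r" for z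
    proof -
      have "w \<odot> y \<oplus> (z - w) \<odot> y = z \<odot> y" using y smult_add_left[of y w "z - w"] by simp
      then show ?thesis using r(2)[OF that] by (simp add: g_def)
    qed
    then show ?thesis
      using r(1) by (intro exI[of _ r] exI[of _ "\<lambda>k. P k y"] conjI allI impI)
  qed
  have "g field_differentiable at w" for w
  proof -
    from ball[of w] obtain r c where r: "r > 0" "\<forall>z. cmod (z - w) < r \<longrightarrow> (\<lambda>k. c k * (z - w) ^ k) sums g z"
      by (elim exE conjE) (rule that)
    have "g holomorphic_on ball w r"
      by (rule power_series_holomorphic[where a=c]) (use r(2) in \<open>simp add: dist_norm norm_minus_commute\<close>)
    then show ?thesis using r(1) by (simp add: holomorphic_on_imp_differentiable_at)
  qed
  then have "g holomorphic_on UNIV"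
    by (simp add: holomorphic_on_def field_differentiable_at_within)
  \<comment> \<open>Radius 2, since the series is wanted at z = 1.\<close>
  then have hol: "g holomorphic_on ball 0 2" by (rule holomorphic_on_subset) simp
  define c where "c k = (deriv ^^ k) g 0 / fact k" for k
  have c: "(\<lambda>k. c k * z ^ k) sums g z" if "cmod z < 2" for z
    using holomorphic_power_series[OF hol, of z] that by (simp add: c_def)
  obtain P where P: "taylor_series_at E f \<zero> P" using f by (auto simp: entire_def)
  obtain r where r: "r > 0" "\<And>z. cmod z < r \<Longrightarrow> (\<lambda>k. P k y * z ^ k) sums f (\<zero> \<oplus> z \<odot> y)"
    using taylor_series_at_line[OF P M.zero_closed y] by blast
  have "(\<lambda>k. P k y) = c"
    by (rule powser_unique[of "min r 2" _ g]) (use r c y in \<open>auto simp: g_def\<close>)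
  then show ?thesis using c[of 1] y taylor_term_eq[OF P] by (simp add: g_def)
qed

abbreviation "H \<equiv> Hb \<AA> E"
abbreviation "tt \<equiv> taylor_term E"

lemma tt_fsum: "coeffs P \<Longrightarrow> tt (fsum P) = P"
  by (rule taylor_term_eq[OF taylor_series_at_0])

lemma fsum_in_H:
  assumes P: "coeffs P" shows "fsum P \<in> H"
proof -
  have "(\<lambda>k. root k (nk k (P k))) \<longlonglongrightarrow> 0"
    using P A.norm_nonneg[OF coeffs_mem[OF P]]
    by (subst root_tendsto_0_iff_summable) (auto simp: coeffs_def)
  then show ?thesis
    unfolding Hb_def using P fsum_entire[OF P] A.fscale_mem[OF coeffs_mem[OF P]] by (simp add: tt_fsum)
qed

lemma coeffs_tt:
  assumes f: "f \<in> H" shows "coeffs (tt f)"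
proof -
  have tA: "tt f k \<in> A k" for k
  proof -
    have "fscale (fact k) (tt f k) \<in> A k" using f unfolding Hb_def by blast
    then have "fscale (1 / fact k) (fscale (fact k) (tt f k)) \<in> A k" by (rule A.fscale_mem)
    moreover have "fscale (1 / fact k) (fscale (fact k) (tt f k)) = tt f k"
      by (auto simp: fun_eq_iff)
    ultimately show ?thesis by simp
  qed
  moreover have "(\<lambda>k. root k (nk k (tt f k))) \<longlonglongrightarrow> 0" using f by (simp add: Hb_def)
  ultimately show ?thesis
    using root_tendsto_0_iff_summable[of "\<lambda>k. nk k (tt f k)"] A.norm_nonneg[OF tA]
    by (auto simp: coeffs_def)
qed

lemma H_outside: "f \<in> H \<Longrightarrow> x \<notin> carrier E \<Longrightarrow> f x = 0"
  by (auto simp: Hb_def entire_def)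

lemma H_sums: "f \<in> H \<Longrightarrow> x \<in> carrier E \<Longrightarrow> (\<lambda>k. tt f k x) sums f x"
  by (rule entire_taylor_sums) (auto simp: Hb_def)

lemma fsum_tt: "f \<in> H \<Longrightarrow> fsum (tt f) = f"
  using H_sums H_outside by (auto simp: fsum_def zext_def fun_eq_iff sums_iff)

end

section \<open>The Frechet space of functions of bounded type\<close>

lemma (in function_normed_space) norm_limit_le:
  assumes F: "F \<in> S" and f: "\<And>i::nat. f i \<in> S" and sum: "summable (\<lambda>i. N (f i))"
    and lim: "(\<lambda>n. N (F - (\<Sum>i<n. f i))) \<longlonglongrightarrow> 0"
  shows "N (F - (\<Sum>i<n. f i)) \<le> (\<Sum>i. N (f (i + n)))"
proof (rule LIMSEQ_le_const)
  have "(\<lambda>m. N (F - (\<Sum>i<m + n. f i)) + (\<Sum>i. N (f (i + n)))) \<longlonglongrightarrow> 0 + (\<Sum>i. N (f (i + n)))"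
    using LIMSEQ_ignore_initial_segment[OF lim, of n] by (intro tendsto_add tendsto_const)
  then show "(\<lambda>m. N (F - (\<Sum>i<m + n. f i)) + (\<Sum>i. N (f (i + n)))) \<longlonglongrightarrow> (\<Sum>i. N (f (i + n)))" by simp
  have "N (F - (\<Sum>i<n. f i)) \<le> N (F - (\<Sum>i<m + n. f i)) + (\<Sum>i. N (f (i + n)))" for m
  proof -
    have mem: "(\<Sum>i<j. f i) \<in> S" for j using f by (intro sum_mem)
    have "(\<Sum>i<n. f i) + (\<Sum>i=n..<m+n. f i) = (\<Sum>i<m + n. f i)"
      unfolding lessThan_atLeast0 by (intro sum.atLeastLessThan_concat) auto
    moreover have "(\<Sum>i=n..<m+n. f i) = (\<Sum>i<m. f (i + n))"
      using sum.shift_bounds_nat_ivl[of f 0 n m] by (simp only: lessThan_atLeast0 add_0)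
    ultimately have "(\<Sum>i<m + n. f i) - (\<Sum>i<n. f i) = (\<Sum>i<m. f (i + n))"
      by (metis add_diff_cancel_left')
    then have "N ((\<Sum>i<m + n. f i) - (\<Sum>i<n. f i)) \<le> (\<Sum>i<m. N (f (i + n)))"
      using norm_sum[of "{..<m}" "\<lambda>i. f (i + n)"] f by (simp only:)
    also have "\<dots> \<le> (\<Sum>i. N (f (i + n)))"
      using summable_ignore_initial_segment[OF sum] norm_nonneg[OF f] by (intro sum_le_suminf) auto
    finally show ?thesis using norm_triangle_diff[OF F mem mem, of n "m + n"] by linarith
  qed
  then show "\<exists>M. \<forall>m\<ge>M. N (F - (\<Sum>i<n. f i)) \<le> N (F - (\<Sum>i<m + n. f i)) + (\<Sum>i. N (f (i + n)))"
    by blast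
qed

context holomorphy
begin

abbreviation p :: "real \<Rightarrow> ('u \<Rightarrow> complex) \<Rightarrow> real" where "p \<equiv> Hb_seminorm \<AA> E"

lemma tt_mem: "f \<in> H \<Longrightarrow> tt f k \<in> A k"
  by (rule coeffs_mem[OF coeffs_tt])

lemma nk_tt_nonneg: "f \<in> H \<Longrightarrow> 0 \<le> nk k (tt f k)"
  by (rule A.norm_nonneg[OF tt_mem])

lemma p_summable: "f \<in> H \<Longrightarrow> 0 \<le> s \<Longrightarrow> summable (\<lambda>k. s ^ k * nk k (tt f k))"
  by (rule coeffs_summable[OF coeffs_tt])

lemma H_add_aux:
  assumes f: "f \<in> H" and g: "g \<in> H"
  shows "f + g \<in> H \<and> tt (f + g) = (\<lambda>k. tt f k + tt g k)"
proof -
  let ?P = "\<lambda>k. tt f k + tt g k"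
  have "coeffs ?P"
    unfolding coeffs_def
  proof (intro conjI allI impI)
    show "?P k \<in> A k" for k by (rule A.add_mem[OF tt_mem[OF f] tt_mem[OF g]])
    fix s :: real assume s: "0 < s"
    show "summable (\<lambda>k. s ^ k * nk k (?P k))"
    proof (rule summable_comparison_test')
      show "summable (\<lambda>k. s ^ k * nk k (tt f k) + s ^ k * nk k (tt g k))"
        using s by (intro summable_add p_summable f g) auto
      show "norm (s ^ k * nk k (?P k)) \<le> s ^ k * nk k (tt f k) + s ^ k * nk k (tt g k)" for k
        using s A.norm_triangle[OF tt_mem[OF f] tt_mem[OF g], of k]
          A.norm_nonneg[OF A.add_mem[OF tt_mem[OF f] tt_mem[OF g]], of k]
        by (simp add: abs_mult flip: distrib_left)
    qed
  qed
  moreover have "fsum ?P = f + g"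
  proof
    fix x show "fsum ?P x = (f + g) x"
      using sums_unique[OF sums_add[OF H_sums[OF f] H_sums[OF g]], of x] H_outside[OF f] H_outside[OF g]
      by (cases "x \<in> carrier E") (auto simp: fsum_def)
  qed
  ultimately show ?thesis using fsum_in_H tt_fsum by metis
qed

lemma H_fscale_aux:
  assumes f: "f \<in> H"
  shows "fscale c f \<in> H \<and> tt (fscale c f) = (\<lambda>k. fscale c (tt f k))"
proof -
  let ?P = "\<lambda>k. fscale c (tt f k)"
  have "coeffs ?P"
    unfolding coeffs_def
  proof (intro conjI allI impI)
    show "?P k \<in> A k" for k by (rule A.fscale_mem[OF tt_mem[OF f]])
    fix s :: real assume s: "0 < s"
    have "summable (\<lambda>k. cmod c * (s ^ k * nk k (tt f k)))" using s by (intro summable_mult p_summable f) auto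
    then show "summable (\<lambda>k. s ^ k * nk k (?P k))"
      by (simp add: A.norm_fscale[OF tt_mem[OF f]] mult.left_commute)
  qed
  moreover have "fsum ?P = fscale c f"
  proof
    fix x show "fsum ?P x = fscale c f x"
      using sums_unique[OF sums_mult[OF H_sums[OF f]], of x c] H_outside[OF f]
      by (cases "x \<in> carrier E") (auto simp: fsum_def)
  qed
  ultimately show ?thesis using fsum_in_H tt_fsum by metis
qed

lemma H_add: "f \<in> H \<Longrightarrow> g \<in> H \<Longrightarrow> f + g \<in> H"
  and tt_add: "f \<in> H \<Longrightarrow> g \<in> H \<Longrightarrow> tt (f + g) k = tt f k + tt g k"
  and H_fscale: "f \<in> H \<Longrightarrow> fscale c f \<in> H"
  and tt_fscale: "f \<in> H \<Longrightarrow> tt (fscale c f) k = fscale c (tt f k)"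
  by (simp_all add: H_add_aux H_fscale_aux)

lemma H_zero: "0 \<in> H" and tt_zero: "tt 0 k = 0"
proof -
  have "coeffs (\<lambda>k. 0)" by (simp add: coeffs_def A.zero_mem)
  moreover have "fsum (\<lambda>k. 0) = 0" by (auto simp: fsum_def zext_def)
  ultimately show "0 \<in> H" "tt 0 k = 0" using fsum_in_H tt_fsum by metis+
qed

lemma H_subspace: "cfun.subspace H"
  by (simp add: cfun.subspace_def H_add H_fscale H_zero)

lemma H_diff: "f \<in> H \<Longrightarrow> g \<in> H \<Longrightarrow> f - g \<in> H"
  by (rule cfun.subspace_diff[OF H_subspace])

lemma H_sum: "(\<And>i. i \<in> I \<Longrightarrow> F i \<in> H) \<Longrightarrow> (\<Sum>i\<in>I. F i) \<in> H"
  by (rule cfun.subspace_sum[OF H_subspace])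

lemma diff_fscale: "f - g = f + fscale (-1) g" for f g :: "'u \<Rightarrow> complex"
  by (simp add: fun_eq_iff)

lemma tt_diff: "f \<in> H \<Longrightarrow> g \<in> H \<Longrightarrow> tt (f - g) k = tt f k - tt g k"
  unfolding diff_fscale by (simp only: tt_add tt_fscale H_fscale)

lemma tt_sum: "(\<And>i. i \<in> I \<Longrightarrow> F i \<in> H) \<Longrightarrow> tt (\<Sum>i\<in>I. F i) k = (\<Sum>i\<in>I. tt (F i) k)"
proof (induction I rule: infinite_finite_induct)
  case (insert i I)
  have "tt (F i + (\<Sum>i\<in>I. F i)) k = tt (F i) k + tt (\<Sum>i\<in>I. F i) k"
    using insert.prems by (intro tt_add H_sum) auto
  moreover have "tt (\<Sum>i\<in>I. F i) k = (\<Sum>i\<in>I. tt (F i) k)"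
    using insert.prems by (intro insert.IH) auto
  ultimately show ?case unfolding sum.insert[OF insert.hyps] by (simp only:)
qed (simp_all add: tt_zero)

lemma p_nonneg: "f \<in> H \<Longrightarrow> 0 \<le> s \<Longrightarrow> 0 \<le> p s f"
  unfolding Hb_seminorm_def by (intro suminf_nonneg p_summable mult_nonneg_nonneg nk_tt_nonneg) auto

lemma p_triangle:
  assumes f: "f \<in> H" and g: "g \<in> H" and s: "0 \<le> s" shows "p s (f + g) \<le> p s f + p s g"
proof -
  have "p s (f + g) \<le> (\<Sum>k. s ^ k * nk k (tt f k) + s ^ k * nk k (tt g k))"
    unfolding Hb_seminorm_def
  proof (intro suminf_le summable_add p_summable H_add f g s)
    show "s ^ k * nk k (tt (f + g) k) \<le> s ^ k * nk k (tt f k) + s ^ k * nk k (tt g k)" for k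
      unfolding tt_add[OF f g] distrib_left[symmetric]
      using s by (intro mult_left_mono A.norm_triangle tt_mem f g) auto
  qed
  also have "\<dots> = p s f + p s g"
    unfolding Hb_seminorm_def by (rule suminf_add[symmetric]) (intro p_summable f g s)+
  finally show ?thesis .
qed

lemma p_fscale:
  assumes "f \<in> H" "0 \<le> s" shows "p s (fscale c f) = cmod c * p s f"
  unfolding Hb_seminorm_def
  by (subst suminf_mult[symmetric])
    (use assms in \<open>auto intro!: p_summable simp: tt_fscale A.norm_fscale[OF tt_mem] mult.left_commute\<close>)

lemma p_0 [simp]: "p s 0 = 0"
  by (simp add: Hb_seminorm_def tt_zero)

lemma p_minus: "f \<in> H \<Longrightarrow> 0 \<le> s \<Longrightarrow> p s (- f) = p s f"
  using p_fscale[of f s "-1"] by (simp add: fscale_def fun_Compl_def)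

lemma p_diff_commute: "f \<in> H \<Longrightarrow> g \<in> H \<Longrightarrow> 0 \<le> s \<Longrightarrow> p s (f - g) = p s (g - f)"
  using p_minus[OF H_diff, of f g s] by simp

lemma p_triangle_diff:
  assumes "f \<in> H" "g \<in> H" "h \<in> H" "0 \<le> s" shows "p s (f - h) \<le> p s (f - g) + p s (g - h)"
  using p_triangle[OF H_diff[OF assms(1,2)] H_diff[OF assms(2,3)] assms(4)] by simp

lemma p_mono: "f \<in> H \<Longrightarrow> 0 \<le> s \<Longrightarrow> s \<le> s' \<Longrightarrow> p s f \<le> p s' f"
  unfolding Hb_seminorm_def
  by (intro suminf_le p_summable mult_right_mono power_mono nk_tt_nonneg) auto

lemma p_term: "f \<in> H \<Longrightarrow> 0 \<le> s \<Longrightarrow> s ^ k * nk k (tt f k) \<le> p s f"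
  unfolding Hb_seminorm_def
  using sum_le_suminf[OF p_summable, of f s "{k}"] nk_tt_nonneg[of f] by auto

lemma p_eval:
  assumes f: "f \<in> H" and x: "x \<in> carrier E" "nrm E x \<le> s"
  shows "cmod (f x) \<le> p s f"
proof -
  have s: "0 \<le> s" using nrm_nonneg[OF x(1)] x(2) by linarith
  have "cmod (tt f k x) \<le> s ^ k * nk k (tt f k)" for k
    using poly_bound[OF tt_mem[OF f, of k] x(1)]
      mult_left_mono[OF power_mono[OF x(2) nrm_nonneg[OF x(1)]] nk_tt_nonneg[OF f], of k k]
    by (simp add: mult.commute)
  from norm_suminf_le[OF this p_summable[OF f s]] show ?thesis
    using sums_unique[OF H_sums[OF f x(1)]] by (simp add: Hb_seminorm_def)
qed

text \<open>Each single seminorm is a norm. This is what lets \<open>p 1\<close> alone identify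
  limits and decide injectivity later.\<close>

lemma p_eq_0:
  assumes "f \<in> H" "0 < s" "p s f = 0" shows "f = 0"
proof -
  have "nk k (tt f k) = 0" for k
  proof -
    have "s ^ k * nk k (tt f k) \<le> 0" using p_term[OF assms(1), of s k] assms by simp
    then have "nk k (tt f k) \<le> 0" using zero_less_power[OF assms(2), of k] by (simp add: mult_le_0_iff not_le)
    then show ?thesis using nk_tt_nonneg[OF assms(1), of k] by simp
  qed
  then have "tt f k = 0" for k using A.norm_eq_0[OF tt_mem[OF assms(1)]] by blast
  then have "tt f = (\<lambda>k. 0)" by blast
  then have "fsum (tt f) = 0" by (auto simp: fsum_def zext_def)
  then show ?thesis using fsum_tt[OF assms(1)] by simp
qed

text \<open>Only finite sums over the degree are interchanged with the sum over i; the infinite sum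
  follows from the boundedness of its partial sums.\<close>

lemma coeffs_of_bound:
  assumes f: "\<And>i::nat. f i \<in> H" and sum: "\<And>s. 0 < s \<Longrightarrow> summable (\<lambda>i. p s (f i))"
    and R: "\<And>k. R k \<in> A k" "\<And>k. nk k (R k) \<le> (\<Sum>i. nk k (tt (f i) k))"
  shows "coeffs R" "0 < s \<Longrightarrow> (\<Sum>k. s ^ k * nk k (R k)) \<le> (\<Sum>i. p s (f i))"
proof -
  have sk: "summable (\<lambda>i. nk k (tt (f i) k))" for k
    by (rule summable_comparison_test'[OF sum[OF zero_less_one]])
      (use p_term[OF f, of 1 k] nk_tt_nonneg[OF f] in simp)
  have part: "(\<Sum>k<K. s ^ k * nk k (R k)) \<le> (\<Sum>i. p s (f i))" if s: "0 < s" for s K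
  proof -
    have "(\<Sum>k<K. s ^ k * nk k (R k)) \<le> (\<Sum>k<K. s ^ k * (\<Sum>i. nk k (tt (f i) k)))"
      using s R by (intro sum_mono mult_left_mono) auto
    also have "\<dots> = (\<Sum>k<K. \<Sum>i. s ^ k * nk k (tt (f i) k))"
      by (simp add: suminf_mult[OF sk])
    also have "\<dots> = (\<Sum>i. \<Sum>k<K. s ^ k * nk k (tt (f i) k))"
      by (rule suminf_sum[symmetric]) (intro summable_mult sk)
    also have "\<dots> \<le> (\<Sum>i. p s (f i))"
    proof (intro suminf_le summable_sum summable_mult sk sum[OF s])
      show "(\<Sum>k<K. s ^ k * nk k (tt (f i) k)) \<le> p s (f i)" for i
        unfolding Hb_seminorm_def
        using s nk_tt_nonneg[OF f] by (intro sum_le_suminf p_summable f) auto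
    qed
    finally show ?thesis .
  qed
  have nn: "0 \<le> s ^ k * nk k (R k)" if "0 < s" for s k using A.norm_nonneg[OF R(1)] that by simp
  have sm: "summable (\<lambda>k. s ^ k * nk k (R k))" if s: "0 < s" for s
    by (rule summableI_nonneg_bounded[OF nn[OF s] part[OF s]])
  then show "coeffs R" using R(1) by (simp add: coeffs_def)
  show "(\<Sum>k. s ^ k * nk k (R k)) \<le> (\<Sum>i. p s (f i))" if s: "0 < s"
    by (rule suminf_le_const[OF sm[OF s] part[OF s]])
qed

text \<open>Completeness of \<open>H\<close> in the form used throughout: absolutely convergent
  series converge, with the pointwise sum as limit and an explicit tail bound. The sum is built
  degree by degree in the ideals.\<close>

lemma H_series:
  assumes f: "\<And>i::nat. f i \<in> H" and sum: "\<And>s. 0 < s \<Longrightarrow> summable (\<lambda>i. p s (f i))"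
  defines "F \<equiv> \<lambda>x. \<Sum>i. f i x"
  shows "F \<in> H" and "0 < s \<Longrightarrow> p s (F - (\<Sum>i<n. f i)) \<le> (\<Sum>i. p s (f (i + n)))"
    and "(\<lambda>i. f i x) sums F x"
proof -
  have sk: "summable (\<lambda>i. nk k (tt (f i) k))" for k
    by (rule summable_comparison_test'[OF sum[OF zero_less_one]])
      (use p_term[OF f, of 1 k] nk_tt_nonneg[OF f] in simp)
  have "\<exists>G\<in>A k. (\<lambda>n. nk k (G - (\<Sum>i<n. tt (f i) k))) \<longlonglongrightarrow> 0" for k
    by (rule A.absolutely_convergent[OF ideal_banach[OF banach] tt_mem[OF f] sk])
  then obtain Q where Q: "\<And>k. Q k \<in> A k" "\<And>k. (\<lambda>n. nk k (Q k - (\<Sum>i<n. tt (f i) k))) \<longlonglongrightarrow> 0"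
    by metis
  \<comment> \<open>The coefficient of degree k of the n-th remainder: n = 0 shows that the sum
    belongs to \<open>H\<close>, larger n give the tail bound.\<close>
  define R where "R n k = Q k - (\<Sum>i<n. tt (f i) k)" for n k
  have R: "R n k \<in> A k" "nk k (R n k) \<le> (\<Sum>i. nk k (tt (f (i + n)) k))" for n k
  proof -
    show "R n k \<in> A k" unfolding R_def by (rule A.diff_mem[OF Q(1) A.sum_mem[OF tt_mem[OF f]]])
    show "nk k (R n k) \<le> (\<Sum>i. nk k (tt (f (i + n)) k))"
      unfolding R_def by (rule A.norm_limit_le[OF Q(1) tt_mem[OF f] sk Q(2)])
  qed
  have sum': "0 < s \<Longrightarrow> summable (\<lambda>i. p s (f (i + n)))" for s n
    by (rule summable_ignore_initial_segment[OF sum])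
  have "R 0 = Q" by (simp add: R_def fun_eq_iff)
  with coeffs_of_bound(1)[of "\<lambda>i. f (i + 0)" "R 0", OF f sum' R] have cQ: "coeffs Q" by simp
  define G where "G = fsum Q"
  have G: "G \<in> H" "tt G = Q" using fsum_in_H[OF cQ] tt_fsum[OF cQ] by (simp_all add: G_def)
  have bound: "p s (G - (\<Sum>i<n. f i)) \<le> (\<Sum>i. p s (f (i + n)))" if s: "0 < s" for s n
  proof -
    have "tt (G - (\<Sum>i<n. f i)) k = R n k" for k
      unfolding R_def tt_diff[OF G(1) H_sum[of "{..<n}" f, OF f]] tt_sum[of "{..<n}" f, OF f] G(2) ..
    then show ?thesis
      using coeffs_of_bound(2)[of "\<lambda>i. f (i + n)" "R n", OF f sum' R s] by (simp add: Hb_seminorm_def)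
  qed
  have pt: "(\<lambda>i. f i x) sums G x" for x
  proof (cases "x \<in> carrier E")
    case True
    define s where "s = nrm E x + 1"
    have s: "0 < s" "nrm E x \<le> s" using nrm_nonneg[OF True] by (auto simp: s_def)
    have "(\<lambda>n. G x - (\<Sum>i<n. f i x)) \<longlonglongrightarrow> 0"
    proof (rule Lim_null_comparison)
      have "norm (G x - (\<Sum>i<n. f i x)) \<le> (\<Sum>i. p s (f (i + n)))" for n
        using p_eval[OF H_diff[OF G(1) H_sum[of "{..<n}" f, OF f]] True s(2)] bound[OF s(1), of n]
        by (simp add: sum_apply)
      then show "\<forall>\<^sub>F n in sequentially. norm (G x - (\<Sum>i<n. f i x)) \<le> (\<Sum>i. p s (f (i + n)))"
        by (intro always_eventually allI)
      show "(\<lambda>n. \<Sum>i. p s (f (i + n))) \<longlonglongrightarrow> 0"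
        using suminf_exist_split2[OF sum[OF s(1)]] by simp
    qed
    from tendsto_diff[OF tendsto_const[of "G x"] this] show ?thesis unfolding sums_def by simp
  next
    case False
    then show ?thesis using H_outside[OF f False] H_outside[OF G(1) False] by simp
  qed
  have FG: "F = G" using sums_unique[OF pt] by (auto simp: F_def fun_eq_iff)
  show "F \<in> H" "0 < s \<Longrightarrow> p s (F - (\<Sum>i<n. f i)) \<le> (\<Sum>i. p s (f (i + n)))" "(\<lambda>i. f i x) sums F x"
    unfolding FG using G(1) bound pt by auto
qed

section \<open>Basic neighbourhoods and closed sets\<close>

abbreviation \<tau> :: "('u \<Rightarrow> complex) topology" where "\<tau> \<equiv> Hb_topology \<AA> E"

definition pball :: "real \<Rightarrow> real \<Rightarrow> ('u \<Rightarrow> complex) \<Rightarrow> ('u \<Rightarrow> complex) set" where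
  "pball s r f = {g \<in> H. p s (g - f) < r}"

lemma openin_pball: "f \<in> H \<Longrightarrow> 0 < s \<Longrightarrow> 0 < r \<Longrightarrow> openin \<tau> (pball s r f)"
  unfolding Hb_topology_def pball_def by (rule topology_generated_by_Basis) blast

lemma center_pball: "f \<in> H \<Longrightarrow> 0 < r \<Longrightarrow> f \<in> pball s r f"
  by (simp add: pball_def)

lemma openin_subset_H:
  assumes "openin \<tau> U" shows "U \<subseteq> H"
proof -
  have "topspace \<tau> \<subseteq> H" unfolding Hb_topology_def topology_generated_by_topspace by blast
  then show ?thesis using openin_subset[OF assms] by blast
qed

lemma topspace_H: "topspace \<tau> = H"
proof
  show "topspace \<tau> \<subseteq> H" by (rule openin_subset_H[OF openin_topspace])
  show "H \<subseteq> topspace \<tau>"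
    using openin_subset[OF openin_pball[OF _ zero_less_one zero_less_one]] center_pball[OF _ zero_less_one]
    by blast
qed

text \<open>The topology is given by a subbasis. As \<open>p s\<close> increases with s, two balls
  with the same centre contain a third one, so the balls around f form a neighbourhood
  basis.\<close>

lemma openin_contains_pball:
  assumes "openin \<tau> U" "f \<in> U"
  shows "\<exists>s>0. \<exists>r>0. pball s r f \<subseteq> U"
proof -
  have "generate_topology_on {{g \<in> H. p s (g - f) < r} | f s r. f \<in> H \<and> 0 < s \<and> 0 < r} U"
    using assms(1) unfolding Hb_topology_def openin_topology_generated_by_iff .
  then show ?thesis using assms(2)
  proof (induction arbitrary: f)
    case (Int a b)
    obtain s1 r1 s2 r2 where *: "0 < s1" "0 < r1" "pball s1 r1 f \<subseteq> a" "0 < s2" "0 < r2" "pball s2 r2 f \<subseteq> b"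
      using Int.IH(1)[of f] Int.IH(2)[of f] Int.prems by auto
    have f: "f \<in> H"
    proof -
      have "openin \<tau> a" unfolding Hb_topology_def openin_topology_generated_by_iff by (rule Int.hyps(1))
      then show ?thesis using openin_subset_H Int.prems by blast
    qed
    have "pball (max s1 s2) (min r1 r2) f \<subseteq> pball s1 r1 f \<inter> pball s2 r2 f"
    proof
      fix g assume g: "g \<in> pball (max s1 s2) (min r1 r2) f"
      then have gH: "g \<in> H" by (simp add: pball_def)
      show "g \<in> pball s1 r1 f \<inter> pball s2 r2 f"
        using g * p_mono[OF H_diff[OF gH f], of s1 "max s1 s2"] p_mono[OF H_diff[OF gH f], of s2 "max s1 s2"]
        by (simp add: pball_def)
    qed
    then show ?case using * by (intro exI[of _ "max s1 s2"] conjI exI[of _ "min r1 r2"]) auto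
  next
    case (UN K)
    then obtain k where k: "k \<in> K" "f \<in> k" by blast
    from UN.IH[OF this] show ?case using k(1) by blast
  next
    case (Basis b)
    then obtain f0 s r where b: "b = {g \<in> H. p s (g - f0) < r}" "f0 \<in> H" "0 < s" "0 < r" by blast
    then have f: "f \<in> H" "p s (f - f0) < r" using Basis.prems by auto
    have "pball s (r - p s (f - f0)) f \<subseteq> b"
    proof
      fix g assume "g \<in> pball s (r - p s (f - f0)) f"
      then have g: "g \<in> H" "p s (g - f) < r - p s (f - f0)" by (auto simp: pball_def)
      then show "g \<in> b" using p_triangle_diff[OF g(1) f(1) b(2), of s] b by simp
    qed
    then show ?case using b f by (intro exI[of _ s] conjI exI[of _ "r - p s (f - f0)"]) auto
  qed simp
qed

lemma closedinI:
  assumes sub: "M \<subseteq> H"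
    and cl: "\<And>f. f \<in> H \<Longrightarrow> (\<And>s e. 0 < s \<Longrightarrow> 0 < e \<Longrightarrow> \<exists>g\<in>M. p s (g - f) < e) \<Longrightarrow> f \<in> M"
  shows "closedin \<tau> M"
proof -
  have "openin \<tau> (H - M)"
  proof (subst openin_subopen, rule ballI)
    fix f assume f: "f \<in> H - M"
    then obtain s e where s: "0 < s" "0 < e" "\<forall>g\<in>M. \<not> p s (g - f) < e" using cl[of f] by blast
    then have "pball s e f \<subseteq> H - M" by (auto simp: pball_def)
    then show "\<exists>T. openin \<tau> T \<and> f \<in> T \<and> T \<subseteq> H - M"
      using openin_pball[of f s e] center_pball[of f e s] f s by blast
  qed
  then show ?thesis using sub by (simp add: closedin_def topspace_H)
qed

end

section \<open>Convolution operators as bounded linear maps\<close>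

locale conv_operator = holomorphy +
  fixes T :: "('a \<Rightarrow> complex) \<Rightarrow> 'a \<Rightarrow> complex"
  assumes conv: "convolution_operator \<AA> E T"
begin

lemma T_H: "f \<in> H \<Longrightarrow> T f \<in> H"
  and T_add: "f \<in> H \<Longrightarrow> g \<in> H \<Longrightarrow> T (f + g) = T f + T g"
  and T_fscale: "f \<in> H \<Longrightarrow> T (fscale c f) = fscale c (T f)"
  and T_translation: "f \<in> H \<Longrightarrow> x \<in> carrier E \<Longrightarrow> T (translation E x f) = translation E x (T f)"
  using conv by (auto simp: convolution_operator_def)

lemma T_zero: "T 0 = 0"
  using T_fscale[OF H_zero, of 0] by simp

lemma T_diff: "f \<in> H \<Longrightarrow> g \<in> H \<Longrightarrow> T (f - g) = T f - T g"
  unfolding diff_fscale by (simp only: T_add T_fscale H_fscale)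

lemma T_sum: "(\<And>i. i \<in> I \<Longrightarrow> F i \<in> H) \<Longrightarrow> T (\<Sum>i\<in>I. F i) = (\<Sum>i\<in>I. T (F i))"
proof (induction I rule: infinite_finite_induct)
  case (insert i I)
  have "T (F i + (\<Sum>i\<in>I. F i)) = T (F i) + T (\<Sum>i\<in>I. F i)"
    using insert.prems by (intro T_add H_sum) auto
  moreover have "T (\<Sum>i\<in>I. F i) = (\<Sum>i\<in>I. T (F i))" using insert.prems by (intro insert.IH) auto
  ultimately show ?case unfolding sum.insert[OF insert.hyps] by (simp only:)
qed (simp_all add: T_zero)

lemma T_bounded:
  assumes s: "0 < s"
  shows "\<exists>s'>0. \<exists>C>0. \<forall>f\<in>H. p s (T f) \<le> C * p s' f"
proof -
  have cont: "continuous_map \<tau> \<tau> T" using conv by (simp add: convolution_operator_def)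
  define U where "U = {f \<in> H. T f \<in> pball s 1 0}"
  have "openin \<tau> U"
    using openin_continuous_map_preimage[OF cont openin_pball[OF H_zero s zero_less_one]]
    by (simp add: U_def topspace_H)
  moreover have "0 \<in> U" using center_pball[OF H_zero zero_less_one] by (simp add: U_def H_zero T_zero)
  ultimately obtain s' r where s': "0 < s'" "0 < r" "pball s' r 0 \<subseteq> U"
    using openin_contains_pball by metis
  have small: "p s (T f) < 1" if "f \<in> H" "p s' f < r" for f
    using s'(3) that by (auto simp: pball_def U_def)
  have "p s (T f) \<le> (2 / r) * p s' f" if f: "f \<in> H" for f
  proof (cases "p s' f = 0")
    case True
    then have "f = 0" using p_eq_0[OF f s'(1)] by simp
    then show ?thesis by (simp add: T_zero)
  next
    case False
    define q where "q = p s' f"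
    have q: "q > 0" using False p_nonneg[OF f, of s'] s' by (simp add: q_def)
    \<comment> \<open>Scales f to seminorm r / 2, strictly inside the ball of radius r.\<close>
    define c where "c = complex_of_real (r / (2 * q))"
    have c: "cmod c = r / (2 * q)" using q s' by (simp add: c_def norm_divide)
    have "p s' (fscale c f) < r"
      using p_fscale[OF f, of s' c] q s' c by (simp add: field_simps flip: q_def)
    then have "cmod c * p s (T f) < 1"
      using small[OF H_fscale[OF f, of c]] p_fscale[OF T_H[OF f], of s c] s by (simp add: T_fscale[OF f])
    then show ?thesis using q s' unfolding c by (simp add: field_simps flip: q_def)
  qed
  then show ?thesis using s' by (intro exI[of _ s'] conjI exI[of _ "2 / r"]) auto
qed

end

section \<open>Exponentials along lines\<close>

text \<open>Orthogonality of the characters of a cyclic group; it extracts a single coefficient of a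
  polynomial from its values at roots of unity.\<close>

lemma sum_roots_of_unity:
  assumes "j < N" "k < N"
  shows "(\<Sum>l<N. cis (2 * pi * real l / real N) ^ j * cnj (cis (2 * pi * real l / real N)) ^ k) =
    (if j = k then of_nat N else 0)"
proof -
  define t where "t = 2 * pi * (real j - real k) / real N"
  have N: "real N > 0" using assms by simp
  have eq: "cis (2 * pi * real l / real N) ^ j * cnj (cis (2 * pi * real l / real N)) ^ k = cis t ^ l" for l
    unfolding cis_cnj Complex.DeMoivre cis_mult t_def
    by (rule arg_cong[where f=cis]) (simp add: algebra_simps diff_divide_distrib)
  show ?thesis
  proof (cases "j = k")
    case True
    then show ?thesis unfolding eq by (simp add: t_def)
  next
    case False
    have "cis t \<noteq> 1"
    proof
      assume "cis t = 1"
      then have "cos t = 1" by (simp add: complex_eq_iff)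
      then obtain n :: int where n: "t = of_int n * 2 * pi" using cos_one_2pi_int by auto
      have "pi * (real j - real k - of_int n * real N) = 0"
        using n N by (simp add: t_def field_simps)
      then have "real j - real k = of_int n * real N" by simp
      then have "int j - int k = n * int N" by (metis of_int_eq_iff of_int_diff of_int_mult of_int_of_nat_eq)
      then have "int N dvd int j - int k" by simp
      then have "int j mod int N = int k mod int N" by (simp add: mod_eq_dvd_iff)
      then show False using assms False by simp
    qed
    moreover have "cis t ^ N = 1"
    proof -
      have "real N * t = 2 * pi * of_int (int j - int k)" using N by (simp add: t_def)
      then have "cis (real N * t) = 1" using cis_multiple_2pi[of "of_int (int j - int k)"] by simp
      then show ?thesis by (simp add: Complex.DeMoivre)
    qed
    ultimately show ?thesis unfolding eq using False by (simp add: geometric_sum)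
  qed
qed

context holomorphy
begin

text \<open>The degree \<open>m\<close> part of \<open>exp(\<gamma>\<^sub>0 + w \<gamma>\<^sub>1)\<close> is a polynomial in \<open>w\<close>; \<open>expc \<gamma>\<^sub>0 \<gamma>\<^sub>1 k m\<close> is its
  \<open>k\<close>-th coefficient. Since the ideals need not be closed under products, its norm is bounded by
  averaging over roots of unity as in Cauchy's estimates.\<close>

definition expc :: "('u \<Rightarrow> complex) \<Rightarrow> ('u \<Rightarrow> complex) \<Rightarrow> nat \<Rightarrow> nat \<Rightarrow> 'u \<Rightarrow> complex" where
  "expc \<gamma>0 \<gamma>1 k m = zext (carrier E) (\<lambda>x. of_nat (m choose k) / fact m * \<gamma>0 x ^ (m - k) * \<gamma>1 x ^ k)"

lemma expc_bound:
  assumes g: "\<gamma>0 \<in> carrier (dual E)" "\<gamma>1 \<in> carrier (dual E)" and r: "0 < r"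
  shows "expc \<gamma>0 \<gamma>1 k m \<in> A m \<and> nk m (expc \<gamma>0 \<gamma>1 k m) \<le> (dnorm \<gamma>0 + r * dnorm \<gamma>1) ^ m / fact m / r ^ k"
proof -
  \<comment> \<open>The order must exceed both the degree m and the index k, for otherwise distinct
    exponents could agree modulo \<open>N\<close>.\<close>
  define N where "N = m + k + 1"
  define W where "W l = cis (2 * pi * real l / real N)" for l
  define \<gamma> where "\<gamma> l = \<gamma>0 + fscale (of_real r * W l) \<gamma>1" for l
  define c where "c l = cnj (W l) ^ k / (of_nat N * of_real r ^ k * fact m)" for l
  have \<gamma>: "\<gamma> l \<in> carrier (dual E)" for l
    unfolding \<gamma>_def by (intro dual_add dual_fscale g)
  have n\<gamma>: "dnorm (\<gamma> l) \<le> dnorm \<gamma>0 + r * dnorm \<gamma>1" for l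
  proof (rule dnorm_le)
    fix x assume x: "x \<in> carrier E"
    have "cmod (\<gamma> l x) \<le> cmod (\<gamma>0 x) + r * cmod (\<gamma>1 x)"
      using norm_triangle_ineq[of "\<gamma>0 x" "of_real r * W l * \<gamma>1 x"] r
      by (simp add: \<gamma>_def W_def norm_mult)
    also have "\<dots> \<le> dnorm \<gamma>0 * nrm E x + r * (dnorm \<gamma>1 * nrm E x)"
      using r by (intro add_mono mult_left_mono dual_bound g x) auto
    finally show "cmod (\<gamma> l x) \<le> (dnorm \<gamma>0 + r * dnorm \<gamma>1) * nrm E x" by (simp add: algebra_simps)
  qed (use r dnorm_nonneg[OF g(1)] dnorm_nonneg[OF g(2)] in simp)
  have eq: "expc \<gamma>0 \<gamma>1 k m = (\<Sum>l<N. fscale (c l) (pw (\<gamma> l) m))"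
  proof
    fix x
    show "expc \<gamma>0 \<gamma>1 k m x = (\<Sum>l<N. fscale (c l) (pw (\<gamma> l) m)) x"
    proof (cases "x \<in> carrier E")
      case True
      define b where "b j = of_nat (m choose j) * of_real r ^ j * \<gamma>1 x ^ j * \<gamma>0 x ^ (m - j)" for j
      define C where "C = of_nat N * of_real r ^ k * (fact m :: complex)"
      have pwx: "pw (\<gamma> l) m x = (\<Sum>j\<le>m. b j * W l ^ j)" for l
      proof -
        have "pw (\<gamma> l) m x = (of_real r * W l * \<gamma>1 x + \<gamma>0 x) ^ m"
          using True by (simp add: pw_def \<gamma>_def add.commute)
        also have "\<dots> = (\<Sum>j\<le>m. of_nat (m choose j) * (of_real r * W l * \<gamma>1 x) ^ j * \<gamma>0 x ^ (m - j))"
          by (rule binomial_ring)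
        finally show ?thesis by (simp add: b_def power_mult_distrib mult_ac)
      qed
      have "(\<Sum>l<N. fscale (c l) (pw (\<gamma> l) m)) x = (\<Sum>l<N. \<Sum>j\<le>m. b j / C * (W l ^ j * cnj (W l) ^ k))"
        by (simp add: sum_apply pwx c_def C_def sum_distrib_left sum_divide_distrib mult_ac)
      also have "\<dots> = (\<Sum>j\<le>m. b j / C * (\<Sum>l<N. W l ^ j * cnj (W l) ^ k))"
        by (subst sum.swap) (simp add: sum_distrib_left)
      also have "\<dots> = (\<Sum>j\<le>m. b j / C * (if j = k then of_nat N else 0))"
        unfolding W_def by (intro sum.cong refl arg_cong2[where f="(*)"] sum_roots_of_unity) (auto simp: N_def)
      also have "\<dots> = (\<Sum>j\<le>m. if j = k then b k / C * of_nat N else 0)"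
        by (intro sum.cong) auto
      also have "\<dots> = b k / C * of_nat N" by (auto simp: b_def)
      also have "\<dots> = expc \<gamma>0 \<gamma>1 k m x"
        using True r by (simp add: expc_def b_def C_def N_def del: of_nat_Suc of_nat_add)
      finally show ?thesis by simp
    qed (simp add: expc_def pw_def sum_apply)
  qed
  have "expc \<gamma>0 \<gamma>1 k m \<in> A m"
    unfolding eq by (intro A.sum_mem A.fscale_mem pw_in_A \<gamma>)
  moreover have "nk m (expc \<gamma>0 \<gamma>1 k m) \<le> (\<Sum>l<N. nk m (fscale (c l) (pw (\<gamma> l) m)))"
    unfolding eq by (intro A.norm_sum A.fscale_mem pw_in_A \<gamma>)
  moreover have "nk m (fscale (c l) (pw (\<gamma> l) m)) \<le> (dnorm \<gamma>0 + r * dnorm \<gamma>1) ^ m / fact m / r ^ k / real N" for l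
  proof -
    have "nk m (pw (\<gamma> l) m) \<le> (dnorm \<gamma>0 + r * dnorm \<gamma>1) ^ m"
      by (rule order.trans[OF pw_in_A(2)[OF \<gamma>] power_mono[OF n\<gamma> dnorm_nonneg[OF \<gamma>]]])
    from mult_left_mono[OF this norm_ge_zero[of "c l"]]
    have "nk m (fscale (c l) (pw (\<gamma> l) m)) \<le> cmod (c l) * (dnorm \<gamma>0 + r * dnorm \<gamma>1) ^ m"
      unfolding A.norm_fscale[OF pw_in_A(1)[OF \<gamma>]] .
    moreover have "cmod (c l) = 1 / (real N * r ^ k * fact m)"
      using r by (simp add: c_def W_def norm_divide norm_mult norm_power)
    ultimately show ?thesis by (simp add: mult_ac)
  qed
  then have "(\<Sum>l<N. nk m (fscale (c l) (pw (\<gamma> l) m))) \<le>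
      (\<Sum>l<N. (dnorm \<gamma>0 + r * dnorm \<gamma>1) ^ m / fact m / r ^ k / real N)"
    by (intro sum_mono)
  then have "(\<Sum>l<N. nk m (fscale (c l) (pw (\<gamma> l) m))) \<le> (dnorm \<gamma>0 + r * dnorm \<gamma>1) ^ m / fact m / r ^ k"
    by (simp add: N_def del: of_nat_Suc of_nat_add)
  ultimately show ?thesis by linarith
qed

text \<open>The coefficient of w^k in exp(\<gamma>0 + w \<gamma>1), that is, exp(\<gamma>0)
  \<gamma>1^k / k! by \<open>ev_apply\<close>. Assembling it from homogeneous parts gives membership
  in \<open>H\<close> by \<open>expc_bound\<close>.\<close>

definition ev :: "('u \<Rightarrow> complex) \<Rightarrow> ('u \<Rightarrow> complex) \<Rightarrow> nat \<Rightarrow> 'u \<Rightarrow> complex" where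
  "ev \<gamma>0 \<gamma>1 k = fsum (expc \<gamma>0 \<gamma>1 k)"

definition Ex :: "('u \<Rightarrow> complex) \<Rightarrow> 'u \<Rightarrow> complex" where
  "Ex \<gamma> = zext (carrier E) (\<lambda>x. exp (\<gamma> x))"

lemma exp_series_real: "(\<lambda>m. s ^ m * (a ^ m / fact m)) sums exp (s * a)" for s a :: real
  using exp_converges[of "s * a"] by (simp add: power_mult_distrib divide_inverse mult_ac scaleR_conv_of_real)

text \<open>The radius r is free, so the seminorms of \<open>ev \<gamma>0 \<gamma>1 k\<close> decay
  in k faster than every geometric sequence; the series in w converges on the whole plane.\<close>

lemma ev_facts:
  assumes g: "\<gamma>0 \<in> carrier (dual E)" "\<gamma>1 \<in> carrier (dual E)" and r: "0 < r"
  shows "coeffs (expc \<gamma>0 \<gamma>1 k)" "ev \<gamma>0 \<gamma>1 k \<in> H"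
    "0 \<le> s \<Longrightarrow> p s (ev \<gamma>0 \<gamma>1 k) \<le> exp (s * (dnorm \<gamma>0 + r * dnorm \<gamma>1)) / r ^ k"
proof -
  let ?b = "dnorm \<gamma>0 + r * dnorm \<gamma>1"
  have ser: "(\<lambda>m. s ^ m * (?b ^ m / fact m / r ^ k)) sums (exp (s * ?b) / r ^ k)" for s
    using sums_divide[OF exp_series_real[of s ?b], of "r ^ k"] by simp
  have le: "s ^ m * nk m (expc \<gamma>0 \<gamma>1 k m) \<le> s ^ m * (?b ^ m / fact m / r ^ k)" if "0 \<le> s" for s m
    using expc_bound[OF g r, of k m] that by (intro mult_left_mono) auto
  have nn: "0 \<le> s ^ m * nk m (expc \<gamma>0 \<gamma>1 k m)" if "0 \<le> s" for s m
    using that A.norm_nonneg[of "expc \<gamma>0 \<gamma>1 k m" m] expc_bound[OF g r, of k m] by simp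
  have sm: "summable (\<lambda>m. s ^ m * nk m (expc \<gamma>0 \<gamma>1 k m))" if "0 \<le> s" for s
    by (rule summable_comparison_test'[OF sums_summable[OF ser]]) (use le[OF that] nn[OF that] in simp)
  show co: "coeffs (expc \<gamma>0 \<gamma>1 k)"
    using expc_bound[OF g r, of k] sm unfolding coeffs_def by auto
  show "ev \<gamma>0 \<gamma>1 k \<in> H" unfolding ev_def by (rule fsum_in_H[OF co])
  show "p s (ev \<gamma>0 \<gamma>1 k) \<le> exp (s * ?b) / r ^ k" if s: "0 \<le> s"
    unfolding ev_def Hb_seminorm_def tt_fsum[OF co]
    using suminf_le[OF le[OF s] sm[OF s] sums_summable[OF ser]] sums_unique[OF ser[of s]] by simp
qed

lemma ev_H: "\<gamma>0 \<in> carrier (dual E) \<Longrightarrow> \<gamma>1 \<in> carrier (dual E) \<Longrightarrow> ev \<gamma>0 \<gamma>1 k \<in> H"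
  by (rule ev_facts(2)[OF _ _ zero_less_one])

lemma ev_apply: "ev \<gamma>0 \<gamma>1 k = zext (carrier E) (\<lambda>x. exp (\<gamma>0 x) * \<gamma>1 x ^ k / fact k)"
proof
  fix x
  show "ev \<gamma>0 \<gamma>1 k x = zext (carrier E) (\<lambda>x. exp (\<gamma>0 x) * \<gamma>1 x ^ k / fact k) x"
  proof (cases "x \<in> carrier E")
    case True
    have "(\<lambda>m. expc \<gamma>0 \<gamma>1 k (m + k) x) = (\<lambda>m. \<gamma>0 x ^ m /\<^sub>R fact m * (\<gamma>1 x ^ k / fact k))"
    proof
      fix m
      have "(fact k * fact m * of_nat (m + k choose k) :: complex) = fact (m + k)"
        using binomial_fact_lemma[of k "m + k"] by (metis add_diff_cancel_right' le_add2 of_nat_fact of_nat_mult)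
      then have "(of_nat (m + k choose k) / fact (m + k) :: complex) = 1 / (fact k * fact m)"
        by (simp add: field_simps)
      then show "expc \<gamma>0 \<gamma>1 k (m + k) x = \<gamma>0 x ^ m /\<^sub>R fact m * (\<gamma>1 x ^ k / fact k)"
      proof -
        have "expc \<gamma>0 \<gamma>1 k (m + k) x = of_nat (m + k choose k) / fact (m + k) * (\<gamma>0 x ^ m * \<gamma>1 x ^ k)"
          using True by (simp add: expc_def)
        also have "of_nat (m + k choose k) / fact (m + k) = (1 / (fact k * fact m) :: complex)" by fact
        finally show ?thesis by (simp add: scaleR_conv_of_real field_simps)
      qed
    qed
    then have "(\<lambda>m. expc \<gamma>0 \<gamma>1 k (m + k) x) sums (exp (\<gamma>0 x) * (\<gamma>1 x ^ k / fact k))"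
      by (simp only: sums_mult2[OF exp_converges])
    moreover have "(\<Sum>m<k. expc \<gamma>0 \<gamma>1 k m x) = 0"
      using True by (intro sum.neutral) (auto simp: expc_def binomial_eq_0)
    ultimately have "(\<lambda>m. expc \<gamma>0 \<gamma>1 k m x) sums (exp (\<gamma>0 x) * (\<gamma>1 x ^ k / fact k))"
      using sums_iff_shift[of "\<lambda>m. expc \<gamma>0 \<gamma>1 k m x" k "exp (\<gamma>0 x) * (\<gamma>1 x ^ k / fact k)"] by simp
    from sums_unique[OF this] show ?thesis using True by (simp add: ev_def fsum_def)
  qed (simp add: ev_def fsum_def)
qed

section \<open>Exponentials as power series in a direction\<close>

lemma Ex_ev: "Ex \<gamma> = ev \<gamma> \<delta> 0"
  by (simp add: Ex_def ev_apply)

lemma Ex_H: "\<gamma> \<in> carrier (dual E) \<Longrightarrow> Ex \<gamma> \<in> H"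
  using ev_H[of \<gamma> \<gamma> 0] by (simp flip: Ex_ev)

lemma ev_summable:
  assumes g: "\<gamma>0 \<in> carrier (dual E)" "\<gamma>1 \<in> carrier (dual E)" and s: "0 \<le> s" and w: "0 \<le> w"
  shows "summable (\<lambda>k. w ^ k * p s (ev \<gamma>0 \<gamma>1 k))"
proof -
  \<comment> \<open>Makes w / r smaller than 1/2 and keeps r positive for w = 0.\<close>
  define r where "r = 2 * w + 1"
  have r: "0 < r" using w by (simp add: r_def)
  let ?B = "exp (s * (dnorm \<gamma>0 + r * dnorm \<gamma>1))"
  show ?thesis
  proof (rule summable_comparison_test')
    have "w / r < 1" using w by (simp add: r_def)
    then show "summable (\<lambda>k. ?B * (w / r) ^ k)" using w r by (intro summable_mult summable_geometric) simp
    show "norm (w ^ k * p s (ev \<gamma>0 \<gamma>1 k)) \<le> ?B * (w / r) ^ k" for k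
      using mult_left_mono[OF ev_facts(3)[OF g r s, of k], of "w ^ k"] w p_nonneg[OF ev_H[OF g] s, of k]
      by (simp add: power_divide mult_ac)
  qed
qed

lemma ev_series:
  assumes g: "\<gamma>0 \<in> carrier (dual E)" "\<gamma>1 \<in> carrier (dual E)"
  shows "0 \<le> s \<Longrightarrow> summable (\<lambda>k. p s (fscale (w ^ k) (ev \<gamma>0 \<gamma>1 k)))"
    and "(\<lambda>x. \<Sum>k. fscale (w ^ k) (ev \<gamma>0 \<gamma>1 k) x) = Ex (\<gamma>0 + fscale w \<gamma>1)"
proof -
  show "summable (\<lambda>k. p s (fscale (w ^ k) (ev \<gamma>0 \<gamma>1 k)))" if s: "0 \<le> s"
    using ev_summable[OF g s norm_ge_zero[of w]] by (simp add: p_fscale[OF ev_H[OF g] s] norm_power)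
  show "(\<lambda>x. \<Sum>k. fscale (w ^ k) (ev \<gamma>0 \<gamma>1 k) x) = Ex (\<gamma>0 + fscale w \<gamma>1)"
  proof
    fix x
    show "(\<Sum>k. fscale (w ^ k) (ev \<gamma>0 \<gamma>1 k) x) = Ex (\<gamma>0 + fscale w \<gamma>1) x"
    proof (cases "x \<in> carrier E")
      case True
      have "(\<lambda>k. exp (\<gamma>0 x) * ((w * \<gamma>1 x) ^ k /\<^sub>R fact k)) sums (exp (\<gamma>0 x) * exp (w * \<gamma>1 x))"
        by (intro sums_mult exp_converges)
      then have "(\<lambda>k. fscale (w ^ k) (ev \<gamma>0 \<gamma>1 k) x) sums (exp (\<gamma>0 x) * exp (w * \<gamma>1 x))"
        using True by (simp add: ev_apply power_mult_distrib scaleR_conv_of_real divide_inverse mult_ac)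
      from sums_unique[OF this] show ?thesis using True by (simp add: Ex_def exp_add)
    qed (simp add: Ex_def ev_apply)
  qed
qed

text \<open>The series in w without its constant term. Cauchy's estimate with radius 1 and the bound
  1/2 on w compare it with a geometric series of ratio 1/2.\<close>

lemma Ex_diff_line:
  assumes g: "\<gamma> \<in> carrier (dual E)" "\<delta> \<in> carrier (dual E)" and s: "0 < s" and w: "cmod w \<le> 1 / 2"
  shows "p s (Ex (\<gamma> + fscale w \<delta>) - Ex \<gamma>) \<le> 2 * cmod w * exp (s * (dnorm \<gamma> + dnorm \<delta>))"
proof -
  let ?f = "\<lambda>k. fscale (w ^ k) (ev \<gamma> \<delta> k)" and ?B = "exp (s * (dnorm \<gamma> + dnorm \<delta>))"
  have f: "?f k \<in> H" for k by (intro H_fscale ev_H g)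
  have sm: "summable (\<lambda>k. p s (?f k))" if "0 < s" for s using that by (intro ev_series g) auto
  have "p s (Ex (\<gamma> + fscale w \<delta>) - (\<Sum>k<1. ?f k)) \<le> (\<Sum>k. p s (?f (k + 1)))"
    using H_series(2)[of ?f, OF f sm s] unfolding ev_series(2)[OF g] .
  also have "\<dots> \<le> (\<Sum>k. ?B * cmod w * (1 / 2) ^ k)"
  proof (rule suminf_le)
    show "p s (?f (k + 1)) \<le> ?B * cmod w * (1 / 2) ^ k" for k
    proof -
      have "p s (?f (k + 1)) = cmod w ^ (k + 1) * p s (ev \<gamma> \<delta> (k + 1))"
        using s by (subst p_fscale[OF ev_H[OF g]]) (auto simp: norm_power norm_mult)
      also have "\<dots> \<le> (cmod w * (1 / 2) ^ k) * ?B"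
        using ev_facts(3)[OF g zero_less_one, of s "k + 1"] s w
        by (intro mult_mono p_nonneg ev_H g) (auto intro!: mult_left_mono power_mono)
      finally show ?thesis by (simp add: mult_ac)
    qed
    show "summable (\<lambda>k. p s (?f (k + 1)))" by (rule summable_ignore_initial_segment[OF sm[OF s]])
    show "summable (\<lambda>k. ?B * cmod w * (1 / 2) ^ k)" by (intro summable_mult summable_geometric) simp
  qed
  also have "\<dots> = ?B * cmod w * 2"
    using sums_unique[OF sums_mult[OF geometric_sums[of "1/2 :: real"]], of "?B * cmod w"] by simp
  finally show ?thesis using Ex_ev[of \<gamma> \<delta>] by (simp add: mult_ac)
qed

text \<open>Local Lipschitz continuity of \<open>Ex\<close> for the dual norm, from the line
  estimate in the normalized direction from \<gamma> to \<delta>.\<close>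

lemma Ex_diff:
  assumes g: "\<gamma> \<in> carrier (dual E)" "\<delta> \<in> carrier (dual E)" and s: "0 < s" and d: "dnorm (\<delta> - \<gamma>) \<le> 1 / 2"
  shows "p s (Ex \<delta> - Ex \<gamma>) \<le> 2 * dnorm (\<delta> - \<gamma>) * exp (s * (dnorm \<gamma> + 1))"
proof (cases "dnorm (\<delta> - \<gamma>) = 0")
  case True
  interpret D: function_normed_space "carrier (dual E)" dnorm by (rule dual_function_normed_space)
  have "\<delta> - \<gamma> = 0" using True D.norm_eq_0[OF dual_diff[OF g(2,1)]] by simp
  then show ?thesis using True by simp
next
  case False
  define e where "e = dnorm (\<delta> - \<gamma>)"
  define \<eta> where "\<eta> = fscale (of_real (inverse e)) (\<delta> - \<gamma>)"
  have e: "0 < e" using False dnorm_nonneg[OF dual_diff[OF g(2,1)]] by (simp add: e_def)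
  have \<eta>: "\<eta> \<in> carrier (dual E)" unfolding \<eta>_def by (intro dual_fscale dual_diff g)
  have "dnorm \<eta> \<le> 1"
    using dnorm_fscale_le[OF dual_diff[OF g(2,1)], of "of_real (inverse e)"] e
    by (simp add: \<eta>_def norm_inverse flip: e_def)
  moreover have "\<gamma> + fscale (of_real e) \<eta> = \<delta>"
    using e by (simp add: \<eta>_def fun_eq_iff)
  ultimately have "p s (Ex \<delta> - Ex \<gamma>) \<le> 2 * e * exp (s * (dnorm \<gamma> + dnorm \<eta>))"
    using Ex_diff_line[OF g(1) \<eta> s, of "of_real e"] e d by (simp flip: e_def)
  also have "\<dots> \<le> 2 * e * exp (s * (dnorm \<gamma> + 1))"
    using e s \<open>dnorm \<eta> \<le> 1\<close> by (intro mult_left_mono) auto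
  finally show ?thesis by (simp add: e_def)
qed

section \<open>Closed subspaces\<close>

definition closed_subspace :: "('u \<Rightarrow> complex) set \<Rightarrow> bool" where
  "closed_subspace V \<longleftrightarrow> V \<subseteq> H \<and> cfun.subspace V \<and>
     (\<forall>f\<in>H. (\<forall>s>0. \<forall>e>0. \<exists>g\<in>V. p s (g - f) < e) \<longrightarrow> f \<in> V)"

lemma closed_subspaceD:
  assumes "closed_subspace V"
  shows "V \<subseteq> H" "cfun.subspace V" "f \<in> H \<Longrightarrow> (\<And>s e. 0 < s \<Longrightarrow> 0 < e \<Longrightarrow> \<exists>g\<in>V. p s (g - f) < e) \<Longrightarrow> f \<in> V"
  using assms by (auto simp: closed_subspace_def)

lemma closed_subspace_limit:
  assumes V: "closed_subspace V" and g: "\<And>n::nat. g n \<in> V" and f: "f \<in> H"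
    and lim: "\<And>s. 0 < s \<Longrightarrow> (\<lambda>n. p s (g n - f)) \<longlonglongrightarrow> 0"
  shows "f \<in> V"
proof (rule closed_subspaceD(3)[OF V f])
  fix s e :: real assume "0 < s" "0 < e"
  then have "\<forall>\<^sub>F n in sequentially. p s (g n - f) < e" using lim by (intro order_tendstoD)
  then obtain n where "p s (g n - f) < e" by (auto simp: eventually_sequentially)
  then show "\<exists>g\<in>V. p s (g - f) < e" using g by blast
qed

lemma closed_subspace_series:
  assumes V: "closed_subspace V" and f: "\<And>i::nat. f i \<in> V" and sm: "\<And>s. 0 < s \<Longrightarrow> summable (\<lambda>i. p s (f i))"
  shows "(\<lambda>x. \<Sum>i. f i x) \<in> V"
proof (rule closed_subspace_limit[OF V])
  have fH: "f i \<in> H" for i using f closed_subspaceD(1)[OF V] by blast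
  have S1: "(\<lambda>x. \<Sum>i. f i x) \<in> H" by (rule H_series(1)[of f, OF fH sm])
  have S2: "p s ((\<lambda>x. \<Sum>i. f i x) - (\<Sum>i<n. f i)) \<le> (\<Sum>i. p s (f (i + n)))" if "0 < s" for s n
    using that by (intro H_series(2)[of f, OF fH sm])
  show "(\<Sum>i<n. f i) \<in> V" for n by (rule cfun.subspace_sum[OF closed_subspaceD(2)[OF V] f])
  show "(\<lambda>x. \<Sum>i. f i x) \<in> H" by (rule S1)
  show "(\<lambda>n. p s ((\<Sum>i<n. f i) - (\<lambda>x. \<Sum>i. f i x))) \<longlonglongrightarrow> 0" if s: "0 < s" for s
  proof (rule Lim_null_comparison)
    show "(\<lambda>n. \<Sum>i. p s (f (i + n))) \<longlonglongrightarrow> 0"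
      using suminf_exist_split2[OF sm[OF s]] by simp
    have "norm (p s ((\<Sum>i<n. f i) - (\<lambda>x. \<Sum>i. f i x))) \<le> (\<Sum>i. p s (f (i + n)))" for n
    proof -
      have sH: "(\<Sum>i<n. f i) \<in> H" by (rule H_sum[of "{..<n}" f, OF fH])
      show ?thesis
        using S2[OF s, of n] p_nonneg[OF H_diff[OF sH S1], of s]
          p_diff_commute[OF sH S1, of s] s by simp
    qed
    then show "\<forall>\<^sub>F n in sequentially. norm (p s ((\<Sum>i<n. f i) - (\<lambda>x. \<Sum>i. f i x))) \<le> (\<Sum>i. p s (f (i + n)))"
      by (intro always_eventually allI)
  qed
qed

text \<open>If the values of a power series along a null sequence w_n lie in V, so do its
  coefficients: subtract the first k terms, which are in V by induction, and divide by w_n^k; what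
  remains is v_k + O(w_n).\<close>

lemma closed_subspace_coeff:
  assumes V: "closed_subspace V" and v: "\<And>k. v k \<in> H" and r: "0 < r"
    and sm: "\<And>s. 0 < s \<Longrightarrow> summable (\<lambda>k. r ^ k * p s (v k))"
    and w: "w \<longlonglongrightarrow> 0" "\<And>n::nat. w n \<noteq> 0" "\<And>n. cmod (w n) \<le> r"
    and F: "\<And>n. (\<lambda>x. \<Sum>k. fscale (w n ^ k) (v k) x) \<in> V"
  shows "v k \<in> V"
proof (induction k rule: less_induct)
  case (less k)
  let ?f = "\<lambda>n k. fscale (w n ^ k) (v k)"
  define F where "F n = (\<lambda>x. \<Sum>k. ?f n k x)" for n
  define g where "g n = fscale (1 / w n ^ k) (F n - (\<Sum>j<k. ?f n j))" for n
  have fH: "?f n j \<in> H" for n j by (intro H_fscale v)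
  have pf: "p s (?f n j) = cmod (w n) ^ j * p s (v j)" if "0 < s" for s n j
    using that by (subst p_fscale[OF v]) (auto simp: norm_power)
  have pn: "0 \<le> p s (v j)" if "0 < s" for s j using p_nonneg[OF v] that by simp
  have smf: "summable (\<lambda>j. p s (?f n j))" if s: "0 < s" for s n
    unfolding pf[OF s]
    by (rule summable_comparison_test'[OF sm[OF s]])
      (use w(3) pn[OF s] in \<open>auto intro!: mult_right_mono power_mono simp: abs_mult\<close>)
  show ?case
  proof (rule closed_subspace_limit[OF V _ v])
    show gV: "g n \<in> V" for n
    proof -
      have "(\<Sum>j<k. ?f n j) \<in> V"
        using less closed_subspaceD(2)[OF V] by (intro cfun.subspace_sum cfun.subspace_scale) auto
      moreover have "F n \<in> V" using assms(8) by (simp add: F_def)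
      ultimately show ?thesis unfolding g_def
        using closed_subspaceD(2)[OF V] by (intro cfun.subspace_scale cfun.subspace_diff)
    qed
    fix s :: real assume s: "0 < s"
    define C where "C = (\<Sum>i. r ^ i * p s (v (i + (k + 1))))"
    have smC: "summable (\<lambda>i. r ^ i * p s (v (i + (k + 1))))"
    proof -
      have "summable (\<lambda>i. inverse (r ^ (k + 1)) * (r ^ (i + (k + 1)) * p s (v (i + (k + 1)))))"
        by (intro summable_mult summable_ignore_initial_segment[OF sm[OF s]])
      then show ?thesis using r by (simp add: power_add field_simps)
    qed
    have bound: "p s (g n - v k) \<le> C * cmod (w n)" for n
    proof -
      have "g n - v k = fscale (1 / w n ^ k) (F n - (\<Sum>j<k + 1. ?f n j))"
        using w(2)[of n] by (simp add: g_def fun_eq_iff field_simps)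
      then have "p s (g n - v k) = 1 / cmod (w n) ^ k * p s (F n - (\<Sum>j<k + 1. ?f n j))"
        using s p_fscale[OF H_diff[OF H_series(1)[of "?f n", OF fH smf] H_sum[of "{..<k+1}" "?f n", OF fH]], of s "1 / w n ^ k"]
        by (simp add: F_def norm_divide norm_power)
      also have "\<dots> \<le> 1 / cmod (w n) ^ k * (\<Sum>i. p s (?f n (i + (k + 1))))"
        unfolding F_def by (intro mult_left_mono H_series(2)[of "?f n", OF fH smf s]) auto
      also have "\<dots> = (\<Sum>i. 1 / cmod (w n) ^ k * p s (?f n (i + (k + 1))))"
        by (rule suminf_mult[symmetric, OF summable_ignore_initial_segment[OF smf[OF s]]])
      also have "\<dots> \<le> (\<Sum>i. cmod (w n) * (r ^ i * p s (v (i + (k + 1)))))"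
      proof (rule suminf_le)
        show "1 / cmod (w n) ^ k * p s (?f n (i + (k + 1))) \<le> cmod (w n) * (r ^ i * p s (v (i + (k + 1))))" for i
        proof -
          have "1 / cmod (w n) ^ k * p s (?f n (i + (k + 1))) = cmod (w n) * (cmod (w n) ^ i * p s (v (i + (k + 1))))"
            unfolding pf[OF s] using w(2)[of n] by (simp add: power_add field_simps)
          also have "\<dots> \<le> cmod (w n) * (r ^ i * p s (v (i + (k + 1))))"
            using w(3)[of n] pn[OF s] by (intro mult_left_mono mult_right_mono power_mono) auto
          finally show ?thesis .
        qed
        show "summable (\<lambda>i. 1 / cmod (w n) ^ k * p s (?f n (i + (k + 1))))"
          by (intro summable_mult summable_ignore_initial_segment[OF smf[OF s]])
        show "summable (\<lambda>i. cmod (w n) * (r ^ i * p s (v (i + (k + 1)))))" by (intro summable_mult smC)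
      qed
      also have "\<dots> = C * cmod (w n)" unfolding C_def using suminf_mult[OF smC, of "cmod (w n)"] by simp
      finally show ?thesis .
    qed
    show "(\<lambda>n. p s (g n - v k)) \<longlonglongrightarrow> 0"
    proof (rule Lim_null_comparison)
      show "(\<lambda>n. C * cmod (w n)) \<longlonglongrightarrow> 0"
        by (rule tendsto_mult_right_zero[OF tendsto_norm_zero[OF w(1)]])
      show "\<forall>\<^sub>F n in sequentially. norm (p s (g n - v k)) \<le> C * cmod (w n)"
        using bound p_nonneg[OF H_diff[OF _ v], of "g n" for n] gV closed_subspaceD(1)[OF V] s
        by (intro always_eventually allI) (simp add: subset_iff p_nonneg H_diff v)
    qed
  qed
qed

lemma polynomial_in_H:
  assumes P: "P \<in> A k"
  shows "P \<in> H" "p s P = s ^ k * nk k P"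
proof -
  define Q where "Q m = (if m = k then P else 0)" for m
  have s0: "s ^ m * nk m (Q m) = (if m = k then s ^ k * nk k P else 0)" for m and s :: real by (simp add: Q_def)
  have Q: "coeffs Q" unfolding coeffs_def s0 using P A.zero_mem by (auto simp: Q_def)
  have "fsum Q = P"
  proof
    fix x
    have "Q m x = (if m = k then P x else 0)" for m by (simp add: Q_def)
    then show "fsum Q x = P x"
      using hom_poly_outside[OF A_hom[OF P], of x] sums_unique[OF sums_single[of k "\<lambda>m. P x"]]
      by (cases "x \<in> carrier E") (simp_all add: fsum_def)
  qed
  then show "P \<in> H" using fsum_in_H[OF Q] by simp
  show "p s P = s ^ k * nk k P"
    using \<open>fsum Q = P\<close> tt_fsum[OF Q] sums_unique[OF sums_single[of k "\<lambda>m. s ^ k * nk k P"]]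
    by (simp add: Hb_seminorm_def s0)
qed

text \<open>The exponentials are total. Extracting coefficients from exp(w \<gamma>) yields the
  powers of \<gamma>, hence the finite type polynomials, by density each \<open>A k\<close>, and by
  Taylor series all of \<open>H\<close>.\<close>

lemma closed_subspace_all:
  assumes V: "closed_subspace V" and ex: "\<And>\<gamma>. \<gamma> \<in> carrier (dual E) \<Longrightarrow> Ex \<gamma> \<in> V"
    and dense: "\<And>k. ntop (ideal_space (\<AA> k) E) closure_of finite_type E k = A k"
  shows "V = H"
proof -
  note sub = closed_subspaceD(2)[OF V]
  have pwV: "pw \<gamma> k \<in> V" if g: "\<gamma> \<in> carrier (dual E)" for \<gamma> k
  proof -
    have "ev 0 \<gamma> k \<in> V"
    proof (rule closed_subspace_coeff[OF V ev_H[OF dual_zero g] zero_less_one])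
      show "summable (\<lambda>k. 1 ^ k * p s (ev 0 \<gamma> k))" if "0 < s" for s
        using that by (intro ev_summable dual_zero g) auto
      show "(\<lambda>n. of_real (1 / real (Suc n)) :: complex) \<longlonglongrightarrow> 0"
        using tendsto_of_real[OF LIMSEQ_inverse_real_of_nat, where 'a=complex] by (simp add: inverse_eq_divide)
      show "(\<lambda>x. \<Sum>k. fscale (of_real (1 / real (Suc n)) ^ k) (ev 0 \<gamma> k) x) \<in> V" for n
        unfolding ev_series(2)[OF dual_zero g] by (intro ex dual_add dual_fscale dual_zero g)
    qed (auto simp: norm_divide simp del: of_nat_Suc)
    then have "fscale (fact k) (ev 0 \<gamma> k) \<in> V" by (rule cfun.subspace_scale[OF sub])
    moreover have "fscale (fact k) (ev 0 \<gamma> k) = pw \<gamma> k"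
      by (auto simp: ev_apply pw_def zext_def fun_eq_iff)
    ultimately show ?thesis by simp
  qed
  have fin: "finite_type E k \<subseteq> V" for k
    unfolding finite_type_def by (rule cfun.span_minimal[OF _ sub]) (use pwV in \<open>auto simp: pw_def\<close>)
  have finA: "finite_type E k \<subseteq> A k" for k
    unfolding finite_type_def
    by (rule cfun.span_minimal[OF _ A.subspace]) (use pw_in_A(1) in \<open>auto simp: pw_def\<close>)
  have AV: "P \<in> V" if P: "P \<in> A k" for P k
  proof (rule closed_subspaceD(3)[OF V polynomial_in_H(1)[OF P]])
    fix s e :: real assume s: "0 < s" and e: "0 < e"
    have "P \<in> ntop (fun_space (A k) (nk k)) closure_of finite_type E k"
      using dense[of k] P by (simp add: ideal_space_def)
    then have "\<forall>e>0. \<exists>g\<in>finite_type E k. nk k (g - P) < e" using A.closure_iff[OF finA] by simp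
    then obtain Q where Q: "Q \<in> finite_type E k" "nk k (Q - P) < e / s ^ k"
      using s e by (meson divide_pos_pos zero_less_power)
    then have "Q - P \<in> A k" using finA P by (intro A.diff_mem) auto
    then have "p s (Q - P) < e" using polynomial_in_H(2)[of "Q - P" k s] Q(2) s by (simp add: field_simps)
    then show "\<exists>g\<in>V. p s (g - P) < e" using Q(1) fin by blast
  qed
  have "f \<in> V" if f: "f \<in> H" for f
  proof -
    have "(\<lambda>x. \<Sum>k. tt f k x) \<in> V"
    proof (rule closed_subspace_series[OF V AV[OF tt_mem[OF f]]])
      show "summable (\<lambda>k. p s (tt f k))" if "0 < s" for s
        using p_summable[OF f, of s] polynomial_in_H(2)[OF tt_mem[OF f], of s] that by simp
    qed
    moreover have "(\<lambda>x. \<Sum>k. tt f k x) = f"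
    proof
      fix x show "(\<Sum>k. tt f k x) = f x"
        using H_sums[OF f] sums_unique H_outside[OF f] hom_poly_outside[OF A_hom[OF tt_mem[OF f]]]
        by (cases "x \<in> carrier E") force+
    qed
    ultimately show ?thesis by simp
  qed
  then show ?thesis using closed_subspaceD(1)[OF V] by blast
qed

end

section \<open>The symbol of a convolution operator\<close>

context conv_operator
begin

definition \<phi> :: "('a \<Rightarrow> complex) \<Rightarrow> complex" where "\<phi> \<gamma> = T (Ex \<gamma>) \<zero>"

text \<open>Translation by x multiplies \<open>Ex \<gamma>\<close> by exp(\<gamma>(x)), and T
  commutes with translations. The translate of \<open>T (Ex \<gamma>)\<close>, evaluated at 0, is
  its value at x.\<close>

lemma T_Ex:
  assumes g: "\<gamma> \<in> carrier (dual E)"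
  shows "T (Ex \<gamma>) = fscale (\<phi> \<gamma>) (Ex \<gamma>)"
proof
  fix x
  show "T (Ex \<gamma>) x = fscale (\<phi> \<gamma>) (Ex \<gamma>) x"
  proof (cases "x \<in> carrier E")
    case True
    have "translation E x (Ex \<gamma>) = fscale (exp (\<gamma> x)) (Ex \<gamma>)"
      using True by (auto simp: translation_def Ex_def zext_def fun_eq_iff dualD(1)[OF g] exp_add)
    then have "translation E x (T (Ex \<gamma>)) = fscale (exp (\<gamma> x)) (T (Ex \<gamma>))"
      using T_translation[OF Ex_H[OF g] True] T_fscale[OF Ex_H[OF g]] by simp
    from fun_cong[OF this, of \<zero>] show ?thesis
      using True by (simp add: translation_def Ex_def \<phi>_def)
  qed (use H_outside[OF T_H[OF Ex_H[OF g]]] in \<open>simp add: Ex_def\<close>)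
qed

lemma T_series:
  assumes f: "\<And>i::nat. f i \<in> H" and sm: "\<And>s. 0 < s \<Longrightarrow> summable (\<lambda>i. p s (f i))"
  shows "0 < s \<Longrightarrow> summable (\<lambda>i. p s (T (f i)))" and "T (\<lambda>x. \<Sum>i. f i x) = (\<lambda>x. \<Sum>i. T (f i) x)"
proof -
  show smT: "summable (\<lambda>i. p s (T (f i)))" if s: "0 < s" for s
  proof -
    obtain s' C where C: "0 < s'" "0 < C" "\<forall>f\<in>H. p s (T f) \<le> C * p s' f" using T_bounded[OF s] by auto
    show ?thesis
    proof (rule summable_comparison_test')
      show "summable (\<lambda>i. C * p s' (f i))" by (intro summable_mult sm C)
      show "norm (p s (T (f i))) \<le> C * p s' (f i)" for i
        using bspec[OF C(3) f] p_nonneg[OF T_H[OF f]] s by simp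
    qed
  qed
  let ?F = "\<lambda>x. \<Sum>i. f i x" and ?G = "\<lambda>x. \<Sum>i. T (f i) x"
  have S1: "?F \<in> H" by (rule H_series(1)[of f, OF f sm])
  have S2: "p s (?F - (\<Sum>i<n. f i)) \<le> (\<Sum>i. p s (f (i + n)))" if "0 < s" for s n
    using that by (intro H_series(2)[of f, OF f sm])
  have S1': "?G \<in> H" by (rule H_series(1)[of "\<lambda>i. T (f i)", OF T_H[OF f] smT])
  have S2': "p s (?G - (\<Sum>i<n. T (f i))) \<le> (\<Sum>i. p s (T (f (i + n))))" if "0 < s" for s n
    using that by (intro H_series(2)[of "\<lambda>i. T (f i)", OF T_H[OF f] smT])
  have "T ?F - ?G = 0"
  proof (rule p_eq_0[OF H_diff[OF T_H[OF S1] S1'] zero_less_one])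
    obtain s' C where C: "0 < s'" "0 < C" "\<forall>f\<in>H. p 1 (T f) \<le> C * p s' f" using T_bounded[OF zero_less_one] by auto
    have bound: "p 1 (T ?F - ?G) \<le> C * (\<Sum>i. p s' (f (i + n))) + (\<Sum>i. p 1 (T (f (i + n))))" for n
    proof -
      have sH: "(\<Sum>i<n. f i) \<in> H" by (rule H_sum[of "{..<n}" f, OF f])
      have Ts: "T (\<Sum>i<n. f i) = (\<Sum>i<n. T (f i))" by (rule T_sum[of "{..<n}" f, OF f])
      have sH': "(\<Sum>i<n. T (f i)) \<in> H" by (rule H_sum[of "{..<n}" "\<lambda>i. T (f i)", OF T_H[OF f]])
      have "p 1 (T ?F - ?G) \<le> p 1 (T ?F - (\<Sum>i<n. T (f i))) + p 1 ((\<Sum>i<n. T (f i)) - ?G)"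
        by (rule p_triangle_diff[OF T_H[OF S1] sH' S1']) simp
      moreover have "p 1 (T ?F - (\<Sum>i<n. T (f i))) \<le> C * p s' (?F - (\<Sum>i<n. f i))"
        unfolding Ts[symmetric] T_diff[OF S1 sH, symmetric] by (rule bspec[OF C(3) H_diff[OF S1 sH]])
      moreover have "C * p s' (?F - (\<Sum>i<n. f i)) \<le> C * (\<Sum>i. p s' (f (i + n)))"
        using C by (intro mult_left_mono S2) auto
      moreover have "p 1 ((\<Sum>i<n. T (f i)) - ?G) = p 1 (?G - (\<Sum>i<n. T (f i)))"
        by (rule p_diff_commute[OF sH' S1']) simp
      moreover have "p 1 (?G - (\<Sum>i<n. T (f i))) \<le> (\<Sum>i. p 1 (T (f (i + n))))"
        by (rule S2'[OF zero_less_one])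
      ultimately show ?thesis by linarith
    qed
    have "(\<lambda>n. C * (\<Sum>i. p s' (f (i + n))) + (\<Sum>i. p 1 (T (f (i + n))))) \<longlonglongrightarrow> C * 0 + 0"
      by (intro tendsto_add tendsto_mult tendsto_const suminf_exist_split2 sm smT C) auto
    then have "p 1 (T ?F - ?G) \<le> C * 0 + 0"
      by (rule LIMSEQ_le_const) (use bound in blast)
    then show "p 1 (T ?F - ?G) = 0" using p_nonneg[OF H_diff[OF T_H[OF S1] S1'], of 1] by simp
  qed
  then show "T ?F = ?G" by simp
qed

lemma \<phi>_line:
  assumes g: "\<gamma>0 \<in> carrier (dual E)" "\<gamma>1 \<in> carrier (dual E)"
  shows "(\<lambda>k. T (ev \<gamma>0 \<gamma>1 k) \<zero> * w ^ k) sums \<phi> (\<gamma>0 + fscale w \<gamma>1)"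
proof -
  let ?f = "\<lambda>k. fscale (w ^ k) (ev \<gamma>0 \<gamma>1 k)"
  have f: "?f k \<in> H" for k by (intro H_fscale ev_H g)
  have sm: "summable (\<lambda>k. p s (?f k))" if "0 < s" for s using that by (intro ev_series g) auto
  have "(\<lambda>k. T (?f k) \<zero>) sums (\<Sum>k. T (?f k) \<zero>)"
    by (rule H_series(3)[of "\<lambda>k. T (?f k)", OF T_H[OF f] T_series(1)[of ?f, OF f sm]])
  moreover have "(\<Sum>k. T (?f k) \<zero>) = \<phi> (\<gamma>0 + fscale w \<gamma>1)"
    using fun_cong[OF T_series(2)[of ?f, OF f sm], of \<zero>] unfolding ev_series(2)[OF g] by (simp add: \<phi>_def)
  ultimately show ?thesis by (simp add: T_fscale[OF ev_H[OF g]] mult.commute)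
qed

lemma \<phi>_holomorphic:
  assumes g: "\<gamma>0 \<in> carrier (dual E)" "\<gamma>1 \<in> carrier (dual E)"
  shows "(\<lambda>w. \<phi> (\<gamma>0 + fscale w \<gamma>1)) holomorphic_on UNIV"
proof -
  have "(\<lambda>w. \<phi> (\<gamma>0 + fscale w \<gamma>1)) holomorphic_on ball 0 r" for r
    by (rule power_series_holomorphic) (use \<phi>_line[OF g] in simp)
  then have "(\<lambda>w. \<phi> (\<gamma>0 + fscale w \<gamma>1)) field_differentiable at w" for w
    by (rule holomorphic_on_imp_differentiable_at[of _ "ball 0 (cmod w + 1)"]) auto
  then show ?thesis by (simp add: holomorphic_on_def field_differentiable_at_within)
qed

text \<open>One seminorm and one constant serve all functionals. This gives the locally uniform
  convergence that Hurwitz' theorem asks for.\<close>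

lemma \<phi>_diff:
  "\<exists>s>0. \<exists>C>0. \<forall>\<gamma>\<in>carrier (dual E). \<forall>\<delta>\<in>carrier (dual E). cmod (\<phi> \<gamma> - \<phi> \<delta>) \<le> C * p s (Ex \<gamma> - Ex \<delta>)"
proof -
  obtain s C where C: "0 < s" "0 < C" "\<forall>f\<in>H. p 1 (T f) \<le> C * p s f" using T_bounded[OF zero_less_one] by auto
  have "cmod (\<phi> \<gamma> - \<phi> \<delta>) \<le> C * p s (Ex \<gamma> - Ex \<delta>)"
    if g: "\<gamma> \<in> carrier (dual E)" "\<delta> \<in> carrier (dual E)" for \<gamma> \<delta>
  proof -
    have h: "Ex \<gamma> - Ex \<delta> \<in> H" by (intro H_diff Ex_H g)
    have "\<phi> \<gamma> - \<phi> \<delta> = T (Ex \<gamma> - Ex \<delta>) \<zero>"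
      unfolding T_diff[OF Ex_H[OF g(1)] Ex_H[OF g(2)]] by (simp add: \<phi>_def)
    then have "cmod (\<phi> \<gamma> - \<phi> \<delta>) \<le> p 1 (T (Ex \<gamma> - Ex \<delta>))"
      using p_eval[OF T_H[OF h] M.zero_closed, of 1] by simp
    then show ?thesis using bspec[OF C(3) h] by linarith
  qed
  then show ?thesis using C(1,2) by blast
qed

end

section \<open>Separated sets of positive lower density\<close>

text \<open>A set that contains, up to finitely many terms, a strictly increasing sequence of at
  most linear growth has positive lower density.\<close>

lemma lower_density_pos:
  assumes f: "strict_mono f" "\<And>j. f j \<le> c * (j + 1)" and D: "\<And>j. j0 \<le> j \<Longrightarrow> f j \<in> D"
  shows "0 < lower_density D"
proof -
  \<comment> \<open>Half of 1 / (c + 1); the other half absorbs the \<open>j0\<close> missing terms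
    and the rounding once N is large.\<close>
  define e where "e = 1 / (2 * (real c + 1))"
  have "ereal e \<le> liminf (\<lambda>N. ereal (real (card (D \<inter> {..N})) / real (N + 1)))"
  proof (rule Liminf_bounded)
    show "\<forall>\<^sub>F N in sequentially. ereal e \<le> ereal (real (card (D \<inter> {..N})) / real (N + 1))"
      using eventually_ge_at_top[of "2 * (c + 1) * (j0 + 2)"]
    proof eventually_elim
      case (elim N)
      define J where "J = {j0..<N div (c + 1)}"
      have "f ` J \<subseteq> D \<inter> {..N}"
      proof
        fix y assume "y \<in> f ` J"
        then obtain j where j: "j \<in> J" "y = f j" by auto
        have "f j \<le> (c + 1) * (j + 1)" using f(2)[of j] by simp
        also have "\<dots> \<le> (c + 1) * (N div (c + 1))" using j by (intro mult_left_mono) (auto simp: J_def)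
        also have "\<dots> \<le> N" by (rule times_div_less_eq_dividend)
        finally show "y \<in> D \<inter> {..N}" using j D by (auto simp: J_def)
      qed
      then have "card (f ` J) \<le> card (D \<inter> {..N})" by (intro card_mono) auto
      moreover have "card (f ` J) = N div (c + 1) - j0"
        using strict_mono_imp_inj_on[OF f(1)] by (subst card_image) (auto simp: J_def inj_on_def)
      ultimately have card: "real (N div (c + 1)) - real j0 \<le> real (card (D \<inter> {..N}))" by simp
      have "N < (c + 1) * (N div (c + 1) + 1)"
        using mod_less_divisor[of "c + 1" N] div_mult_mod_eq[of N "c + 1"] by (simp add: algebra_simps del: mod_less_divisor)
      then have "real N < real ((c + 1) * (N div (c + 1) + 1))" by (simp only: of_nat_less_iff)
      then have 1: "real N < (real c + 1) * (real (N div (c + 1)) + 1)" by (simp add: algebra_simps)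
      have "real (2 * (c + 1) * (j0 + 2)) \<le> real N" using elim by (simp only: of_nat_le_iff)
      then have 2: "2 * (real c + 1) * (real j0 + 2) \<le> real N" by (simp add: algebra_simps)
      have "real N + 1 \<le> 2 * (real c + 1) * (real (N div (c + 1)) - real j0)"
        using 1 2 by (simp add: algebra_simps)
      then have "e * real (N + 1) \<le> real (N div (c + 1)) - real j0"
        by (simp add: e_def field_simps)
      then have "e * real (N + 1) \<le> real (card (D \<inter> {..N}))" using card by linarith
      then show ?case by (simp add: field_simps)
    qed
  qed
  moreover have "0 < ereal e" by (simp add: e_def)
  ultimately show ?thesis unfolding lower_density_def by (rule order.strict_trans2[rotated])
qed

text \<open>\<open>ruler k\<close> is one more than the exponent of 2 in \<open>k + 1\<close>.\<close>

function ruler :: "nat \<Rightarrow> nat" where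
  "ruler k = (if even k then 1 else Suc (ruler (k div 2)))"
  by auto
termination by (relation "Wellfounded.measure id") (auto elim!: oddE)

declare ruler.simps [simp del]

lemma ruler_even [simp]: "ruler (2 * m) = 1"
  by (subst ruler.simps) simp

lemma ruler_odd [simp]: "ruler (Suc (2 * m)) = Suc (ruler m)"
  by (subst ruler.simps) simp

lemma ruler_pos: "1 \<le> ruler k"
  by (subst ruler.simps) simp

text \<open>The average value is at most 2, so \<open>position\<close> grows at most linearly. Half
  of the entries are 1, the others repeat the sequence increased by 1, whence the recursion over
  halves.\<close>

lemma sum_ruler: "(\<Sum>i<n. ruler i) \<le> 2 * n"
proof (induction n rule: less_induct)
  case (less n)
  have double: "(\<Sum>i<2 * m. ruler i) = 2 * m + (\<Sum>i<m. ruler i)" for m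
    by (induction m) auto
  show ?case
  proof (cases "n = 0")
    case False
    define m where "m = n div 2"
    have IH: "(\<Sum>i<m. ruler i) \<le> 2 * m" using less False by (simp add: m_def)
    consider "n = 2 * m" | "n = Suc (2 * m)" unfolding m_def by linarith
    then show ?thesis using IH double[of m] by cases auto
  qed simp
qed

text \<open>Every positive value is taken along an arithmetic progression: here k + 1 is 2^r times
  an odd number.\<close>

lemma ruler_progression: "ruler (2 ^ r - 1 + 2 ^ Suc r * j) = Suc r"
proof (induction r)
  case (Suc r)
  have "2 ^ Suc r - 1 + 2 ^ Suc (Suc r) * j = Suc (2 * (2 ^ r - 1 + 2 ^ Suc r * j))"
  proof -
    obtain y where y: "(2::nat) ^ r = Suc y" using not0_implies_Suc[of "2 ^ r"] by auto
    show ?thesis by (simp add: y algebra_simps)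
  qed
  then show ?case using Suc by (simp only: ruler_odd)
qed simp

text \<open>Each k owns an interval of length 2 * \<open>ruler k\<close>, and the position is its
  midpoint. Two positions are therefore at least the sum of their ruler values apart.\<close>

definition position :: "nat \<Rightarrow> nat" where
  "position k = 2 * (\<Sum>i<k. ruler i) + ruler k"

lemma position_gap: "k < m \<Longrightarrow> position k + ruler k + ruler m \<le> position m"
proof -
  assume "k < m"
  then have "(\<Sum>i<Suc k. ruler i) \<le> (\<Sum>i<m. ruler i)" by (intro sum_mono2) auto
  then show ?thesis by (simp add: position_def)
qed

lemma ruler_le_position: "ruler k \<le> position k"
  by (simp add: position_def)

lemma position_less: "k < m \<Longrightarrow> position k < position m"
  using position_gap[of k m] ruler_pos[of k] by linarith

lemma position_density:
  assumes r: "1 \<le> r" and D: "\<And>k. k0 \<le> k \<Longrightarrow> ruler k = r \<Longrightarrow> position k \<in> D"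
  shows "0 < lower_density D"
proof -
  obtain q where q: "r = Suc q" using r by (cases r) auto
  define g where "g j = 2 ^ q - 1 + 2 ^ Suc q * j" for j :: nat
  have g: "ruler (g j) = r" for j unfolding g_def q by (rule ruler_progression)
  have "strict_mono g"
    unfolding strict_mono_Suc_iff g_def by (intro allI add_strict_left_mono mult_strict_left_mono) auto
  show ?thesis
  proof (rule lower_density_pos[of "\<lambda>j. position (g j)" "4 * 2 ^ Suc q"])
    show "strict_mono (\<lambda>j. position (g j))"
      using \<open>strict_mono g\<close> position_less by (auto simp: strict_mono_def)
    show "position (g j) \<le> 4 * 2 ^ Suc q * (j + 1)" for j
    proof -
      have "position (g j) \<le> 2 * (\<Sum>i<Suc (g j). ruler i)" by (simp add: position_def)
      also have "\<dots> \<le> 4 * (g j + 1)" using sum_ruler[of "Suc (g j)"] by simp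
      also have "g j + 1 \<le> 2 ^ Suc q * (j + 1)" by (simp add: g_def)
      finally show ?thesis by simp
    qed
    show "position (g j) \<in> D" if "k0 \<le> j" for j
      using D[OF _ g] seq_suble[OF \<open>strict_mono g\<close>, of j] that by simp
  qed
qed

section \<open>Decay of Fourier coefficients\<close>

text \<open>The double zeros at a and b remove the boundary terms of two integrations by parts. A
  polynomial weight keeps the integrand holomorphic, so that its second derivative can be bounded by
  Cauchy's inequality.\<close>

definition bump :: "real \<Rightarrow> real \<Rightarrow> 'a::real_algebra_1 \<Rightarrow> 'a" where
  "bump a b z = (z - of_real a)\<^sup>2 * (of_real b - z)\<^sup>2"

lemma bump_of_real: "bump a b (of_real t) = (of_real (bump a b t) :: 'a::real_algebra_1)"
  by (simp add: bump_def)

lemma integral_exp_by_parts: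
  fixes G :: "complex \<Rightarrow> complex"
  assumes hol: "G holomorphic_on S" "open S" and ab: "a \<le> b" and sub: "\<And>t. t \<in> {a..b} \<Longrightarrow> of_real t \<in> S"
    and 0: "G (of_real a) = 0" "G (of_real b) = 0" "deriv G (of_real a) = 0" "deriv G (of_real b) = 0"
    and n: "(n::int) \<noteq> 0"
  shows "integral {a..b} (\<lambda>t. exp (\<i> * of_int n * of_real t) * G (of_real t)) =
    - (1 / (of_int n)\<^sup>2) * integral {a..b} (\<lambda>t. exp (\<i> * of_int n * of_real t) * deriv (deriv G) (of_real t))"
proof -
  define N :: complex where "N = of_int n"
  have N: "N \<noteq> 0" using n by (simp add: N_def)
  \<comment> \<open>Two integrations by parts in one primitive: the terms with
    \<open>deriv G\<close> cancel in its derivative because \<i>/N + 1/(\<i> N) = 0.\<close>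
  define f where "f z = exp (\<i> * N * z) * (G z / (\<i> * N) + deriv G z / N\<^sup>2)" for z
  have hd: "deriv G holomorphic_on S" by (rule holomorphic_deriv[OF hol])
  have hdd: "deriv (deriv G) holomorphic_on S" by (rule holomorphic_deriv[OF hd hol(2)])
  have f': "(f has_field_derivative (exp (\<i> * N * z) * G z + exp (\<i> * N * z) * deriv (deriv G) z / N\<^sup>2)) (at z)"
    if z: "z \<in> S" for z
  proof -
    have G: "(G has_field_derivative deriv G z) (at z)"
      by (rule holomorphic_derivI[OF hol z])
    have dG: "(deriv G has_field_derivative deriv (deriv G) z) (at z)"
      by (rule holomorphic_derivI[OF hd hol(2) z])
    show ?thesis unfolding f_def
      by (rule derivative_eq_intros G dG refl | simp add: N)+
        (use N in \<open>simp add: field_simps power2_eq_square power4_eq_xxxx\<close>)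
  qed
  have int: "((\<lambda>t. exp (\<i> * N * of_real t) * G (of_real t) + exp (\<i> * N * of_real t) * deriv (deriv G) (of_real t) / N\<^sup>2)
      has_integral (f (of_real b) - f (of_real a))) {a..b}"
    by (rule fundamental_theorem_of_calculus[OF ab])
      (intro has_vector_derivative_real_field f' sub)
  have cont: "continuous_on {a..b} (\<lambda>t. exp (\<i> * N * of_real t) * h (of_real t))" if "h holomorphic_on S" for h
  proof -
    have "continuous_on (of_real ` {a..b}) h"
      using holomorphic_on_imp_continuous_on[OF that] sub by (auto intro: continuous_on_subset)
    then have "continuous_on {a..b} (\<lambda>t. h (of_real t))"
      by (rule continuous_on_compose2) (auto intro!: continuous_intros)
    then show ?thesis by (intro continuous_intros)
  qed
  have i1: "(\<lambda>t. exp (\<i> * N * of_real t) * G (of_real t)) integrable_on {a..b}"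
    by (rule integrable_continuous_real[OF cont[OF hol(1)]])
  have i2: "(\<lambda>t. exp (\<i> * N * of_real t) * deriv (deriv G) (of_real t)) integrable_on {a..b}"
    by (rule integrable_continuous_real[OF cont[OF hdd]])
  let ?X = "\<lambda>t. exp (\<i> * N * of_real t) * G (of_real t)" and ?Y = "\<lambda>t. exp (\<i> * N * of_real t) * deriv (deriv G) (of_real t)"
  have "integral {a..b} ?X + integral {a..b} (\<lambda>t. ?Y t / N\<^sup>2) = f (of_real b) - f (of_real a)"
    unfolding integral_unique[OF int, symmetric]
    by (rule integral_add[OF i1 integrable_on_divide[OF i2], symmetric])
  moreover have "integral {a..b} (\<lambda>t. ?Y t / N\<^sup>2) = integral {a..b} ?Y / N\<^sup>2"
    by (rule integral_divide)
  moreover have "f (of_real b) - f (of_real a) = 0" unfolding f_def 0 by simp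
  ultimately have "integral {a..b} ?X + integral {a..b} ?Y / N\<^sup>2 = 0" by (simp only:)
  then have "integral {a..b} ?X = - (integral {a..b} ?Y / N\<^sup>2)" by (simp only: add_eq_0_iff2)
  then show ?thesis unfolding N_def[symmetric] by (simp only: mult_minus_left times_divide_eq_left mult_1)
qed

text \<open>The bound is linear in B and its constant does not depend on F, so it applies to all
  powers of one function at once. The factor (3 r)^4 bounds \<open>bump\<close> on the ball of
  radius 2 r; Cauchy's inequality is used on discs of radius r / 2, which stay in that ball.\<close>

lemma fourier_decay:
  assumes r: "0 < r" and ab: "a < b" "{a..b} \<subseteq> {-r<..<r}"
    and hol: "F holomorphic_on ball 0 (2 * r)" and B: "\<And>z. z \<in> ball 0 (2 * r) \<Longrightarrow> cmod (F z) \<le> B"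
  shows "cmod (integral {a..b} (\<lambda>t. exp (\<i> * of_int n * of_real t) * (bump a b (of_real t) * F (of_real t))))
    \<le> (b - a) * (3 * r) ^ 4 * (1 + 16 / r\<^sup>2) * B / (1 + (of_int n)\<^sup>2)"
proof -
  define G where "G z = bump a b z * F z" for z
  have B0: "0 \<le> B" by (rule order.trans[OF norm_ge_zero B[of 0]]) (use r in simp)
  have tr: "\<bar>t\<bar> < r" if "t \<in> {a..b}" for t using subsetD[OF ab(2) that] by auto
  have aS: "of_real t \<in> ball (0::complex) (2 * r)" if "t \<in> {a..b}" for t
    using tr[OF that] r by simp
  have holG: "G holomorphic_on ball 0 (2 * r)"
    unfolding G_def bump_def by (intro holomorphic_intros hol)
  have GB: "cmod (G z) \<le> (3 * r) ^ 4 * B" if z: "z \<in> ball 0 (2 * r)" for z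
  proof -
    have "\<bar>a\<bar> \<le> r" "\<bar>b\<bar> \<le> r" using tr[of a] tr[of b] ab(1) by simp_all
    then have "cmod (z - of_real a) \<le> 3 * r" "cmod (of_real b - z) \<le> 3 * r"
      using z norm_triangle_ineq4[of z "of_real a"] norm_triangle_ineq4[of "of_real b" z] by auto
    then have "cmod (bump a b z) \<le> (3 * r)\<^sup>2 * (3 * r)\<^sup>2"
      unfolding bump_def norm_mult norm_power by (intro mult_mono power_mono) auto
    then show ?thesis
      unfolding G_def norm_mult using B[OF z] B0 by (intro mult_mono) (auto simp flip: power_add)
  qed
  have holdG: "deriv (deriv G) holomorphic_on ball 0 (2 * r)"
    by (intro holomorphic_deriv holG open_ball)
  have GB2: "cmod (deriv (deriv G) (of_real t)) \<le> 8 * ((3 * r) ^ 4 * B) / r\<^sup>2" if t: "t \<in> {a..b}" for t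
  proof -
    have sub: "cball (of_real t) (r / 2) \<subseteq> ball (0::complex) (2 * r)"
    proof
      fix z :: complex assume "z \<in> cball (of_real t) (r / 2)"
      then have "cmod (z - of_real t) \<le> r / 2" by (simp add: dist_norm norm_minus_commute)
      then have "cmod z < 2 * r" using tr[OF t] norm_triangle_sub[of z "of_real t"] by simp
      then show "z \<in> ball 0 (2 * r)" by simp
    qed
    have "cmod ((deriv ^^ 2) G (of_real t)) \<le> fact 2 * ((3 * r) ^ 4 * B) / (r / 2) ^ 2"
    proof (rule Cauchy_inequality)
      show "G holomorphic_on ball (of_real t) (r / 2)"
        by (rule holomorphic_on_subset[OF holG order.trans[OF ball_subset_cball sub]])
      show "continuous_on (cball (of_real t) (r / 2)) G"
        using holomorphic_on_imp_continuous_on[OF holG] sub by (rule continuous_on_subset)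
      show "cmod (G x) \<le> (3 * r) ^ 4 * B" if "cmod (of_real t - x) = r / 2" for x
        by (rule GB[OF subsetD[OF sub]]) (simp add: dist_norm that)
    qed (use r in auto)
    then show ?thesis by (simp add: numeral_2_eq_2 power2_eq_square)
  qed
  have cont: "continuous_on {a..b} (\<lambda>t. exp (\<i> * of_int n * of_real t) * h (of_real t))"
    if "h holomorphic_on ball 0 (2 * r)" for h
  proof -
    have "continuous_on (of_real ` {a..b}) h"
      using holomorphic_on_imp_continuous_on[OF that] aS by (auto intro: continuous_on_subset)
    then have "continuous_on {a..b} (\<lambda>t. h (of_real t))"
      by (rule continuous_on_compose2) (auto intro!: continuous_intros)
    then show ?thesis by (intro continuous_intros)
  qed
  let ?I = "integral {a..b} (\<lambda>t. exp (\<i> * of_int n * of_real t) * G (of_real t))"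
  have b1: "cmod ?I \<le> (3 * r) ^ 4 * B * (b - a)"
    by (rule integral_bound[OF _ cont[OF holG]]) (use ab GB[OF aS] in \<open>simp_all add: norm_mult\<close>)
  have "cmod ?I * (of_int n)\<^sup>2 \<le> 8 * ((3 * r) ^ 4 * B) / r\<^sup>2 * (b - a)"
  proof (cases "n = 0")
    case False
    \<comment> \<open>G is (z - a)^2 L(z) and also (b - z)^2 M(z), which exhibits its double
      zeros.\<close>
    define L where "L z = (of_real b - z)\<^sup>2 * F z" for z
    define M where "M z = (z - of_real a)\<^sup>2 * F z" for z
    have dF: "F field_differentiable at (of_real t)" if "t \<in> {a..b}" for t
      by (rule holomorphic_on_imp_differentiable_at[OF hol open_ball aS[OF that]])
    have "L field_differentiable at (of_real a)" "M field_differentiable at (of_real b)"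
      unfolding L_def M_def using dF[of a] dF[of b] ab by (auto intro!: derivative_intros)
    then obtain L' M' where L': "(L has_field_derivative L') (at (of_real a))"
      and M': "(M has_field_derivative M') (at (of_real b))"
      by (auto simp: field_differentiable_def)
    have "((\<lambda>z. (z - of_real a)\<^sup>2 * L z) has_field_derivative 0) (at (of_real a))"
      by (rule derivative_eq_intros L' refl | simp)+
    moreover have "(\<lambda>z. (z - of_real a)\<^sup>2 * L z) = G" by (auto simp: G_def L_def bump_def)
    ultimately have da: "deriv G (of_real a) = 0" by (metis DERIV_imp_deriv)
    have "((\<lambda>z. (of_real b - z)\<^sup>2 * M z) has_field_derivative 0) (at (of_real b))"
      by (rule derivative_eq_intros M' refl | simp)+
    moreover have "(\<lambda>z. (of_real b - z)\<^sup>2 * M z) = G" by (auto simp: G_def M_def bump_def)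
    ultimately have db: "deriv G (of_real b) = 0" by (metis DERIV_imp_deriv)
    have "?I = - (1 / (of_int n)\<^sup>2) * integral {a..b} (\<lambda>t. exp (\<i> * of_int n * of_real t) * deriv (deriv G) (of_real t))"
      by (rule integral_exp_by_parts[OF holG open_ball _ aS _ _ da db False])
        (use ab in \<open>auto simp: G_def bump_def\<close>)
    then have "cmod ?I * (of_int n)\<^sup>2 = cmod (integral {a..b} (\<lambda>t. exp (\<i> * of_int n * of_real t) * deriv (deriv G) (of_real t)))"
      using False by (simp add: norm_mult norm_divide norm_power)
    also have "\<dots> \<le> 8 * ((3 * r) ^ 4 * B) / r\<^sup>2 * (b - a)"
      by (rule integral_bound[OF _ cont[OF holdG]]) (use ab GB2 in \<open>simp_all add: norm_mult\<close>)
    finally show ?thesis .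
  qed (use ab B0 r in auto)
  \<comment> \<open>Adding the trivial bound and the bound by parts gives the denominator 1 + n^2,
    valid for n = 0 too.\<close>
  then have "cmod ?I * (1 + (of_int n)\<^sup>2) \<le> (3 * r) ^ 4 * B * (b - a) + 8 * ((3 * r) ^ 4 * B) / r\<^sup>2 * (b - a)"
    using b1 by (simp add: distrib_left)
  also have "\<dots> = (b - a) * (3 * r) ^ 4 * (1 + 8 / r\<^sup>2) * B"
    using r by (simp add: field_simps)
  also have "\<dots> \<le> (b - a) * (3 * r) ^ 4 * (1 + 16 / r\<^sup>2) * B"
    using ab B0 r by (intro mult_right_mono mult_left_mono add_left_mono divide_right_mono) auto
  finally show ?thesis
    by (simp add: G_def pos_le_divide_eq add_pos_nonneg)
qed

text \<open>Term by term integration under the M-test; through it the averages of functions in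
  \<open>H\<close> need only scalar integrals.\<close>

lemma sums_integral_powers:
  fixes h \<Psi> :: "real \<Rightarrow> complex"
  assumes h: "continuous_on {a..b} h" and \<Psi>: "continuous_on {a..b} \<Psi>" "\<And>t. t \<in> {a..b} \<Longrightarrow> cmod (\<Psi> t) \<le> R"
    and c: "summable (\<lambda>k. cmod (c k) * R ^ k)"
  shows "(\<lambda>k. integral {a..b} (\<lambda>t. h t * \<Psi> t ^ k) * c k) sums integral {a..b} (\<lambda>t. h t * (\<Sum>k. c k * \<Psi> t ^ k))"
proof -
  have "compact (h ` {a..b})" by (rule compact_continuous_image[OF h]) simp
  then obtain K where K: "\<And>t. t \<in> {a..b} \<Longrightarrow> cmod (h t) \<le> K"
    by (meson compact_imp_bounded bounded_iff imageI)
  have b: "cmod (c k * \<Psi> t ^ k) \<le> cmod (c k) * R ^ k" if "t \<in> {a..b}" for t k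
    using \<Psi>(2)[OF that] by (auto simp: norm_mult norm_power intro!: mult_left_mono power_mono)
  have u: "uniform_limit {a..b} (\<lambda>n t. \<Sum>k<n. c k * \<Psi> t ^ k) (\<lambda>t. \<Sum>k. c k * \<Psi> t ^ k) sequentially"
    by (rule Weierstrass_m_test[OF b c])
  have bs: "bounded ((\<lambda>t. \<Sum>k. c k * \<Psi> t ^ k) ` {a..b})"
    unfolding bounded_iff
  proof (intro exI ballI)
    fix y assume "y \<in> (\<lambda>t. \<Sum>k. c k * \<Psi> t ^ k) ` {a..b}"
    then obtain t where t: "t \<in> {a..b}" "y = (\<Sum>k. c k * \<Psi> t ^ k)" by blast
    show "norm y \<le> (\<Sum>k. cmod (c k) * R ^ k)" unfolding t(2) by (rule norm_suminf_le[OF b[OF t(1)] c])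
  qed
  have "uniform_limit {a..b} (\<lambda>n t. h t * (\<Sum>k<n. c k * \<Psi> t ^ k)) (\<lambda>t. h t * (\<Sum>k. c k * \<Psi> t ^ k)) sequentially"
    by (rule uniform_lim_mult[OF uniform_limit_const u _ bs]) (use K in \<open>auto simp: bounded_iff intro!: exI[of _ K]\<close>)
  then obtain I J where IJ: "\<And>n. ((\<lambda>t. h t * (\<Sum>k<n. c k * \<Psi> t ^ k)) has_integral I n) {a..b}"
    "((\<lambda>t. h t * (\<Sum>k. c k * \<Psi> t ^ k)) has_integral J) {a..b}" "I \<longlonglongrightarrow> J"
    by (rule uniform_limit_integral) (auto intro!: continuous_intros h \<Psi>)
  have "I n = (\<Sum>k<n. integral {a..b} (\<lambda>t. h t * \<Psi> t ^ k) * c k)" for n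
  proof -
    have "I n = integral {a..b} (\<lambda>t. \<Sum>k<n. (h t * \<Psi> t ^ k) * c k)"
      using integral_unique[OF IJ(1)[of n]] by (simp add: sum_distrib_left mult_ac)
    also have "\<dots> = (\<Sum>k<n. integral {a..b} (\<lambda>t. (h t * \<Psi> t ^ k) * c k))"
      by (rule integral_sum) (auto intro!: integrable_continuous_real continuous_intros h \<Psi>)
    finally show ?thesis by simp
  qed
  then have "I = (\<lambda>n. \<Sum>k<n. integral {a..b} (\<lambda>t. h t * \<Psi> t ^ k) * c k)" by (rule ext)
  then show ?thesis using IJ(3) integral_unique[OF IJ(2)] by (simp only: sums_def)
qed

lemma bump_average:
  fixes f :: "real \<Rightarrow> complex"
  assumes ab: "a < b" and f: "continuous_on {a..b} f" and d: "\<And>t. t \<in> {a..b} \<Longrightarrow> cmod (f t - y) \<le> d"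
  shows "0 < integral {a..b} (bump a b)"
    "cmod (integral {a..b} (\<lambda>t. bump a b (of_real t) * f t) / of_real (integral {a..b} (bump a b)) - y) \<le> d"
proof -
  have c: "continuous_on {a..b} (bump a b :: real \<Rightarrow> real)" unfolding bump_def by (intro continuous_intros)
  have c': "continuous_on {a..b} (\<lambda>t. bump a b (of_real t) :: complex)"
    unfolding bump_def by (intro continuous_intros)
  have nn: "0 \<le> bump a b t" for t :: real by (simp add: bump_def)
  show pos: "0 < integral {a..b} (bump a b)"
  proof (rule ccontr)
    assume "\<not> ?thesis"
    then have "integral {a..b} (bump a b) = 0"
      using integral_nonneg[OF integrable_continuous_real[OF c]] nn by force
    then have "(bump a b has_integral 0) (cbox a b)"
      using integrable_integral[OF integrable_continuous_real[OF c]] by simp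
    moreover have "(a + b) / 2 \<in> cbox a b" using ab by simp
    ultimately have "bump a b ((a + b) / 2) = 0"
      using has_integral_0_cbox_imp_0[of a b "bump a b"] c nn ab by force
    then show False using ab by (simp add: bump_def field_simps)
  qed
  define I where "I = integral {a..b} (bump a b)"
  have ci: "integral {a..b} (\<lambda>t. bump a b (of_real t)) = complex_of_real I"
    unfolding I_def bump_of_real
    using has_integral_of_real[OF integrable_integral[OF integrable_continuous_real[OF c]]]
    by (rule integral_unique)
  have "integral {a..b} (\<lambda>t. bump a b (of_real t) * f t) - y * of_real I =
      integral {a..b} (\<lambda>t. bump a b (of_real t) * (f t - y))"
  proof -
    have i1: "(\<lambda>t. bump a b (of_real t) * f t) integrable_on {a..b}"
      and i2: "(\<lambda>t. bump a b (of_real t) * y) integrable_on {a..b}"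
      by (intro integrable_continuous_real continuous_intros c' f)+
    show ?thesis
      unfolding right_diff_distrib integral_diff[OF i1 i2] integral_mult_left ci by (simp add: mult.commute)
  qed
  also have "cmod \<dots> \<le> integral {a..b} (\<lambda>t. bump a b t * d)"
  proof (rule Henstock_Kurzweil_Integration.integral_norm_bound_integral)
    show "(\<lambda>t. bump a b (of_real t) * (f t - y)) integrable_on {a..b}"
      by (intro integrable_continuous_real continuous_intros c' f)
    show "(\<lambda>t. bump a b t * d) integrable_on {a..b}"
      by (intro integrable_continuous_real continuous_intros c)
    show "cmod (bump a b (of_real t) * (f t - y)) \<le> bump a b t * d" if "t \<in> {a..b}" for t
      unfolding bump_of_real norm_mult norm_of_real using d[OF that] nn[of t]
      by (simp add: mult_left_mono)
  qed
  also have "\<dots> = I * d" by (simp add: I_def)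
  finally have "cmod (integral {a..b} (\<lambda>t. bump a b (of_real t) * f t) - y * of_real I) \<le> I * d" .
  moreover have "integral {a..b} (\<lambda>t. bump a b (of_real t) * f t) / of_real I - y =
      (integral {a..b} (\<lambda>t. bump a b (of_real t) * f t) - y * of_real I) / of_real I"
    using pos by (simp add: I_def field_simps)
  ultimately show "cmod (integral {a..b} (\<lambda>t. bump a b (of_real t) * f t) / of_real (integral {a..b} (bump a b)) - y) \<le> d"
    using pos by (simp add: norm_divide field_simps flip: I_def)
qed

section \<open>Values of entire functions\<close>

text \<open>Liouville's theorem, applied to q and to 1/q.\<close>

lemma entire_small_value:
  assumes q: "q holomorphic_on UNIV" "\<not> q constant_on UNIV"
  shows "\<exists>w. cmod (q w) < 1" "\<exists>w. 1 < cmod (q w)"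
proof -
  show "\<exists>w. 1 < cmod (q w)"
  proof (rule ccontr)
    assume "\<not> ?thesis"
    then have "bounded (range q)" unfolding bounded_iff by (intro exI[of _ 1]) (auto simp: not_less)
    then show False using Liouville_theorem q by blast
  qed
  show "\<exists>w. cmod (q w) < 1"
  proof (rule ccontr)
    assume "\<not> ?thesis"
    then have ge: "1 \<le> cmod (q w)" for w by (meson not_less)
    then have nz: "q w \<noteq> 0" for w by (metis norm_zero not_one_le_zero)
    have "bounded (range (\<lambda>w. inverse (q w)))"
      unfolding bounded_iff using ge by (intro exI[of _ 1]) (auto simp: norm_inverse inverse_le_1_iff)
    moreover have "(\<lambda>w. inverse (q w)) holomorphic_on UNIV" using q nz by (intro holomorphic_intros) auto
    ultimately have "(\<lambda>w. inverse (q w)) constant_on UNIV" by (intro Liouville_theorem)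
    then show False using q(2) unfolding constant_on_def by (metis inverse_inverse_eq)
  qed
qed

text \<open>The modulus of q takes values below and above 1 and the image is open, so the image
  contains an arc of the unit circle. The arc is uncountable, whereas the zeros of the derivative,
  and with them the critical values, are countable.\<close>

lemma entire_regular_unimodular_value:
  assumes q: "q holomorphic_on UNIV" "\<not> q constant_on UNIV"
  shows "\<exists>w. cmod (q w) = 1 \<and> deriv q w \<noteq> 0"
proof -
  have dq: "deriv q holomorphic_on UNIV" by (rule holomorphic_deriv[OF q(1) open_UNIV])
  have "countable {w. deriv q w = 0}"
  proof (cases "deriv q constant_on UNIV")
    case True
    then obtain c where c: "\<And>w. deriv q w = c" by (auto simp: constant_on_def)
    have "c \<noteq> 0"
    proof
      assume "c = 0"
      then have "(q has_field_derivative 0) (at w)" for w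
        using holomorphic_derivI[OF q(1) open_UNIV, of w] c by simp
      then have "q constant_on UNIV"
        using has_field_derivative_zero_constant[of UNIV q] by (auto simp: constant_on_def)
      then show False using q(2) by blast
    qed
    then show ?thesis using c by simp
  next
    case False
    show ?thesis
      using holomorphic_countable_zeros[OF dq open_UNIV connected_UNIV _ False] by (simp add: fsigma_UNIV)
  qed
  then have cnt: "countable (q ` {w. deriv q w = 0})" by simp
  have op: "open (range q)" by (rule open_mapping_thm[OF q(1) open_UNIV connected_UNIV open_UNIV]) (use q in auto)
  have "connected ((\<lambda>w. cmod (q w)) ` UNIV)"
    using holomorphic_on_imp_continuous_on[OF q(1)]
    by (intro connected_continuous_image continuous_intros connected_UNIV)
  moreover obtain w1 w2 where "cmod (q w1) < 1" "1 < cmod (q w2)" using entire_small_value[OF q] by blast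
  ultimately have "1 \<in> (\<lambda>w. cmod (q w)) ` UNIV"
    unfolding connected_iff_interval by (meson UNIV_I imageI less_imp_le)
  then obtain w0 where w0: "cmod (q w0) = 1" by force
  obtain e where e: "0 < e" "ball (q w0) e \<subseteq> range q" using op by (meson openE rangeI)
  have "((\<lambda>t. q w0 * cis t) \<longlongrightarrow> q w0 * cis 0) (at_right 0)"
    by (intro tendsto_intros)
  then have "\<forall>\<^sub>F t in at_right 0. q w0 * cis t \<in> ball (q w0) e"
    using e by (intro topological_tendstoD) auto
  then obtain d where d: "0 < d" "\<And>t. 0 < t \<Longrightarrow> t < d \<Longrightarrow> q w0 * cis t \<in> ball (q w0) e"
    by (auto simp: eventually_at_right_field)
  define D where "D = {0<..<min d pi}"
  have inj: "inj_on (\<lambda>t. q w0 * cis t) D"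
  proof (rule inj_onI)
    fix s t assume st: "s \<in> D" "t \<in> D" "q w0 * cis s = q w0 * cis t"
    moreover have "q w0 \<noteq> 0" using w0 by auto
    ultimately have "cis s = cis t" by simp
    then have "cos s = cos t" by (metis cis.sel(1))
    then show "s = t" using cos_inj_pi[of s t] st by (auto simp: D_def)
  qed
  have "uncountable D" unfolding D_def uncountable_open_interval using d(1) pi_gt_zero by simp
  have "\<not> (\<lambda>t. q w0 * cis t) ` D \<subseteq> q ` {w. deriv q w = 0}"
  proof
    assume "(\<lambda>t. q w0 * cis t) ` D \<subseteq> q ` {w. deriv q w = 0}"
    then have "countable ((\<lambda>t. q w0 * cis t) ` D)" by (rule countable_subset[OF _ cnt])
    then have "countable D" by (rule countable_image_inj_on[OF _ inj])
    then show False using \<open>uncountable D\<close> by simp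
  qed
  then obtain t where t: "t \<in> D" "q w0 * cis t \<notin> q ` {w. deriv q w = 0}" by (auto simp: subset_iff)
  have "q w0 * cis t \<in> range q"
    by (rule subsetD[OF e(2) d(2)[of t]]) (use t(1) in \<open>simp_all add: D_def\<close>)
  then obtain w where w: "q w = q w0 * cis t" by auto
  then have "deriv q w \<noteq> 0" using t(2) by (metis (mono_tags) image_eqI mem_Collect_eq)
  moreover have "cmod (q w) = 1" unfolding w norm_mult using w0 by simp
  ultimately show ?thesis by blast
qed

text \<open>If only finitely many members took the value l, a tail of the sequence minus l would
  have no zeros, and by Hurwitz neither would g - l.\<close>

lemma hurwitz_infinitely_many:
  assumes F: "\<And>n::nat. \<F> n holomorphic_on UNIV" and g: "g holomorphic_on UNIV" "\<not> g constant_on UNIV"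
    and lim: "\<And>K. compact K \<Longrightarrow> uniform_limit K \<F> g sequentially" and z: "g z0 = l"
  shows "infinite {n. \<exists>z. \<F> n z = l}"
proof
  assume "finite {n. \<exists>z. \<F> n z = l}"
  then obtain N where N: "\<And>n. N \<le> n \<Longrightarrow> n \<notin> {n. \<exists>z. \<F> n z = l}"
    by (metis finite_nat_bounded lessThan_iff not_less subsetD)
  have "g z0 - l \<noteq> 0"
  proof (rule Hurwitz_no_zeros[of UNIV "\<lambda>n z. \<F> (n + N) z - l" "\<lambda>z. g z - l"])
    show "uniform_limit K (\<lambda>n z. \<F> (n + N) z - l) (\<lambda>z. g z - l) sequentially" if "compact K" for K
    proof (intro uniform_limit_intros)
      show "uniform_limit K (\<lambda>n. \<F> (n + N)) g sequentially"
        using filterlim_compose[OF lim[OF that] filterlim_add_const_nat_at_top[of N]] .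
    qed
    show "\<not> (\<lambda>z. g z - l) constant_on UNIV"
      using g(2) unfolding constant_on_def by (metis diff_add_cancel)
    show "\<F> (n + N) z - l \<noteq> 0" for n z using N[of "n + N"] by auto
  qed (use F g in \<open>auto intro!: holomorphic_intros\<close>)
  then show False using z by simp
qed

section \<open>Closures and countable dense sets\<close>

lemma gaussian_rational_approx:
  assumes "0 < e"
  shows "\<exists>a b. cmod (Complex (of_rat a) (of_rat b) - c) < e"
proof -
  obtain a where a: "Re c < of_rat a" "of_rat a < Re c + e / 2"
    using of_rat_dense[of "Re c" "Re c + e / 2"] assms by auto
  obtain b where b: "Im c < of_rat b" "of_rat b < Im c + e / 2"
    using of_rat_dense[of "Im c" "Im c + e / 2"] assms by auto
  have "cmod (Complex (of_rat a) (of_rat b) - c) \<le> \<bar>of_rat a - Re c\<bar> + \<bar>of_rat b - Im c\<bar>"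
    using cmod_le[of "Complex (of_rat a) (of_rat b) - c"] by simp
  then show ?thesis using a b by (intro exI[of _ a] exI[of _ b]) simp
qed

context holomorphy
begin

definition cl :: "('u \<Rightarrow> complex) set \<Rightarrow> ('u \<Rightarrow> complex) set" where
  "cl X = {f \<in> H. \<forall>s>0. \<forall>e>0. \<exists>g\<in>X. p s (g - f) < e}"

lemma clI: "f \<in> H \<Longrightarrow> (\<And>s e. 0 < s \<Longrightarrow> 0 < e \<Longrightarrow> \<exists>g\<in>X. p s (g - f) < e) \<Longrightarrow> f \<in> cl X"
  by (simp add: cl_def)

lemma clD: "f \<in> cl X \<Longrightarrow> 0 < s \<Longrightarrow> 0 < e \<Longrightarrow> \<exists>g\<in>X. p s (g - f) < e"
  by (simp add: cl_def)

lemma cl_H: "f \<in> cl X \<Longrightarrow> f \<in> H"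
  by (simp add: cl_def)

lemma subset_cl:
  assumes "X \<subseteq> H" shows "X \<subseteq> cl X"
proof
  fix f assume "f \<in> X"
  then show "f \<in> cl X" using assms by (intro clI bexI[of _ f]) auto
qed

text \<open>Stability under Gaussian rational scalars suffices, which allows a countable X as in
  \<open>countable_dense\<close>.\<close>

lemma closed_subspace_cl:
  assumes X: "X \<subseteq> H" "0 \<in> X" and add: "\<And>f g. f \<in> X \<Longrightarrow> g \<in> X \<Longrightarrow> f + g \<in> X"
    and scale: "\<And>f a b. f \<in> X \<Longrightarrow> fscale (Complex (of_rat a) (of_rat b)) f \<in> X"
  shows "closed_subspace (cl X)"
  unfolding closed_subspace_def cfun.subspace_def
proof (intro conjI ballI allI impI)
  show "cl X \<subseteq> H" by (auto simp: cl_def)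
  show "0 \<in> cl X" using X subset_cl by blast
  fix f g assume f: "f \<in> cl X" and g: "g \<in> cl X"
  show "f + g \<in> cl X"
  proof (rule clI[OF H_add[OF cl_H[OF f] cl_H[OF g]]])
    fix s e :: real assume s: "0 < s" and e: "0 < e"
    obtain f' where f': "f' \<in> X" "p s (f' - f) < e / 2" using clD[OF f s, of "e / 2"] e by auto
    obtain g' where g': "g' \<in> X" "p s (g' - g) < e / 2" using clD[OF g s, of "e / 2"] e by auto
    have h: "f' \<in> H" "g' \<in> H" using f' g' X by auto
    have "p s ((f' - f) + (g' - g)) \<le> p s (f' - f) + p s (g' - g)"
      using s by (intro p_triangle H_diff h cl_H[OF f] cl_H[OF g]) auto
    moreover have "(f' - f) + (g' - g) = (f' + g') - (f + g)" by simp
    ultimately have "p s ((f' + g') - (f + g)) < e" using f'(2) g'(2) by simp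
    then show "\<exists>h\<in>X. p s (h - (f + g)) < e" using add[OF f'(1) g'(1)] by blast
  qed
next
  fix c f assume f: "f \<in> cl X"
  note fH = cl_H[OF f]
  show "fscale c f \<in> cl X"
  proof (rule clI[OF H_fscale[OF fH]])
    fix s e :: real assume s: "0 < s" and e: "0 < e"
    have pf: "0 \<le> p s f" using p_nonneg[OF fH] s by simp
    obtain a b where ab: "cmod (Complex (of_rat a) (of_rat b) - c) < e / (2 * (p s f + 1))"
      using gaussian_rational_approx[of "e / (2 * (p s f + 1))" c] e pf by auto
    define d where "d = Complex (of_rat a) (of_rat b)"
    obtain g where g: "g \<in> X" "p s (g - f) < e / (2 * (cmod d + 1))"
      using clD[OF f s, of "e / (2 * (cmod d + 1))"] e by (auto simp: add_nonneg_pos)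
    have gH: "g \<in> H" using g X by auto
    have gf: "g - f \<in> H" by (intro H_diff gH fH)
    have 1: "p s (fscale d g - fscale c f) \<le> p s (fscale d g - fscale d f) + p s (fscale d f - fscale c f)"
      using s by (intro p_triangle_diff H_fscale gH fH) auto
    have eq: "fscale d g - fscale d f = fscale d (g - f)" "fscale d f - fscale c f = fscale (d - c) f"
      by (simp_all add: fun_eq_iff algebra_simps)
    have 2: "p s (fscale d g - fscale d f) = cmod d * p s (g - f)"
      unfolding eq using s by (intro p_fscale gf) auto
    have 3: "p s (fscale d f - fscale c f) = cmod (d - c) * p s f"
      unfolding eq using s by (intro p_fscale fH) auto
    have 4: "cmod d * p s (g - f) \<le> (cmod d + 1) * p s (g - f)"
      using p_nonneg[OF gf] s by (intro mult_right_mono) auto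
    have 5: "(cmod d + 1) * p s (g - f) < e / 2"
    proof -
      have "0 < 2 * (cmod d + 1)" by (simp add: add_nonneg_pos)
      then show ?thesis using g(2) by (simp add: pos_less_divide_eq algebra_simps)
    qed
    have 6: "cmod (d - c) * p s f \<le> cmod (d - c) * (p s f + 1)" by (intro mult_left_mono) auto
    have 7: "cmod (d - c) * (p s f + 1) < e / 2"
    proof -
      have "0 < 2 * (p s f + 1)" using pf by simp
      then show ?thesis using ab by (simp add: pos_less_divide_eq algebra_simps flip: d_def)
    qed
    have "p s (fscale d g - fscale c f) < e" using 1 2 3 4 5 6 7 by linarith
    then show "\<exists>h\<in>X. p s (h - fscale c f) < e" using scale[OF g(1)] unfolding d_def by blast
  qed
next
  fix f assume f: "f \<in> H" and ap: "\<forall>s>0. \<forall>e>0. \<exists>g\<in>cl X. p s (g - f) < e"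
  show "f \<in> cl X"
  proof (rule clI[OF f])
    fix s e :: real assume s: "0 < s" and e: "0 < e"
    obtain g where g: "g \<in> cl X" "p s (g - f) < e / 2" using ap s e half_gt_zero by blast
    obtain h where h: "h \<in> X" "p s (h - g) < e / 2" using clD[OF g(1) s, of "e / 2"] e by auto
    have "p s (h - f) \<le> p s (h - g) + p s (g - f)"
      using s h X by (intro p_triangle_diff f cl_H[OF g(1)]) auto
    then show "\<exists>g\<in>X. p s (g - f) < e" using h g(2) by (intro bexI[of _ h]) auto
  qed
qed

lemma p_diff_le:
  assumes "f \<in> H" "g \<in> H" "0 \<le> s" shows "p s (f - g) \<le> p s f + p s g"
  using p_triangle_diff[OF assms(1) H_zero assms(2,3)] p_diff_commute[OF H_zero assms(2,3)]
  by (simp only: diff_0_right)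

text \<open>Finite combinations, with Gaussian rational coefficients, of exponentials of countably
  many functionals that are dense in the dual. Their closure contains every
  \<open>Ex \<gamma>\<close> by \<open>Ex_diff\<close>, and the exponentials are total.\<close>

lemma countable_dense:
  assumes sep: "separable_space (ntop (dual E))"
    and dense: "\<And>k. ntop (ideal_space (\<AA> k) E) closure_of finite_type E k = A k"
  shows "\<exists>d::nat \<Rightarrow> _. (\<forall>n. d n \<in> H) \<and> (\<forall>f\<in>H. \<forall>s>0. \<forall>e>0. \<exists>n. p s (d n - f) < e)"
proof -
  interpret D: function_normed_space "carrier (dual E)" dnorm by (rule dual_function_normed_space)
  obtain C where C: "countable C" "C \<subseteq> carrier (dual E)"
    "ntop (fun_space (carrier (dual E)) dnorm) closure_of C = carrier (dual E)"
    using sep unfolding dual_eq_fun_space[symmetric] separable_space_def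
    using D.topspace_eq unfolding dual_eq_fun_space[symmetric] by blast
  have approx: "\<exists>\<delta>\<in>C. dnorm (\<delta> - \<gamma>) < e" if "\<gamma> \<in> carrier (dual E)" "0 < e" for \<gamma> e
    using D.closure_iff[OF C(2), of \<gamma>] C(3) that by simp
  have "C \<noteq> {}" using approx[OF dual_zero zero_less_one] by blast
  define \<delta> where "\<delta> = from_nat_into C"
  have \<delta>: "\<delta> i \<in> carrier (dual E)" for i
    unfolding \<delta>_def using from_nat_into[OF \<open>C \<noteq> {}\<close>] C(2) by blast
  define gterm where "gterm = (\<lambda>(i, a, b). fscale (Complex (of_rat a) (of_rat b)) (Ex (\<delta> i)))"
  define comb where "comb cs = sum_list (map gterm cs)" for cs :: "(nat \<times> rat \<times> rat) list"
  have gtermH: "gterm z \<in> H" for z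
    unfolding gterm_def by (cases z) (simp only: prod.case H_fscale Ex_H \<delta>)
  have comb_simps: "comb [] = 0" "comb (z # cs) = gterm z + comb cs" for z cs
    unfolding comb_def by (simp_all only: list.map sum_list.Nil sum_list.Cons)
  have combH: "comb cs \<in> H" for cs
    by (induction cs) (simp_all only: comb_simps H_zero H_add gtermH)
  have V: "closed_subspace (cl (range comb))"
  proof (rule closed_subspace_cl)
    show "range comb \<subseteq> H" using combH by blast
    have "comb [] = 0" by (simp add: comb_def)
    then show "0 \<in> range comb" by (metis rangeI)
    show "f + g \<in> range comb" if fg: "f \<in> range comb" "g \<in> range comb" for f g
    proof -
      obtain xs ys where "f = comb xs" "g = comb ys" using fg by blast
      then have "f + g = comb (xs @ ys)" by (simp add: comb_def)
      then show ?thesis by blast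
    qed
    show "fscale (Complex (of_rat a) (of_rat b)) f \<in> range comb" if f: "f \<in> range comb" for f a b
    proof -
      obtain cs where cs: "f = comb cs" using f by blast
      \<comment> \<open>Multiplication by a + \<i> b on the real and imaginary parts of a
        coefficient.\<close>
      let ?m = "\<lambda>(i::nat, c, d). (i, a * c - b * d, a * d + b * c)"
      have "fscale (Complex (of_rat a) (of_rat b)) (comb cs) = comb (map ?m cs)" for cs
      proof (induction cs)
        case (Cons z cs)
        obtain i c d where z: "z = (i, c, d)" by (cases z) auto
        have "fscale (Complex (of_rat a) (of_rat b)) (gterm z) = gterm (?m z)"
          by (auto simp: z gterm_def fun_eq_iff complex_eq_iff of_rat_mult of_rat_diff of_rat_add algebra_simps)
        moreover have "fscale r (f + g) = fscale r f + fscale r g" for r and f g :: "'u \<Rightarrow> complex"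
          by (simp add: fun_eq_iff algebra_simps)
        ultimately show ?case using Cons by (simp only: comb_simps list.map)
      qed (simp add: comb_def)
      then show ?thesis using cs by blast
    qed
  qed
  have "Ex \<gamma> \<in> cl (range comb)" if \<gamma>: "\<gamma> \<in> carrier (dual E)" for \<gamma>
  proof (rule closed_subspaceD(3)[OF V Ex_H[OF \<gamma>]])
    fix s e :: real assume s: "0 < s" and e: "0 < e"
    define B where "B = exp (s * (dnorm \<gamma> + 1))"
    have B: "0 < B" by (simp add: B_def)
    \<comment> \<open>The bound 1/2 is required by \<open>Ex_diff\<close>; the other one makes its
      estimate 2 d B at most e / 2.\<close>
    define d where "d = min (1 / 2) (e / (4 * B))"
    have "0 < d" using e B by (simp add: d_def)
    then obtain \<eta> where \<eta>: "\<eta> \<in> C" "dnorm (\<eta> - \<gamma>) < d" using approx[OF \<gamma>] by blast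
    then have \<eta>E: "\<eta> \<in> carrier (dual E)" using C by blast
    have "p s (Ex \<eta> - Ex \<gamma>) \<le> 2 * dnorm (\<eta> - \<gamma>) * B"
      unfolding B_def using \<eta>(2) by (intro Ex_diff \<gamma> \<eta>E s) (simp add: d_def)
    also have "\<dots> \<le> 2 * (e / (4 * B)) * B"
      using \<eta>(2) B by (intro mult_right_mono mult_left_mono) (auto simp: d_def)
    also have "\<dots> < e" using e B by simp
    finally have small: "p s (Ex \<eta> - Ex \<gamma>) < e" .
    obtain i where "\<eta> = \<delta> i" using from_nat_into_surj[OF C(1) \<eta>(1)] unfolding \<delta>_def by metis
    moreover have "comb [(i, 1, 0)] = Ex (\<delta> i)"
      by (simp add: comb_def gterm_def fun_eq_iff complex_eq_iff)
    ultimately have "comb [(i, 1, 0)] = Ex \<eta>" by simp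
    then have "Ex \<eta> \<in> cl (range comb)" using subset_cl[of "range comb"] combH by (metis image_subsetI rangeI subsetD)
    then show "\<exists>g\<in>cl (range comb). p s (g - Ex \<gamma>) < e" using small by blast
  qed
  then have all: "cl (range comb) = H" by (rule closed_subspace_all[OF V _ dense])
  show ?thesis
  proof (intro exI[of _ "\<lambda>n. comb (from_nat n)"] conjI allI ballI impI combH)
    fix f s e assume "f \<in> H" and se: "0 < (s::real)" "0 < (e::real)"
    then have "f \<in> cl (range comb)" using all by simp
    from clD[OF this se] obtain cs where "p s (comb cs - f) < e" by blast
    then show "\<exists>n. p s (comb (from_nat n) - f) < e" by (metis from_nat_to_nat)
  qed
qed

end

section \<open>Bilateral orbits\<close>

text \<open>\<Psi> is a local inverse of q composed with the map z to q(0) exp(\<i> z), so for real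
  t the values q(\<Psi>(t)) run through an arc of the unit circle. With r \<le> 1 the arc does not
  return to q(0).\<close>

lemma local_parametrization:
  assumes q: "q holomorphic_on UNIV" and q0: "cmod (q 0) = 1" "deriv q 0 \<noteq> 0"
  obtains r R \<Psi> where "0 < r" "r \<le> 1" "0 < R" "\<Psi> holomorphic_on ball 0 (2 * r)" "\<Psi> 0 = 0"
    "\<And>z. z \<in> ball 0 (2 * r) \<Longrightarrow> cmod (\<Psi> z) \<le> R" "\<And>z. z \<in> ball 0 (2 * r) \<Longrightarrow> q (\<Psi> z) = q 0 * exp (\<i> * z)"
proof -
  obtain R where R: "R > 0" "open (q ` ball 0 R)" "inj_on q (ball 0 R)"
    using has_complex_derivative_locally_invertible[OF q UNIV_I open_UNIV q0(2)] by metis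
  have hq: "q holomorphic_on ball 0 R" by (rule holomorphic_on_subset[OF q]) simp
  obtain g where g: "g holomorphic_on (q ` ball 0 R)" "\<And>z. z \<in> ball 0 R \<Longrightarrow> g (q z) = z"
    using holomorphic_has_inverse[OF hq open_ball R(3)] by metis
  define E where "E z = q 0 * exp (\<i> * z)" for z
  have "continuous_on UNIV E" unfolding E_def by (intro continuous_intros)
  then have "open (E -` (q ` ball 0 R))" using R(2) by (rule open_vimage[rotated])
  moreover have "0 \<in> E -` (q ` ball 0 R)" using R(1) by (auto simp: E_def)
  ultimately obtain e where e: "e > 0" "ball 0 e \<subseteq> E -` (q ` ball 0 R)" by (meson openE)
  define r where "r = min 1 (e / 2)"
  have sub: "E ` ball 0 (2 * r) \<subseteq> q ` ball 0 R"
  proof -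
    have "ball (0::complex) (2 * r) \<subseteq> ball 0 e" by (rule subset_ball) (simp add: r_def)
    then show ?thesis using e(2) by blast
  qed
  have gE: "g y \<in> ball 0 R \<and> q (g y) = y" if "y \<in> q ` ball 0 R" for y using that g(2) by auto
  show ?thesis
  proof (rule that[of r R "\<lambda>z. g (E z)"])
    have "E holomorphic_on ball 0 (2 * r)" unfolding E_def by (intro holomorphic_intros)
    from holomorphic_on_compose_gen[OF this g(1) sub]
    show "(\<lambda>z. g (E z)) holomorphic_on ball 0 (2 * r)" by (simp add: o_def)
    show "g (E 0) = 0" using g(2)[of 0] R(1) by (simp add: E_def)
    fix z :: complex assume "z \<in> ball 0 (2 * r)"
    then have "E z \<in> q ` ball 0 R" using sub by blast
    from gE[OF this] show "cmod (g (E z)) \<le> R" "q (g (E z)) = q 0 * exp (\<i> * z)" by (auto simp: E_def)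
  qed (use e R in \<open>auto simp: r_def\<close>)
qed

text \<open>The mean value bound k R^(k-1) |x - y|, multiplied by R to avoid the exponent k -
  1.\<close>

lemma norm_power_diff_le:
  fixes x y :: complex
  assumes "cmod x \<le> R" "cmod y \<le> R"
  shows "cmod (x ^ k - y ^ k) * R \<le> real k * R ^ k * cmod (x - y)"
proof (induction k)
  case (Suc k)
  have R: "0 \<le> R" using assms(1) norm_ge_zero order.trans by blast
  have "x ^ Suc k - y ^ Suc k = x * (x ^ k - y ^ k) + (x - y) * y ^ k" by (simp add: algebra_simps)
  then have "cmod (x ^ Suc k - y ^ Suc k) \<le> cmod x * cmod (x ^ k - y ^ k) + cmod (x - y) * cmod y ^ k"
    by (metis norm_mult norm_power norm_triangle_ineq)
  also have "\<dots> \<le> R * cmod (x ^ k - y ^ k) + cmod (x - y) * R ^ k"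
    using assms R by (intro add_mono mult_right_mono mult_left_mono power_mono) auto
  finally have "cmod (x ^ Suc k - y ^ Suc k) * R \<le> (R * cmod (x ^ k - y ^ k) + cmod (x - y) * R ^ k) * R"
    using R by (rule mult_right_mono)
  also have "\<dots> = R * (cmod (x ^ k - y ^ k) * R) + R ^ Suc k * cmod (x - y)" by (simp add: algebra_simps)
  also have "\<dots> \<le> R * (real k * R ^ k * cmod (x - y)) + R ^ Suc k * cmod (x - y)"
    using R Suc by (intro add_mono mult_left_mono) auto
  finally show ?case by (simp add: algebra_simps)
qed simp

context conv_operator
begin

text \<open>\<open>x (-n)\<close> is an n-fold preimage of \<open>x 0\<close>; carrying the
  preimages along replaces a right inverse of T. Quadratic decay makes the orbit summable in both
  directions.\<close>

definition bilateral :: "(int \<Rightarrow> 'a \<Rightarrow> complex) \<Rightarrow> bool" where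
  "bilateral x \<longleftrightarrow> (\<forall>n. x n \<in> H \<and> T (x n) = x (n + 1)) \<and>
     (\<forall>s>0. \<exists>C. \<forall>n. p s (x n) \<le> C / (1 + (of_int n)\<^sup>2))"

lemma bilateralD:
  assumes "bilateral x"
  shows "x n \<in> H" "T (x n) = x (n + 1)" "0 < s \<Longrightarrow> \<exists>C. \<forall>n. p s (x n) \<le> C / (1 + (of_int n)\<^sup>2)"
  using assms by (auto simp: bilateral_def)

lemma bilateral_zero: "bilateral (\<lambda>n. 0)"
  unfolding bilateral_def by (auto simp: H_zero T_zero intro!: exI[of _ 0])

lemma bilateral_add:
  assumes x: "bilateral x" and y: "bilateral y"
  shows "bilateral (\<lambda>n. x n + y n)"
  unfolding bilateral_def
proof (intro conjI allI impI)
  fix n show "x n + y n \<in> H" by (intro H_add bilateralD(1)[OF x] bilateralD(1)[OF y])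
  show "T (x n + y n) = x (n + 1) + y (n + 1)"
    using T_add[OF bilateralD(1)[OF x] bilateralD(1)[OF y], of n n] by (simp only: bilateralD(2)[OF x] bilateralD(2)[OF y])
next
  fix s :: real assume s: "0 < s"
  obtain C D where C: "\<And>n. p s (x n) \<le> C / (1 + (of_int n)\<^sup>2)" and D: "\<And>n. p s (y n) \<le> D / (1 + (of_int n)\<^sup>2)"
    using bilateralD(3)[OF x s] bilateralD(3)[OF y s] by auto
  have "p s (x n + y n) \<le> (C + D) / (1 + (of_int n)\<^sup>2)" for n
    using p_triangle[OF bilateralD(1)[OF x] bilateralD(1)[OF y], of s n n] s C[of n] D[of n]
    by (simp add: add_divide_distrib)
  then show "\<exists>C. \<forall>n. p s (x n + y n) \<le> C / (1 + (of_int n)\<^sup>2)" by blast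
qed

lemma bilateral_fscale:
  assumes x: "bilateral x"
  shows "bilateral (\<lambda>n. fscale c (x n))"
  unfolding bilateral_def
proof (intro conjI allI impI)
  fix n show "fscale c (x n) \<in> H" by (intro H_fscale bilateralD(1)[OF x])
  show "T (fscale c (x n)) = fscale c (x (n + 1))"
    using T_fscale[OF bilateralD(1)[OF x], of c n] by (simp only: bilateralD(2)[OF x])
next
  fix s :: real assume s: "0 < s"
  obtain C where C: "\<And>n. p s (x n) \<le> C / (1 + (of_int n)\<^sup>2)" using bilateralD(3)[OF x s] by auto
  have "p s (fscale c (x n)) \<le> (cmod c * C) / (1 + (of_int n)\<^sup>2)" for n
    using p_fscale[OF bilateralD(1)[OF x], of s c n] s mult_left_mono[OF C[of n], of "cmod c"] by simp
  then show "\<exists>C. \<forall>n. p s (fscale c (x n)) \<le> C / (1 + (of_int n)\<^sup>2)" by blast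
qed

lemma T_ev_summable:
  assumes g: "\<gamma>0 \<in> carrier (dual E)" "\<gamma>1 \<in> carrier (dual E)" and w: "0 \<le> w" and s: "0 < s"
  shows "summable (\<lambda>k. w ^ k * p s (T (ev \<gamma>0 \<gamma>1 k)))"
proof -
  have "summable (\<lambda>k. p s (T (fscale (of_real w ^ k) (ev \<gamma>0 \<gamma>1 k))))"
    by (rule T_series(1)[OF _ _ s]) (auto intro!: H_fscale ev_H g ev_series(1))
  moreover have "p s (T (fscale (of_real w ^ k) (ev \<gamma>0 \<gamma>1 k))) = w ^ k * p s (T (ev \<gamma>0 \<gamma>1 k))" for k
    unfolding T_fscale[OF ev_H[OF g]] using p_fscale[OF T_H[OF ev_H[OF g]], of s "of_real w ^ k" k] w s
    by (simp add: norm_power)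
  ultimately show ?thesis by simp
qed

lemma T_ev_sum:
  assumes g: "\<gamma>0 \<in> carrier (dual E)" "\<gamma>1 \<in> carrier (dual E)"
  shows "(\<Sum>k. T (ev \<gamma>0 \<gamma>1 k) y * w ^ k) = \<phi> (\<gamma>0 + fscale w \<gamma>1) * Ex (\<gamma>0 + fscale w \<gamma>1) y"
proof -
  have "T (\<lambda>x. \<Sum>k. fscale (w ^ k) (ev \<gamma>0 \<gamma>1 k) x) = (\<lambda>x. \<Sum>k. T (fscale (w ^ k) (ev \<gamma>0 \<gamma>1 k)) x)"
    by (rule T_series(2)[OF H_fscale[OF ev_H[OF g]] ev_series(1)[OF g less_imp_le]])
  then have "T (Ex (\<gamma>0 + fscale w \<gamma>1)) y = (\<Sum>k. T (ev \<gamma>0 \<gamma>1 k) y * w ^ k)"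
    unfolding ev_series(2)[OF g] T_fscale[OF ev_H[OF g]] by (simp add: mult.commute)
  moreover have "\<gamma>0 + fscale w \<gamma>1 \<in> carrier (dual E)" by (intro dual_add dual_fscale g)
  ultimately show ?thesis using T_Ex by simp
qed

lemma ev_sum:
  assumes g: "\<gamma>0 \<in> carrier (dual E)" "\<gamma>1 \<in> carrier (dual E)"
  shows "(\<Sum>k. ev \<gamma>0 \<gamma>1 k y * w ^ k) = Ex (\<gamma>0 + fscale w \<gamma>1) y"
  using fun_cong[OF ev_series(2)[OF g, of w], of y] by (simp add: mult.commute)

text \<open>Averaging the eigenvectors \<open>exp(\<gamma>\<^sub>0 + \<Psi>(t) \<gamma>\<^sub>1)\<close>, with eigenvalue \<open>\<phi>(\<gamma>\<^sub>0) e\<^sup>i\<^sup>t\<close>, over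
  an arc against the weight \<open>bump a b t\<close> and multiplying the weight with powers of the eigenvalue yields a
  bilateral orbit. Its decay is that of Fourier coefficients.\<close>

lemma arc_orbit:
  assumes g: "\<gamma>0 \<in> carrier (dual E)" "\<gamma>1 \<in> carrier (dual E)"
    and \<zeta>: "cmod (\<phi> \<gamma>0) = 1"
    and r: "0 < r" and R: "0 < R" and \<Psi>: "\<Psi> holomorphic_on ball 0 (2 * r)"
      "\<And>z. z \<in> ball 0 (2 * r) \<Longrightarrow> cmod (\<Psi> z) \<le> R"
      "\<And>z. z \<in> ball 0 (2 * r) \<Longrightarrow> \<phi> (\<gamma>0 + fscale (\<Psi> z) \<gamma>1) = \<phi> \<gamma>0 * exp (\<i> * z)"
    and ab: "a < b" "{a..b} \<subseteq> {-r<..<r}"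
  shows "\<exists>x. bilateral x \<and>
    x 0 = (\<lambda>y. \<Sum>k. fscale (integral {a..b} (\<lambda>t. bump a b (of_real t) * \<Psi> (of_real t) ^ k)) (ev \<gamma>0 \<gamma>1 k) y)"
proof -
  \<comment> \<open>The weight of \<open>x n\<close>: the n-th power of the eigenvalue
    \<phi>(\<gamma>0) exp(\<i> t) times \<open>bump\<close>. Multiplication by the eigenvalue, which
    is the effect of T, raises n by 1.\<close>
  define h where "h n t = \<phi> \<gamma>0 powi n * (exp (\<i> * of_int n * of_real t) * bump a b (of_real t))"
    for n :: int and t :: real
  \<comment> \<open>The average is expanded in \<open>ev \<gamma>0 \<gamma>1 k\<close>, so that
    integrals occur only as scalar coefficients.\<close>
  define c where "c n k = integral {a..b} (\<lambda>t. h n t * \<Psi> (of_real t) ^ k)" for n k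
  define x where "x n = (\<lambda>y. \<Sum>k. fscale (c n k) (ev \<gamma>0 \<gamma>1 k) y)" for n
  define K where "K = (b - a) * (3 * r) ^ 4 * (1 + 16 / r\<^sup>2)"
  have in_ball: "of_real t \<in> ball (0::complex) (2 * r)" if "t \<in> {a..b}" for t
    using subsetD[OF ab(2) that] r by auto
  have \<phi>0: "\<phi> \<gamma>0 \<noteq> 0" using \<zeta> by auto
  have K: "0 \<le> K" using ab(1) r by (simp add: K_def)
  have hc: "continuous_on {a..b} (h n)" for n
    unfolding h_def bump_def by (intro continuous_intros)
  have \<Psi>c: "continuous_on {a..b} (\<lambda>t. \<Psi> (of_real t))"
    by (rule continuous_on_compose2[OF holomorphic_on_imp_continuous_on[OF \<Psi>(1)]])
      (use in_ball in \<open>auto intro!: continuous_intros\<close>)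
  have c_bound: "cmod (c n k) \<le> K * R ^ k / (1 + (of_int n)\<^sup>2)" for n k
  proof -
    have "c n k = \<phi> \<gamma>0 powi n *
        integral {a..b} (\<lambda>t. exp (\<i> * of_int n * of_real t) * (bump a b (of_real t) * \<Psi> (of_real t) ^ k))"
      unfolding c_def h_def by (simp add: mult.assoc)
    then have "cmod (c n k) = cmod (integral {a..b} (\<lambda>t. exp (\<i> * of_int n * of_real t) * (bump a b (of_real t) * \<Psi> (of_real t) ^ k)))"
      by (simp add: norm_mult norm_power_int \<zeta>)
    also have "\<dots> \<le> (b - a) * (3 * r) ^ 4 * (1 + 16 / r\<^sup>2) * R ^ k / (1 + (of_int n)\<^sup>2)"
    proof (rule fourier_decay[OF r ab])
      show "(\<lambda>z. \<Psi> z ^ k) holomorphic_on ball 0 (2 * r)" by (intro holomorphic_intros \<Psi>(1))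
      show "cmod (\<Psi> z ^ k) \<le> R ^ k" if "z \<in> ball 0 (2 * r)" for z
        unfolding norm_power by (intro power_mono \<Psi>(2) that) simp
    qed
    finally show ?thesis by (simp add: K_def)
  qed
  have evH: "fscale (c n k) (ev \<gamma>0 \<gamma>1 k) \<in> H" for n k by (intro H_fscale ev_H g)
  have pc: "p s (fscale (c n k) (ev \<gamma>0 \<gamma>1 k)) \<le> K / (1 + (of_int n)\<^sup>2) * (R ^ k * p s (ev \<gamma>0 \<gamma>1 k))"
    if s: "0 < s" for s n k
    using p_fscale[OF ev_H[OF g], of s "c n k" k] mult_right_mono[OF c_bound[of n k] p_nonneg[OF ev_H[OF g], of s k]] s
    by simp
  have evs: "summable (\<lambda>k. R ^ k * p s (ev \<gamma>0 \<gamma>1 k))" if "0 < s" for s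
    using that R by (intro ev_summable g) auto
  have sm: "summable (\<lambda>k. p s (fscale (c n k) (ev \<gamma>0 \<gamma>1 k)))" if s: "0 < s" for s n
    by (rule summable_comparison_test'[OF summable_mult[OF evs[OF s], of "K / (1 + (of_int n)\<^sup>2)"]])
      (use pc[OF s] p_nonneg[OF evH] s in simp)
  have xH: "x n \<in> H" for n unfolding x_def by (rule H_series(1)[OF evH sm])
  have "T (x n) = x (n + 1)" for n
  proof
    fix y
    have "T (x n) y = (\<Sum>k. T (fscale (c n k) (ev \<gamma>0 \<gamma>1 k)) y)"
      unfolding x_def using fun_cong[OF T_series(2)[of "\<lambda>k. fscale (c n k) (ev \<gamma>0 \<gamma>1 k)", OF evH sm], of y] by simp
    then have 1: "T (x n) y = (\<Sum>k. c n k * T (ev \<gamma>0 \<gamma>1 k) y)"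
      unfolding T_fscale[OF ev_H[OF g]] by simp
    show "T (x n) y = x (n + 1) y"
    proof (cases "y \<in> carrier E")
      case True
      define s where "s = nrm E y + 1"
      have s: "0 < s" "nrm E y \<le> s" using nrm_nonneg[OF True] by (auto simp: s_def)
      have sT: "summable (\<lambda>k. cmod (T (ev \<gamma>0 \<gamma>1 k) y) * R ^ k)"
        by (rule summable_comparison_test'[OF T_ev_summable[OF g less_imp_le[OF R] s(1)]])
          (use p_eval[OF T_H[OF ev_H[OF g]] True s(2)] R in \<open>simp add: mult.commute mult_left_mono abs_mult\<close>)
      have sE: "summable (\<lambda>k. cmod (ev \<gamma>0 \<gamma>1 k y) * R ^ k)"
        by (rule summable_comparison_test'[OF evs[OF s(1)]])
          (use p_eval[OF ev_H[OF g] True s(2)] R in \<open>simp add: mult.commute mult_left_mono abs_mult\<close>)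
      have \<Psi>R: "cmod (\<Psi> (of_real t)) \<le> R" if "t \<in> {a..b}" for t by (rule \<Psi>(2)[OF in_ball[OF that]])
      have "T (x n) y = integral {a..b} (\<lambda>t. h n t * (\<Sum>k. T (ev \<gamma>0 \<gamma>1 k) y * \<Psi> (of_real t) ^ k))"
        unfolding 1 c_def by (rule sums_unique[OF sums_integral_powers[OF hc \<Psi>c \<Psi>R sT], symmetric])
      also have "\<dots> = integral {a..b} (\<lambda>t. h (n + 1) t * (\<Sum>k. ev \<gamma>0 \<gamma>1 k y * \<Psi> (of_real t) ^ k))"
      proof (rule integral_cong)
        fix t assume t: "t \<in> {a..b}"
        have "h n t * (\<phi> \<gamma>0 * exp (\<i> * of_real t)) = h (n + 1) t"
          using \<phi>0 by (simp add: h_def power_int_add distrib_left distrib_right exp_add mult_ac)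
        then show "h n t * (\<Sum>k. T (ev \<gamma>0 \<gamma>1 k) y * \<Psi> (of_real t) ^ k) =
            h (n + 1) t * (\<Sum>k. ev \<gamma>0 \<gamma>1 k y * \<Psi> (of_real t) ^ k)"
          unfolding T_ev_sum[OF g] ev_sum[OF g] \<Psi>(3)[OF in_ball[OF t]] by (simp only: mult.assoc[symmetric])
      qed
      also have "\<dots> = x (n + 1) y"
        unfolding x_def c_def fscale_apply
        by (rule sums_unique[OF sums_integral_powers[OF hc \<Psi>c \<Psi>R sE]])
      finally show ?thesis .
    qed (use H_outside[OF T_H[OF xH]] H_outside[OF xH] in simp)
  qed
  moreover have "\<exists>C. \<forall>n. p s (x n) \<le> C / (1 + (of_int n)\<^sup>2)" if s: "0 < s" for s
  proof (intro exI allI)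
    fix n
    have "p s (x n - (\<Sum>k<0. fscale (c n k) (ev \<gamma>0 \<gamma>1 k))) \<le> (\<Sum>k. p s (fscale (c n (k + 0)) (ev \<gamma>0 \<gamma>1 (k + 0))))"
      unfolding x_def by (rule H_series(2)[of "\<lambda>k. fscale (c n k) (ev \<gamma>0 \<gamma>1 k)", OF evH sm _ ]) (use s in auto)
    then have "p s (x n) \<le> (\<Sum>k. p s (fscale (c n k) (ev \<gamma>0 \<gamma>1 k)))" by simp
    also have "\<dots> \<le> (\<Sum>k. K / (1 + (of_int n)\<^sup>2) * (R ^ k * p s (ev \<gamma>0 \<gamma>1 k)))"
      by (intro suminf_le pc s sm summable_mult evs)
    also have "\<dots> = K / (1 + (of_int n)\<^sup>2) * (\<Sum>k. R ^ k * p s (ev \<gamma>0 \<gamma>1 k))"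
      by (rule suminf_mult[OF evs[OF s]])
    finally show "p s (x n) \<le> (K * (\<Sum>k. R ^ k * p s (ev \<gamma>0 \<gamma>1 k))) / (1 + (of_int n)\<^sup>2)" by simp
  qed
  ultimately have "bilateral x" unfolding bilateral_def using xH by blast
  moreover have "x 0 = (\<lambda>y. \<Sum>k. fscale (integral {a..b} (\<lambda>t. bump a b (of_real t) * \<Psi> (of_real t) ^ k)) (ev \<gamma>0 \<gamma>1 k) y)"
    by (simp add: x_def c_def h_def)
  ultimately show ?thesis by blast
qed

section \<open>Density of the averaged eigenvectors\<close>

definition orbit_points :: "('a \<Rightarrow> complex) set" where "orbit_points = {x 0 | x. bilateral x}"

text \<open>Arcs that shrink to a point give the eigenvector at that point. Moving the point to 0,
  \<open>closed_subspace_coeff\<close> gives every \<open>ev \<gamma>0 \<gamma>1 k\<close>, and with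
  them the exponentials on the whole line, whatever their eigenvalues.\<close>

lemma line_in_closure:
  assumes V: "closed_subspace V" and X: "orbit_points \<subseteq> V"
    and g: "\<gamma>0 \<in> carrier (dual E)" "\<gamma>1 \<in> carrier (dual E)"
    and \<zeta>: "cmod (\<phi> \<gamma>0) = 1" and d: "deriv (\<lambda>w. \<phi> (\<gamma>0 + fscale w \<gamma>1)) 0 \<noteq> 0"
  shows "Ex (\<gamma>0 + fscale w \<gamma>1) \<in> V"
proof -
  define q where "q w = \<phi> (\<gamma>0 + fscale w \<gamma>1)" for w
  have q0: "q 0 = \<phi> \<gamma>0" by (simp add: q_def)
  have qh: "q holomorphic_on UNIV" unfolding q_def by (rule \<phi>_holomorphic[OF g])
  have qd: "deriv q 0 \<noteq> 0" using d unfolding q_def .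
  obtain r R \<Psi> where r: "0 < r" "r \<le> 1" and R: "0 < R" and \<Psi>: "\<Psi> holomorphic_on ball 0 (2 * r)" "\<Psi> 0 = 0"
    "\<And>z. z \<in> ball 0 (2 * r) \<Longrightarrow> cmod (\<Psi> z) \<le> R" "\<And>z. z \<in> ball 0 (2 * r) \<Longrightarrow> q (\<Psi> z) = q 0 * exp (\<i> * z)"
    using local_parametrization[OF qh \<zeta>[folded q0] qd] by metis
  let ?u = "ev \<gamma>0 \<gamma>1"
  have u: "?u k \<in> H" for k by (rule ev_H[OF g])
  have contR: "continuous_on {-r<..<r} (\<lambda>t. \<Psi> (of_real t))"
    by (rule continuous_on_compose2[OF holomorphic_on_imp_continuous_on[OF \<Psi>(1)]])
      (use r in \<open>auto intro!: continuous_intros\<close>)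
  have inb: "of_real t \<in> ball (0::complex) (2 * r)" if "t \<in> {-r<..<r}" for t using that r by auto
  have exV: "Ex (\<gamma>0 + fscale (\<Psi> (of_real \<tau>)) \<gamma>1) \<in> V" if \<tau>: "\<tau> \<in> {0<..<r}" for \<tau>
  proof -
    let ?y = "\<Psi> (of_real \<tau>)" and ?L = "Ex (\<gamma>0 + fscale (\<Psi> (of_real \<tau>)) \<gamma>1)"
    have gE: "\<gamma>0 + fscale ?y \<gamma>1 \<in> carrier (dual E)" by (intro dual_add dual_fscale g)
    show ?thesis
    proof (rule closed_subspaceD(3)[OF V Ex_H[OF gE]])
      fix s e :: real assume s: "0 < s" and e: "0 < e"
      define S where "S = (\<Sum>k. (2 * R) ^ k * p s (?u k))"
      have smS: "summable (\<lambda>k. (2 * R) ^ k * p s (?u k))" using R s by (intro ev_summable g) auto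
      have S: "0 \<le> S" unfolding S_def using R s p_nonneg[OF u] by (intro suminf_nonneg smS) auto
      \<comment> \<open>Chosen so that the final error \<eta> / R * S equals e S / (S + 1), which is
        below e.\<close>
      define \<eta> where "\<eta> = e * R / (S + 1)"
      have \<eta>: "0 < \<eta>" using e R S by (simp add: \<eta>_def)
      have "isCont (\<lambda>t. \<Psi> (of_real t)) \<tau>"
        using contR \<tau> r by (simp add: continuous_on_eq_continuous_at)
      then obtain d where d: "0 < d" "\<And>t. \<bar>t - \<tau>\<bar> < d \<Longrightarrow> cmod (\<Psi> (of_real t) - ?y) < \<eta>"
        using \<eta> unfolding continuous_at_eps_delta dist_norm real_norm_def by metis
      \<comment> \<open>Half the length of the arc: it stays within the continuity interval around
        \<tau> and within (0, r).\<close>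
      define m where "m = min (d / 2) (min (\<tau> / 2) ((r - \<tau>) / 2))"
      define a b where "a = \<tau> - m" and "b = \<tau> + m"
      have "m \<le> d / 2" "m \<le> \<tau> / 2" "m \<le> (r - \<tau>) / 2" unfolding m_def by linarith+
      moreover have "0 < m" using d(1) \<tau> by (simp add: m_def)
      ultimately have m: "0 < m" "m < d" "m < \<tau>" "m < r - \<tau>" using d(1) \<tau> by auto
      have ab: "a < b" "{a..b} \<subseteq> {-r<..<r}" using m \<tau> by (auto simp: a_def b_def)
      have close: "cmod (\<Psi> (of_real t) - ?y) < \<eta>" if "t \<in> {a..b}" for t
        using that m by (intro d(2)) (auto simp: a_def b_def)
      obtain x where x: "bilateral x"
        "x 0 = (\<lambda>y. \<Sum>k. fscale (integral {a..b} (\<lambda>t. bump a b (of_real t) * \<Psi> (of_real t) ^ k)) (?u k) y)"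
        using arc_orbit[OF g \<zeta> r(1) R \<Psi>(1,3) _ ab] \<Psi>(4) unfolding q_def q0[unfolded q_def] by blast
      define I where "I = integral {a..b} (bump a b :: real \<Rightarrow> real)"
      define c where "c k = integral {a..b} (\<lambda>t. bump a b (of_real t) * \<Psi> (of_real t) ^ k) / of_real I" for k
      have cont: "continuous_on {a..b} (\<lambda>t. \<Psi> (of_real t) ^ k)" for k
        by (intro continuous_intros continuous_on_subset[OF contR ab(2)])
      have yR: "cmod ?y \<le> R" using \<Psi>(3)[OF inb] \<tau> by auto
      \<comment> \<open>The factor k of the mean value bound is absorbed into 2^k, hence the radius
        2 R.\<close>
      have ck: "cmod (c k - ?y ^ k) \<le> (2 * R) ^ k / R * \<eta>" for k
        unfolding c_def I_def
      proof (rule bump_average(2)[OF ab(1) cont])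
        fix t assume t: "t \<in> {a..b}"
        have "cmod (\<Psi> (of_real t) ^ k - ?y ^ k) * R \<le> real k * R ^ k * cmod (\<Psi> (of_real t) - ?y)"
          by (rule norm_power_diff_le[OF \<Psi>(3)[OF inb[OF subsetD[OF ab(2) t]]] yR])
        also have "\<dots> \<le> 2 ^ k * R ^ k * \<eta>"
        proof (intro mult_mono)
          show "real k \<le> 2 ^ k" using of_nat_less_two_power[of k, where 'a=real] by simp
        qed (use R close[OF t] \<eta> in auto)
        finally show "cmod (\<Psi> (of_real t) ^ k - ?y ^ k) \<le> (2 * R) ^ k / R * \<eta>"
          using R by (simp add: field_simps power_mult_distrib)
      qed
      let ?f = "\<lambda>k. fscale (c k - ?y ^ k) (?u k)"
      have I: "0 < I" unfolding I_def using bump_average(1)[OF ab(1) cont[of 0], of 1 0] by simp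
      have fH: "?f k \<in> H" for k by (intro H_fscale u)
      have pf: "p s' (?f k) \<le> \<eta> / R * ((2 * R) ^ k * p s' (?u k))" if "0 < s'" for s' k
        using p_fscale[OF u, of s' "c k - ?y ^ k" k] mult_right_mono[OF ck[of k] p_nonneg[OF u, of s' k]] that
        by (simp add: mult_ac)
      have sm0: "summable (\<lambda>k. (2 * R) ^ k * p s' (?u k))" if "0 < s'" for s' using R that by (intro ev_summable g) auto
      have smf: "summable (\<lambda>k. p s' (?f k))" if s': "0 < s'" for s'
        by (rule summable_comparison_test'[OF summable_mult[OF sm0[OF s'], of "\<eta> / R"]])
          (use pf[OF s'] p_nonneg[OF fH] s' in simp)
      define G where "G = (\<lambda>y. \<Sum>k. ?f k y)"
      have "p s (G - (\<Sum>k<0. ?f k)) \<le> (\<Sum>k. p s (?f (k + 0)))"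
        unfolding G_def by (rule H_series(2)[of ?f, OF fH smf]) (use s in auto)
      also have "\<dots> \<le> (\<Sum>k. \<eta> / R * ((2 * R) ^ k * p s (?u k)))"
        using s by (simp only: add_0_right) (intro suminf_le pf smf summable_mult sm0)
      also have "\<dots> = \<eta> / R * S" unfolding S_def by (rule suminf_mult[OF smS])
      also have "\<eta> / R * S = e * (S / (S + 1))" using R by (simp add: \<eta>_def)
      also have "\<dots> < e * 1" using e S by (intro mult_strict_left_mono) auto
      finally have small: "p s G < e" by simp
      have "fscale (1 / of_real I) (x 0) - ?L = G"
      proof
        fix y
        have s1: "(\<lambda>k. ?f k y) sums G y" unfolding G_def by (rule H_series(3)[of ?f, OF fH smf])
        have "(\<lambda>k. fscale (?y ^ k) (?u k) y) sums (\<Sum>k. fscale (?y ^ k) (?u k) y)"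
          by (rule H_series(3)[OF H_fscale[OF u] ev_series(1)[OF g less_imp_le]])
        then have s2: "(\<lambda>k. fscale (?y ^ k) (?u k) y) sums ?L y"
          using fun_cong[OF ev_series(2)[OF g, of ?y], of y] by simp
        have "(\<lambda>k. c k * ?u k y) sums (G y + ?L y)"
          using sums_add[OF s1 s2] by (simp add: algebra_simps)
        from sums_mult[OF this, of "of_real I"]
        have "(\<lambda>k. fscale (integral {a..b} (\<lambda>t. bump a b (of_real t) * \<Psi> (of_real t) ^ k)) (?u k) y) sums (of_real I * (G y + ?L y))"
          using I by (simp add: c_def)
        from sums_unique[OF this] have "x 0 y = of_real I * (G y + ?L y)" by (simp add: x(2))
        then show "(fscale (1 / of_real I) (x 0) - ?L) y = G y" using I by simp
      qed
      moreover have "fscale (1 / of_real I) (x 0) \<in> V"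
        using x(1) X by (intro cfun.subspace_scale[OF closed_subspaceD(2)[OF V]]) (auto simp: orbit_points_def)
      ultimately show "\<exists>h\<in>V. p s (h - ?L) < e" using small by metis
    qed
  qed
  have evV: "?u k \<in> V" for k
  proof (rule closed_subspace_coeff[OF V u R])
    define \<tau> where "\<tau> n = r / (real n + 2)" for n :: nat
    have \<tau>: "\<tau> n \<in> {0<..<r}" for n using r by (auto simp: \<tau>_def divide_less_eq)
    show "summable (\<lambda>k. R ^ k * p s (?u k))" if "0 < s" for s using R that by (intro ev_summable g) auto
    have "\<tau> \<longlonglongrightarrow> 0" unfolding \<tau>_def by real_asymp
    then have "(\<lambda>n. complex_of_real (\<tau> n)) \<longlonglongrightarrow> 0" using tendsto_of_real[of \<tau> 0 sequentially, where 'a=complex] by simp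
    moreover have "isCont \<Psi> 0"
      using holomorphic_on_imp_continuous_on[OF \<Psi>(1)] r by (simp add: continuous_on_eq_continuous_at)
    ultimately show "(\<lambda>n. \<Psi> (of_real (\<tau> n))) \<longlonglongrightarrow> 0"
      using isCont_tendsto_compose[of 0 \<Psi> "\<lambda>n. complex_of_real (\<tau> n)" sequentially] \<Psi>(2) by simp
    have ti: "\<tau> n \<in> {-r<..<r}" for n using \<tau>[of n] r by auto
    show "cmod (\<Psi> (of_real (\<tau> n))) \<le> R" for n by (rule \<Psi>(3)[OF inb[OF ti]])
    show "\<Psi> (of_real (\<tau> n)) \<noteq> 0" for n
    proof
      assume "\<Psi> (of_real (\<tau> n)) = 0"
      then have "exp (\<i> * of_real (\<tau> n)) = 1" using \<Psi>(4)[OF inb[OF ti[of n]]] q0 \<zeta> by auto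
      then have "cis (\<tau> n) = 1" by (simp add: cis_conv_exp)
      then have "cos (\<tau> n) = cos 0" by (metis cis.sel(1) cos_zero one_complex.sel(1))
      then have "\<tau> n = 0" using cos_inj_pi[of "\<tau> n" 0] \<tau>[of n] r pi_gt3 by auto
      then show False using \<tau>[of n] by simp
    qed
    show "(\<lambda>x. \<Sum>k. fscale (\<Psi> (of_real (\<tau> n)) ^ k) (?u k) x) \<in> V" for n
      unfolding ev_series(2)[OF g] by (rule exV[OF \<tau>])
  qed
  have "(\<lambda>x. \<Sum>k. fscale (w ^ k) (?u k) x) \<in> V"
    by (rule closed_subspace_series[OF V cfun.subspace_scale[OF closed_subspaceD(2)[OF V] evV]])
      (auto intro!: ev_series(1)[OF g])
  then show ?thesis unfolding ev_series(2)[OF g] .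
qed

lemma eigenspace_closed: "closed_subspace {f \<in> H. T f = fscale c f}" (is "closed_subspace ?V")
  unfolding closed_subspace_def cfun.subspace_def
proof (intro conjI ballI allI impI)
  show "0 \<in> ?V" by (simp add: H_zero T_zero)
  show "f + g \<in> ?V" if "f \<in> ?V" "g \<in> ?V" for f g
    using that by (simp add: H_add T_add fun_eq_iff algebra_simps)
  show "fscale a f \<in> ?V" if "f \<in> ?V" for a f
    using that by (simp add: H_fscale T_fscale fun_eq_iff)
  fix f assume f: "f \<in> H" and ap: "\<forall>s>0. \<forall>e>0. \<exists>g\<in>?V. p s (g - f) < e"
  have dH: "T f - fscale c f \<in> H" by (intro H_diff T_H H_fscale f)
  obtain s' C where C: "0 < s'" "0 < C" "\<forall>f\<in>H. p 1 (T f) \<le> C * p s' f" using T_bounded[OF zero_less_one] by auto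
  have "p 1 (T f - fscale c f) \<le> 0 + e" if e: "0 < e" for e
  proof -
    define s where "s = max 1 s'"
    define d where "d = e / (C + cmod c)"
    have d: "0 < d" using e C by (simp add: d_def add_pos_nonneg)
    have "0 < s" by (simp add: s_def)
    then obtain g where g: "g \<in> H" "T g = fscale c g" "p s (g - f) < d" using ap d by blast
    have gf: "f - g \<in> H" by (intro H_diff f g)
    have ps: "p s (f - g) < d" using g(3) p_diff_commute[OF g(1) f, of s] \<open>0 < s\<close> by simp
    have "T f - fscale c f = T (f - g) - fscale c (f - g)"
      unfolding T_diff[OF f g(1)] g(2) by (simp add: fun_eq_iff algebra_simps)
    then have 1: "p 1 (T f - fscale c f) = p 1 (T (f - g) - fscale c (f - g))" by (simp only:)
    have 2: "p 1 (T (f - g) - fscale c (f - g)) \<le> p 1 (T (f - g)) + p 1 (fscale c (f - g))"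
      by (rule p_diff_le[OF T_H[OF gf] H_fscale[OF gf]]) simp
    have 3: "p 1 (T (f - g)) \<le> C * p s' (f - g)" by (rule bspec[OF C(3) gf])
    have 4: "C * p s' (f - g) \<le> C * p s (f - g)"
      using C by (intro mult_left_mono p_mono gf) (auto simp: s_def)
    have 5: "p 1 (fscale c (f - g)) = cmod c * p 1 (f - g)" by (rule p_fscale[OF gf]) simp
    have 6: "cmod c * p 1 (f - g) \<le> cmod c * p s (f - g)" by (intro mult_left_mono p_mono gf) (auto simp: s_def)
    have "p 1 (T f - fscale c f) \<le> (C + cmod c) * p s (f - g)"
      unfolding distrib_right using 1 2 3 4 5 6 by linarith
    also have "\<dots> \<le> (C + cmod c) * d" using ps C by (intro mult_left_mono) auto
    also have "\<dots> = e" using C by (simp add: d_def add_pos_nonneg less_imp_neq[symmetric])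
    finally show ?thesis by simp
  qed
  then have "p 1 (T f - fscale c f) \<le> 0" by (rule field_le_epsilon)
  then have "p 1 (T f - fscale c f) = 0" using p_nonneg[OF dH, of 1] by simp
  then have "T f - fscale c f = 0" by (rule p_eq_0[OF dH zero_less_one])
  then show "f \<in> ?V" using f by simp
qed auto

end

locale fhc_operator = conv_operator +
  assumes separable: "separable_space (ntop (dual E))"
    and dense: "\<And>k. ntop (ideal_space (\<AA> k) E) closure_of finite_type E k = A k"
    and nontrivial: "\<not> trivial_operator \<AA> E T"
begin

text \<open>Otherwise all exponentials would lie in the eigenspace for \<phi>(0), and T would be
  scalar because they are total.\<close>

lemma \<phi>_nonconstant: "\<exists>\<gamma>\<in>carrier (dual E). \<not> (\<lambda>w. \<phi> (fscale w \<gamma>)) constant_on UNIV"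
proof (rule ccontr)
  assume con: "\<not> ?thesis"
  have "\<phi> \<gamma> = \<phi> 0" if "\<gamma> \<in> carrier (dual E)" for \<gamma>
  proof -
    have "(\<lambda>w. \<phi> (fscale w \<gamma>)) constant_on UNIV" using con that by blast
    then obtain c where c: "\<forall>w\<in>UNIV. \<phi> (fscale w \<gamma>) = c" unfolding constant_on_def by blast
    from bspec[OF c UNIV_I[of 1]] bspec[OF c UNIV_I[of 0]] show ?thesis by simp
  qed
  then have "Ex \<gamma> \<in> {f \<in> H. T f = fscale (\<phi> 0) f}" if "\<gamma> \<in> carrier (dual E)" for \<gamma>
    using that Ex_H T_Ex by simp
  from closed_subspace_all[OF eigenspace_closed this dense]
  have "\<forall>f\<in>H. T f = fscale (\<phi> 0) f" by blast
  then show False using nontrivial by (auto simp: trivial_operator_def)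
qed

text \<open>From a regular unimodular point \<gamma>0, \<open>line_in_closure\<close> reaches every
  \<gamma>0 + \<gamma>1 for which the derivative of the symbol in direction \<gamma>1 is nonzero.
  This derivative is linear in the direction and nonzero at \<gamma>s, so the other directions are
  limits of admissible ones.\<close>

lemma orbit_points_dense: "cl orbit_points = H"
proof -
  have V: "closed_subspace (cl orbit_points)"
  proof (rule closed_subspace_cl)
    show "orbit_points \<subseteq> H" using bilateralD(1) by (auto simp: orbit_points_def)
    show "0 \<in> orbit_points" using bilateral_zero by (force simp: orbit_points_def)
    show "f + g \<in> orbit_points" if fg: "f \<in> orbit_points" "g \<in> orbit_points" for f g
    proof -
      obtain x y where "bilateral x" "f = x 0" "bilateral y" "g = y 0"
        using fg unfolding orbit_points_def by blast
      then show ?thesis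
        unfolding orbit_points_def using bilateral_add by (intro CollectI exI[of _ "\<lambda>n. x n + y n"]) auto
    qed
    show "fscale (Complex (of_rat a) (of_rat b)) f \<in> orbit_points" if f: "f \<in> orbit_points" for f a b
    proof -
      obtain x where "bilateral x" "f = x 0" using f unfolding orbit_points_def by blast
      then show ?thesis unfolding orbit_points_def
        using bilateral_fscale by (intro CollectI exI[of _ "\<lambda>n. fscale (Complex (of_rat a) (of_rat b)) (x n)"]) auto
    qed
  qed
  have "orbit_points \<subseteq> H" using bilateralD(1) by (auto simp: orbit_points_def)
  then have X: "orbit_points \<subseteq> cl orbit_points" by (rule subset_cl)
  obtain \<gamma>s where s: "\<gamma>s \<in> carrier (dual E)" "\<not> (\<lambda>w. \<phi> (fscale w \<gamma>s)) constant_on UNIV"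
    using \<phi>_nonconstant by blast
  have hol: "(\<lambda>w. \<phi> (fscale w \<gamma>s)) holomorphic_on UNIV" using \<phi>_holomorphic[OF dual_zero s(1)] by simp
  obtain w0 where w0: "cmod (\<phi> (fscale w0 \<gamma>s)) = 1" "deriv (\<lambda>w. \<phi> (fscale w \<gamma>s)) w0 \<noteq> 0"
    using entire_regular_unimodular_value[OF hol s(2)] by blast
  define \<gamma>0 where "\<gamma>0 = fscale w0 \<gamma>s"
  have g0: "\<gamma>0 \<in> carrier (dual E)" unfolding \<gamma>0_def by (rule dual_fscale[OF s(1)])
  \<comment> \<open>The derivative of the symbol at \<gamma>0 as the first coefficient in
    \<open>\<phi>_line\<close>; in this form its linearity in the direction is visible.\<close>
  define D where "D \<gamma> = T (ev \<gamma>0 \<gamma> 1) \<zero>" for \<gamma>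
  have D: "deriv (\<lambda>w. \<phi> (\<gamma>0 + fscale w \<gamma>)) 0 = D \<gamma>" if \<gamma>: "\<gamma> \<in> carrier (dual E)" for \<gamma>
  proof -
    have sums: "(\<lambda>k. T (ev \<gamma>0 \<gamma> k) \<zero> * w ^ k) sums \<phi> (\<gamma>0 + fscale w \<gamma>)" for w
      by (rule \<phi>_line[OF g0 \<gamma>])
    define q where "q w = \<phi> (\<gamma>0 + fscale w \<gamma>)" for w
    have qh: "q holomorphic_on ball 0 1"
      unfolding q_def by (rule holomorphic_on_subset[OF \<phi>_holomorphic[OF g0 \<gamma>]]) simp
    have "(\<lambda>k. (deriv ^^ k) q 0 / fact k) = (\<lambda>k. T (ev \<gamma>0 \<gamma> k) \<zero>)"
      by (rule powser_unique[of 1 _ q])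
        (use holomorphic_power_series[OF qh] sums in \<open>auto simp: q_def\<close>)
    from fun_cong[OF this, of 1] show ?thesis unfolding q_def[abs_def] D_def by simp
  qed
  have Ds: "D \<gamma>s \<noteq> 0"
  proof -
    have "((\<lambda>w. \<phi> (fscale w \<gamma>s)) has_field_derivative deriv (\<lambda>w. \<phi> (fscale w \<gamma>s)) w0) (at (w0 + 0))"
      using holomorphic_derivI[OF hol open_UNIV, of w0] by simp
    from DERIV_shift[THEN iffD1, OF this[unfolded add.commute[of w0]]]
    have "((\<lambda>w. \<phi> (fscale (w + w0) \<gamma>s)) has_field_derivative deriv (\<lambda>w. \<phi> (fscale w \<gamma>s)) w0) (at 0)" by simp
    moreover have "fscale (w + w0) \<gamma>s = \<gamma>0 + fscale w \<gamma>s" for w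
      by (simp add: \<gamma>0_def fun_eq_iff algebra_simps)
    ultimately have "((\<lambda>w. \<phi> (\<gamma>0 + fscale w \<gamma>s)) has_field_derivative deriv (\<lambda>w. \<phi> (fscale w \<gamma>s)) w0) (at 0)" by simp
    then show ?thesis using D[OF s(1)] w0(2) DERIV_imp_deriv by metis
  qed
  have "Ex \<gamma> \<in> cl orbit_points" if \<gamma>: "\<gamma> \<in> carrier (dual E)" for \<gamma>
  proof -
    define \<gamma>1 where "\<gamma>1 = \<gamma> - \<gamma>0"
    have g1: "\<gamma>1 \<in> carrier (dual E)" unfolding \<gamma>1_def by (intro dual_diff \<gamma> g0)
    have line: "Ex (\<gamma>0 + \<eta>) \<in> cl orbit_points" if \<eta>: "\<eta> \<in> carrier (dual E)" "D \<eta> \<noteq> 0" for \<eta>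
      using line_in_closure[OF V X g0 \<eta>(1), of 1] w0(1) D[OF \<eta>(1)] \<eta>(2) by (simp add: \<gamma>0_def)
    show ?thesis
    proof (cases "D \<gamma>1 = 0")
      case False
      then show ?thesis using line[OF g1] by (simp add: \<gamma>1_def)
    next
      case True
      define e where "e n = 1 / (real n + 2)" for n :: nat
      have e: "0 < e n" "e n \<le> 1 / 2" for n by (auto simp: e_def field_simps)
      show ?thesis
      proof (rule closed_subspace_limit[OF V _ Ex_H[OF \<gamma>]])
        fix n
        define \<eta> where "\<eta> = \<gamma>1 + fscale (of_real (e n)) \<gamma>s"
        have \<eta>: "\<eta> \<in> carrier (dual E)" unfolding \<eta>_def by (intro dual_add dual_fscale g1 s)
        have "ev \<gamma>0 \<eta> 1 = ev \<gamma>0 \<gamma>1 1 + fscale (of_real (e n)) (ev \<gamma>0 \<gamma>s 1)"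
          by (auto simp: \<eta>_def ev_apply zext_def fun_eq_iff algebra_simps)
        then have "D \<eta> = D \<gamma>1 + of_real (e n) * D \<gamma>s"
          unfolding D_def by (simp add: T_add[OF ev_H[OF g0 g1] H_fscale[OF ev_H[OF g0 s(1)]]] T_fscale[OF ev_H[OF g0 s(1)]])
        then have "D \<eta> \<noteq> 0" using True Ds e[of n] by simp
        from line[OF \<eta> this] show "Ex (\<gamma> + fscale (of_real (e n)) \<gamma>s) \<in> cl orbit_points"
          by (simp add: \<eta>_def \<gamma>1_def algebra_simps)
      next
        fix t :: real assume t: "0 < t"
        show "(\<lambda>n. p t (Ex (\<gamma> + fscale (of_real (e n)) \<gamma>s) - Ex \<gamma>)) \<longlonglongrightarrow> 0"
        proof (rule Lim_null_comparison)
          have "norm (p t (Ex (\<gamma> + fscale (of_real (e n)) \<gamma>s) - Ex \<gamma>)) \<le> 2 * e n * exp (t * (dnorm \<gamma> + dnorm \<gamma>s))" for n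
          proof -
            have "Ex (\<gamma> + fscale (of_real (e n)) \<gamma>s) - Ex \<gamma> \<in> H" by (intro H_diff Ex_H dual_add dual_fscale \<gamma> s)
            from p_nonneg[OF this, of t] Ex_diff_line[OF \<gamma> s(1) t, of "of_real (e n)"] e[of n] t
            show ?thesis by simp
          qed
          then show "\<forall>\<^sub>F n in sequentially. norm (p t (Ex (\<gamma> + fscale (of_real (e n)) \<gamma>s) - Ex \<gamma>)) \<le> 2 * e n * exp (t * (dnorm \<gamma> + dnorm \<gamma>s))"
            by (intro always_eventually allI)
          have "e \<longlonglongrightarrow> 0" unfolding e_def by real_asymp
          then show "(\<lambda>n. 2 * e n * exp (t * (dnorm \<gamma> + dnorm \<gamma>s))) \<longlonglongrightarrow> 0"
            by (intro tendsto_mult_left_zero tendsto_mult_right_zero)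
        qed
      qed
    qed
  qed
  then show ?thesis by (rule closed_subspace_all[OF V _ dense])
qed

text \<open>Every approximation must recur at arbitrarily large indices, because only a large index
  makes the error in \<open>T_power_K_approx\<close> small. Therefore the precision m is part of the
  index.\<close>

lemma dense_bilateral_sequence:
  "\<exists>Y :: nat \<Rightarrow> int \<Rightarrow> 'a \<Rightarrow> complex. (\<forall>i. bilateral (Y i)) \<and>
     (\<forall>f\<in>H. \<forall>s>0. \<forall>e>0. infinite {i. p s (Y i 0 - f) < e})"
proof -
  obtain d :: "nat \<Rightarrow> 'a \<Rightarrow> complex" where d: "\<And>n. d n \<in> H" "\<forall>f\<in>H. \<forall>s>0. \<forall>e>0. \<exists>n. p s (d n - f) < e"
    using countable_dense[OF separable dense] by auto
  have "\<exists>x. bilateral x \<and> p (real m + 1) (x 0 - d n) < 1 / (real m + 1)" for n m :: nat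
  proof -
    have "d n \<in> cl orbit_points" using d(1) orbit_points_dense by simp
    from clD[OF this, of "real m + 1" "1 / (real m + 1)"]
    obtain g where "g \<in> orbit_points" "p (real m + 1) (g - d n) < 1 / (real m + 1)" by auto
    then show ?thesis by (auto simp: orbit_points_def)
  qed
  note ex = this
  define x where "x n m = (SOME x. bilateral x \<and> p (real m + 1) (x 0 - d n) < 1 / (real m + 1))" for n m :: nat
  have x: "bilateral (x n m)" "p (real m + 1) (x n m 0 - d n) < 1 / (real m + 1)" for n m
    using someI_ex[OF ex[of m n]] unfolding x_def by blast+
  define Y where "Y i = (case prod_decode i of (n, m) \<Rightarrow> x n m)" for i
  have "infinite {i. p s (Y i 0 - f) < e}" if f: "f \<in> H" and s: "0 < s" and e: "0 < e" for f s e
  proof -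
    define m0 where "m0 = nat \<lceil>s\<rceil> + nat \<lceil>2 / e\<rceil>"
    have "\<exists>n. p s (x n m 0 - f) < e" if m: "m0 \<le> m" for m
    proof -
      obtain n where n: "p s (d n - f) < e / 2" using d(2) f s e half_gt_zero by blast
      have xH: "x n m 0 \<in> H" by (rule bilateralD(1)[OF x(1)])
      have "s \<le> real m + 1" "2 / e < real m + 1" using m by (auto simp: m0_def) linarith+
      then have "p s (x n m 0 - d n) \<le> p (real m + 1) (x n m 0 - d n)"
        using s by (intro p_mono H_diff xH d) auto
      also have "\<dots> < 1 / (real m + 1)" by (rule x(2))
      also have "\<dots> < e / 2" using \<open>2 / e < real m + 1\<close> e by (simp add: field_simps)
      finally show ?thesis
        using n p_triangle_diff[OF xH d(1) f, of s n] s by (intro exI[of _ n]) simp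
    qed
    then obtain n where n: "\<And>m. m0 \<le> m \<Longrightarrow> p s (x (n m) m 0 - f) < e" by metis
    have "inj_on (\<lambda>m. prod_encode (n m, m)) {m0..}" by (auto simp: inj_on_def)
    then have "infinite ((\<lambda>m. prod_encode (n m, m)) ` {m0..})"
      by (simp add: finite_image_iff infinite_Ici)
    moreover have "(\<lambda>m. prod_encode (n m, m)) ` {m0..} \<subseteq> {i. p s (Y i 0 - f) < e}"
      using n by (auto simp: Y_def)
    ultimately show ?thesis using infinite_super by blast
  qed
  moreover have "bilateral (Y i)" for i using x(1) by (simp add: Y_def split: prod.split)
  ultimately show ?thesis by blast
qed

end

section \<open>Independent exponentials and invariant subspaces\<close>

text \<open>Uniform over finite sets of integers, as the time differences to which it is applied are
  scattered. Each modulus occurs at most twice, hence a one-sided tail below e / 2.\<close>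

lemma inverse_square_tail:
  assumes "0 < e"
  shows "\<exists>n. \<forall>F::int set. finite F \<longrightarrow> (\<forall>r\<in>F. int n \<le> \<bar>r\<bar>) \<longrightarrow> (\<Sum>r\<in>F. 1 / (1 + (of_int r)\<^sup>2)) \<le> (e::real)"
proof -
  define g where "g m = 1 / (1 + (real m)\<^sup>2)" for m
  have g0: "0 \<le> g m" for m by (simp add: g_def)
  have sm: "summable g"
  proof (rule summable_comparison_test'[where N=1])
    show "summable (\<lambda>m. inverse ((real m)\<^sup>2))" by (rule inverse_power_summable) simp
    show "norm (g m) \<le> inverse ((real m)\<^sup>2)" if "1 \<le> m" for m
      using that by (simp add: g_def divide_simps add_pos_nonneg)
  qed
  obtain n where n: "\<And>m. n \<le> m \<Longrightarrow> norm (\<Sum>i. g (i + m)) < e / 2"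
    using suminf_exist_split[OF half_gt_zero[OF assms] sm] by blast
  have "(\<Sum>r\<in>F. 1 / (1 + (of_int r)\<^sup>2)) \<le> e" if F: "finite F" "\<forall>r\<in>F. int n \<le> \<bar>r\<bar>" for F :: "int set"
  proof -
    define A where "A = (\<lambda>r. nat \<bar>r\<bar>) ` F"
    have A: "finite A" "\<And>m. m \<in> A \<Longrightarrow> n \<le> m" using F by (auto simp: A_def)
    have inj: "inj_on (\<lambda>m. m - n) A" using A(2) by (intro inj_onI) (simp add: eq_diff_iff)
    have "sum g A = sum (\<lambda>i. g (i + n)) ((\<lambda>m. m - n) ` A)"
      unfolding sum.reindex[OF inj] o_def by (rule sum.cong[OF refl]) (simp add: A(2))
    also have "\<dots> \<le> (\<Sum>i. g (i + n))"
      using A(1) g0 summable_ignore_initial_segment[OF sm] by (intro sum_le_suminf) auto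
    also have "\<dots> \<le> e / 2" using n[of n] by simp
    finally have gA: "sum g A \<le> e / 2" .
    have sub: "F \<subseteq> int ` A \<union> (\<lambda>m. - int m) ` A"
    proof
      fix r assume "r \<in> F"
      then have "nat \<bar>r\<bar> \<in> A" by (simp add: A_def)
      moreover have "r = int (nat \<bar>r\<bar>) \<or> r = - int (nat \<bar>r\<bar>)" by auto
      ultimately show "r \<in> int ` A \<union> (\<lambda>m. - int m) ` A" by blast
    qed
    have "(\<Sum>r\<in>F. 1 / (1 + (of_int r)\<^sup>2)) \<le> (\<Sum>r\<in>int ` A \<union> (\<lambda>m. - int m) ` A. 1 / (1 + (of_int r)\<^sup>2 :: real))"
      using A(1) sub by (intro sum_mono2) auto
    also have "\<dots> \<le> (\<Sum>r\<in>int ` A. 1 / (1 + (of_int r)\<^sup>2)) + (\<Sum>r\<in>(\<lambda>m. - int m) ` A. 1 / (1 + (of_int r)\<^sup>2))"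
      using A(1) by (subst sum.union_inter[symmetric]) (auto intro!: sum_nonneg)
    also have "\<dots> = sum g A + sum g A"
      by (subst (1 2) sum.reindex) (auto simp: inj_on_def g_def)
    finally show ?thesis using gA by simp
  qed
  then show ?thesis by blast
qed

text \<open>Expansion at 0 makes all moments vanish, hence the sum of c_n P(a_n) for every
  polynomial P. Take P with zeros exactly at the other a_m.\<close>

lemma exponentials_independent:
  fixes a c :: "nat \<Rightarrow> complex"
  assumes F: "finite F" "inj_on a F" and 0: "\<And>z. (\<Sum>n\<in>F. c n * exp (a n * z)) = 0" and n: "n \<in> F"
  shows "c n = 0"
proof -
  have "(\<lambda>k. (\<Sum>n\<in>F. c n * a n ^ k / fact k)) = (\<lambda>k. 0)"
  proof (rule powser_unique[of 1 _ "\<lambda>z. 0"])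
    fix z :: complex
    have "(\<lambda>k. \<Sum>n\<in>F. c n * ((a n * z) ^ k /\<^sub>R fact k)) sums (\<Sum>n\<in>F. c n * exp (a n * z))"
      by (intro sums_sum sums_mult exp_converges)
    moreover have "(\<lambda>k. \<Sum>n\<in>F. c n * ((a n * z) ^ k /\<^sub>R fact k)) = (\<lambda>k. (\<Sum>n\<in>F. c n * a n ^ k / fact k) * z ^ k)"
      unfolding sum_distrib_right
      by (intro ext sum.cong refl) (simp add: power_mult_distrib scaleR_conv_of_real divide_inverse mult_ac)
    ultimately show "(\<lambda>k. (\<Sum>n\<in>F. c n * a n ^ k / fact k) * z ^ k) sums 0"
      unfolding 0 by (simp only:)
  qed auto
  note mom0 = fun_cong[OF this]
  have mom: "(\<Sum>n\<in>F. c n * a n ^ k) = 0" for k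
    using mom0[of k] by (simp flip: sum_divide_distrib)
  have pol: "(\<Sum>n\<in>F. c n * poly P (a n)) = 0" for P
  proof -
    have "(\<Sum>n\<in>F. c n * poly P (a n)) = (\<Sum>n\<in>F. \<Sum>k\<le>degree P. coeff P k * (c n * a n ^ k))"
      by (simp add: poly_altdef sum_distrib_left mult_ac)
    also have "\<dots> = (\<Sum>k\<le>degree P. coeff P k * (\<Sum>n\<in>F. c n * a n ^ k))"
      by (subst sum.swap) (simp add: sum_distrib_left)
    finally show ?thesis by (simp add: mom)
  qed
  define P where "P = (\<Prod>m\<in>F - {n}. [:- a m, 1:])"
  have P: "poly P (a m) = (if m = n then poly P (a n) else 0)" if "m \<in> F" for m
    using that F(1) by (auto simp: P_def poly_prod)
  have "poly P (a n) \<noteq> 0"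
    using F n by (auto simp: P_def poly_prod inj_on_def)
  moreover have "(\<Sum>m\<in>F. c m * poly P (a m)) = (\<Sum>m\<in>F. if m = n then c n * poly P (a n) else 0)"
    by (rule sum.cong[OF refl]) (simp add: P split: if_splits)
  then have "c n * poly P (a n) = 0" using pol[of P] F(1) n by simp
  ultimately show ?thesis by simp
qed

context holomorphy
begin

text \<open>As the dimension exceeds 1, the kernel of \<gamma>1 contains some v \<noteq> 0. A
  functional that does not vanish at v, corrected by a multiple of \<gamma>1, completes the dual
  basis.\<close>

lemma dual_plane:
  assumes g: "\<gamma>1 \<in> carrier (dual E)" "\<gamma>1 \<noteq> 0"
  shows "\<exists>\<gamma>2\<in>carrier (dual E). \<exists>x1\<in>carrier E. \<exists>x2\<in>carrier E. \<gamma>1 x1 = 1 \<and> \<gamma>1 x2 = 0 \<and> \<gamma>2 x1 = 0 \<and> \<gamma>2 x2 = 1"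
proof -
  obtain y where y: "\<gamma>1 y \<noteq> 0" using g(2) by (auto simp: fun_eq_iff)
  then have yE: "y \<in> carrier E" using dualD(3)[OF g(1)] by blast
  define x1 where "x1 = (1 / \<gamma>1 y) \<odot> y"
  have x1: "x1 \<in> carrier E" "\<gamma>1 x1 = 1" using y yE by (auto simp: x1_def dualD(2)[OF g(1)])
  have "\<exists>v\<in>carrier E. v \<noteq> \<zero> \<and> \<gamma>1 v = 0"
  proof -
    obtain a b where ab: "a \<in> carrier E" "b \<in> carrier E" "\<And>s t. s \<odot> a \<oplus> t \<odot> b = \<zero> \<Longrightarrow> s = 0 \<and> t = 0"
      using dim_gt_1 by blast
    show ?thesis
    proof (cases "\<gamma>1 a = 0")
      case True
      have "a \<noteq> \<zero>" using ab(3)[of 1 0] ab(1,2) by auto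
      then show ?thesis using True ab(1) by blast
    next
      case False
      let ?v = "\<gamma>1 b \<odot> a \<oplus> (- \<gamma>1 a) \<odot> b"
      have "?v \<noteq> \<zero>" using ab(3)[of "\<gamma>1 b" "- \<gamma>1 a"] False by auto
      moreover have "\<gamma>1 ?v = 0" using ab(1,2) by (simp add: dualD(1,2)[OF g(1)])
      ultimately show ?thesis using ab(1,2) by (intro bexI[of _ ?v]) auto
    qed
  qed
  then obtain v where v: "v \<in> carrier E" "v \<noteq> \<zero>" "\<gamma>1 v = 0" by blast
  obtain \<delta> where \<delta>: "\<delta> \<in> carrier (dual E)" "\<delta> v \<noteq> 0" using hahn_banach[OF v(1,2)] by blast
  define x2 where "x2 = (1 / \<delta> v) \<odot> v"
  define \<gamma>2 where "\<gamma>2 = \<delta> - fscale (\<delta> x1) \<gamma>1"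
  have "x2 \<in> carrier E" "\<gamma>1 x2 = 0" "\<delta> x2 = 1"
    using v \<delta> by (auto simp: x2_def dualD(2)[OF g(1)] dualD(2)[OF \<delta>(1)])
  moreover have "\<gamma>2 \<in> carrier (dual E)" unfolding \<gamma>2_def by (intro dual_diff dual_fscale g(1) \<delta>(1))
  ultimately show ?thesis using x1 by (intro bexI[of _ \<gamma>2] bexI[of _ x1] bexI[of _ x2]) (auto simp: \<gamma>2_def)
qed

text \<open>On the points t x2 + x1, P is a polynomial in t with infinitely many zeros. Homogeneity
  covers the rest of the plane except the direction x2, where P is the leading coefficient of that
  polynomial.\<close>

lemma hom_poly_zero_on_plane:
  assumes P: "P \<in> hom_poly E k" and x: "x1 \<in> carrier E" "x2 \<in> carrier E"
    and 0: "\<And>j::nat. P (of_nat j \<odot> x2 \<oplus> x1) = 0"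
  shows "P (c2 \<odot> x2 \<oplus> c1 \<odot> x1) = 0"
proof -
  define b where "b j = of_nat (k choose j) * poly_at E k P x2 j x1" for j
  have eq: "P (t \<odot> x2 \<oplus> x1) = (\<Sum>j\<le>k. b j * t ^ j)" for t
    unfolding hom_poly_binomial[OF P smult_carrier[OF x(2)] x(1)] b_def
    by (intro sum.cong refl) (simp add: poly_at_smult[OF P x(2,1)])
  have b0: "b j = 0" if "j \<le> k" for j
  proof (rule ccontr)
    assume "b j \<noteq> 0"
    then have "finite {t. (\<Sum>j\<le>k. b j * t ^ j) = 0}" unfolding polyfun_finite_roots using that by blast
    moreover have "range (of_nat :: nat \<Rightarrow> complex) \<subseteq> {t. (\<Sum>j\<le>k. b j * t ^ j) = 0}"
      using 0 eq by auto
    ultimately have "finite (range (of_nat :: nat \<Rightarrow> complex))" by (rule finite_subset[rotated])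
    then show False using infinite_UNIV_char_0 range_inj_infinite[OF inj_of_nat] by blast
  qed
  then have z: "P (t \<odot> x2 \<oplus> x1) = 0" for t unfolding eq by simp
  show ?thesis
  proof (cases "c1 = 0")
    case False
    have "c2 \<odot> x2 \<oplus> c1 \<odot> x1 = c1 \<odot> ((c2 / c1) \<odot> x2 \<oplus> x1)"
      using x False by (simp add: smult_add_right smult_smult)
    then show ?thesis using hom_poly_smult[OF P, of "(c2 / c1) \<odot> x2 \<oplus> x1" c1] x z by simp
  next
    case True
    have "P x2 = polar E k P (replicate k x2)"
      using fun_cong[OF polar(3)[OF P], of x2] x by (simp add: diag_def)
    then have "b k = P x2" using x by (simp add: b_def poly_at_def)
    then have "P x2 = 0" using b0[of k] by simp
    then show ?thesis using True x hom_poly_smult[OF P x(2), of c2] by simp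
  qed
qed

lemma closed_subspace_invariant:
  assumes \<pi>: "\<And>y. y \<in> carrier E \<Longrightarrow> \<pi> y \<in> carrier E"
  shows "closed_subspace {f \<in> H. \<forall>y\<in>carrier E. f (\<pi> y) = f y}" (is "closed_subspace ?V")
  unfolding closed_subspace_def cfun.subspace_def
proof (intro conjI ballI allI impI)
  fix f assume f: "f \<in> H" and ap: "\<forall>s>0. \<forall>e>0. \<exists>g\<in>?V. p s (g - f) < e"
  have "f (\<pi> y) = f y" if y: "y \<in> carrier E" for y
  proof -
    define s where "s = nrm E y + nrm E (\<pi> y) + 1"
    have s: "0 < s" "nrm E y \<le> s" "nrm E (\<pi> y) \<le> s"
      using nrm_nonneg[OF y] nrm_nonneg[OF \<pi>[OF y]] by (auto simp: s_def)
    have "cmod (f (\<pi> y) - f y) \<le> 0 + e" if e: "0 < e" for e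
    proof -
      obtain g where g: "g \<in> H" "g (\<pi> y) = g y" "p s (g - f) < e / 2"
        using ap s(1) e half_gt_zero y by blast
      have "cmod ((g - f) y) \<le> p s (g - f)" "cmod ((g - f) (\<pi> y)) \<le> p s (g - f)"
        using p_eval[OF H_diff[OF g(1) f] y s(2)] p_eval[OF H_diff[OF g(1) f] \<pi>[OF y] s(3)] by auto
      moreover have "f (\<pi> y) - f y = (g - f) y - (g - f) (\<pi> y)" using g(2) by simp
      ultimately show ?thesis using g(3) norm_triangle_ineq4[of "(g - f) y" "(g - f) (\<pi> y)"] by simp
    qed
    then have "cmod (f (\<pi> y) - f y) \<le> 0" by (rule field_le_epsilon)
    then show ?thesis by simp
  qed
  then show "f \<in> ?V" using f by simp
qed (auto simp: H_zero H_add H_fscale)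

lemma closed_subspace_Int:
  assumes "closed_subspace V" "closed_subspace W" shows "closed_subspace (V \<inter> W)"
proof -
  have "f \<in> V \<inter> W" if f: "f \<in> H" "\<forall>s>0. \<forall>e>0. \<exists>g\<in>V \<inter> W. p s (g - f) < e" for f
  proof
    show "f \<in> V" by (rule closed_subspaceD(3)[OF assms(1) f(1)]) (use f(2) in blast)
    show "f \<in> W" by (rule closed_subspaceD(3)[OF assms(2) f(1)]) (use f(2) in blast)
  qed
  then show ?thesis
    unfolding closed_subspace_def
    using closed_subspaceD(1,2)[OF assms(1)] closed_subspaceD(1,2)[OF assms(2)] by (auto intro: cfun.subspace_inter)
qed

end

section \<open>The frequently hypercyclic subspace\<close>

text \<open>An index j stands for a pair (l, m) of a coordinate and an orbit \<open>Y m\<close>.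
  \<open>N_tail\<close> makes the orbits of all indices up to i small at times of modulus at least
  \<open>N i\<close>; the divisor i + 1 distributes the error over these i + 1 indices.\<close>

locale fhc_construction = fhc_operator +
  fixes \<gamma>1 \<gamma>2 :: "'a \<Rightarrow> complex" and x1 x2 :: 'a and lam :: complex
    and Y :: "nat \<Rightarrow> int \<Rightarrow> 'a \<Rightarrow> complex" and N :: "nat \<Rightarrow> nat"
  assumes \<gamma>12: "\<gamma>1 \<in> carrier (dual E)" "\<gamma>2 \<in> carrier (dual E)"
    and x12: "x1 \<in> carrier E" "x2 \<in> carrier E"
    and dual_basis: "\<gamma>1 x1 = 1" "\<gamma>1 x2 = 0" "\<gamma>2 x1 = 0" "\<gamma>2 x2 = 1"
    and lam: "cmod lam < 1"
    and level: "infinite {n. \<exists>w. \<phi> (fscale w \<gamma>1 + fscale (of_real (1 / (real n + 2))) \<gamma>2) = lam}"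
    and Y: "\<And>i. bilateral (Y i)"
    and Y_dense: "\<And>f s e. f \<in> H \<Longrightarrow> 0 < s \<Longrightarrow> 0 < e \<Longrightarrow> infinite {i. p s (Y i 0 - f) < e}"
    and N: "strict_mono N" "1 \<le> N 0"
    and N_tail: "\<And>i j F. j \<le> i \<Longrightarrow> finite F \<Longrightarrow> (\<And>r. r \<in> F \<Longrightarrow> int (N i) \<le> \<bar>r\<bar>) \<Longrightarrow>
      (\<Sum>r\<in>F. p (real i + 1) (Y (snd (prod_decode j)) r)) \<le> (1 / 2) ^ i / (8 * (real i + 1))"
begin

definition Z :: "nat \<Rightarrow> int \<Rightarrow> 'a \<Rightarrow> complex" where "Z j = Y (snd (prod_decode j))"

text \<open>The projection onto the plane of x1 and x2 along the common kernel of \<gamma>1 and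
  \<gamma>2. Functions invariant under it depend on \<gamma>1 and \<gamma>2 only.\<close>

definition \<pi> :: "'a \<Rightarrow> 'a" where "\<pi> y = \<gamma>2 y \<odot> x2 \<oplus> \<gamma>1 y \<odot> x1"

definition M0 :: "('a \<Rightarrow> complex) set" where
  "M0 = {f \<in> H. T f = fscale lam f} \<inter> {f \<in> H. \<forall>y\<in>carrier E. f (\<pi> y) = f y}"

text \<open>Coordinates on \<open>M0\<close>: values of Taylor polynomials at the points \<open>j x2 + x1\<close>, scaled
  so as to be bounded by the single seminorm \<open>p 1\<close>.\<close>

definition point :: "nat \<Rightarrow> 'a" where "point j = of_nat j \<odot> x2 \<oplus> x1"

definition coeff :: "nat \<Rightarrow> ('a \<Rightarrow> complex) \<Rightarrow> complex" where
  "coeff l f = (case prod_decode l of (k, j) \<Rightarrow> tt f k (point j) / of_real (1 + nrm E (point j)) ^ k)"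

lemma \<pi>_carrier: "y \<in> carrier E \<Longrightarrow> \<pi> y \<in> carrier E"
  using x12 by (simp add: \<pi>_def)

lemma point_carrier: "point j \<in> carrier E"
  using x12 by (simp add: point_def)

lemma M0_closed: "closed_subspace M0"
  unfolding M0_def by (intro closed_subspace_Int eigenspace_closed closed_subspace_invariant \<pi>_carrier)

lemma M0_H: "f \<in> M0 \<Longrightarrow> f \<in> H"
  by (simp add: M0_def)

lemma coeff_add: "f \<in> H \<Longrightarrow> g \<in> H \<Longrightarrow> coeff l (f + g) = coeff l f + coeff l g"
  by (simp add: coeff_def tt_add add_divide_distrib split: prod.split)

lemma coeff_fscale: "f \<in> H \<Longrightarrow> coeff l (fscale c f) = c * coeff l f"
  by (simp add: coeff_def tt_fscale split: prod.split)

lemma coeff_bound: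
  assumes f: "f \<in> H" shows "cmod (coeff l f) \<le> p 1 f"
proof -
  obtain k j where l: "prod_decode l = (k, j)" by (cases "prod_decode l") auto
  have nn: "0 \<le> nrm E (point j)" by (rule nrm_nonneg[OF point_carrier])
  have "cmod (tt f k (point j)) \<le> nk k (tt f k) * nrm E (point j) ^ k"
    by (rule poly_bound[OF tt_mem[OF f] point_carrier])
  also have "\<dots> \<le> p 1 f * (1 + nrm E (point j)) ^ k"
    using p_term[OF f, of 1 k] nn p_nonneg[OF f, of 1] by (intro mult_mono power_mono) auto
  finally have "cmod (tt f k (point j)) \<le> p 1 f * (1 + nrm E (point j)) ^ k" .
  moreover have "cmod (of_real (1 + nrm E (point j)) ^ k) = (1 + nrm E (point j)) ^ k"
    unfolding norm_power norm_of_real using nn by simp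
  ultimately show ?thesis
    using nn unfolding coeff_def l prod.case norm_divide by (simp add: divide_le_eq)
qed

text \<open>By \<open>hom_poly_zero_on_plane\<close> all Taylor polynomials vanish on the plane, and
  a member of \<open>M0\<close> is determined by its values there.\<close>

lemma coeff_separates:
  assumes f: "f \<in> M0" and 0: "\<And>l. coeff l f = 0"
  shows "f = 0"
proof
  fix y
  note fH = M0_H[OF f]
  show "f y = 0 y"
  proof (cases "y \<in> carrier E")
    case True
    have "tt f k (\<pi> y) = 0" for k
      unfolding \<pi>_def
    proof (rule hom_poly_zero_on_plane[OF A_hom[OF tt_mem[OF fH]] x12])
      fix j :: nat
      have "1 + nrm E (point j) > 0" using nrm_nonneg[OF point_carrier, of j] by simp
      then have "of_real (1 + nrm E (point j)) ^ k \<noteq> (0::complex)"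
        unfolding power_eq_0_iff of_real_eq_0_iff by simp
      then show "tt f k (of_nat j \<odot> x2 \<oplus> x1) = 0"
        using 0[of "prod_encode (k, j)"]
        unfolding coeff_def prod_encode_inverse prod.case divide_eq_0_iff point_def[symmetric] by blast
    qed
    then have "f (\<pi> y) = 0" using sums_unique[OF H_sums[OF fH \<pi>_carrier[OF True]]] by simp
    then show ?thesis using f True by (simp add: M0_def)
  qed (simp add: H_outside[OF fH])
qed

section \<open>Placing the orbits in time: the operator K\<close>

definition active :: "nat \<Rightarrow> bool" where "active k \<longleftrightarrow> ruler k \<in> range N"

text \<open>The index served at position k. The positions with ruler value \<open>N j\<close> belong
  to index j, and by \<open>position_gap\<close> this value is also the distance they keep; the
  remaining positions stay empty.\<close>

definition idx :: "nat \<Rightarrow> nat" where "idx k = (THE j. N j = ruler k)"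

lemma N_inj: "N i = N j \<longleftrightarrow> i = j"
  using strict_mono_eq[OF N(1)] .

lemma idx:
  assumes "active k" shows "N (idx k) = ruler k"
proof -
  obtain j where j: "ruler k = N j" using assms by (auto simp: active_def)
  have "idx k = j" unfolding idx_def j by (rule the_equality) (simp_all add: N_inj)
  then show ?thesis using j by simp
qed

lemma idx_eq:
  assumes "ruler k = N i" shows "active k \<and> idx k = i"
proof
  show a: "active k" using assms by (simp add: active_def)
  show "idx k = i" using idx[OF a] unfolding assms N_inj .
qed

text \<open>The contribution of position k at time n without its coefficient: the orbit is delayed
  so that it passes through \<open>Z (idx k) 0\<close> exactly at time
  \<open>position k\<close>.\<close>

definition zk :: "nat \<Rightarrow> nat \<Rightarrow> 'a \<Rightarrow> complex" where
  "zk n k = (if active k then Z (idx k) (int n - int (position k)) else 0)"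

definition \<kappa> :: "('a \<Rightarrow> complex) \<Rightarrow> nat \<Rightarrow> nat \<Rightarrow> 'a \<Rightarrow> complex" where
  "\<kappa> f n k = fscale (coeff (fst (prod_decode (idx k))) f) (zk n k)"

lemma Z: "bilateral (Z j)" by (simp add: Z_def Y)

lemma zk_H: "zk n k \<in> H"
  by (simp add: zk_def H_zero bilateralD(1)[OF Z])

lemma \<kappa>_H: "\<kappa> f n k \<in> H"
  unfolding \<kappa>_def by (rule H_fscale[OF zk_H])

lemma T_zk: "T (zk n k) = zk (Suc n) k"
  by (simp add: zk_def T_zero bilateralD(2)[OF Z] algebra_simps)

lemma T_\<kappa>: "T (\<kappa> f n k) = \<kappa> f (Suc n) k"
  unfolding \<kappa>_def T_fscale[OF zk_H] T_zk ..

lemma p_\<kappa>: "f \<in> H \<Longrightarrow> 0 \<le> s \<Longrightarrow> p s (\<kappa> f n k) \<le> p 1 f * p s (zk n k)"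
  unfolding \<kappa>_def using mult_right_mono[OF coeff_bound p_nonneg[OF zk_H]] by (simp add: p_fscale[OF zk_H])

text \<open>The positions are grouped by index j. For j \<le> i the distance \<open>N i\<close> is
  used, and these i + 1 groups contribute 2^(-i) / 8 in all; for j > i the distance
  \<open>ruler k\<close>, which is \<open>N j\<close>, is used, and the groups add up to at most
  2^(-i) / 8 again.\<close>

lemma zk_estimate:
  assumes G: "finite G" and act: "\<And>k. k \<in> G \<Longrightarrow> active k"
    and far: "\<And>k. k \<in> G \<Longrightarrow> int (ruler k) \<le> \<bar>int n - int (position k)\<bar>"
      "\<And>k. k \<in> G \<Longrightarrow> int (N i) \<le> \<bar>int n - int (position k)\<bar>"
  shows "(\<Sum>k\<in>G. p (real i + 1) (zk n k)) \<le> (1 / 2) ^ i / 4"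
proof -
  let ?r = "\<lambda>k. int n - int (position k)"
  define b where "b j = (if j \<le> i then (1 / 2) ^ i / (8 * (real i + 1)) else (1 / 2) ^ j / 8)" for j
  define J where "J = {..i} \<union> idx ` G"
  have fJ: "finite J" using G by (simp add: J_def)
  have inj: "inj_on ?r A" for A
    using position_less by (auto simp: inj_on_def) (metis nat_neq_iff less_irrefl)
  have part: "(\<Sum>k\<in>{k \<in> G. idx k = j}. p (real i + 1) (zk n k)) \<le> b j" for j
  proof -
    let ?G = "{k \<in> G. idx k = j}" and ?m = "max i j"
    have "(\<Sum>k\<in>?G. p (real i + 1) (zk n k)) \<le> (\<Sum>k\<in>?G. p (real ?m + 1) (zk n k))"
      by (intro sum_mono p_mono zk_H) auto
    also have "\<dots> = (\<Sum>k\<in>?G. p (real ?m + 1) (Y (snd (prod_decode j)) (?r k)))"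
      by (intro sum.cong refl) (auto simp: zk_def Z_def act)
    also have "\<dots> = (\<Sum>r\<in>?r ` ?G. p (real ?m + 1) (Y (snd (prod_decode j)) r))"
      by (simp add: sum.reindex[OF inj])
    also have "\<dots> \<le> (1 / 2) ^ ?m / (8 * (real ?m + 1))"
    proof (rule N_tail)
      fix r assume "r \<in> ?r ` ?G"
      then obtain k where k: "k \<in> G" "idx k = j" "r = ?r k" by auto
      have "N j = ruler k" using idx[OF act[OF k(1)]] k(2) by simp
      then show "int (N ?m) \<le> \<bar>r\<bar>" using far[OF k(1)] k(3) by (simp add: max_def)
    qed (use G in auto)
    also have "\<dots> \<le> b j"
    proof (cases "j \<le> i")
      case False
      then have "?m = j" by simp
      moreover have "(1 / 2) ^ j / (8 * (real j + 1)) \<le> (1 / 2 :: real) ^ j / 8"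
        by (intro divide_left_mono) auto
      ultimately show ?thesis using False by (simp add: b_def)
    qed (simp add: b_def max_def)
    finally show ?thesis .
  qed
  have "(\<Sum>k\<in>G. p (real i + 1) (zk n k)) = (\<Sum>j\<in>J. \<Sum>k\<in>{k \<in> G. idx k = j}. p (real i + 1) (zk n k))"
    by (rule sum.group[symmetric, OF G fJ]) (auto simp: J_def)
  also have "\<dots> \<le> (\<Sum>j\<in>J. b j)" by (intro sum_mono part)
  also have "\<dots> = (\<Sum>j\<in>{..i}. b j) + (\<Sum>j\<in>J - {..i}. b j)"
    using fJ by (subst sum.subset_diff[of "{..i}" J]) (auto simp: J_def)
  also have "(\<Sum>j\<in>{..i}. b j) = (1 / 2) ^ i / 8"
  proof -
    have "(\<Sum>j\<in>{..i}. b j) = (real i + 1) * ((1 / 2) ^ i / (8 * (real i + 1)))"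
      by (simp add: b_def add.commute)
    moreover have "x * (a / (8 * x)) = a / 8" if "x \<noteq> 0" for x a :: real using that by simp
    ultimately show ?thesis by (metis of_nat_0_le_iff add_nonneg_eq_0_iff zero_le_one zero_neq_one)
  qed
  also have "(\<Sum>j\<in>J - {..i}. b j) \<le> (1 / 2) ^ i / 8"
  proof -
    have geo: "(\<lambda>m. (1 / 2) ^ (m + Suc i) / 8) sums ((1 / 2 :: real) ^ i / 8)"
      using sums_mult[OF geometric_sums[of "1/2 :: real"], of "(1 / 2) ^ Suc i / 8"]
      by (simp add: power_add mult_ac)
    have "(\<Sum>j\<in>J - {..i}. b j) = (\<Sum>j\<in>J - {..i}. (1 / 2) ^ j / 8)"
      by (intro sum.cong) (auto simp: b_def)
    also have "\<dots> = (\<Sum>m\<in>(\<lambda>j. j - Suc i) ` (J - {..i}). (1 / 2) ^ (m + Suc i) / 8)"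
    proof -
      have inj: "inj_on (\<lambda>j. j - Suc i) (J - {..i})" by (intro inj_onI) (simp add: eq_diff_iff)
      have "j - Suc i + Suc i = j" if "j \<in> J - {..i}" for j using that by simp
      then show ?thesis unfolding sum.reindex[OF inj] o_def by (intro sum.cong refl) (simp only:)
    qed
    also have "\<dots> \<le> (\<Sum>m. (1 / 2) ^ (m + Suc i) / 8)"
      using fJ sums_summable[OF geo] by (intro sum_le_suminf) auto
    also have "\<dots> = (1 / 2) ^ i / 8" by (rule sums_unique[OF geo, symmetric])
    finally show ?thesis .
  qed
  finally show ?thesis by simp
qed

lemma position_ge: "k \<le> position k"
proof (induction k)
  case (Suc k)
  then show ?case using position_less[of k "Suc k"] by simp
qed simp

lemma zk_sum_0:
  assumes "finite G" "\<And>k. k \<in> G \<Longrightarrow> N i \<le> position k"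
  shows "(\<Sum>k\<in>G. p (real i + 1) (zk 0 k)) \<le> (1 / 2) ^ i / 4"
proof -
  have "(\<Sum>k\<in>G. p (real i + 1) (zk 0 k)) = (\<Sum>k\<in>{k \<in> G. active k}. p (real i + 1) (zk 0 k))"
    by (rule sum.mono_neutral_right) (use assms(1) in \<open>auto simp: zk_def\<close>)
  also have "\<dots> \<le> (1 / 2) ^ i / 4"
    by (rule zk_estimate) (use assms ruler_le_position in auto)
  finally show ?thesis .
qed

lemma zk_0_summable:
  assumes s: "0 < s" shows "summable (\<lambda>k. p s (zk 0 k))"
proof -
  define i where "i = nat \<lceil>s\<rceil>"
  have si: "s \<le> real i + 1" unfolding i_def by linarith
  have "summable (\<lambda>k. p s (zk 0 (k + N i)))"
  proof (rule summableI_nonneg_bounded)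
    show "0 \<le> p s (zk 0 (k + N i))" for k using p_nonneg[OF zk_H] s by simp
    fix K
    have "(\<Sum>k<K. p s (zk 0 (k + N i))) \<le> (\<Sum>k<K. p (real i + 1) (zk 0 (k + N i)))"
      using si s by (intro sum_mono p_mono zk_H) auto
    also have "\<dots> = (\<Sum>k\<in>(\<lambda>k. k + N i) ` {..<K}. p (real i + 1) (zk 0 k))"
      by (subst sum.reindex) (auto simp: inj_on_def)
    also have "\<dots> \<le> (1 / 2) ^ i / 4"
      by (rule zk_sum_0) (auto intro: order.trans[OF _ position_ge])
    finally show "(\<Sum>k<K. p s (zk 0 (k + N i))) \<le> (1 / 2) ^ i / 4" .
  qed
  then show ?thesis using summable_iff_shift[of "\<lambda>k. p s (zk 0 k)" "N i"] by simp
qed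

text \<open>Every occupied position is at least \<open>N 0\<close>, so the estimate for i = 0 covers
  the whole series. The value 1/4 makes K a contraction for \<open>p 1\<close>.\<close>

lemma zk_0_sum_le: "(\<Sum>k. p 1 (zk 0 k)) \<le> 1 / 4"
proof -
  have "(\<Sum>k<K. p 1 (zk 0 k)) \<le> 1 / 4" for K
  proof -
    have "(\<Sum>k<K. p 1 (zk 0 k)) = (\<Sum>k\<in>{k \<in> {..<K}. active k}. p 1 (zk 0 k))"
      by (rule sum.mono_neutral_right) (auto simp: zk_def)
    also have "\<dots> \<le> 1 / 4"
    proof -
      have "N 0 \<le> position k" if "active k" for k
      proof -
        have "N 0 \<le> N (idx k)" using N(1) by (simp add: strict_mono_less_eq)
        then show ?thesis using idx[OF that] ruler_le_position[of k] by simp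
      qed
      then show ?thesis using zk_sum_0[of "{k \<in> {..<K}. active k}" 0] by simp
    qed
    finally show ?thesis .
  qed
  then show ?thesis by (intro suminf_le_const zk_0_summable) auto
qed

definition K :: "('a \<Rightarrow> complex) \<Rightarrow> 'a \<Rightarrow> complex" where "K f = (\<lambda>y. \<Sum>k. \<kappa> f 0 k y)"

lemma \<kappa>_0_summable:
  assumes f: "f \<in> H" and s: "0 < s" shows "summable (\<lambda>k. p s (\<kappa> f 0 k))"
  by (rule summable_comparison_test'[OF summable_mult[OF zk_0_summable[OF s], of "p 1 f"]])
    (use p_\<kappa>[OF f] p_nonneg[OF \<kappa>_H] s in simp)

lemma T_power_K:
  assumes f: "f \<in> H"
  shows "(\<forall>s>0. summable (\<lambda>k. p s (\<kappa> f n k))) \<and> (T ^^ n) (K f) = (\<lambda>y. \<Sum>k. \<kappa> f n k y)"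
proof (induction n)
  case 0
  then show ?case using \<kappa>_0_summable[OF f] by (simp add: K_def)
next
  case (Suc n)
  then have sm: "summable (\<lambda>k. p s (\<kappa> f n k))" if "0 < s" for s using that by blast
  have "(T ^^ Suc n) (K f) = T (\<lambda>y. \<Sum>k. \<kappa> f n k y)" using Suc by simp
  also have "\<dots> = (\<lambda>y. \<Sum>k. \<kappa> f (Suc n) k y)"
    using T_series(2)[of "\<kappa> f n", OF \<kappa>_H sm] by (simp add: T_\<kappa>)
  finally show ?case
    using T_series(1)[of "\<kappa> f n", OF \<kappa>_H sm] by (simp add: T_\<kappa>)
qed

lemma K_H: "f \<in> H \<Longrightarrow> K f \<in> H"
  unfolding K_def by (rule H_series(1)[OF \<kappa>_H \<kappa>_0_summable])

lemma K_sums: "f \<in> H \<Longrightarrow> (\<lambda>k. \<kappa> f 0 k y) sums K f y"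
  unfolding K_def by (rule H_series(3)[OF \<kappa>_H \<kappa>_0_summable])

lemma K_add:
  assumes f: "f \<in> H" and g: "g \<in> H" shows "K (f + g) = K f + K g"
proof
  fix y
  have "(\<lambda>k. \<kappa> (f + g) 0 k y) sums (K f y + K g y)"
    using sums_add[OF K_sums[OF f] K_sums[OF g], of y y] by (simp add: \<kappa>_def coeff_add[OF f g] distrib_right)
  from sums_unique2[OF this K_sums[OF H_add[OF f g]]] show "K (f + g) y = (K f + K g) y" by simp
qed

lemma K_fscale:
  assumes f: "f \<in> H" shows "K (fscale c f) = fscale c (K f)"
proof
  fix y
  have "(\<lambda>k. \<kappa> (fscale c f) 0 k y) sums (c * K f y)"
    using sums_mult[OF K_sums[OF f], of c y] by (simp add: \<kappa>_def coeff_fscale[OF f] mult.assoc)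
  from sums_unique2[OF this K_sums[OF H_fscale[OF f]]] show "K (fscale c f) y = fscale c (K f) y" by simp
qed

lemma K_zero: "K 0 = 0"
  using K_fscale[OF H_zero, of 0] by simp

lemma K_diff: "f \<in> H \<Longrightarrow> g \<in> H \<Longrightarrow> K (f - g) = K f - K g"
  unfolding diff_fscale by (simp only: K_add K_fscale H_fscale)

text \<open>K is bounded from the single norm \<open>p 1\<close> into every seminorm, because the
  coordinates are bounded by \<open>p 1\<close>. The closedness of \<open>M\<close> rests on
  this.\<close>

lemma K_bound:
  assumes f: "f \<in> H" and s: "0 < s"
  shows "p s (K f) \<le> p 1 f * (\<Sum>k. p s (zk 0 k))"
proof -
  have "p s (K f - (\<Sum>k<0. \<kappa> f 0 k)) \<le> (\<Sum>k. p s (\<kappa> f 0 (k + 0)))"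
    unfolding K_def by (rule H_series(2)[of "\<kappa> f 0", OF \<kappa>_H \<kappa>_0_summable[OF f] s])
  then have "p s (K f) \<le> (\<Sum>k. p s (\<kappa> f 0 k))" by simp
  also have "\<dots> \<le> (\<Sum>k. p 1 f * p s (zk 0 k))"
    using s by (intro suminf_le p_\<kappa> f \<kappa>_0_summable summable_mult zk_0_summable) auto
  also have "\<dots> = p 1 f * (\<Sum>k. p s (zk 0 k))" by (rule suminf_mult[OF zk_0_summable[OF s]])
  finally show ?thesis .
qed

text \<open>I + K is bounded below for \<open>p 1\<close> because K has norm at most 1/4 there; the
  factor 4/3 is rounded up to 2.\<close>

lemma K_lower:
  assumes f: "f \<in> H" shows "p 1 f \<le> 2 * p 1 (f + K f)"
proof -
  have "p 1 (K f) \<le> p 1 f * (1 / 4)"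
    by (rule order.trans[OF K_bound[OF f zero_less_one] mult_left_mono[OF zk_0_sum_le p_nonneg[OF f]]]) simp
  moreover have "p 1 ((f + K f) - K f) \<le> p 1 (f + K f) + p 1 (K f)"
    by (rule p_diff_le[OF H_add[OF f K_H[OF f]] K_H[OF f]]) simp
  moreover have "(f + K f) - K f = f" by simp
  ultimately show ?thesis using p_nonneg[OF f, of 1] by simp
qed

text \<open>At time \<open>position k0\<close> the summand k0 is exactly the multiple of
  \<open>Z i 0\<close>. Every other position is at distance at least \<open>ruler k + N i\<close> by
  \<open>position_gap\<close>, so \<open>zk_estimate\<close> bounds the rest.\<close>

lemma T_power_K_approx:
  assumes f: "f \<in> H" and k0: "ruler k0 = N i"
  shows "p (real i + 1) ((T ^^ position k0) (K f) - fscale (coeff (fst (prod_decode i)) f) (Z i 0)) \<le> p 1 f * ((1 / 2) ^ i / 4)"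
proof -
  let ?n = "position k0"
  define g where "g k = (if k = k0 then 0 else \<kappa> f ?n k)" for k
  have gH: "g k \<in> H" for k by (simp add: g_def H_zero \<kappa>_H)
  have sm: "summable (\<lambda>k. p s (\<kappa> f ?n k))" if "0 < s" for s using T_power_K[OF f, of ?n] that by blast
  have smg: "summable (\<lambda>k. p s (g k))" if s: "0 < s" for s
    by (rule summable_comparison_test'[OF sm[OF s]]) (use p_nonneg[OF \<kappa>_H] s in \<open>auto simp: g_def\<close>)
  have \<kappa>0: "\<kappa> f ?n k0 = fscale (coeff (fst (prod_decode i)) f) (Z i 0)"
    using idx_eq[OF k0] by (simp add: \<kappa>_def zk_def)
  have "(T ^^ ?n) (K f) - \<kappa> f ?n k0 = (\<lambda>y. \<Sum>k. g k y)"
  proof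
    fix y
    have "(\<lambda>k. \<kappa> f ?n k y) sums (\<Sum>k. \<kappa> f ?n k y)" by (rule H_series(3)[OF \<kappa>_H sm])
    from sums_diff[OF this sums_single[of k0 "\<lambda>k. \<kappa> f ?n k y"]]
    have "(\<lambda>k. g k y) sums ((\<Sum>k. \<kappa> f ?n k y) - \<kappa> f ?n k0 y)"
      by (rule sums_cong[THEN iffD1, rotated]) (simp add: g_def)
    from sums_unique[OF this] show "((T ^^ ?n) (K f) - \<kappa> f ?n k0) y = (\<Sum>k. g k y)"
      using T_power_K[OF f, of ?n] by simp
  qed
  moreover have "p (real i + 1) (\<lambda>y. \<Sum>k. g k y) \<le> p 1 f * ((1 / 2) ^ i / 4)"
  proof -
    have s: "0 < real i + 1" by simp
    have "p (real i + 1) ((\<lambda>y. \<Sum>k. g k y) - (\<Sum>k<0. g k)) \<le> (\<Sum>k. p (real i + 1) (g (k + 0)))"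
      by (rule H_series(2)[of g, OF gH smg s])
    then have "p (real i + 1) (\<lambda>y. \<Sum>k. g k y) \<le> (\<Sum>k. p (real i + 1) (g k))" by simp
    also have "\<dots> \<le> p 1 f * ((1 / 2) ^ i / 4)"
    proof (rule suminf_le_const[OF smg[OF s]])
      fix m
      define G where "G = {k \<in> {..<m}. active k \<and> k \<noteq> k0}"
      have "(\<Sum>k<m. p (real i + 1) (g k)) = (\<Sum>k\<in>G. p (real i + 1) (g k))"
        by (rule sum.mono_neutral_right) (auto simp: G_def g_def \<kappa>_def zk_def)
      also have "\<dots> \<le> (\<Sum>k\<in>G. p 1 f * p (real i + 1) (zk ?n k))"
        by (intro sum_mono) (auto simp: G_def g_def intro!: p_\<kappa> f)
      also have "\<dots> = p 1 f * (\<Sum>k\<in>G. p (real i + 1) (zk ?n k))" by (simp add: sum_distrib_left)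
      also have "\<dots> \<le> p 1 f * ((1 / 2) ^ i / 4)"
      proof (intro mult_left_mono zk_estimate)
        have gap: "int (ruler k) + int (N i) \<le> \<bar>int ?n - int (position k)\<bar>" if "k \<in> G" for k
        proof -
          have "k < k0 \<or> k0 < k" using that by (auto simp: G_def)
          then show ?thesis using position_gap[of k k0] position_gap[of k0 k] k0 by auto
        qed
        show "int (ruler k) \<le> \<bar>int ?n - int (position k)\<bar>" "int (N i) \<le> \<bar>int ?n - int (position k)\<bar>"
          if "k \<in> G" for k using gap[OF that] by linarith+
      qed (auto simp: G_def p_nonneg f)
      finally show "(\<Sum>k<m. p (real i + 1) (g k)) \<le> p 1 f * ((1 / 2) ^ i / 4)" .
    qed
    finally show ?thesis .
  qed
  ultimately show ?thesis by (simp only: \<kappa>0)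
qed

section \<open>Frequent hypercyclicity of f + K f\<close>

lemma T_power_H: "f \<in> H \<Longrightarrow> (T ^^ n) f \<in> H"
  by (induction n) (auto simp: T_H)

lemma T_power_add: "f \<in> H \<Longrightarrow> g \<in> H \<Longrightarrow> (T ^^ n) (f + g) = (T ^^ n) f + (T ^^ n) g"
  by (induction n) (simp_all only: funpow.simps id_apply o_apply T_add T_power_H)

lemma T_power_M0: "f \<in> M0 \<Longrightarrow> (T ^^ n) f = fscale (lam ^ n) f"
proof (induction n)
  case (Suc n)
  have "(T ^^ Suc n) f = T ((T ^^ n) f)" by simp
  also have "\<dots> = T (fscale (lam ^ n) f)" by (simp only: Suc.IH[OF Suc.prems])
  also have "\<dots> = fscale (lam ^ n) (fscale lam f)"
    using Suc.prems T_fscale[OF M0_H[OF Suc.prems]] by (simp add: M0_def)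
  finally show ?case by (simp add: fun_eq_iff mult_ac)
qed simp

text \<open>Some coordinate a = \<open>coeff l f\<close> is nonzero. If \<open>Y m 0\<close> is
  close to u / a, then a times it is close to u; the pair (l, m) is an index i, and the visiting
  times are the positions with ruler value \<open>N i\<close>. The error consists of three parts
  below r / 3.\<close>

lemma frequently_hypercyclic_vector:
  assumes f: "f \<in> M0" "f \<noteq> 0"
  shows "frequently_hypercyclic \<tau> T (f + K f)"
  unfolding frequently_hypercyclic_def
proof (intro conjI allI impI)
  note fH = M0_H[OF f(1)]
  show "f + K f \<in> topspace \<tau>" unfolding topspace_H by (rule H_add[OF fH K_H[OF fH]])
  obtain l where l: "coeff l f \<noteq> 0" using coeff_separates[OF f(1)] f(2) by blast
  fix U assume U: "openin \<tau> U \<and> U \<noteq> {}"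
  then obtain u where u: "u \<in> U" by blast
  have uH: "u \<in> H" using openin_subset_H U u by blast
  obtain s r where sr: "0 < s" "0 < r" "pball s r u \<subseteq> U" using openin_contains_pball[of U u] U u by blast
  define a where "a = coeff l f"
  have a: "0 < cmod a" using l by (simp add: a_def)
  have uaH: "fscale (1 / a) u \<in> H" by (rule H_fscale[OF uH])
  have r3: "0 < r / 3" using sr(2) by simp
  have "(\<lambda>i. p 1 f * ((1 / 2) ^ i / 4)) \<longlonglongrightarrow> 0"
    by (intro tendsto_mult_right_zero tendsto_divide_zero LIMSEQ_power_zero) simp
  then have "\<forall>\<^sub>F i in sequentially. p 1 f * ((1 / 2) ^ i / 4) < r / 3" by (rule order_tendstoD(2)[OF _ r3])
  then obtain i1 where i1: "\<And>i. i1 \<le> i \<Longrightarrow> p 1 f * ((1 / 2) ^ i / 4) < r / 3"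
    by (auto simp: eventually_sequentially)
  define i0 where "i0 = max i1 (nat \<lceil>s\<rceil>)"
  \<comment> \<open>Infinitely many m are available, so the index can be taken beyond
    \<open>i0\<close>, where the error is small and \<open>p s\<close> is dominated by
    \<open>p (real i + 1)\<close>.\<close>
  have "infinite ((\<lambda>m. prod_encode (l, m)) ` {m. p s (Y m 0 - fscale (1 / a) u) < r / (3 * cmod a)})"
    using Y_dense[OF uaH sr(1), of "r / (3 * cmod a)"] sr(2) a
    by (subst finite_image_iff) (auto simp: inj_on_def)
  then obtain m where m: "p s (Y m 0 - fscale (1 / a) u) < r / (3 * cmod a)" "i0 < prod_encode (l, m)"
    unfolding infinite_nat_iff_unbounded by blast
  define i where "i = prod_encode (l, m)"
  have i: "prod_decode i = (l, m)" "i1 \<le> i" "s \<le> real i + 1"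
    using m(2) by (auto simp: i_def i0_def) linarith
  have Zi: "Z i 0 \<in> H" by (rule bilateralD(1)[OF Z])
  have 3: "p s (fscale a (Z i 0) - u) < r / 3"
  proof -
    have "fscale a (Z i 0) - u = fscale a (Y m 0 - fscale (1 / a) u)"
      using a by (auto simp: Z_def i fun_eq_iff algebra_simps)
    then have "p s (fscale a (Z i 0) - u) = cmod a * p s (Y m 0 - fscale (1 / a) u)"
      using p_fscale[OF H_diff[OF bilateralD(1)[OF Y] uaH], of s a m 0] sr(1) by simp
    also have "\<dots> < cmod a * (r / (3 * cmod a))" using m(1) a by (intro mult_strict_left_mono)
    also have "\<dots> = r / 3" using a by simp
    finally show ?thesis .
  qed
  have "(\<lambda>n. cmod lam ^ n * p s f) \<longlonglongrightarrow> 0"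
    using lam by (intro tendsto_mult_left_zero LIMSEQ_power_zero) simp
  then have "\<forall>\<^sub>F n in sequentially. cmod lam ^ n * p s f < r / 3" by (rule order_tendstoD(2)[OF _ r3])
  then obtain n0 where n0: "\<And>n. n0 \<le> n \<Longrightarrow> cmod lam ^ n * p s f < r / 3" by (auto simp: eventually_sequentially)
  show "0 < lower_density {n. (T ^^ n) (f + K f) \<in> U}"
  proof (rule position_density[of "N i" n0])
    have "N 0 \<le> N i" using N(1) by (simp add: strict_mono_less_eq)
    then show "1 \<le> N i" using N(2) by simp
    fix k assume k: "n0 \<le> k" "ruler k = N i"
    let ?n = "position k" and ?a = "fscale a (Z i 0)"
    have TK: "(T ^^ ?n) (K f) \<in> H" by (rule T_power_H[OF K_H[OF fH]])
    have aH: "?a \<in> H" by (rule H_fscale[OF Zi])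
    have eq: "(T ^^ ?n) (f + K f) - u = fscale (lam ^ ?n) f + (((T ^^ ?n) (K f) - ?a) + (?a - u))"
      unfolding T_power_add[OF fH K_H[OF fH]] T_power_M0[OF f(1)] by simp
    have s0: "0 \<le> s" using sr(1) by simp
    have h1: "p s (((T ^^ ?n) (K f) - ?a) + (?a - u)) \<le> p s ((T ^^ ?n) (K f) - ?a) + p s (?a - u)"
      by (rule p_triangle[OF H_diff[OF TK aH] H_diff[OF aH uH] s0])
    have h2: "p s ((T ^^ ?n) (f + K f) - u) \<le> p s (fscale (lam ^ ?n) f) + p s (((T ^^ ?n) (K f) - ?a) + (?a - u))"
      unfolding eq by (rule p_triangle[OF H_fscale[OF fH] H_add[OF H_diff[OF TK aH] H_diff[OF aH uH]] s0])
    have h3: "p s (fscale (lam ^ ?n) f) = cmod lam ^ ?n * p s f"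
      using p_fscale[OF fH s0, of "lam ^ ?n"] by (simp add: norm_power)
    have h4: "cmod lam ^ ?n * p s f < r / 3" using k(1) position_ge[of k] by (intro n0) simp
    have h5: "p s ((T ^^ ?n) (K f) - ?a) \<le> p (real i + 1) ((T ^^ ?n) (K f) - ?a)"
      by (rule p_mono[OF H_diff[OF TK aH] s0 i(3)])
    have h6: "p (real i + 1) ((T ^^ ?n) (K f) - ?a) \<le> p 1 f * ((1 / 2) ^ i / 4)"
      using T_power_K_approx[OF fH k(2)] unfolding i(1) fst_conv a_def .
    have "p s ((T ^^ ?n) (f + K f) - u) < r" using h1 h2 h3 h4 h5 h6 i1[OF i(2)] 3 by linarith
    moreover have "(T ^^ ?n) (f + K f) \<in> H" by (rule T_power_H[OF H_add[OF fH K_H[OF fH]]])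
    ultimately show "?n \<in> {n. (T ^^ n) (f + K f) \<in> U}" using sr(3) by (auto simp: pball_def)
  qed
qed

section \<open>The range of I + K on \<open>M0\<close>\<close>

definition M :: "('a \<Rightarrow> complex) set" where "M = (\<lambda>f. f + K f) ` M0"

lemma M_subspace: "cfun.subspace M"
  unfolding cfun.subspace_def
proof (intro conjI ballI allI)
  note sub = closed_subspaceD(2)[OF M0_closed]
  have "0 \<in> M0" by (rule cfun.subspace_0[OF sub])
  then show "0 \<in> M" unfolding M_def by (intro image_eqI[of _ _ 0]) (simp_all add: K_zero)
  fix h h' assume h: "h \<in> M" and h': "h' \<in> M"
  obtain f where f: "f \<in> M0" "h = f + K f" using h by (auto simp: M_def)
  obtain g where g: "g \<in> M0" "h' = g + K g" using h' by (auto simp: M_def)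
  show "h + h' \<in> M" unfolding M_def
    by (intro image_eqI[of _ _ "f + g"] cfun.subspace_add[OF sub] f g)
      (simp add: f g K_add[OF M0_H[OF f(1)] M0_H[OF g(1)]])
next
  note sub = closed_subspaceD(2)[OF M0_closed]
  fix c h assume h: "h \<in> M"
  obtain f where f: "f \<in> M0" "h = f + K f" using h by (auto simp: M_def)
  show "fscale c h \<in> M" unfolding M_def
    by (intro image_eqI[of _ _ "fscale c f"] cfun.subspace_scale[OF sub] f)
      (simp add: f K_fscale[OF M0_H[OF f(1)]] fun_eq_iff algebra_simps)
qed

text \<open>If f_m + K f_m tends to h fast, then \<open>K_lower\<close> makes the differences d_m
  summable for \<open>p 1\<close>. From d = (d + K d) - K d and \<open>K_bound\<close> they are
  summable for every seminorm. The limit is compared with h in \<open>p 1\<close> only, which is a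
  norm.\<close>

lemma M_closed: "closedin \<tau> M"
proof (rule closedinI)
  show "M \<subseteq> H" unfolding M_def using M0_H K_H H_add by blast
  fix h assume h: "h \<in> H" and ap: "\<And>s e. 0 < s \<Longrightarrow> 0 < e \<Longrightarrow> \<exists>g\<in>M. p s (g - h) < e"
  note sub = closed_subspaceD(2)[OF M0_closed]
  have "\<exists>f\<in>M0. p (real m + 1) ((f + K f) - h) < (1 / 2) ^ m" for m
    using ap[of "real m + 1" "(1 / 2) ^ m"] by (auto simp: M_def)
  then obtain f where f: "\<And>m. f m \<in> M0" "\<And>m. p (real m + 1) ((f m + K (f m)) - h) < (1 / 2) ^ m" by metis
  have fH: "f m \<in> H" for m by (rule M0_H[OF f(1)])
  have LH: "f m + K (f m) \<in> H" for m by (intro H_add fH K_H)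
  define d where "d m = f (Suc m) - f m" for m
  have dM: "d m \<in> M0" for m unfolding d_def by (rule cfun.subspace_diff[OF sub f(1) f(1)])
  have dH: "d m \<in> H" for m by (rule M0_H[OF dM])
  have Ld: "p s (d m + K (d m)) \<le> 2 * (1 / 2) ^ m" if s: "0 < s" "s \<le> real m + 1" for s m
  proof -
    have "d m + K (d m) = ((f (Suc m) + K (f (Suc m))) - (f m + K (f m)))"
      unfolding d_def K_diff[OF fH fH] by simp
    then have "p s (d m + K (d m)) \<le> p s ((f (Suc m) + K (f (Suc m))) - h) + p s (h - (f m + K (f m)))"
      using p_triangle_diff[OF LH h LH, of s "Suc m" m] s by simp
    moreover have "p s ((f (Suc m) + K (f (Suc m))) - h) \<le> p (real (Suc m) + 1) ((f (Suc m) + K (f (Suc m))) - h)"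
      using s by (intro p_mono H_diff LH h) auto
    moreover have "p s (h - (f m + K (f m))) = p s ((f m + K (f m)) - h)" using s by (intro p_diff_commute h LH) auto
    moreover have "p s ((f m + K (f m)) - h) \<le> p (real m + 1) ((f m + K (f m)) - h)"
      using s by (intro p_mono H_diff LH h) auto
    moreover have "(1 / 2 :: real) ^ Suc m \<le> (1 / 2) ^ m" by simp
    ultimately show ?thesis using f(2)[of m] f(2)[of "Suc m"] by linarith
  qed
  have d1: "p 1 (d m) \<le> 4 * (1 / 2) ^ m" for m using K_lower[OF dH, of m] Ld[of 1 m] by simp
  have smd: "summable (\<lambda>m. p s (d m))" if s: "0 < s" for s
  proof (rule summable_comparison_test'[where N="nat \<lceil>s\<rceil>"])
    define C where "C = (\<Sum>k. p s (zk 0 k))"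
    have C: "0 \<le> C" unfolding C_def using s p_nonneg[OF zk_H] by (intro suminf_nonneg zk_0_summable) auto
    show "summable (\<lambda>m. (2 + 4 * C) * (1 / 2) ^ m)" by (intro summable_mult summable_geometric) simp
    fix m assume m: "nat \<lceil>s\<rceil> \<le> m"
    then have sm: "s \<le> real m + 1" by linarith
    have dd: "(d m + K (d m)) - K (d m) = d m" by simp
    have "p s ((d m + K (d m)) - K (d m)) \<le> p s (d m + K (d m)) + p s (K (d m))"
      using s by (intro p_diff_le H_add dH K_H) auto
    then have t1: "p s (d m) \<le> p s (d m + K (d m)) + p s (K (d m))" unfolding dd .
    have t2: "p s (K (d m)) \<le> p 1 (d m) * C" unfolding C_def by (rule K_bound[OF dH s])
    have t3: "p 1 (d m) * C \<le> 4 * (1 / 2) ^ m * C" by (rule mult_right_mono[OF d1 C])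
    have t4: "(2 + 4 * C) * (1 / 2) ^ m = 2 * (1 / 2) ^ m + 4 * (1 / 2) ^ m * C" by (simp add: algebra_simps)
    have "p s (d m) \<le> (2 + 4 * C) * (1 / 2) ^ m" using t1 t2 t3 t4 Ld[OF s sm] by linarith
    then show "norm (p s (d m)) \<le> (2 + 4 * C) * (1 / 2) ^ m" using p_nonneg[OF dH] s by simp
  qed
  define F where "F = (\<lambda>x. \<Sum>m. d m x)"
  have FM: "F \<in> M0" unfolding F_def by (rule closed_subspace_series[OF M0_closed dM smd])
  define g where "g = f 0 + F"
  have gM: "g \<in> M0" unfolding g_def by (rule cfun.subspace_add[OF sub f(1) FM])
  note gH = M0_H[OF gM]
  have "(\<Sum>m<n. d m) = f n - f 0" for n unfolding d_def by (rule sum_lessThan_telescope)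
  then have gf: "g - f n = F - (\<Sum>m<n. d m)" for n by (simp add: g_def)
  have gn: "p 1 (g - f n) \<le> (\<Sum>m. p 1 (d (m + n)))" for n
    unfolding gf F_def by (rule H_series(2)[of d, OF dH smd zero_less_one])
  have Lg: "g + K g \<in> H" by (intro H_add gH K_H)
  have bound: "p 1 ((g + K g) - h) \<le> 2 * (\<Sum>m. p 1 (d (m + n))) + (1 / 2) ^ n" for n
  proof -
    have gnH: "g - f n \<in> H" by (rule H_diff[OF gH fH])
    have eq: "(g + K g) - (f n + K (f n)) = (g - f n) + K (g - f n)"
      unfolding K_diff[OF gH fH] by simp
    have "p 1 ((g + K g) - h) \<le> p 1 ((g + K g) - (f n + K (f n))) + p 1 ((f n + K (f n)) - h)"
      by (rule p_triangle_diff[OF Lg LH h]) simp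
    moreover have "p 1 ((g + K g) - (f n + K (f n))) \<le> p 1 (g - f n) + p 1 (K (g - f n))"
      unfolding eq by (rule p_triangle[OF gnH K_H[OF gnH]]) simp
    moreover have "p 1 (K (g - f n)) \<le> p 1 (g - f n) * (1 / 4)"
      by (rule order.trans[OF K_bound[OF gnH zero_less_one] mult_left_mono[OF zk_0_sum_le p_nonneg[OF gnH]]]) simp
    moreover have "p 1 ((f n + K (f n)) - h) \<le> p (real n + 1) ((f n + K (f n)) - h)"
      by (rule p_mono[OF H_diff[OF LH h]]) auto
    ultimately show ?thesis using f(2)[of n] gn[of n] p_nonneg[OF gnH, of 1] by linarith
  qed
  have "(\<lambda>n. 2 * (\<Sum>m. p 1 (d (m + n))) + (1 / 2) ^ n) \<longlonglongrightarrow> 2 * 0 + 0"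
    by (intro tendsto_intros suminf_exist_split2 smd LIMSEQ_power_zero) auto
  then have "p 1 ((g + K g) - h) \<le> 2 * 0 + 0" by (rule LIMSEQ_le_const) (use bound in blast)
  then have "p 1 ((g + K g) - h) = 0" using p_nonneg[OF H_diff[OF Lg h], of 1] by simp
  then have "(g + K g) - h = 0" by (rule p_eq_0[OF H_diff[OF Lg h] zero_less_one])
  then have "h = g + K g" by simp
  then show "h \<in> M" unfolding M_def using gM by blast
qed

text \<open>For infinitely many n the space \<open>M0\<close> contains an exponential whose
  functional has \<gamma>2-coordinate 1 / (n + 2). These coordinates are distinct, so the
  exponentials are independent, and I + K is injective.\<close>

lemma M_infinite_dimensional: "\<not> (\<exists>B. finite B \<and> M \<subseteq> cfun.span B)"
proof
  assume "\<exists>B. finite B \<and> M \<subseteq> cfun.span B"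
  then obtain B where B: "finite B" "M \<subseteq> cfun.span B" by blast
  define e where "e n = complex_of_real (1 / (real n + 2))" for n :: nat
  obtain F where F: "finite F" "card F = card B + 1" "F \<subseteq> {n. \<exists>w. \<phi> (fscale w \<gamma>1 + fscale (e n) \<gamma>2) = lam}"
    using infinite_arbitrarily_large[OF level, of "card B + 1"] unfolding e_def by blast
  then obtain w where w: "\<And>n. n \<in> F \<Longrightarrow> \<phi> (fscale (w n) \<gamma>1 + fscale (e n) \<gamma>2) = lam" by (auto simp: subset_iff) metis
  define g where "g n = fscale (w n) \<gamma>1 + fscale (e n) \<gamma>2" for n
  have g: "g n \<in> carrier (dual E)" for n unfolding g_def by (intro dual_add dual_fscale \<gamma>12)
  have XM: "Ex (g n) \<in> M0" if n: "n \<in> F" for n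
  proof -
    have "\<gamma>1 (\<pi> y) = \<gamma>1 y" "\<gamma>2 (\<pi> y) = \<gamma>2 y" if "y \<in> carrier E" for y
      using x12 dual_basis by (simp_all add: \<pi>_def dualD[OF \<gamma>12(1)] dualD[OF \<gamma>12(2)])
    then have "Ex (g n) (\<pi> y) = Ex (g n) y" if "y \<in> carrier E" for y
      using that \<pi>_carrier by (simp add: Ex_def g_def)
    then show ?thesis using T_Ex[OF g] w[OF n] Ex_H[OF g] by (simp add: M0_def flip: g_def)
  qed
  define W where "W n = Ex (g n) + K (Ex (g n))" for n
  have indep: "c n = 0" if sum0: "(\<Sum>n\<in>F. fscale (c n) (W n)) = 0" and n: "n \<in> F" for c n
  proof -
    define v where "v = (\<Sum>n\<in>F. fscale (c n) (Ex (g n)))"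
    have part: "(\<Sum>n\<in>G. fscale (c n) (Ex (g n))) \<in> H" for G
      by (intro H_sum H_fscale Ex_H g)
    have "K (\<Sum>n\<in>G. fscale (c n) (Ex (g n))) = (\<Sum>n\<in>G. fscale (c n) (K (Ex (g n))))" if "finite G" for G
      using that
    proof (induction G rule: finite_induct)
      case (insert a G)
      show ?case unfolding sum.insert[OF insert.hyps] K_add[OF H_fscale[OF Ex_H[OF g]] part] K_fscale[OF Ex_H[OF g]] insert.IH ..
    qed (simp only: sum.empty K_zero)
    then have Kv: "K v = (\<Sum>n\<in>F. fscale (c n) (K (Ex (g n))))" unfolding v_def using F(1) by blast
    have "v + K v = (\<Sum>n\<in>F. fscale (c n) (W n))"
      unfolding Kv unfolding v_def sum.distrib[symmetric] W_def
      by (intro sum.cong refl) (simp add: fun_eq_iff distrib_left)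
    then have "v + K v = 0" using sum0 by (simp only:)
    moreover have vH: "v \<in> H" unfolding v_def by (rule part)
    ultimately have "p 1 v \<le> 0" using K_lower[OF vH] by simp
    then have "p 1 v = 0" using p_nonneg[OF vH, of 1] by simp
    then have v0: "v = 0" by (rule p_eq_0[OF vH zero_less_one])
    have "(\<Sum>n\<in>F. c n * exp (e n * z)) = 0" for z
    proof -
      \<comment> \<open>On the line through x2 the functional \<gamma>1 vanishes and \<gamma>2 is
        the parameter, so only the distinct rates \<open>e n\<close> remain.\<close>
      have "v (z \<odot> x2) = (\<Sum>n\<in>F. c n * exp (e n * z))"
        using x12 dual_basis by (simp add: v_def sum_apply Ex_def g_def dualD[OF \<gamma>12(1)] dualD[OF \<gamma>12(2)])
      then show ?thesis by (simp add: v0)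
    qed
    moreover have "inj_on e F" by (auto simp: inj_on_def e_def)
    ultimately show ?thesis using exponentials_independent[OF F(1)] n by blast
  qed
  \<comment> \<open>\<open>cfun.independent\<close> concerns a set; injectivity of the family is
    what allows its members to be counted.\<close>
  have injW: "inj_on W F"
  proof (rule inj_onI, rule ccontr)
    fix m n assume mn: "m \<in> F" "n \<in> F" "W m = W n" "m \<noteq> n"
    define c where "c k = (if k = m then 1 else if k = n then -1 else 0 :: complex)" for k
    have "(\<Sum>k\<in>F. fscale (c k) (W k)) = (\<Sum>k\<in>{m, n}. fscale (c k) (W k))"
      using F(1) mn by (intro sum.mono_neutral_right) (auto simp: c_def)
    also have "\<dots> = fscale 1 (W m) + fscale (-1) (W n)" using mn by (simp add: c_def)
    also have "\<dots> = 0" unfolding mn(3) by (simp add: fun_eq_iff)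
    finally have "c m = 0" using indep mn(1) by blast
    then show False by (simp add: c_def)
  qed
  have "cfun.independent (W ` F)"
  proof
    assume "cfun.dependent (W ` F)"
    then obtain u where u: "\<exists>v\<in>W ` F. u v \<noteq> 0" "(\<Sum>v\<in>W ` F. fscale (u v) v) = 0"
      using cfun.dependent_finite[of "W ` F"] F(1) by auto
    have "(\<Sum>n\<in>F. fscale (u (W n)) (W n)) = 0" using u(2) by (simp only: sum.reindex[OF injW] o_def)
    then show False using indep[of "\<lambda>n. u (W n)"] u(1) by blast
  qed
  moreover have "W ` F \<subseteq> cfun.span B" using B(2) XM by (auto simp: M_def W_def)
  ultimately have "card (W ` F) \<le> card B" using cfun.independent_span_bound[OF B(1)] by blast
  then show False using card_image[OF injW] F(2) by simp
qed

lemma M_frequently_hypercyclic: "frequently_hypercyclic_subspace \<tau> T M"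
  unfolding frequently_hypercyclic_subspace_def
proof (intro conjI ballI impI M_closed M_subspace M_infinite_dimensional)
  fix h assume h: "h \<in> M" "h \<noteq> 0"
  then obtain f where f: "f \<in> M0" "h = f + K f" by (auto simp: M_def)
  have "f \<noteq> 0" using h(2) f(2) K_zero by auto
  then show "frequently_hypercyclic \<tau> T h" unfolding f(2) by (rule frequently_hypercyclic_vector[OF f(1)])
qed

end

section \<open>Choice of the level set, the orbits and the separation constants\<close>

context fhc_operator
begin

text \<open>Adding \<gamma>2 / (n + 2) changes \<phi>(w \<gamma>1) by O(1/n), uniformly for w in a
  compact set, and the limit function takes the value lam at w0; Hurwitz' theorem applies.\<close>

lemma infinite_level_set:
  assumes g: "\<gamma>1 \<in> carrier (dual E)" "\<gamma>2 \<in> carrier (dual E)"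
    and nc: "\<not> (\<lambda>w. \<phi> (fscale w \<gamma>1)) constant_on UNIV" and l: "\<phi> (fscale w0 \<gamma>1) = lam"
  shows "infinite {n. \<exists>w. \<phi> (fscale w \<gamma>1 + fscale (of_real (1 / (real n + 2))) \<gamma>2) = lam}"
proof (rule hurwitz_infinitely_many[OF _ _ nc _ l])
  let ?e = "\<lambda>n. complex_of_real (1 / (real n + 2))"
  have comm: "fscale (?e n) \<gamma>2 + fscale w \<gamma>1 = fscale w \<gamma>1 + fscale (?e n) \<gamma>2" for n w by (rule add.commute)
  show "(\<lambda>w. \<phi> (fscale w \<gamma>1 + fscale (?e n) \<gamma>2)) holomorphic_on UNIV" for n
    using \<phi>_holomorphic[OF dual_fscale[OF g(2)] g(1), of "?e n"] unfolding comm .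
  show "(\<lambda>w. \<phi> (fscale w \<gamma>1)) holomorphic_on UNIV"
    using \<phi>_holomorphic[OF dual_zero g(1)] by simp
  fix C :: "complex set" assume "compact C"
  then obtain B where B: "\<And>w. w \<in> C \<Longrightarrow> cmod w \<le> B" by (meson compact_imp_bounded bounded_iff)
  obtain s D where sD: "0 < s" "0 < D"
    "\<forall>\<gamma>\<in>carrier (dual E). \<forall>\<delta>\<in>carrier (dual E). cmod (\<phi> \<gamma> - \<phi> \<delta>) \<le> D * p s (Ex \<gamma> - Ex \<delta>)"
    using \<phi>_diff by blast
  define Q where "Q = D * (2 * exp (s * (B * dnorm \<gamma>1 + dnorm \<gamma>2)))"
  have Q: "0 < Q" using sD by (simp add: Q_def)
  have est: "cmod (\<phi> (fscale w \<gamma>1 + fscale (?e n) \<gamma>2) - \<phi> (fscale w \<gamma>1)) \<le> Q * (1 / (real n + 2))" if w: "w \<in> C" for w n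
  proof -
    let ?\<gamma> = "fscale w \<gamma>1"
    have h: "?\<gamma> \<in> carrier (dual E)" "?\<gamma> + fscale (?e n) \<gamma>2 \<in> carrier (dual E)" by (intro dual_add dual_fscale g)+
    have ce: "cmod (?e n) = 1 / (real n + 2)" unfolding norm_of_real by simp
    have "p s (Ex (?\<gamma> + fscale (?e n) \<gamma>2) - Ex ?\<gamma>) \<le> 2 * cmod (?e n) * exp (s * (dnorm ?\<gamma> + dnorm \<gamma>2))"
      by (rule Ex_diff_line[OF h(1) g(2) sD(1)]) (simp only: ce, simp add: field_simps)
    also have "\<dots> \<le> 2 * cmod (?e n) * exp (s * (B * dnorm \<gamma>1 + dnorm \<gamma>2))"
    proof -
      have "dnorm ?\<gamma> \<le> B * dnorm \<gamma>1"
        by (rule order.trans[OF dnorm_fscale_le[OF g(1)] mult_right_mono[OF B[OF w] dnorm_nonneg[OF g(1)]]])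
      then show ?thesis using sD(1) by (intro mult_left_mono) auto
    qed
    finally have "D * p s (Ex (?\<gamma> + fscale (?e n) \<gamma>2) - Ex ?\<gamma>) \<le> D * (2 * cmod (?e n) * exp (s * (B * dnorm \<gamma>1 + dnorm \<gamma>2)))"
      using sD(2) by (intro mult_left_mono) auto
    moreover have "cmod (\<phi> (?\<gamma> + fscale (?e n) \<gamma>2) - \<phi> ?\<gamma>) \<le> D * p s (Ex (?\<gamma> + fscale (?e n) \<gamma>2) - Ex ?\<gamma>)"
      using sD(3) h by blast
    moreover have "D * (2 * cmod (?e n) * exp (s * (B * dnorm \<gamma>1 + dnorm \<gamma>2))) = Q * (1 / (real n + 2))"
      unfolding ce Q_def by (simp add: mult_ac)
    ultimately show ?thesis by linarith
  qed
  show "uniform_limit C (\<lambda>n w. \<phi> (fscale w \<gamma>1 + fscale (?e n) \<gamma>2)) (\<lambda>w. \<phi> (fscale w \<gamma>1)) sequentially"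
  proof (rule uniform_limitI)
    fix \<epsilon> :: real assume \<epsilon>: "0 < \<epsilon>"
    have "(\<lambda>n. Q * (1 / (real n + 2))) \<longlonglongrightarrow> 0" by real_asymp
    then have "\<forall>\<^sub>F n in sequentially. Q * (1 / (real n + 2)) < \<epsilon>" by (rule order_tendstoD(2)[OF _ \<epsilon>])
    then show "\<forall>\<^sub>F n in sequentially. \<forall>w\<in>C. dist (\<phi> (fscale w \<gamma>1 + fscale (?e n) \<gamma>2)) (\<phi> (fscale w \<gamma>1)) < \<epsilon>"
    proof (rule eventually_mono, intro ballI)
      fix n w assume n: "Q * (1 / (real n + 2)) < \<epsilon>" and w: "w \<in> C"
      show "dist (\<phi> (fscale w \<gamma>1 + fscale (?e n) \<gamma>2)) (\<phi> (fscale w \<gamma>1)) < \<epsilon>"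
        unfolding dist_norm by (rule order.strict_trans1[OF est[OF w] n])
    qed
  qed
qed

text \<open>The decay constants of the orbits need not be uniform in j: \<open>N i\<close> has to
  serve only the finitely many indices j \<le> i, and later orbits are left to their own larger
  constants.\<close>

lemma separation_constants:
  assumes Y: "\<And>i. bilateral (Y i)"
  shows "\<exists>N::nat \<Rightarrow> nat. strict_mono N \<and> 1 \<le> N 0 \<and> (\<forall>i j F. j \<le> i \<longrightarrow> finite F \<longrightarrow> (\<forall>r\<in>F. int (N i) \<le> \<bar>r\<bar>) \<longrightarrow>
      (\<Sum>r\<in>F. p (real i + 1) (Y (snd (prod_decode j)) r)) \<le> (1 / 2) ^ i / (8 * (real i + 1)))"
proof -
  define ok where "ok i j n \<longleftrightarrow> (\<forall>F. finite F \<longrightarrow> (\<forall>r\<in>F. int n \<le> \<bar>r\<bar>) \<longrightarrow>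
      (\<Sum>r\<in>F. p (real i + 1) (Y (snd (prod_decode j)) r)) \<le> (1 / 2) ^ i / (8 * (real i + 1)))" for i j n
  have ex: "\<exists>n. ok i j n" for i j
  proof -
    have "0 < real i + 1" by simp
    then obtain C where C: "\<And>n. p (real i + 1) (Y (snd (prod_decode j)) n) \<le> C / (1 + (of_int n)\<^sup>2)"
      using bilateralD(3)[OF Y] by blast
    define e where "e = (1 / 2) ^ i / (8 * (real i + 1))"
    have e: "0 < e" by (simp add: e_def)
    define D where "D = \<bar>C\<bar> + 1"
    have D: "0 < D" by (simp add: D_def)
    obtain n where n: "\<And>F::int set. finite F \<Longrightarrow> \<forall>r\<in>F. int n \<le> \<bar>r\<bar> \<Longrightarrow> (\<Sum>r\<in>F. 1 / (1 + (of_int r)\<^sup>2)) \<le> e / D"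
      using inverse_square_tail[of "e / D"] e D by auto
    have "ok i j n"
      unfolding ok_def e_def[symmetric]
    proof (intro allI impI)
      fix F :: "int set" assume F: "finite F" "\<forall>r\<in>F. int n \<le> \<bar>r\<bar>"
      have "(\<Sum>r\<in>F. p (real i + 1) (Y (snd (prod_decode j)) r)) \<le> (\<Sum>r\<in>F. D * (1 / (1 + (of_int r)\<^sup>2)))"
      proof (rule sum_mono)
        fix r
        have "C / (1 + (of_int r)\<^sup>2) \<le> D / (1 + (of_int r)\<^sup>2)" by (intro divide_right_mono) (auto simp: D_def)
        then show "p (real i + 1) (Y (snd (prod_decode j)) r) \<le> D * (1 / (1 + (of_int r)\<^sup>2))" using C[of r] by simp
      qed
      also have "\<dots> = D * (\<Sum>r\<in>F. 1 / (1 + (of_int r)\<^sup>2))" by (simp add: sum_distrib_left)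
      also have "\<dots> \<le> D * (e / D)" using D by (intro mult_left_mono n F) auto
      also have "\<dots> = e" using D by simp
      finally show "(\<Sum>r\<in>F. p (real i + 1) (Y (snd (prod_decode j)) r)) \<le> e" .
    qed
    then show ?thesis by blast
  qed
  define n0 where "n0 i j = (SOME n. ok i j n)" for i j
  have n0: "ok i j (n0 i j)" for i j unfolding n0_def by (rule someI_ex[OF ex])
  have mono: "ok i j m" if "ok i j n" "n \<le> m" for i j n m
    using that unfolding ok_def by (meson of_nat_le_iff order.trans)
  \<comment> \<open>A sum dominates each of its terms, and the successor makes \<open>N\<close>
    strictly increasing with \<open>N 0\<close> at least 1.\<close>
  define N where "N i = (\<Sum>k\<le>i. Suc (\<Sum>j\<le>k. n0 k j))" for i
  have "ok i j (N i)" if "j \<le> i" for i j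
  proof (rule mono[OF n0])
    have "n0 i j \<le> (\<Sum>j\<le>i. n0 i j)" using that by (intro member_le_sum) auto
    also have "\<dots> \<le> Suc (\<Sum>j\<le>i. n0 i j)" by simp
    also have "\<dots> \<le> N i" unfolding N_def by (intro member_le_sum) auto
    finally show "n0 i j \<le> N i" .
  qed
  moreover have "strict_mono N" unfolding strict_mono_Suc_iff by (simp add: N_def)
  moreover have "1 \<le> N 0" by (simp add: N_def)
  ultimately show ?thesis unfolding ok_def by (intro exI[of _ N]) blast
qed

lemma frequently_hypercyclic_subspace_exists: "\<exists>M. frequently_hypercyclic_subspace \<tau> T M"
proof -
  obtain \<gamma>1 where g1: "\<gamma>1 \<in> carrier (dual E)" and nc: "\<not> (\<lambda>w. \<phi> (fscale w \<gamma>1)) constant_on UNIV"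
    using \<phi>_nonconstant by blast
  have "\<gamma>1 \<noteq> 0" using nc by (auto simp: constant_on_def)
  then obtain \<gamma>2 x1 x2 where g2: "\<gamma>2 \<in> carrier (dual E)" and x: "x1 \<in> carrier E" "x2 \<in> carrier E"
    and b: "\<gamma>1 x1 = 1" "\<gamma>1 x2 = 0" "\<gamma>2 x1 = 0" "\<gamma>2 x2 = 1"
    using dual_plane[OF g1] by blast
  have hol: "(\<lambda>w. \<phi> (fscale w \<gamma>1)) holomorphic_on UNIV" using \<phi>_holomorphic[OF dual_zero g1] by simp
  \<comment> \<open>The eigenvalue is a value of the symbol on the line of \<gamma>1 itself, which
    provides the solution for the limit function in Hurwitz' theorem.\<close>
  obtain w0 where w0: "cmod (\<phi> (fscale w0 \<gamma>1)) < 1" using entire_small_value(1)[OF hol nc] by blast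
  obtain Y :: "nat \<Rightarrow> int \<Rightarrow> 'a \<Rightarrow> complex" where Y: "\<forall>i. bilateral (Y i)"
    "\<forall>f\<in>H. \<forall>s>0. \<forall>e>0. infinite {i. p s (Y i 0 - f) < e}"
    using dense_bilateral_sequence by blast
  obtain N :: "nat \<Rightarrow> nat" where N: "strict_mono N" "1 \<le> N 0"
    "\<forall>i j F. j \<le> i \<longrightarrow> finite F \<longrightarrow> (\<forall>r\<in>F. int (N i) \<le> \<bar>r\<bar>) \<longrightarrow>
      (\<Sum>r\<in>F. p (real i + 1) (Y (snd (prod_decode j)) r)) \<le> (1 / 2) ^ i / (8 * (real i + 1))"
    using separation_constants[of Y] Y(1) by blast
  interpret fhc_construction \<AA> E T \<gamma>1 \<gamma>2 x1 x2 "\<phi> (fscale w0 \<gamma>1)" Y N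
    by unfold_locales (use g1 g2 x b w0 Y N infinite_level_set[OF g1 g2 nc refl] in \<open>simp_all del: of_real_divide of_real_add\<close>)
  show ?thesis using M_frequently_hypercyclic by blast
qed

end

theorem theorem4p4:
  fixes \<AA> :: "nat \<Rightarrow> 'u poly_ideal"
    and E :: "'u cnspace"
    and T :: "('u \<Rightarrow> complex) \<Rightarrow> 'u \<Rightarrow> complex"
  assumes "holomorphy_type \<AA>"
    and "complex_banach_space E"
    and dim_gt_1: "\<exists>x\<in>carrier E. \<exists>y\<in>carrier E. \<forall>a b.
          a \<odot>\<^bsub>E\<^esub> x \<oplus>\<^bsub>E\<^esub> b \<odot>\<^bsub>E\<^esub> y = \<zero>\<^bsub>E\<^esub> \<longrightarrow> a = 0 \<and> b = 0"
    and "separable_space (ntop (dual E))"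
    and finite_type_dense:
      "\<And>k. ntop (ideal_space (\<AA> k) E) closure_of finite_type E k = polys (\<AA> k) E"
    and "convolution_operator \<AA> E T"
    and "\<not> trivial_operator \<AA> E T"
  shows "\<exists>M. frequently_hypercyclic_subspace (Hb_topology \<AA> E) T M"
proof -
  interpret fhc_operator \<AA> E T
    by (intro fhc_operator.intro conv_operator.intro holomorphy.intro
        conv_operator_axioms.intro fhc_operator_axioms.intro assms)
  show ?thesis by (rule frequently_hypercyclic_subspace_exists)
qed

end
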